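(* Let $\beta>0$ and let $\Lambda$ be the anisotropic box $V^{\alpha_1}\times V^{\alpha_2}\times V^{\alpha_3}$ with $\alpha_1\ge\alpha_2\ge\alpha_3$, $\alpha_1+\alpha_2+\alpha_3=1$, with periodic boundary conditions. Let $q\in\Lambda^*$, and consider the perfect Bose gas with a symmetry-breaking source in the single mode $q$, $$H^0_\Lambda(\mu;\eta)=\sum_{k\in\Lambda^*}(\varepsilon_k-\mu)b_k^*b_k+\sqrt V\,(\overline\eta\,b_q+\eta\,b_q^* ),\qquad \mu<0,$$ with Gibbs state $\omega^0_{\beta,\mu,\Lambda,\eta}$ and total density $\rho_\Lambda(\beta,\mu,\eta)=\frac1V\sum_{k\in\Lambda^*}\omega^0_{\beta,\mu,\Lambda,\eta}(b_k^*b_k)$. For fixed density $\rho$ the condensate equation is $$\rho=\rho_\Lambda(\beta,\mu,\eta)=\frac1V\frac1{e^{\beta(\varepsilon_q-\mu)}-1}+\frac1V\sum_{k\in\Lambda^*\setminus\{q\}}\frac1{e^{\beta(\varepsilon_k-\mu)}-1}+\frac{|\eta|^2}{(\varepsilon_q-\mu)^2},$$ and $\mu_\Lambda(\beta,\rho,\eta)<0$ denotes its unique solution $\mu$. Let $\mathcal I(\beta,\mu)=\lim_\Lambda\rho_\Lambda(\beta,\mu,0)=\frac1{(2\pi)^3}\int_{\mathbb R^3}\frac{d^3k}{e^{\beta(k^2-\mu)}-1}$ and $\rho_c(\beta)=\mathcal I(\beta,0)$; $\lim_\Lambda$ denotes $V\to\infty$. (i) If $\lim_\Lambda\varepsilon_q>0$,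 then the limiting condensate equation is $\rho=\lim_{\eta\to0}\lim_\Lambda\rho_\Lambda(\beta,\mu,\eta)=\mathcal I(\beta,\mu)$, i.e. the quasi-average coincides with the average; one is thus returned to the condensate equation with $\eta=0$, whose finite-volume solutions $\mu_\Lambda(\beta,\rho)$ lead to all possible types (I, II, III) of condensation as a function of the anisotropy $\alpha_1$. (ii) If $\lim_\Lambda\varepsilon_q=0$, then the limiting condensate equation is $$\rho=\lim_\Lambda\rho_\Lambda(\beta,\mu,\eta)=\mathcal I(\beta,\mu)+\frac{|\eta|^2}{\mu^2}.$$ Let $\mu(\beta,\rho,\eta)=\lim_\Lambda\mu_\Lambda(\beta,\rho,\eta)<0$. (a) If $\rho\le\rho_c(\beta)$, then $\lim_{\eta\to0}\mu(\beta,\rho,\eta)=\mu_0(\beta,\rho)<0$, and there is no condensation in any mode. (b) If $\rho>\rho_c(\beta)$, then $\lim_{\eta\to0}\mu(\beta,\rho,\eta)=0$ and the density of the condensate is $$\rho_0(\beta)=\rho-\rho_c(\beta)=\lim_{\eta\to0}\frac{|\eta|^2}{\mu(\beta,\rho,\eta)^2}.$$ The Bogoliubov quasi-average of $b_q^*b_q/V$ is $$\lim_{\eta\to0}\lim_\Lambda\omega^0_{\beta,\mu_\Lambda(\beta,\rho,\eta),\Lambda,\eta}\Big(\frac{b_q^*b_q}{V}\Big)=\rho-\rho_c(\beta),$$ while for any $k\neq q$ such that $\lim_\Lambda\varepsilon_k=0$, $$\lim_{\eta\to0}\lim_\Lambda\omega^0_{\beta,\mu_\Lambda(\beta,\rho,\eta),\Lambda,\eta}\Big(\frac{b_k^*b_k}{V}\Big)=0;$$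 that is, for any $\alpha_1$ the quasi-average condensation $(\mathrm{BEC})_{qa}$ occurs only in one mode (type I), whereas for $\alpha_1>1/2$ the BEC (without source) is of type III. Moreover, along $\eta=|\eta|e^{i\arg\eta}$ with $|\eta|\to0$, $$\lim_{\eta\to0}\lim_\Lambda\omega^0_{\beta,\mu_\Lambda(\beta,\rho,\eta),\Lambda,\eta}\Big(\frac{b_q}{\sqrt V}\Big)=\lim_{\eta\to0}\frac{\eta}{\mu(\beta,\rho,\eta)}=e^{i\arg\eta}\sqrt{\rho-\rho_c(\beta)},$$ and $(\mathrm{SSB})_{qa}$ and $(\mathrm{BEC})_{qa}$ are equivalent: $$\lim_{\eta\to0}\lim_\Lambda\omega^0_{\beta,\mu_\Lambda(\beta,\rho,\eta),\Lambda,\eta}\Big(\frac{b_q^*}{\sqrt V}\Big)\,\omega^0_{\beta,\mu_\Lambda(\beta,\rho,\eta),\Lambda,\eta}\Big(\frac{b_q}{\sqrt V}\Big)=\lim_{\eta\to0}\lim_\Lambda\omega^0_{\beta,\mu_\Lambda(\beta,\rho,\eta),\Lambda,\eta}\Big(\frac{b_q^*b_q}{V}\Big)=\rho-\rho_c(\beta).$$ Furthermore $(\mathrm{SSB})_{qa}$ and $(\mathrm{BEC})_{qa}$ are in turn equivalent to $(\mathrm{ODLRO})_{qa}$. (c) In contrast, for the conventional BEC (no source, $\eta=0$), as soon as $\alpha_1>1/2$ one has for any $\rho$ and any $q\in\Lambda^*$ $$\lim_\Lambda\omega^0_{\beta,\mu_\Lambda(\beta,\rho,0),\Lambda,0}\Big(\frac{b_q^*b_q}{V}\Big)=\lim_\Lambda\omega^0_{\beta,\mu_\Lambda(\beta,\rho,0),\Lambda,0}\Big(\frac{b_q^*}{\sqrt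 V}\Big)\,\omega^0_{\beta,\mu_\Lambda(\beta,\rho,0),\Lambda,0}\Big(\frac{b_q}{\sqrt V}\Big)=0 .$$ Thus the results in (b) do not depend on the anisotropy, i.e. on whether the condensation without source is in the single mode $k=0$ or is extended (type III), and the quasi-average method settles the equivalence of $(\mathrm{BEC})_{qa}$, $(\mathrm{SSB})_{qa}$ and $(\mathrm{ODLRO})_{qa}$ when they are defined via the one-mode quasi-average.
   Context: The Hilbert space is the boson Fock space over $L^2(\Lambda)$, $|\Lambda|=V$. The dual set is $\Lambda^*=\{k=(k_1,k_2,k_3): k_j=\frac{2\pi}{V^{\alpha_j}}n_j,\ n_j\in\mathbb Z\}$ and $\varepsilon_k=\sum_{j=1}^3k_j^2$. $b_k,b_k^*$ are the annihilation and creation operators of the normalized plane waves $e^{ikx}/\sqrt V$, with $[b_k,b_{k'}^*]=\delta_{k,k'}$, and $b(x)=\sum_{k\in\Lambda^*}b_k\,e^{ikx}/\sqrt V$. The Gibbs state is $\omega^0_{\beta,\mu,\Lambda,\eta}(A)=\mathrm{Tr}(e^{-\beta H^0_\Lambda(\mu;\eta)}A)/\mathrm{Tr}\,e^{-\beta H^0_\Lambda(\mu;\eta)}$, $\eta\in\mathbb C$. A momentum $k$ (or $q$) in $\Lambda^*$ under $\lim_\Lambda$ may depend on $\Lambda$. A quasi-average is a limit $\lim_{\eta\to0}\lim_\Lambda$ (thermodynamic limit first, then the source is switched off). $(\mathrm{BEC})_{qa}$: the quasi-average of $b_q^*b_q/V$ is non-zero. $(\mathrm{SSB})_{qa}$ (breaking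 of the gauge symmetry $b_k\mapsto e^{-is}b_k$): the quasi-average of $b_q/\sqrt V$ is non-zero. ODLRO without source means $\lim_\Lambda\omega^0_{\beta,\mu,\Lambda}\big(\frac1V\int_\Lambda b^*(x)dx\ \frac1V\int_\Lambda b(x)dx\big)=\lim_\Lambda\omega^0_{\beta,\mu,\Lambda}(b_0^*b_0/V)>0$, and $(\mathrm{ODLRO})_{qa}$ is its quasi-average counterpart. Types of condensation of the perfect gas without source, for $\rho>\rho_c(\beta)$: type I ($\alpha_1<1/2$): the whole condensate $\rho-\rho_c(\beta)$ is in the mode $k=0$; type II ($\alpha_1=1/2$): infinitely many modes are macroscopically occupied; type III ($\alpha_1>1/2$): no mode is macroscopically occupied, but $\rho-\rho_c(\beta)=\lim_{\delta\to+0}\lim_\Lambda\frac1V\sum_{k\in\Lambda^*,\,\|k\|\le\delta}\{e^{\beta(\varepsilon_k-\mu_\Lambda(\beta,\rho))}-1\}^{-1}$, where $\mu_\Lambda(\beta,\rho)=\mu_\Lambda(\beta,\rho,0)$ is the unique solution of the condensate equation for $\eta=0$.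
   Formalization: The limit of ω(b_q/√V) and of η/μ is −e^{i arg η}√(ρ−ρ_c), since μ<0; in (a) μ_0=0 at ρ=ρ_c; α_3>0 and ρ>0 are assumed; for q≠0 (ODLRO)_qa is taken at momentum q (e^{-iqx}b(x) in place of b(x)), and literally only for q=0. *)

theory Defs
  imports "HOL-Analysis.Analysis"
begin

text \<open>The exponents \<open>\<alpha>\<^sub>1, \<alpha>\<^sub>2, \<alpha>\<^sub>3\<close> are the components of a vector \<open>a\<close>.  Because of the periodic
  boundary conditions the position of the box plays no role.\<close>

definition Box :: "real^3 \<Rightarrow> real \<Rightarrow> (real^3) set" where
  "Box a V = cbox 0 (\<chi> j. V powr (a $ j))"

definition momentum :: "real^3 \<Rightarrow> real \<Rightarrow> int^3 \<Rightarrow> real^3" where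
  "momentum a V n = (\<chi> j. 2 * pi / V powr (a $ j) * of_int (n $ j))"

definition dual_lattice :: "real^3 \<Rightarrow> real \<Rightarrow> (real^3) set" where
  "dual_lattice a V = range (momentum a V)"

definition energy :: "real^3 \<Rightarrow> real" where
  "energy k = (\<Sum>j\<in>UNIV. (k $ j)^2)"

text \<open>A momentum that may depend on the box is a function of \<open>V\<close>.\<close>

definition mode_family :: "real^3 \<Rightarrow> (real \<Rightarrow> real^3) \<Rightarrow> bool" where
  "mode_family a k \<longleftrightarrow> (\<forall>V>0. k V \<in> dual_lattice a V)"

text \<open>The boson Fock space over \<open>L\<^sup>2(\<Lambda>)\<close> is written in the occupation number representation given by
  the orthonormal basis of plane waves \<open>e\<^sup>i\<^sup>k\<^sup>x / \<surd>V\<close>, \<open>k \<in> K\<close>, where \<open>K\<close> is the dual lattice: a vector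
  is the square-summable family of its coefficients with respect to the orthonormal basis of
  occupation number states.\<close>

type_synonym config = "real^3 \<Rightarrow> nat"
type_synonym state = "config \<Rightarrow> complex"

definition configs :: "(real^3) set \<Rightarrow> config set" where
  "configs K = {n. finite {k. n k \<noteq> 0} \<and> {k. n k \<noteq> 0} \<subseteq> K}"

definition fock :: "(real^3) set \<Rightarrow> state set" where
  "fock K = {\<psi>. (\<forall>n. n \<notin> configs K \<longrightarrow> \<psi> n = 0) \<and> (\<lambda>n. (cmod (\<psi> n))^2) summable_on configs K}"

definition fock_inner :: "(real^3) set \<Rightarrow> state \<Rightarrow> state \<Rightarrow> complex" where
  "fock_inner K \<phi> \<psi> = (\<Sum>\<^sub>\<infinity>n\<in>configs K. cnj (\<phi> n) * \<psi> n)"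

definition ket :: "config \<Rightarrow> state" where
  "ket n = (\<lambda>m. if m = n then 1 else 0)"

text \<open>Unbounded operators are given by their action on coefficient families, which need not be
  square-summable.  The Hilbert space operator is the restriction to the maximal domain
  \<open>{\<psi> \<in> fock K. A \<psi> \<in> fock K}\<close>.\<close>

type_synonym oper = "state \<Rightarrow> state"

definition op_scale :: "complex \<Rightarrow> oper \<Rightarrow> oper" where
  "op_scale c A = (\<lambda>\<psi> n. c * A \<psi> n)"

text \<open>\<open>b\<^sub>k |n\<rangle> = \<surd>n\<^sub>k |n - \<delta>\<^sub>k\<rangle>\<close> and \<open>b\<^sub>k\<^sup>* |n\<rangle> = \<surd>(n\<^sub>k + 1) |n + \<delta>\<^sub>k\<rangle>\<close>, read off on the coefficients.
  For \<open>n k = 0\<close> the square root makes \<open>cre k \<psi> n\<close> vanish.\<close>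

definition ann :: "real^3 \<Rightarrow> oper" where
  "ann k \<psi> = (\<lambda>n. complex_of_real (sqrt (real (n k) + 1)) * \<psi> (n(k := n k + 1)))"

definition cre :: "real^3 \<Rightarrow> oper" where
  "cre k \<psi> = (\<lambda>n. complex_of_real (sqrt (real (n k))) * \<psi> (n(k := n k - 1)))"

text \<open>On a fixed configuration only finitely many terms of the sum over \<open>k\<close> are non-zero.\<close>

definition hamiltonian ::
  "real^3 \<Rightarrow> real \<Rightarrow> real^3 \<Rightarrow> real \<Rightarrow> complex \<Rightarrow> oper" where
  "hamiltonian a V q \<mu> \<eta> \<psi> = (\<lambda>n.
     (\<Sum>\<^sub>\<infinity>k\<in>dual_lattice a V. complex_of_real (energy k - \<mu>) * cre k (ann k \<psi>) n)
     + complex_of_real (sqrt V) * (cnj \<eta> * ann q \<psi> n + \<eta> * cre q \<psi> n))"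

definition eigenbasis ::
  "(real^3) set \<Rightarrow> oper \<Rightarrow> (nat \<Rightarrow> state) \<Rightarrow> (nat \<Rightarrow> real) \<Rightarrow> bool" where
  "eigenbasis K H \<Phi> E \<longleftrightarrow>
     (\<forall>i. \<Phi> i \<in> fock K) \<and>
     (\<forall>i j. fock_inner K (\<Phi> i) (\<Phi> j) = (if i = j then 1 else 0)) \<and>
     (\<forall>\<psi>\<in>fock K. (\<forall>i. fock_inner K (\<Phi> i) \<psi> = 0) \<longrightarrow> \<psi> = (\<lambda>n. 0)) \<and>
     (\<forall>i. H (\<Phi> i) = (\<lambda>n. complex_of_real (E i) * \<Phi> i n))"

text \<open>The functional calculus \<open>e\<^sup>t\<^sup>H = \<Sum>\<^sub>i e\<^sup>t\<^sup>E\<^sup>i |\<Phi>\<^sub>i\<rangle>\<langle>\<Phi>\<^sub>i|\<close> of a self-adjoint operator with pure point spectrum;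
  it does not depend on the choice of the orthonormal eigenbasis.\<close>

definition exp_op :: "(real^3) set \<Rightarrow> real \<Rightarrow> oper \<Rightarrow> oper" where
  "exp_op K t H \<psi> =
     (let p = (SOME p. eigenbasis K H (fst p) (snd p)) in
      (\<lambda>n. \<Sum>\<^sub>\<infinity>i. complex_of_real (exp (t * snd p i)) * fock_inner K (fst p i) \<psi> * fst p i n))"

definition op_trace :: "(real^3) set \<Rightarrow> oper \<Rightarrow> complex" where
  "op_trace K A = (\<Sum>\<^sub>\<infinity>n\<in>configs K. fock_inner K (ket n) (A (ket n)))"

definition gibbs :: "(real^3) set \<Rightarrow> real \<Rightarrow> oper \<Rightarrow> oper \<Rightarrow> complex" where
  "gibbs K \<beta> H A = op_trace K (exp_op K (-\<beta>) H \<circ> A) / op_trace K (exp_op K (-\<beta>) H)"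

definition omega ::
  "real^3 \<Rightarrow> real \<Rightarrow> real \<Rightarrow> real^3 \<Rightarrow> real \<Rightarrow> complex \<Rightarrow> oper \<Rightarrow> complex" where
  "omega a \<beta> V q \<mu> \<eta> A = gibbs (dual_lattice a V) \<beta> (hamiltonian a V q \<mu> \<eta>) A"

definition total_density ::
  "real^3 \<Rightarrow> real \<Rightarrow> real \<Rightarrow> real^3 \<Rightarrow> real \<Rightarrow> complex \<Rightarrow> complex" where
  "total_density a \<beta> V q \<mu> \<eta> =
     1 / complex_of_real V * (\<Sum>\<^sub>\<infinity>k\<in>dual_lattice a V. omega a \<beta> V q \<mu> \<eta> (cre k \<circ> ann k))"

definition chem_pot ::
  "real^3 \<Rightarrow> real \<Rightarrow> real \<Rightarrow> real \<Rightarrow> real^3 \<Rightarrow> complex \<Rightarrow> real" where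
  "chem_pot a \<beta> \<rho> V q \<eta> = (THE \<mu>. \<mu> < 0 \<and> total_density a \<beta> V q \<mu> \<eta> = complex_of_real \<rho>)"

definition chem_pot_lim ::
  "real^3 \<Rightarrow> real \<Rightarrow> real \<Rightarrow> (real \<Rightarrow> real^3) \<Rightarrow> complex \<Rightarrow> real" where
  "chem_pot_lim a \<beta> \<rho> q \<eta> = Lim at_top (\<lambda>V. chem_pot a \<beta> \<rho> V (q V) \<eta>)"

definition bose_integral :: "real \<Rightarrow> real \<Rightarrow> real" where
  "bose_integral \<beta> \<mu> =
     1 / (2 * pi)^3 * (LINT k|lborel. 1 / (exp (\<beta> * ((norm (k :: real^3))^2 - \<mu>)) - 1))"

definition rho_c :: "real \<Rightarrow> real" where
  "rho_c \<beta> = bose_integral \<beta> 0"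

definition bose_field :: "real^3 \<Rightarrow> real \<Rightarrow> real^3 \<Rightarrow> oper" where
  "bose_field a V x \<psi> = (\<lambda>n. \<Sum>\<^sub>\<infinity>k\<in>dual_lattice a V. ann k \<psi> n * (cis (k \<bullet> x) / complex_of_real (sqrt V)))"

definition bose_field_adj :: "real^3 \<Rightarrow> real \<Rightarrow> real^3 \<Rightarrow> oper" where
  "bose_field_adj a V x \<psi> = (\<lambda>n. \<Sum>\<^sub>\<infinity>k\<in>dual_lattice a V. cre k \<psi> n * (cis (- (k \<bullet> x)) / complex_of_real (sqrt V)))"

text \<open>\<open>1/V \<integral>\<^sub>\<Lambda> F(x) dx\<close>, as a weak integral.\<close>

definition space_avg :: "real^3 \<Rightarrow> real \<Rightarrow> (real^3 \<Rightarrow> oper) \<Rightarrow> oper" where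
  "space_avg a V F \<psi> = (\<lambda>n. 1 / complex_of_real V * (LINT x:Box a V|lborel. F x \<psi> n))"

definition odlro_obs :: "real^3 \<Rightarrow> real \<Rightarrow> oper" where
  "odlro_obs a V = space_avg a V (bose_field_adj a V) \<circ> space_avg a V (bose_field a V)"

text \<open>The same observable at momentum \<open>p\<close>, with \<open>b(x)\<close> replaced by \<open>e\<^sup>-\<^sup>i\<^sup>p\<^sup>x b(x)\<close>.  For \<open>p = 0\<close> it is
  \<open>odlro_obs\<close>.\<close>

definition odlro_obs_at :: "real^3 \<Rightarrow> real \<Rightarrow> real^3 \<Rightarrow> oper" where
  "odlro_obs_at a V p =
     space_avg a V (\<lambda>x. op_scale (cis (p \<bullet> x)) (bose_field_adj a V x))
     \<circ> space_avg a V (\<lambda>x. op_scale (cis (- (p \<bullet> x))) (bose_field a V x))"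

text \<open>\<open>lim\<^sub>F lim\<^sub>V\<^sub>\<rightarrow>\<^sub>\<infinity> f s V = l\<close>: the inner limits exist, and they tend to \<open>l\<close>.\<close>

definition iterated_limit ::
  "'s filter \<Rightarrow> ('s \<Rightarrow> real \<Rightarrow> 'b :: topological_space) \<Rightarrow> 'b \<Rightarrow> bool" where
  "iterated_limit F f l \<longleftrightarrow>
     (\<exists>g. (\<forall>\<^sub>F s in F. (f s \<longlongrightarrow> g s) at_top) \<and> (g \<longlongrightarrow> l) F)"

text \<open>\<open>\<eta> = |\<eta>| e\<^sup>i\<^sup>\<theta>\<close> with fixed phase and \<open>|\<eta>| \<rightarrow> 0\<close>.\<close>

definition ray :: "real \<Rightarrow> complex filter" where
  "ray \<theta> = filtermap (\<lambda>r. complex_of_real r * cis \<theta>) (at_right 0)"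

definition omega_rho ::
  "real^3 \<Rightarrow> real \<Rightarrow> real \<Rightarrow> real \<Rightarrow> real^3 \<Rightarrow> complex \<Rightarrow> oper \<Rightarrow> complex" where
  "omega_rho a \<beta> \<rho> V q \<eta> A = omega a \<beta> V q (chem_pot a \<beta> \<rho> V q \<eta>) \<eta> A"

definition quasi_average ::
  "real^3 \<Rightarrow> real \<Rightarrow> real \<Rightarrow> (real \<Rightarrow> real^3) \<Rightarrow> complex filter \<Rightarrow> (real \<Rightarrow> oper) \<Rightarrow> complex \<Rightarrow> bool" where
  "quasi_average a \<beta> \<rho> q F A l \<longleftrightarrow>
     iterated_limit F (\<lambda>\<eta> V. omega_rho a \<beta> \<rho> V (q V) \<eta> (A V)) l"

definition occ_obs :: "real \<Rightarrow> real^3 \<Rightarrow> oper" where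
  "occ_obs V k = op_scale (1 / complex_of_real V) (cre k \<circ> ann k)"

definition ann_obs :: "real \<Rightarrow> real^3 \<Rightarrow> oper" where
  "ann_obs V k = op_scale (1 / complex_of_real (sqrt V)) (ann k)"

definition cre_obs :: "real \<Rightarrow> real^3 \<Rightarrow> oper" where
  "cre_obs V k = op_scale (1 / complex_of_real (sqrt V)) (cre k)"

text \<open>Condensation in the mode \<open>k\<close> when the source is in the mode \<open>q\<close>.\<close>

definition BEC_qa ::
  "real^3 \<Rightarrow> real \<Rightarrow> real \<Rightarrow> (real \<Rightarrow> real^3) \<Rightarrow> (real \<Rightarrow> real^3) \<Rightarrow> bool" where
  "BEC_qa a \<beta> \<rho> q k \<longleftrightarrow> (\<exists>l. l \<noteq> 0 \<and> quasi_average a \<beta> \<rho> q (at 0) (\<lambda>V. occ_obs V (k V)) l)"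

definition SSB_qa ::
  "real^3 \<Rightarrow> real \<Rightarrow> real \<Rightarrow> (real \<Rightarrow> real^3) \<Rightarrow> real \<Rightarrow> bool" where
  "SSB_qa a \<beta> \<rho> q \<theta> \<longleftrightarrow> (\<exists>l. l \<noteq> 0 \<and> quasi_average a \<beta> \<rho> q (ray \<theta>) (\<lambda>V. ann_obs V (q V)) l)"

definition ODLRO_qa ::
  "real^3 \<Rightarrow> real \<Rightarrow> real \<Rightarrow> (real \<Rightarrow> real^3) \<Rightarrow> bool" where
  "ODLRO_qa a \<beta> \<rho> q \<longleftrightarrow>
     (\<exists>l>0. quasi_average a \<beta> \<rho> q (at 0) (\<lambda>V. odlro_obs a V) (complex_of_real l))"

definition ODLRO_qa_at ::
  "real^3 \<Rightarrow> real \<Rightarrow> real \<Rightarrow> (real \<Rightarrow> real^3) \<Rightarrow> (real \<Rightarrow> real^3) \<Rightarrow> bool" where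
  "ODLRO_qa_at a \<beta> \<rho> q p \<longleftrightarrow>
     (\<exists>l>0. quasi_average a \<beta> \<rho> q (at 0) (\<lambda>V. odlro_obs_at a V (p V)) (complex_of_real l))"

text \<open>For \<open>\<eta> = 0\<close> the Hamiltonian does not depend on the mode of the source, here taken to be \<open>0\<close>.\<close>

definition chem_pot_free :: "real^3 \<Rightarrow> real \<Rightarrow> real \<Rightarrow> real \<Rightarrow> real" where
  "chem_pot_free a \<beta> \<rho> V = chem_pot a \<beta> \<rho> V 0 0"

definition free_occ :: "real^3 \<Rightarrow> real \<Rightarrow> real \<Rightarrow> real \<Rightarrow> real^3 \<Rightarrow> complex" where
  "free_occ a \<beta> \<rho> V k = omega_rho a \<beta> \<rho> V 0 0 (occ_obs V k)"

definition type_I :: "real^3 \<Rightarrow> real \<Rightarrow> real \<Rightarrow> bool" where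
  "type_I a \<beta> \<rho> \<longleftrightarrow>
     ((\<lambda>V. free_occ a \<beta> \<rho> V 0) \<longlongrightarrow> complex_of_real (\<rho> - rho_c \<beta>)) at_top \<and>
     (\<forall>k. mode_family a k \<and> (\<forall>\<^sub>F V in at_top. k V \<noteq> 0) \<longrightarrow>
        ((\<lambda>V. free_occ a \<beta> \<rho> V (k V)) \<longlongrightarrow> 0) at_top)"

definition type_II :: "real^3 \<Rightarrow> real \<Rightarrow> real \<Rightarrow> bool" where
  "type_II a \<beta> \<rho> \<longleftrightarrow>
     infinite {n. \<exists>l>0. ((\<lambda>V. free_occ a \<beta> \<rho> V (momentum a V n)) \<longlongrightarrow> complex_of_real l) at_top}"

definition type_III :: "real^3 \<Rightarrow> real \<Rightarrow> real \<Rightarrow> bool" where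
  "type_III a \<beta> \<rho> \<longleftrightarrow>
     (\<forall>k. mode_family a k \<longrightarrow> ((\<lambda>V. free_occ a \<beta> \<rho> V (k V)) \<longlongrightarrow> 0) at_top) \<and>
     iterated_limit (at_right 0)
       (\<lambda>\<delta> V. 1 / V * (\<Sum>\<^sub>\<infinity>k\<in>{k \<in> dual_lattice a V. norm k \<le> \<delta>}.
                 1 / (exp (\<beta> * (energy k - chem_pot_free a \<beta> \<rho> V)) - 1)))
       (\<rho> - rho_c \<beta>)"

end

theory Submission
  imports Defs "HOL-Probability.Probability"
begin

text \<open>The source term is removed by displacing the mode \<open>q\<close>: with
  \<open>z = -\<surd>V \<eta> / (\<epsilon>\<^sub>q - \<mu>)\<close> the displaced number states form an orthonormal eigenbasis of the
  Hamiltonian.  Against these rapidly decreasing states the Hamiltonian is symmetric on its whole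
  maximal domain, so every other eigenbasis gives the same Gibbs state.  Hence \<open>b\<^sub>q\<close> has mean \<open>z\<close>, and the occupation numbers
  are the Bose factors, with \<open>|z|\<^sup>2\<close> added in the mode \<open>q\<close>.

  For the thermodynamic limit the dual lattice is split according to the set \<open>S\<close> of non-zero
  coordinates.  Momenta with three non-zero coordinates give a Riemann sum for the Bose integral:
  rounding away from the origin keeps the step functions below the limiting integrand, so dominated
  convergence applies down to \<open>\<mu> = 0\<close>.  The coordinate planes never contribute, and neither does an
  axis of length \<open>V\<^sup>\<alpha>\<close> with \<open>\<alpha> < 1/2\<close>; what the first axis carries decides the type of
  condensation.  With a source the chemical potential stays negative in the limit, so every mode
  other than \<open>q\<close> is negligible, and the quasi-averages follow from monotonicity of the limiting
  condensate equation.\<close>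

section \<open>Square-summable families\<close>

text \<open>Three obstacles shape the proof. First, \<open>exp_op\<close> chooses its eigenbasis by
  \<open>SOME\<close>, eigenvalues may be degenerate, and operators act on arbitrary coefficient
  families, so nothing about domains may be taken for granted. The trace, moreover, runs over number
  states and not over eigenvectors; exchanging the two summations needs absolute convergence, which
  is why all states carry explicit decay. Second, under rounding away from zero only a null set of
  momenta is sent to lattice points with a vanishing coordinate, so the Riemann sum sees exactly the
  bulk class, and the lower classes need estimates of their own. These use one exponent s: the Bose
  factor is bounded by a product of |n_i|^(-s), convergence needs s > 1, and V^(s * sum of the a_i)
  must be o(V). Without a gap the singularity 1/y of the Bose factor demands s * card S >= 2, hence
  s = 2 and a_i < 1/2 on an axis: the origin of the critical value 1/2. Third, the chemical
  potential moves with V. It is trapped between fixed potentials by monotonicity, so that only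
  limits at fixed potential enter. As the potential is negative, \<eta>/\<mu> has phase opposite to
  that of \<eta>; hence the sign in \<open>- cis \<theta>\<close>.\<close>

definition l2 :: "'a set \<Rightarrow> ('a \<Rightarrow> complex) \<Rightarrow> bool" where
  "l2 X \<psi> \<longleftrightarrow> (\<lambda>n. (cmod (\<psi> n))\<^sup>2) summable_on X"

definition sqnorm :: "'a set \<Rightarrow> ('a \<Rightarrow> complex) \<Rightarrow> real" where
  "sqnorm X \<psi> = (\<Sum>\<^sub>\<infinity>n\<in>X. (cmod (\<psi> n))\<^sup>2)"

definition ip :: "'a set \<Rightarrow> ('a \<Rightarrow> complex) \<Rightarrow> ('a \<Rightarrow> complex) \<Rightarrow> complex" where
  "ip X \<phi> \<psi> = (\<Sum>\<^sub>\<infinity>n\<in>X. cnj (\<phi> n) * \<psi> n)"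

lemma mult_le_weighted_squares:
  fixes a b t :: real
  assumes "t > 0"
  shows "a * b \<le> (t * a\<^sup>2 + b\<^sup>2 / t) / 2"
proof -
  have "0 \<le> (t * a - b)\<^sup>2 / t" using assms by simp
  also have "\<dots> = t * a\<^sup>2 - 2 * (a * b) + b\<^sup>2 / t"
    using assms by (simp add: field_simps power2_eq_square)
  finally show ?thesis by simp
qed

lemma l2_mult_summable:
  assumes "l2 X \<phi>" "l2 X \<psi>"
  shows "(\<lambda>n. cmod (\<phi> n) * cmod (\<psi> n)) summable_on X"
proof (rule summable_on_comparison_test)
  show "(\<lambda>n. (cmod (\<phi> n))\<^sup>2 + (cmod (\<psi> n))\<^sup>2) summable_on X"
    using assms unfolding l2_def by (rule summable_on_add)
  fix n
  show "cmod (\<phi> n) * cmod (\<psi> n) \<le> (cmod (\<phi> n))\<^sup>2 + (cmod (\<psi> n))\<^sup>2"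
    using mult_le_weighted_squares[of 1 "cmod (\<phi> n)" "cmod (\<psi> n)"]
      mult_nonneg_nonneg[of "cmod (\<phi> n)" "cmod (\<psi> n)"] norm_ge_zero
    by (simp add: field_simps) (smt (verit) norm_ge_zero mult_nonneg_nonneg)
  show "0 \<le> cmod (\<phi> n) * cmod (\<psi> n)" by simp
qed

lemma ip_summable:
  assumes "l2 X \<phi>" "l2 X \<psi>"
  shows "(\<lambda>n. cnj (\<phi> n) * \<psi> n) summable_on X"
  by (rule abs_summable_summable) (use l2_mult_summable[OF assms] in \<open>simp add: norm_mult\<close>)

lemma l2_add:
  assumes "l2 X \<phi>" "l2 X \<psi>"
  shows "l2 X (\<lambda>n. \<phi> n + \<psi> n)"
  unfolding l2_def
proof (rule summable_on_comparison_test)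
  show "(\<lambda>n. 2 * (cmod (\<phi> n))\<^sup>2 + 2 * (cmod (\<psi> n))\<^sup>2) summable_on X"
    using assms unfolding l2_def by (intro summable_on_add summable_on_cmult_right)
  fix n
  have "(cmod (\<phi> n + \<psi> n))\<^sup>2 \<le> (cmod (\<phi> n) + cmod (\<psi> n))\<^sup>2"
    by (intro power_mono norm_triangle_ineq) simp
  also have "\<dots> \<le> 2 * (cmod (\<phi> n))\<^sup>2 + 2 * (cmod (\<psi> n))\<^sup>2"
    using mult_le_weighted_squares[of 1 "cmod (\<phi> n)" "cmod (\<psi> n)"]
    by (simp add: power2_sum)
  finally show "(cmod (\<phi> n + \<psi> n))\<^sup>2 \<le> 2 * (cmod (\<phi> n))\<^sup>2 + 2 * (cmod (\<psi> n))\<^sup>2" .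
qed auto

lemma l2_scale: "l2 X \<psi> \<Longrightarrow> l2 X (\<lambda>n. c * \<psi> n)"
  unfolding l2_def by (simp add: norm_mult power_mult_distrib summable_on_cmult_right)

lemma l2_diff: "l2 X \<phi> \<Longrightarrow> l2 X \<psi> \<Longrightarrow> l2 X (\<lambda>n. \<phi> n - \<psi> n)"
  using l2_add[of X \<phi> "\<lambda>n. (-1) * \<psi> n"] l2_scale[of X \<psi> "-1"] by simp

lemma l2_sum: "finite F \<Longrightarrow> (\<And>i. i \<in> F \<Longrightarrow> l2 X (\<Phi> i)) \<Longrightarrow> l2 X (\<lambda>n. \<Sum>i\<in>F. c i * \<Phi> i n)"
proof (induction F rule: finite_induct)
  case empty
  then show ?case by (simp add: l2_def)
next
  case (insert x F)
  then show ?case by (auto intro!: l2_add l2_scale)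
qed

lemma ip_add_right: "l2 X \<phi> \<Longrightarrow> l2 X \<psi> \<Longrightarrow> l2 X \<xi> \<Longrightarrow> ip X \<xi> (\<lambda>n. \<phi> n + \<psi> n) = ip X \<xi> \<phi> + ip X \<xi> \<psi>"
  unfolding ip_def by (simp add: distrib_left infsum_add ip_summable)

lemma ip_scale_right: "ip X \<xi> (\<lambda>n. c * \<psi> n) = c * ip X \<xi> \<psi>"
  unfolding ip_def by (subst infsum_cmult_right'[symmetric]) (simp add: mult.left_commute)

lemma ip_commute: "ip X \<phi> \<psi> = cnj (ip X \<psi> \<phi>)"
  unfolding ip_def by (subst infsum_cnj[symmetric]) (simp add: mult.commute)

lemma ip_diff_right: "l2 X \<phi> \<Longrightarrow> l2 X \<psi> \<Longrightarrow> l2 X \<xi> \<Longrightarrow> ip X \<xi> (\<lambda>n. \<phi> n - \<psi> n) = ip X \<xi> \<phi> - ip X \<xi> \<psi>"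
  using ip_add_right[of X \<phi> "\<lambda>n. (-1) * \<psi> n" \<xi>] ip_scale_right[of X \<xi> "-1" \<psi>] l2_scale[of X \<psi> "-1"]
  by simp

lemma ip_sum_right: "finite F \<Longrightarrow> (\<And>i. i \<in> F \<Longrightarrow> l2 X (\<Phi> i)) \<Longrightarrow> l2 X \<xi>
   \<Longrightarrow> ip X \<xi> (\<lambda>n. \<Sum>i\<in>F. c i * \<Phi> i n) = (\<Sum>i\<in>F. c i * ip X \<xi> (\<Phi> i))"
proof (induction F rule: finite_induct)
  case empty
  then show ?case by (simp add: ip_def)
next
  case (insert x F)
  then show ?case by (simp add: ip_add_right ip_scale_right l2_scale l2_sum)
qed

text \<open>Holds without summability: taking real parts shows that both families are summable or
  neither is, and in the latter case both sums are the default 0.\<close>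

lemma infsum_complex_of_real: "(\<Sum>\<^sub>\<infinity>x\<in>A. complex_of_real (f x)) = complex_of_real (\<Sum>\<^sub>\<infinity>x\<in>A. f x)"
proof (cases "f summable_on A")
  case True
  then show ?thesis by (intro infsumI has_sum_of_real) auto
next
  case False
  then have "\<not> (\<lambda>x. complex_of_real (f x)) summable_on A"
    using summable_on_Re[of "\<lambda>x. complex_of_real (f x)" A] by auto
  with False show ?thesis by (simp add: infsum_not_exists)
qed

lemma ip_self: "ip X \<psi> \<psi> = complex_of_real (sqnorm X \<psi>)"
  unfolding ip_def sqnorm_def
  unfolding infsum_complex_of_real[symmetric]
  by (intro infsum_cong) (simp add: complex_norm_square mult.commute del: of_real_power)

lemma sqnorm_nonneg: "sqnorm X \<psi> \<ge> 0"
  unfolding sqnorm_def by (intro infsum_nonneg) auto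

text \<open>Plays the role of Cauchy-Schwarz. The free weight \<open>t\<close> is tuned later: a
  small \<open>t\<close> suppresses the fixed vector, while the other one is a tail that beats
  1/\<open>t\<close>.\<close>

lemma norm_ip_le_weighted:
  assumes "l2 X \<phi>" "l2 X \<psi>" "t > 0"
  shows "cmod (ip X \<phi> \<psi>) \<le> (t * sqnorm X \<phi> + sqnorm X \<psi> / t) / 2"
proof -
  have s: "(\<lambda>n. (t * (cmod (\<phi> n))\<^sup>2 + (cmod (\<psi> n))\<^sup>2 / t) / 2) summable_on X"
    using assms unfolding l2_def divide_inverse
    by (intro summable_on_cmult_left summable_on_add summable_on_cmult_right)
  have "cmod (ip X \<phi> \<psi>) \<le> (\<Sum>\<^sub>\<infinity>n\<in>X. cmod (\<phi> n) * cmod (\<psi> n))"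
    unfolding ip_def using norm_infsum_bound[of "\<lambda>n. cnj (\<phi> n) * \<psi> n" X] l2_mult_summable[OF assms(1,2)]
    by (simp add: norm_mult)
  also have "\<dots> \<le> (\<Sum>\<^sub>\<infinity>n\<in>X. (t * (cmod (\<phi> n))\<^sup>2 + (cmod (\<psi> n))\<^sup>2 / t) / 2)"
    by (intro infsum_mono l2_mult_summable assms s mult_le_weighted_squares)
  also have "\<dots> = (t * sqnorm X \<phi> + sqnorm X \<psi> / t) / 2"
    unfolding sqnorm_def using assms unfolding l2_def divide_inverse
    by (subst infsum_cmult_left', subst infsum_add)
       (auto simp: infsum_cmult_left' infsum_cmult_right' intro: summable_on_cmult_right summable_on_cmult_left)
  finally show ?thesis .
qed

section \<open>Orthonormal families: Bessel, convergence of series, Parseval\<close>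

definition orthonormal :: "'a set \<Rightarrow> 'i set \<Rightarrow> ('i \<Rightarrow> 'a \<Rightarrow> complex) \<Rightarrow> bool" where
  "orthonormal X I \<Phi> \<longleftrightarrow> (\<forall>i\<in>I. l2 X (\<Phi> i)) \<and>
     (\<forall>i\<in>I. \<forall>j\<in>I. ip X (\<Phi> i) (\<Phi> j) = (if i = j then 1 else 0))"

lemma orthonormal_subset: "orthonormal X I \<Phi> \<Longrightarrow> J \<subseteq> I \<Longrightarrow> orthonormal X J \<Phi>"
  unfolding orthonormal_def by blast

lemma sqnorm_orthonormal_sum:
  assumes on: "orthonormal X I \<Phi>" and F: "finite F" "F \<subseteq> I"
  shows "sqnorm X (\<lambda>n. \<Sum>i\<in>F. c i * \<Phi> i n) = (\<Sum>i\<in>F. (cmod (c i))\<^sup>2)"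
proof -
  have l: "\<And>i. i \<in> F \<Longrightarrow> l2 X (\<Phi> i)" using on F unfolding orthonormal_def by blast
  let ?S = "\<lambda>n. \<Sum>i\<in>F. c i * \<Phi> i n"
  have S: "l2 X ?S" using l F by (intro l2_sum)
  have a: "ip X ?S (\<Phi> i) = cnj (c i)" if "i \<in> F" for i
  proof -
    have "ip X (\<Phi> i) ?S = (\<Sum>j\<in>F. c j * ip X (\<Phi> i) (\<Phi> j))"
      using l F that by (intro ip_sum_right)
    also have "\<dots> = (\<Sum>j\<in>F. if j = i then c i else 0)"
    proof (rule sum.cong)
      fix j assume "j \<in> F"
      then have "ip X (\<Phi> i) (\<Phi> j) = (if i = j then 1 else 0)"
        using on F that unfolding orthonormal_def by blast
      then show "c j * ip X (\<Phi> i) (\<Phi> j) = (if j = i then c i else 0)" by simp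
    qed simp
    also have "\<dots> = c i" using F that by simp
    finally show ?thesis using ip_commute[of X ?S "\<Phi> i"] by simp
  qed
  have "ip X ?S ?S = (\<Sum>i\<in>F. c i * ip X ?S (\<Phi> i))"
    using l F S by (intro ip_sum_right)
  also have "\<dots> = (\<Sum>i\<in>F. c i * cnj (c i))"
    by (intro sum.cong) (auto simp: a)
  also have "\<dots> = complex_of_real (\<Sum>i\<in>F. (cmod (c i))\<^sup>2)"
    by (simp add: complex_norm_square del: of_real_power)
  finally show ?thesis unfolding ip_self of_real_eq_iff .
qed

text \<open>The defect of \<open>y\<close> from its finite expansion has squared norm
  \<open>sqnorm X y\<close> minus the sum on the left, and a squared norm is non-negative.\<close>

lemma bessel_finite:
  assumes on: "orthonormal X I \<Phi>" and F: "finite F" "F \<subseteq> I" and y: "l2 X y"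
  shows "(\<Sum>i\<in>F. (cmod (ip X (\<Phi> i) y))\<^sup>2) \<le> sqnorm X y"
proof -
  have l: "\<And>i. i \<in> F \<Longrightarrow> l2 X (\<Phi> i)" using on F unfolding orthonormal_def by blast
  define c where "c i = ip X (\<Phi> i) y" for i
  define S where "S = (\<lambda>n. \<Sum>i\<in>F. c i * \<Phi> i n)"
  define A where "A = (\<Sum>i\<in>F. (cmod (c i))\<^sup>2)"
  have S: "l2 X S" unfolding S_def using l F by (intro l2_sum)
  have SS: "ip X S S = complex_of_real A" unfolding ip_self S_def A_def
    by (simp only: sqnorm_orthonormal_sum[OF on F])
  have yS: "ip X y S = complex_of_real A"
  proof -
    have "ip X y S = (\<Sum>i\<in>F. c i * ip X y (\<Phi> i))"
      unfolding S_def using l F y by (intro ip_sum_right)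
    also have "\<dots> = (\<Sum>i\<in>F. c i * cnj (c i))"
      unfolding c_def by (subst ip_commute[of X y]) simp
    finally show ?thesis by (simp add: A_def complex_norm_square del: of_real_power)
  qed
  have Sy: "ip X S y = complex_of_real A" using ip_commute[of X S y] yS by simp
  let ?D = "\<lambda>n. y n - S n"
  have D: "l2 X ?D" by (intro l2_diff y S)
  have yD: "ip X y ?D = ip X y y - ip X y S" by (intro ip_diff_right y S)
  have SD: "ip X S ?D = ip X S y - ip X S S" by (intro ip_diff_right y S)
  have "ip X ?D ?D = ip X ?D y - ip X ?D S" by (intro ip_diff_right y S D)
  also have "\<dots> = cnj (ip X y ?D) - cnj (ip X S ?D)" using ip_commute by metis
  also have "\<dots> = complex_of_real (sqnorm X y - A)"
    unfolding yD SD SS Sy yS by (simp add: ip_self)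
  finally have "sqnorm X ?D = sqnorm X y - A" unfolding ip_self of_real_eq_iff .
  then show ?thesis using sqnorm_nonneg[of X ?D] unfolding A_def c_def by simp
qed

lemma bessel_summable:
  assumes on: "orthonormal X I \<Phi>" and y: "l2 X y"
  shows "(\<lambda>i. (cmod (ip X (\<Phi> i) y))\<^sup>2) summable_on I"
  using bessel_finite[OF on _ _ y]
  by (intro nonneg_bdd_above_summable_on bdd_aboveI2[where M="sqnorm X y"]) auto

lemma ip_kronecker:
  assumes "n \<in> X"
  shows "ip X \<phi> (\<lambda>m. if m = n then 1 else 0) = cnj (\<phi> n)"
proof -
  have "ip X \<phi> (\<lambda>m. if m = n then 1 else 0) = (\<Sum>\<^sub>\<infinity>m\<in>{n}. cnj (\<phi> m))"
    unfolding ip_def using assms by (intro infsum_cong_neutral) auto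
  then show ?thesis by simp
qed

lemma l2_kronecker: "l2 X (\<lambda>m. if m = n then 1 else 0)"
  unfolding l2_def by (rule finite_nonzero_values_imp_summable_on) auto

text \<open>Bessel's inequality for the Kronecker function at \<open>n\<close>. It makes the
  expansions converge absolutely at each single point.\<close>

lemma orthonormal_coefficients_l2:
  assumes on: "orthonormal X I \<Phi>" and n: "n \<in> X"
  shows "l2 I (\<lambda>i. \<Phi> i n)"
  using bessel_summable[OF on l2_kronecker[of X n]] unfolding l2_def by (simp add: ip_kronecker n)

lemma orthonormal_series_pointwise:
  assumes on: "orthonormal X I \<Phi>" and c: "l2 I c" and n: "n \<in> X"
  shows "(\<lambda>i. c i * \<Phi> i n) summable_on I"
  by (rule abs_summable_summable)
     (use l2_mult_summable[OF c orthonormal_coefficients_l2[OF on n]] in \<open>simp add: norm_mult\<close>)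

text \<open>Fatou's lemma in disguise: each finite part of the norm is a limit of the corresponding
  parts of the finite partial sums, which are bounded by Pythagoras.\<close>

lemma orthonormal_series_l2:
  assumes on: "orthonormal X I \<Phi>" and c: "l2 I c"
  shows "l2 X (\<lambda>n. \<Sum>\<^sub>\<infinity>i\<in>I. c i * \<Phi> i n)"
    and "sqnorm X (\<lambda>n. \<Sum>\<^sub>\<infinity>i\<in>I. c i * \<Phi> i n) \<le> sqnorm I c"
proof -
  let ?y = "\<lambda>n. \<Sum>\<^sub>\<infinity>i\<in>I. c i * \<Phi> i n"
  have bd: "(\<Sum>n\<in>G. (cmod (?y n))\<^sup>2) \<le> sqnorm I c" if G: "finite G" "G \<subseteq> X" for G
  proof (rule tendsto_upperbound)
    show "((\<lambda>F. \<Sum>n\<in>G. (cmod (\<Sum>i\<in>F. c i * \<Phi> i n))\<^sup>2) \<longlongrightarrow> (\<Sum>n\<in>G. (cmod (?y n))\<^sup>2))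
            (finite_subsets_at_top I)"
      using G by (intro tendsto_sum tendsto_power tendsto_norm infsum_tendsto
        orthonormal_series_pointwise[OF on c]) auto
    show "\<forall>\<^sub>F F in finite_subsets_at_top I. (\<Sum>n\<in>G. (cmod (\<Sum>i\<in>F. c i * \<Phi> i n))\<^sup>2) \<le> sqnorm I c"
    proof (rule eventually_finite_subsets_at_top_weakI)
      fix F assume F: "finite F" "F \<subseteq> I"
      have l: "\<And>i. i \<in> F \<Longrightarrow> l2 X (\<Phi> i)" using on F unfolding orthonormal_def by blast
      have "(\<Sum>n\<in>G. (cmod (\<Sum>i\<in>F. c i * \<Phi> i n))\<^sup>2) \<le> sqnorm X (\<lambda>n. \<Sum>i\<in>F. c i * \<Phi> i n)"
        unfolding sqnorm_def using l2_sum[OF F(1) l] G unfolding l2_def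
        by (intro finite_sum_le_infsum) auto
      also have "\<dots> = (\<Sum>i\<in>F. (cmod (c i))\<^sup>2)" by (rule sqnorm_orthonormal_sum[OF on F])
      also have "\<dots> \<le> sqnorm I c" unfolding sqnorm_def using c F unfolding l2_def
        by (intro finite_sum_le_infsum) auto
      finally show "(\<Sum>n\<in>G. (cmod (\<Sum>i\<in>F. c i * \<Phi> i n))\<^sup>2) \<le> sqnorm I c" .
    qed
  qed simp
  show l: "l2 X ?y" unfolding l2_def
    using bd by (intro nonneg_bdd_above_summable_on bdd_aboveI2[where M="sqnorm I c"]) auto
  show "sqnorm X ?y \<le> sqnorm I c"
    unfolding sqnorm_def[of X] by (rule infsum_le_finite_sums) (use l bd in \<open>auto simp: l2_def\<close>)
qed

text \<open>What remains of the series beyond a finite set F is an orthonormal series over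
  \<open>I - F\<close>, whose squared norm is at most the tail of \<open>sqnorm I c\<close>. The
  weighted inequality turns this into convergence of the inner products.\<close>

lemma orthonormal_series_ip:
  assumes on: "orthonormal X I \<Phi>" and c: "l2 I c" and \<xi>: "l2 X \<xi>"
  shows "((\<lambda>i. c i * ip X \<xi> (\<Phi> i)) has_sum ip X \<xi> (\<lambda>n. \<Sum>\<^sub>\<infinity>i\<in>I. c i * \<Phi> i n)) I"
proof -
  let ?y = "\<lambda>n. \<Sum>\<^sub>\<infinity>i\<in>I. c i * \<Phi> i n"
  let ?S = "\<lambda>F n. \<Sum>i\<in>F. c i * \<Phi> i n"
  have bd: "cmod (ip X \<xi> ?y - (\<Sum>i\<in>F. c i * ip X \<xi> (\<Phi> i)))
       \<le> (t * sqnorm X \<xi> + (sqnorm I c - (\<Sum>i\<in>F. (cmod (c i))\<^sup>2)) / t) / 2"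
    if F: "finite F" "F \<subseteq> I" and t: "t > 0" for F t
  proof -
    have l: "\<And>i. i \<in> F \<Longrightarrow> l2 X (\<Phi> i)" using on F unfolding orthonormal_def by blast
    have S: "l2 X (?S F)" using l F by (intro l2_sum)
    have y: "l2 X ?y" by (rule orthonormal_series_l2[OF on c])
    have onF: "orthonormal X (I - F) \<Phi>" using on by (rule orthonormal_subset) auto
    have cF: "l2 (I - F) c" using c unfolding l2_def by (rule summable_on_subset) auto
    have eq: "?y n - ?S F n = (\<Sum>\<^sub>\<infinity>i\<in>I-F. c i * \<Phi> i n)" if "n \<in> X" for n
    proof -
      have "?y n = (\<Sum>\<^sub>\<infinity>i\<in>F \<union> (I - F). c i * \<Phi> i n)" using F by (simp add: Un_absorb1)
      also have "\<dots> = ?S F n + (\<Sum>\<^sub>\<infinity>i\<in>I-F. c i * \<Phi> i n)"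
        using F orthonormal_series_pointwise[OF onF cF that] by (subst infsum_Un_disjoint) auto
      finally show ?thesis by simp
    qed
    have "ip X \<xi> ?y - (\<Sum>i\<in>F. c i * ip X \<xi> (\<Phi> i)) = ip X \<xi> (\<lambda>n. ?y n - ?S F n)"
      using ip_sum_right[OF F(1) l \<xi>] ip_diff_right[OF y S \<xi>] by simp
    also have "\<dots> = ip X \<xi> (\<lambda>n. \<Sum>\<^sub>\<infinity>i\<in>I-F. c i * \<Phi> i n)"
      unfolding ip_def by (intro infsum_cong) (simp only: eq)
    also have "cmod \<dots> \<le> (t * sqnorm X \<xi> + sqnorm X (\<lambda>n. \<Sum>\<^sub>\<infinity>i\<in>I-F. c i * \<Phi> i n) / t) / 2"
      by (intro norm_ip_le_weighted \<xi> t orthonormal_series_l2[OF onF cF])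
    also have "\<dots> \<le> (t * sqnorm X \<xi> + sqnorm (I - F) c / t) / 2"
      using orthonormal_series_l2(2)[OF onF cF] t by (simp add: divide_right_mono)
    also have "sqnorm (I - F) c = sqnorm I c - (\<Sum>i\<in>F. (cmod (c i))\<^sup>2)"
    proof -
      have "sqnorm I c = (\<Sum>\<^sub>\<infinity>i\<in>F \<union> (I - F). (cmod (c i))\<^sup>2)"
        using F by (simp add: sqnorm_def Un_absorb1)
      also have "\<dots> = (\<Sum>i\<in>F. (cmod (c i))\<^sup>2) + sqnorm (I - F) c"
        using F cF unfolding sqnorm_def l2_def by (subst infsum_Un_disjoint) auto
      finally show ?thesis by simp
    qed
    finally show ?thesis .
  qed
  show ?thesis unfolding has_sum_def
  proof (rule tendstoI)
    fix e :: real assume e: "e > 0"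
    \<comment> \<open>This weight bounds the contribution of \<open>\<xi>\<close> by
      \<open>e\<close>. Tails below \<open>e * t\<close> then contribute less than \<open>e\<close>
      after division by \<open>t\<close>, and the mean of the two is below \<open>e\<close>.\<close>
    define t where "t = e / (sqnorm X \<xi> + 1)"
    have t: "t > 0" "t * sqnorm X \<xi> \<le> e"
      using e sqnorm_nonneg[of X \<xi>] by (auto simp: t_def field_simps)
    have "((\<lambda>F. \<Sum>i\<in>F. (cmod (c i))\<^sup>2) \<longlongrightarrow> sqnorm I c) (finite_subsets_at_top I)"
      using c unfolding l2_def sqnorm_def by (rule infsum_tendsto)
    then have "\<forall>\<^sub>F F in finite_subsets_at_top I. dist (\<Sum>i\<in>F. (cmod (c i))\<^sup>2) (sqnorm I c) < e * t"
      using e t by (auto dest!: tendstoD[where e="e*t"])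
    then show "\<forall>\<^sub>F F in finite_subsets_at_top I.
        dist (\<Sum>i\<in>F. c i * ip X \<xi> (\<Phi> i)) (ip X \<xi> ?y) < e"
      using eventually_finite_subsets_at_top_weakI[of I "\<lambda>F. finite F \<and> F \<subseteq> I", simplified]
    proof eventually_elim
      case (elim F)
      have "sqnorm I c - (\<Sum>i\<in>F. (cmod (c i))\<^sup>2) < e * t" using elim(1) by (auto simp: dist_real_def)
      then have "(sqnorm I c - (\<Sum>i\<in>F. (cmod (c i))\<^sup>2)) / t < e"
        using t by (simp add: pos_divide_less_eq)
      then have "(t * sqnorm X \<xi> + (sqnorm I c - (\<Sum>i\<in>F. (cmod (c i))\<^sup>2)) / t) / 2 < e" using t by simp
      with bd[OF _ _ t(1), of F] elim(2) show ?case by (simp add: dist_norm norm_minus_commute)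
    qed
  qed
qed

text \<open>Completeness is stated for families that vanish outside \<open>X\<close>, as in \<open>fock\<close>.\<close>

lemma parseval_pointwise:
  assumes on: "orthonormal X I \<Phi>"
    and complete: "\<And>\<psi>. l2 X \<psi> \<Longrightarrow> (\<forall>n. n \<notin> X \<longrightarrow> \<psi> n = 0) \<Longrightarrow> (\<forall>i\<in>I. ip X (\<Phi> i) \<psi> = 0) \<Longrightarrow> \<psi> = (\<lambda>n. 0)"
    and y: "l2 X y" and n: "n \<in> X"
  shows "(\<Sum>\<^sub>\<infinity>i\<in>I. ip X (\<Phi> i) y * \<Phi> i n) = y n"
proof -
  define c where "c = (\<lambda>i. ip X (\<Phi> i) y)"
  have c: "l2 I c" unfolding l2_def c_def by (rule bessel_summable[OF on y])
  define z where "z = (\<lambda>n. \<Sum>\<^sub>\<infinity>i\<in>I. c i * \<Phi> i n)"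
  have z: "l2 X z" unfolding z_def by (rule orthonormal_series_l2[OF on c])
  \<comment> \<open>The defect of the expansion, set to 0 outside \<open>X\<close> so that
    completeness applies; all its coefficients vanish.\<close>
  define d where "d = (\<lambda>n. if n \<in> X then y n - z n else 0)"
  have d: "l2 X d"
    using l2_diff[OF y z] unfolding l2_def d_def by (rule summable_on_cong[THEN iffD1, rotated]) simp
  have "ip X (\<Phi> j) d = 0" if j: "j \<in> I" for j
  proof -
    have lj: "l2 X (\<Phi> j)" using on j unfolding orthonormal_def by blast
    have "((\<lambda>i. c i * ip X (\<Phi> j) (\<Phi> i)) has_sum ip X (\<Phi> j) z) I"
      unfolding z_def by (rule orthonormal_series_ip[OF on c lj])
    moreover have "((\<lambda>i. c i * ip X (\<Phi> j) (\<Phi> i)) has_sum c j) I"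
      using on j by (intro has_sum_finite_neutralI[of "{j}"]) (auto simp: orthonormal_def)
    ultimately have "ip X (\<Phi> j) z = c j" by (rule has_sum_unique)
    moreover have "ip X (\<Phi> j) d = ip X (\<Phi> j) (\<lambda>n. y n - z n)"
      unfolding ip_def d_def by (intro infsum_cong) auto
    ultimately show ?thesis using ip_diff_right[OF y z lj] by (simp add: c_def)
  qed
  then have "d = (\<lambda>n. 0)" using complete[OF d] by (auto simp: d_def)
  then have "d n = 0" by simp
  then show ?thesis using n by (simp add: d_def z_def c_def)
qed

section \<open>Displaced number states\<close>

text \<open>\<open>dsp z l i = \<langle>i|D(z)|l\<rangle>\<close> for the displacement operator \<open>D(z)\<close>, which turns the annihilation
  operator \<open>b\<close> into \<open>b + z\<close>.\<close>

primrec dsp :: "complex \<Rightarrow> nat \<Rightarrow> nat \<Rightarrow> complex" where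
  "dsp z 0 = (\<lambda>i. complex_of_real (exp (- (cmod z)\<^sup>2 / 2)) * z ^ i / complex_of_real (sqrt (fact i)))"
| "dsp z (Suc l) = (\<lambda>i. (complex_of_real (sqrt (real i)) * dsp z l (i - 1) - cnj z * dsp z l i)
                       / complex_of_real (sqrt (real (Suc l))))"

lemma sqrt_mult_self_complex [simp]:
  "complex_of_real (sqrt (real n)) * complex_of_real (sqrt (real n)) = of_nat n"
  by (simp flip: of_real_mult)

lemma sqrt_mult_self_complex' [simp]:
  "complex_of_real (sqrt (real n)) * (complex_of_real (sqrt (real n)) * x) = of_nat n * x"
  by (simp flip: mult.assoc)

text \<open>The recursion of \<open>dsp\<close> solved for its first term: creation raises the label
  \<open>l\<close>, up to the shift \<open>cnj z\<close>. At \<open>i = 0\<close> the truncated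
  \<open>i - 1\<close> is harmless because of the factor sqrt 0.\<close>

lemma dsp_raise:
  "complex_of_real (sqrt (real i)) * dsp z l (i - 1)
     = complex_of_real (sqrt (real (Suc l))) * dsp z (Suc l) i + cnj z * dsp z l i"
proof -
  have "complex_of_real (sqrt (real (Suc l))) \<noteq> 0" by (simp del: of_nat_Suc)
  then show ?thesis by (simp del: of_nat_Suc)
qed

declare dsp.simps(2) [simp del]

text \<open>For \<open>l = 0\<close> this says that a coherent state is an eigenvector of
  annihilation. The induction step commutes annihilation past the creation operator hidden in the
  recursion.\<close>

lemma dsp_lower:
  "complex_of_real (sqrt (real (Suc i))) * dsp z l (Suc i)
     = complex_of_real (sqrt (real l)) * dsp z (l - 1) i + z * dsp z l i"
proof (induction l arbitrary: i)
  case 0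
  have "sqrt (real (Suc i)) / sqrt (fact (Suc i)) = 1 / sqrt (fact i)"
    unfolding fact_Suc by (simp add: real_sqrt_mult)
  then have "complex_of_real (sqrt (real (Suc i))) / complex_of_real (sqrt (fact (Suc i)))
      = 1 / complex_of_real (sqrt (fact i))"
    by (metis of_real_divide of_real_1)
  then have "complex_of_real (sqrt (real (Suc i))) * (c * z ^ Suc i / complex_of_real (sqrt (fact (Suc i))))
      = z * (c * z ^ i / complex_of_real (sqrt (fact i)))" for c
    by (simp add: field_simps del: of_nat_Suc fact_Suc)
  from this[of "complex_of_real (exp (- (cmod z)\<^sup>2 / 2))"] show ?case
    by simp
next
  case (Suc l)
  define s where "s = complex_of_real (sqrt (real (Suc l)))"
  have s: "s \<noteq> 0" "s * s = of_nat (Suc l)" unfolding s_def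
    by (simp_all only: sqrt_mult_self_complex) (simp del: of_nat_Suc)
  define r where "r = (\<lambda>i. complex_of_real (sqrt (real i)))"
  define D where "D = dsp z l"
  have rr: "r i * r i = of_nat i" for i unfolding r_def by simp
  have IH: "r (Suc i) * D (Suc i) = r l * dsp z (l - 1) i + z * D i" for i
    using Suc.IH unfolding r_def D_def .
  have step: "s * dsp z (Suc l) i = r i * D (i - 1) - cnj z * D i" for i
    using s(1) unfolding s_def r_def D_def by (simp add: dsp.simps(2) del: of_nat_Suc)
  have up: "r i * dsp z (l - 1) (i - 1) = r l * D i + cnj z * dsp z (l - 1) i" if "l \<noteq> 0"
    using dsp_raise[of i z "l - 1"] that unfolding r_def D_def by simp
  \<comment> \<open>\<open>mid\<close> and \<open>low\<close> treat one product in two ways, by the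
    induction hypothesis and by the raising relation. Eliminating it expresses
    \<open>of_nat i * D i\<close> through \<open>l\<close> and the two shifts, which is the
    commutation relation in coordinates.\<close>
  have mid: "of_nat i * D i = r i * (r l * dsp z (l - 1) (i - 1)) + z * r i * D (i - 1)"
  proof (cases i)
    case 0
    then show ?thesis by (simp add: r_def)
  next
    case (Suc j)
    have "of_nat i * D i = r i * (r i * D i)" using rr[of i] by (simp flip: mult.assoc)
    also have "r i * D i = r l * dsp z (l - 1) j + z * D j" using IH[of j] Suc by simp
    finally show ?thesis using Suc by (simp add: algebra_simps)
  qed
  have low: "r i * (r l * dsp z (l - 1) (i - 1)) = of_nat l * D i + cnj z * (r l * dsp z (l - 1) i)"
  proof (cases "l = 0")
    case False
    have "r i * (r l * dsp z (l - 1) (i - 1)) = r l * (r i * dsp z (l - 1) (i - 1))" by simp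
    also have "\<dots> = r l * (r l * D i + cnj z * dsp z (l - 1) i)" using up[OF False] by simp
    also have "\<dots> = r l * r l * D i + cnj z * (r l * dsp z (l - 1) i)" by (simp add: algebra_simps)
    finally show ?thesis by (simp add: rr)
  qed (simp add: r_def)
  have "s * (r (Suc i) * dsp z (Suc l) (Suc i)) = r (Suc i) * (r (Suc i) * D i) - cnj z * (r (Suc i) * D (Suc i))"
  proof -
    have "s * (r (Suc i) * dsp z (Suc l) (Suc i)) = r (Suc i) * (s * dsp z (Suc l) (Suc i))" by simp
    then show ?thesis unfolding step by (simp add: right_diff_distrib)
  qed
  also have "\<dots> = of_nat (Suc i) * D i - cnj z * (r l * dsp z (l - 1) i + z * D i)"
    unfolding IH by (simp only: rr mult.assoc[symmetric])
  also have "\<dots> = s * s * D i + z * (s * dsp z (Suc l) i)"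
    unfolding step s(2) using mid low by (simp add: algebra_simps)
  finally have "s * (r (Suc i) * dsp z (Suc l) (Suc i)) = s * (s * D i + z * dsp z (Suc l) i)"
    by (simp add: algebra_simps)
  then show ?case using s unfolding r_def s_def D_def by simp
qed

text \<open>Faster than any geometric decay: the class is closed under \<open>ann\<close> and \<open>cre\<close>, so all series
  below converge absolutely.\<close>

definition rapid :: "(nat \<Rightarrow> complex) \<Rightarrow> bool" where
  "rapid f \<longleftrightarrow> (\<forall>r>0. \<exists>C. \<forall>i. cmod (f i) \<le> C * r ^ i)"

lemma rapid_bound: "rapid f \<Longrightarrow> r > 0 \<Longrightarrow> \<exists>C\<ge>0. \<forall>i. cmod (f i) \<le> C * r ^ i"
proof -
  assume "rapid f" "r > 0"
  then obtain C where C: "\<And>i. cmod (f i) \<le> C * r ^ i" unfolding rapid_def by blast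
  have "0 \<le> C" using order.trans[OF norm_ge_zero C[of 0]] by simp
  with C show ?thesis by blast
qed

lemma rapid_add: "rapid f \<Longrightarrow> rapid g \<Longrightarrow> rapid (\<lambda>i. f i + g i)"
  unfolding rapid_def
proof (intro allI impI)
  fix r :: real assume "\<forall>r>0. \<exists>C. \<forall>i. cmod (f i) \<le> C * r ^ i" "\<forall>r>0. \<exists>C. \<forall>i. cmod (g i) \<le> C * r ^ i" "r > 0"
  then obtain C D where CD: "\<And>i. cmod (f i) \<le> C * r ^ i" "\<And>i. cmod (g i) \<le> D * r ^ i" by blast
  have "cmod (f i + g i) \<le> (C + D) * r ^ i" for i
    using order.trans[OF norm_triangle_ineq add_mono[OF CD]] by (simp add: algebra_simps)
  then show "\<exists>C. \<forall>i. cmod (f i + g i) \<le> C * r ^ i" by blast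
qed

lemma rapid_scale: "rapid f \<Longrightarrow> rapid (\<lambda>i. c * f i)"
  unfolding rapid_def
proof (intro allI impI)
  fix r :: real assume "\<forall>r>0. \<exists>C. \<forall>i. cmod (f i) \<le> C * r ^ i" "r > 0"
  then obtain C where C: "\<And>i. cmod (f i) \<le> C * r ^ i" by blast
  have "cmod (c * f i) \<le> (cmod c * C) * r ^ i" for i
    using mult_left_mono[OF C, of "cmod c" i] by (simp add: norm_mult mult.assoc)
  then show "\<exists>C. \<forall>i. cmod (c * f i) \<le> C * r ^ i" by blast
qed

lemma real_le_two_power: "real i \<le> 2 ^ i"
  using of_nat_less_two_power[where 'a=real, of i] by simp

text \<open>Since i + 1 is at most 2^(i+1), the bound with ratio \<open>r / 2\<close> absorbs the
  factor.\<close>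

lemma rapid_linear_growth:
  assumes "rapid f"
  shows "rapid (\<lambda>i. of_nat (Suc i) * f i)"
  unfolding rapid_def
proof (intro allI impI)
  fix r :: real assume r: "r > 0"
  then obtain C where C: "C \<ge> 0" "\<And>i. cmod (f i) \<le> C * (r / 2) ^ i"
    using rapid_bound[OF assms, of "r / 2"] by auto
  have "cmod (of_nat (Suc i) * f i) \<le> (2 * C) * r ^ i" for i
  proof -
    have "cmod (of_nat (Suc i) * f i) = real (Suc i) * cmod (f i)"
      unfolding norm_mult norm_of_nat ..
    also have "\<dots> \<le> 2 ^ Suc i * (C * (r / 2) ^ i)"
      by (intro mult_mono real_le_two_power C) auto
    also have "\<dots> = (2 * C) * r ^ i" by (simp add: power_divide)
    finally show ?thesis .
  qed
  then show "\<exists>C. \<forall>i. cmod (of_nat (Suc i) * f i) \<le> C * r ^ i" by blast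
qed

lemma rapid_mono: "rapid g \<Longrightarrow> (\<And>i. cmod (f i) \<le> cmod (g i)) \<Longrightarrow> rapid f"
  unfolding rapid_def by (meson order.trans)

lemma rapid_Suc: "rapid f \<Longrightarrow> rapid (\<lambda>i. f (Suc i))"
  unfolding rapid_def
proof (intro allI impI)
  fix r :: real assume "\<forall>r>0. \<exists>C. \<forall>i. cmod (f i) \<le> C * r ^ i" "r > 0"
  then obtain C where C: "\<And>i. cmod (f i) \<le> C * r ^ i" by blast
  have "cmod (f (Suc i)) \<le> (C * r) * r ^ i" for i using C[of "Suc i"] by (simp add: mult.assoc)
  then show "\<exists>C. \<forall>i. cmod (f (Suc i)) \<le> C * r ^ i" by blast
qed

lemma rapid_pred: "rapid f \<Longrightarrow> rapid (\<lambda>i. f (i - 1))"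
  unfolding rapid_def
proof (intro allI impI)
  fix r :: real assume *: "\<forall>r>0. \<exists>C. \<forall>i. cmod (f i) \<le> C * r ^ i" and r: "r > 0"
  then obtain C where C: "\<And>i. cmod (f i) \<le> C * r ^ i" by blast
  have C0: "0 \<le> C" using order.trans[OF norm_ge_zero C[of 0]] by simp
  have "cmod (f (i - 1)) \<le> (C / r + C) * r ^ i" for i
  proof (cases i)
    case 0
    then show ?thesis using C[of 0] r C0 by (simp add: add_increasing)
  next
    case (Suc j)
    have "0 \<le> C * r * r ^ j" using C0 r by simp
    then show ?thesis using C[of j] r Suc by (simp add: algebra_simps)
  qed
  then show "\<exists>C. \<forall>i. cmod (f (i - 1)) \<le> C * r ^ i" by blast
qed

lemma sqrt_real_le: "sqrt (real n) \<le> real n"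
  using real_le_rsqrt real_sqrt_le_mono[of "real n" "(real n)\<^sup>2"]
  by (cases n) (auto simp: power2_eq_square)

lemma rapid_ann: "rapid f \<Longrightarrow> rapid (\<lambda>i. complex_of_real (sqrt (real (Suc i))) * f (Suc i))"
  by (rule rapid_mono[OF rapid_linear_growth[OF rapid_Suc]])
     (auto simp: norm_mult simp del: of_nat_Suc intro!: mult_right_mono sqrt_real_le)

lemma rapid_cre: "rapid f \<Longrightarrow> rapid (\<lambda>i. complex_of_real (sqrt (real i)) * f (i - 1))"
proof (rule rapid_mono[OF rapid_linear_growth[OF rapid_pred]])
  fix i
  have "sqrt (real i) \<le> real (Suc i)" using sqrt_real_le[of i] by simp
  then show "cmod (complex_of_real (sqrt (real i)) * f (i - 1)) \<le> cmod (of_nat (Suc i) * f (i - 1))"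
    unfolding norm_mult norm_of_nat by (intro mult_right_mono) auto
qed

lemma rapid_diff: "rapid f \<Longrightarrow> rapid g \<Longrightarrow> rapid (\<lambda>i. f i - g i)"
  using rapid_add[of f "\<lambda>i. (-1) * g i"] rapid_scale[of g "-1"] by simp

lemma rapid_dsp: "rapid (dsp z l)"
proof (induction l)
  case 0
  have "rapid (\<lambda>i. z ^ i / complex_of_real (sqrt (fact i)))"
    unfolding rapid_def
  proof (intro allI impI)
    fix r :: real assume r: "r > 0"
    \<comment> \<open>The term \<open>?a ^ i / fact i\<close> is at most the whole exponential
      series; its square root is the coefficient to be bounded, divided by
      \<open>r ^ i\<close>.\<close>
    let ?a = "(cmod z)\<^sup>2 / r\<^sup>2"
    have "cmod (z ^ i / complex_of_real (sqrt (fact i))) \<le> sqrt (exp ?a) * r ^ i" for i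
    proof -
      have "?a ^ i / fact i \<le> exp ?a"
      proof -
        have "(\<Sum>j\<in>{i}. ?a ^ j /\<^sub>R fact j) \<le> exp ?a"
          unfolding exp_def using summable_exp[of ?a]
          by (intro sum_le_suminf) (auto simp: field_simps)
        then show ?thesis by (simp add: field_simps)
      qed
      then have "sqrt (?a ^ i / fact i) \<le> sqrt (exp ?a)" by simp
      moreover have "sqrt (?a ^ i / fact i) = (cmod z) ^ i / r ^ i / sqrt (fact i)"
      proof -
        have "?a ^ i / fact i = ((cmod z ^ i / r ^ i)\<^sup>2) / fact i"
          by (simp add: power_divide flip: power_mult) (simp add: mult.commute)
        then show ?thesis using r by (simp add: real_sqrt_divide)
      qed
      ultimately have "(cmod z) ^ i / r ^ i / sqrt (fact i) * r ^ i \<le> sqrt (exp ?a) * r ^ i"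
        using r by (intro mult_right_mono) auto
      then show ?thesis using r by (simp add: norm_divide norm_power)
    qed
    then show "\<exists>C. \<forall>i. cmod (z ^ i / complex_of_real (sqrt (fact i))) \<le> C * r ^ i" by blast
  qed
  from rapid_scale[OF this, of "complex_of_real (exp (- (cmod z)\<^sup>2 / 2))"] show ?case by simp
next
  case (Suc l)
  have "rapid (\<lambda>i. (1 / complex_of_real (sqrt (real (Suc l)))) *
     (complex_of_real (sqrt (real i)) * dsp z l (i - 1) - cnj z * dsp z l i))"
    by (intro rapid_scale rapid_diff rapid_cre Suc)
  then show ?case by (simp add: dsp.simps(2) del: of_nat_Suc)
qed

text \<open>Boundedness of the second factor is deliberate: it lets rapidly decreasing states be
  paired with any square-summable vector and its shifts.\<close>

lemma rapid_mult_bounded_summable: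
  assumes f: "rapid f" and g: "\<And>i. cmod (g i) \<le> B"
  shows "(\<lambda>i. f i * g i) summable_on UNIV"
proof -
  obtain C where C: "C \<ge> 0" "\<And>i. cmod (f i) \<le> C * (1/2) ^ i" using rapid_bound[OF f, of "1/2"] by auto
  have B: "B \<ge> 0" using order.trans[OF norm_ge_zero g] .
  have "summable (\<lambda>i. C * (1/2) ^ i * B)" by (intro summable_mult summable_mult2 summable_geometric) auto
  moreover have "norm (f i * g i) \<le> C * (1/2) ^ i * B" for i
    unfolding norm_mult by (intro mult_mono C g) (use C in auto)
  ultimately have "summable (\<lambda>i. norm (f i * g i))"
    by (intro summable_comparison_test[of "\<lambda>i. norm (f i * g i)"]) auto
  then show ?thesis by (rule norm_summable_imp_summable_on)
qed

lemma rapid_bounded: "rapid f \<Longrightarrow> \<exists>B. \<forall>i. cmod (f i) \<le> B"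
  unfolding rapid_def by (metis mult.right_neutral power_one zero_less_one)

lemma rapid_l2: 
  assumes "rapid f" shows "l2 UNIV f"
proof -
  obtain B where B: "\<And>i. cmod (f i) \<le> B" using rapid_bounded[OF assms] by blast
  have "(\<lambda>i. f i * cnj (f i)) summable_on UNIV"
    by (rule rapid_mult_bounded_summable[OF assms]) (use B in simp)
  then have "(\<lambda>i. complex_of_real ((cmod (f i))\<^sup>2)) summable_on UNIV"
    by (simp add: complex_norm_square del: of_real_power)
  then show ?thesis unfolding l2_def using summable_on_Re[of "\<lambda>i. complex_of_real ((cmod (f i))\<^sup>2)"]
    by (simp del: of_real_power)
qed

lemma infsum_nat_shift:
  fixes f :: "nat \<Rightarrow> complex"
  assumes "f 0 = 0"
  shows "(\<Sum>\<^sub>\<infinity>i. f (Suc i)) = (\<Sum>\<^sub>\<infinity>i. f i)"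
proof -
  have "(\<Sum>\<^sub>\<infinity>i. f (Suc i)) = (\<Sum>\<^sub>\<infinity>i\<in>range Suc. f i)"
    by (subst infsum_reindex) (auto simp: o_def)
  also have "\<dots> = (\<Sum>\<^sub>\<infinity>i. f i)"
    using assms not0_implies_Suc by (intro infsum_cong_neutral) (auto, metis not0_implies_Suc rangeI)
  finally show ?thesis .
qed

text \<open>Adjointness for arbitrary families: the two sums agree term by term after an index
  shift, and the term at 0 vanishes.\<close>

lemma ip_cre_ann:
  "ip UNIV (\<lambda>i. complex_of_real (sqrt (real i)) * f (i - 1)) g
     = ip UNIV f (\<lambda>i. complex_of_real (sqrt (real (Suc i))) * g (Suc i))"
  unfolding ip_def by (subst infsum_nat_shift[symmetric]) (simp_all add: mult.commute mult.left_commute del: of_nat_Suc)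

lemma ip_scale_left: "ip X (\<lambda>n. c * \<psi> n) \<xi> = cnj c * ip X \<psi> \<xi>"
  using ip_scale_right[of X \<xi> c \<psi>] ip_commute[of X "\<lambda>n. c * \<psi> n" \<xi>] ip_commute[of X \<psi> \<xi>] by simp

lemma ip_add_left: "l2 X \<phi> \<Longrightarrow> l2 X \<psi> \<Longrightarrow> l2 X \<xi> \<Longrightarrow> ip X (\<lambda>n. \<phi> n + \<psi> n) \<xi> = ip X \<phi> \<xi> + ip X \<psi> \<xi>"
  using ip_add_right[of X \<phi> \<psi> \<xi>] ip_commute[of X "\<lambda>n. \<phi> n + \<psi> n" \<xi>]
    ip_commute[of X \<phi> \<xi>] ip_commute[of X \<psi> \<xi>] by simp

text \<open>Moving creation across the inner product produces the same displacement term on both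
  sides. After cancellation \<open>rel\<close> lowers both labels by one, so that everything reduces
  to the norm of the coherent state and to overlaps that carry the factor sqrt 0.\<close>

lemma dsp_ip: "ip UNIV (dsp z l) (dsp z m) = (if l = m then 1 else 0)"
proof -
  have l2: "l2 UNIV (dsp z l)" for l by (rule rapid_l2[OF rapid_dsp])
  let ?cre = "\<lambda>l i. complex_of_real (sqrt (real i)) * dsp z l (i - 1)"
  let ?ann = "\<lambda>l i. complex_of_real (sqrt (real (Suc i))) * dsp z l (Suc i)"
  have raise: "?cre l = (\<lambda>i. complex_of_real (sqrt (real (Suc l))) * dsp z (Suc l) i + cnj z * dsp z l i)" for l
    by (rule ext) (rule dsp_raise)
  have lower: "?ann l = (\<lambda>i. complex_of_real (sqrt (real l)) * dsp z (l - 1) i + z * dsp z l i)" for l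
    by (rule ext) (rule dsp_lower)
  have rel: "complex_of_real (sqrt (real (Suc l))) * ip UNIV (dsp z (Suc l)) (dsp z m)
      = complex_of_real (sqrt (real m)) * ip UNIV (dsp z l) (dsp z (m - 1))" for l m
  proof -
    have "ip UNIV (?cre l) (dsp z m) = ip UNIV (dsp z l) (?ann m)" by (rule ip_cre_ann)
    then show ?thesis unfolding raise lower
      by (simp add: ip_add_left ip_add_right l2_scale l2 ip_scale_left ip_scale_right del: of_nat_Suc)
  qed
  \<comment> \<open>The squared moduli are the Poisson weights with mean |z|^2, whose sum is
    1.\<close>
  have zero: "ip UNIV (dsp z 0) (dsp z 0) = 1"
  proof -
    let ?a = "(cmod z)\<^sup>2"
    have "(\<lambda>i. ?a ^ i /\<^sub>R fact i) sums exp ?a" by (rule exp_converges)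
    then have "((\<lambda>i. ?a ^ i /\<^sub>R fact i) has_sum exp ?a) UNIV"
      by (intro sums_nonneg_imp_has_sum) auto
    then have "((\<lambda>i. exp (- ?a) * (?a ^ i /\<^sub>R fact i)) has_sum exp (- ?a) * exp ?a) UNIV"
      by (rule has_sum_cmult_right)
    moreover have "exp (- ?a) * (?a ^ i /\<^sub>R fact i) = (cmod (dsp z 0 i))\<^sup>2" for i
    proof -
      have n: "cmod (dsp z 0 i) = exp (- ?a / 2) * cmod z ^ i / sqrt (fact i)"
        by (simp add: norm_mult norm_divide norm_power)
      have e: "(exp (- ?a / 2))\<^sup>2 = exp (- ?a)" using exp_double[of "- ?a / 2"] by simp
      have p: "(cmod z ^ i)\<^sup>2 = ?a ^ i" by (simp add: power_mult[symmetric] mult.commute)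
      show ?thesis unfolding n power_mult_distrib power_divide e p by (simp add: divide_inverse)
    qed
    ultimately have "sqnorm UNIV (dsp z 0) = 1"
      unfolding sqnorm_def by (intro infsumI) (simp add: exp_minus)
    then show ?thesis by (simp only: ip_self of_real_1)
  qed
  have s0: "complex_of_real (sqrt (real (Suc l))) \<noteq> 0" for l by (simp del: of_nat_Suc)
  show ?thesis
  proof (induction l arbitrary: m)
    case 0
    show ?case
    proof (cases m)
      case (Suc k)
      have "complex_of_real (sqrt (real (Suc k))) * ip UNIV (dsp z (Suc k)) (dsp z 0) = 0"
        using rel[of k 0] by simp
      then have "ip UNIV (dsp z m) (dsp z 0) = 0" using s0[of k] Suc by simp
      then show ?thesis using Suc ip_commute[of UNIV "dsp z 0" "dsp z m"] by simp
    qed (use zero in simp)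
  next
    case (Suc l)
    have "complex_of_real (sqrt (real (Suc l))) * ip UNIV (dsp z (Suc l)) (dsp z m)
      = complex_of_real (sqrt (real m)) * (if l = m - 1 then 1 else 0)"
      unfolding rel Suc ..
    also have "\<dots> = complex_of_real (sqrt (real (Suc l))) * (if Suc l = m then 1 else 0)"
      by (cases m) auto
    finally show ?case by (rule iffD1[OF mult_left_cancel[OF s0]])
  qed
qed

lemma orthonormal_dsp: "orthonormal UNIV UNIV (dsp z)"
  unfolding orthonormal_def by (simp add: rapid_l2[OF rapid_dsp] dsp_ip)

text \<open>\<open>D(z)\<^sup>* = D(-z)\<close>: orthonormality for \<open>-z\<close> is completeness for \<open>z\<close>.\<close>

lemma cnj_dsp: "cnj (dsp z l i) = dsp (- z) i l"
proof (induction i arbitrary: l)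
  case 0
  show ?case
  proof (induction l)
    case (Suc l)
    have "complex_of_real (sqrt (real (Suc l))) * cnj (dsp z (Suc l) 0) = (- z) * cnj (dsp z l 0)"
      using arg_cong[OF dsp_raise[of 0 z l], of cnj]
      by (simp add: eq_neg_iff_add_eq_0 del: of_nat_Suc)
    moreover have "complex_of_real (sqrt (real (Suc l))) * dsp (-z) 0 (Suc l) = (-z) * dsp (-z) 0 l"
      using dsp_lower[of l "-z" 0] by simp
    moreover have "complex_of_real (sqrt (real (Suc l))) \<noteq> 0" by (simp del: of_nat_Suc)
    ultimately show ?case using Suc by (metis mult_left_cancel)
  qed simp
next
  case (Suc i)
  have "complex_of_real (sqrt (real (Suc i))) * cnj (dsp z l (Suc i))
      = complex_of_real (sqrt (real l)) * cnj (dsp z (l - 1) i) + cnj z * cnj (dsp z l i)"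
    using arg_cong[OF dsp_lower[of i z l], of cnj] by (simp del: of_nat_Suc)
  moreover have "complex_of_real (sqrt (real (Suc i))) * dsp (-z) (Suc i) l
      = complex_of_real (sqrt (real l)) * dsp (-z) i (l - 1) + cnj z * dsp (-z) i l"
    using dsp_raise[of l "-z" i] by (simp add: algebra_simps del: of_nat_Suc)
  moreover have "complex_of_real (sqrt (real (Suc i))) \<noteq> 0" by (simp del: of_nat_Suc)
  ultimately show ?case using Suc by (metis mult_left_cancel)
qed

text \<open>The numbers \<open>cnj (dsp z l j)\<close> are coefficients of the Kronecker function at
  \<open>j\<close>, by orthonormality for \<open>-z\<close>. Pairing this expansion with \<psi>
  writes \<open>\<psi> j\<close> through overlaps that all vanish.\<close>

lemma dsp_complete:
  assumes \<psi>: "l2 UNIV \<psi>" and orth: "\<And>l. ip UNIV (dsp z l) \<psi> = 0"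
  shows "\<psi> j = 0"
proof -
  define c where "c = (\<lambda>l. cnj (dsp z l j))"
  have c: "c = dsp (-z) j" unfolding c_def by (rule ext) (rule cnj_dsp)
  have l2c: "l2 UNIV c" unfolding c by (rule rapid_l2[OF rapid_dsp])
  have "(\<Sum>\<^sub>\<infinity>l. c l * dsp z l n) = (if n = j then 1 else 0)" for n
  proof -
    have "(\<Sum>\<^sub>\<infinity>l. c l * dsp z l n) = ip UNIV (dsp (-z) n) (dsp (-z) j)"
      unfolding ip_def c using cnj_dsp[of "-z" n] by (simp add: mult.commute)
    then show ?thesis by (simp add: dsp_ip)
  qed
  then have "ip UNIV \<psi> (\<lambda>n. \<Sum>\<^sub>\<infinity>l. c l * dsp z l n) = cnj (\<psi> j)"
    using ip_kronecker[of j UNIV \<psi>] by simp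
  moreover have "((\<lambda>l. c l * ip UNIV \<psi> (dsp z l)) has_sum ip UNIV \<psi> (\<lambda>n. \<Sum>\<^sub>\<infinity>l. c l * dsp z l n)) UNIV"
    by (rule orthonormal_series_ip[OF orthonormal_dsp l2c \<psi>])
  moreover have "ip UNIV \<psi> (dsp z l) = 0" for l using orth[of l] ip_commute[of UNIV \<psi> "dsp z l"] by simp
  ultimately show ?thesis using infsumI by fastforce
qed

section \<open>The gas with a source in one mode\<close>

lemma cre_ann: "cre k (ann k \<psi>) n = of_nat (n k) * \<psi> n"
proof (cases "n k")
  case (Suc m)
  have "n(k := Suc m) = n" using Suc by auto
  then show ?thesis using Suc by (simp add: cre_def ann_def add.commute[of _ 1] flip: of_nat_Suc)
qed (simp add: cre_def ann_def)

text \<open>A configuration is recovered from the finite graph of its non-zero values. Countability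
  is what allows the eigenbasis to be indexed by \<open>nat\<close>, as \<open>eigenbasis\<close>
  requires.\<close>

lemma countable_configs: "countable K \<Longrightarrow> countable (configs K)"
proof -
  assume K: "countable K"
  let ?g = "\<lambda>n :: config. {(k, n k) |k. n k \<noteq> 0}"
  have "inj_on ?g (configs K)"
  proof (rule inj_onI)
    fix n m :: config assume eq: "?g n = ?g m"
    show "n = m"
    proof
      fix k
      have "(k, n k) \<in> ?g n \<longleftrightarrow> n k \<noteq> 0" "(k, m k) \<in> ?g m \<longleftrightarrow> m k \<noteq> 0"
        "(k, n k) \<in> ?g m \<longleftrightarrow> n k = m k \<and> m k \<noteq> 0" "(k, m k) \<in> ?g n \<longleftrightarrow> n k = m k \<and> n k \<noteq> 0" by auto
      then show "n k = m k" unfolding eq by (metis eq)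
    qed
  qed
  moreover have "countable (?g ` configs K)"
  proof (rule countable_subset)
    show "countable {A. finite A \<and> A \<subseteq> K \<times> (UNIV :: nat set)}"
      by (intro countable_Collect_finite_subset countable_SIGMA K) auto
    show "?g ` configs K \<subseteq> {A. finite A \<and> A \<subseteq> K \<times> UNIV}"
    proof
      fix A assume "A \<in> ?g ` configs K"
      then obtain n where n: "n \<in> configs K" "A = ?g n" by blast
      have "A = (\<lambda>k. (k, n k)) ` {k. n k \<noteq> 0}" using n by auto
      then show "A \<in> {A. finite A \<and> A \<subseteq> K \<times> UNIV}" using n by (auto simp: configs_def)
    qed
  qed
  ultimately show ?thesis by (rule countable_image_inj_on[rotated])
qed

lemma configs_upd: "n \<in> configs K \<Longrightarrow> k \<in> K \<Longrightarrow> n(k := i) \<in> configs K"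
proof -
  assume n: "n \<in> configs K" and k: "k \<in> K"
  have "{j. (n(k := i)) j \<noteq> 0} \<subseteq> insert k {j. n j \<noteq> 0}" by auto
  then show ?thesis using n k finite_subset[of "{j. (n(k := i)) j \<noteq> 0}" "insert k {j. n j \<noteq> 0}"]
    unfolding configs_def by (auto split: if_splits)
qed

lemma configs_upd_iff: "k \<in> K \<Longrightarrow> n(k := i) \<in> configs K \<longleftrightarrow> n \<in> configs K"
  using configs_upd[of n K k i] configs_upd[of "n(k := i)" K k "n k"] by auto

lemma ket_eq: "ket n = (\<lambda>m. if m = n then 1 else 0)"
  by (simp add: ket_def)

lemma fock_inner_ip: "fock_inner K = ip (configs K)"
  by (intro ext) (simp add: fock_inner_def ip_def)

lemma ip_single:
  assumes "m \<in> X" "\<And>j. j \<in> X \<Longrightarrow> j \<noteq> m \<Longrightarrow> f j = 0"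
  shows "ip X \<phi> f = cnj (\<phi> m) * f m"
proof -
  have "ip X \<phi> f = (\<Sum>\<^sub>\<infinity>j\<in>{m}. cnj (\<phi> j) * f j)"
    unfolding ip_def using assms by (intro infsum_cong_neutral) auto
  then show ?thesis by simp
qed

lemma ann_ket_support: "ann k (ket n) m \<noteq> 0 \<Longrightarrow> m = n(k := n k - 1) \<and> n k > 0"
  by (auto simp: ann_def ket_def split: if_splits)

lemma cre_ket_support: "cre k (ket n) m \<noteq> 0 \<Longrightarrow> m = n(k := n k + 1)"
proof -
  assume "cre k (ket n) m \<noteq> 0"
  then have "m k \<noteq> 0" "n = m(k := m k - 1)" by (auto simp: cre_def ket_def split: if_splits)
  then show ?thesis by (simp add: fun_eq_iff)
qed

lemma l2_point_support: "(\<And>m. f m \<noteq> 0 \<Longrightarrow> m = n) \<Longrightarrow> l2 X f"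
  unfolding l2_def by (rule finite_nonzero_values_imp_summable_on, rule finite_subset[of _ "{n}"]) auto

lemma l2_ann_ket: "l2 X (ann k (ket n))"
  by (rule l2_point_support) (use ann_ket_support in blast)

lemma l2_cre_ket: "l2 X (cre k (ket n))"
  by (rule l2_point_support) (use cre_ket_support in blast)

text \<open>The image of a number state is supported on one configuration, so adjointness raises no
  domain question and \<phi> may be any family.\<close>

lemma ip_ann_ket:
  assumes "n \<in> configs K" "k \<in> K"
  shows "ip (configs K) \<phi> (ann k (ket n)) = cnj (cre k \<phi> n)"
proof -
  let ?m = "n(k := n k - 1)"
  have "ip (configs K) \<phi> (ann k (ket n)) = cnj (\<phi> ?m) * ann k (ket n) ?m"
    using assms ann_ket_support[of k n] by (intro ip_single configs_upd) blast+
  also have "\<dots> = cnj (cre k \<phi> n)"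
    by (cases "n k") (auto simp: ann_def cre_def ket_def fun_eq_iff)
  finally show ?thesis .
qed

lemma ip_cre_ket:
  assumes "n \<in> configs K" "k \<in> K"
  shows "ip (configs K) \<phi> (cre k (ket n)) = cnj (ann k \<phi> n)"
proof -
  let ?m = "n(k := n k + 1)"
  have "ip (configs K) \<phi> (cre k (ket n)) = cnj (\<phi> ?m) * cre k (ket n) ?m"
    using assms cre_ket_support[of k n] by (intro ip_single configs_upd) blast+
  also have "\<dots> = cnj (ann k \<phi> n)"
    by (auto simp: ann_def cre_def ket_def add.commute)
  finally show ?thesis .
qed

lemma l2_bounded: "l2 X f \<Longrightarrow> n \<in> X \<Longrightarrow> (cmod (f n))\<^sup>2 \<le> sqnorm X f"
  using finite_sum_le_infsum[of "\<lambda>n. (cmod (f n))\<^sup>2" X "{n}"] by (simp add: l2_def sqnorm_def)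

text \<open>Here \<open>w k\<close> stands for \<open>energy k - \<mu>\<close> and \<kappa> for
  \<open>sqrt V * \<eta>\<close>. The gap reflects a negative chemical potential. Summability is
  asked for at every temperature because half of an exponential weight is later spent on absorbing
  occupation numbers.\<close>

locale source_gas =
  fixes K :: "(real^3) set" and q :: "real^3" and w :: "real^3 \<Rightarrow> real" and \<kappa> :: complex
  assumes q_in: "q \<in> K" and countable_K: "countable K"
    and gap: "\<exists>m>0. \<forall>k\<in>K. m \<le> w k"
    and exp_summable: "\<And>t. t > 0 \<Longrightarrow> (\<lambda>k. exp (- (t * w k))) summable_on K"
begin

definition "H = (\<lambda>\<psi> n. (\<Sum>\<^sub>\<infinity>k\<in>K. complex_of_real (w k) * cre k (ann k \<psi>) n)
     + (cnj \<kappa> * ann q \<psi> n + \<kappa> * cre q \<psi> n))"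

text \<open>The displacement that completes the square in the mode \<open>q\<close>: the one-mode
  Hamiltonian becomes w (cre - cnj z)(ann - z) - w |z|^2, which also explains the constant in
  \<open>En\<close>.\<close>

definition z :: complex where "z = - \<kappa> / complex_of_real (w q)"

definition cfg_energy :: "config \<Rightarrow> real" where
  "cfg_energy n = (\<Sum>k | n k \<noteq> 0. w k * real (n k))"

text \<open>A product vector: the one-mode vector \<open>f\<close> in the mode \<open>q\<close>, and
  the sharp occupation numbers of \<alpha> in all other modes. The value \<open>\<alpha> q\<close>
  is immaterial.\<close>

definition sec :: "config \<Rightarrow> (nat \<Rightarrow> complex) \<Rightarrow> state" where
  "sec \<alpha> f n = (if n(q := 0) = \<alpha>(q := 0) then f (n q) else 0)"

definition \<Phi> :: "config \<Rightarrow> state" where "\<Phi> \<alpha> = sec \<alpha> (dsp z (\<alpha> q))"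

definition En :: "config \<Rightarrow> real" where "En \<alpha> = cfg_energy \<alpha> - w q * (cmod z)\<^sup>2"

lemma w_pos: "k \<in> K \<Longrightarrow> w k > 0"
  using gap by force

lemma sec_upd [simp]: "sec \<alpha> f (\<alpha>(q := i)) = f i"
  by (simp add: sec_def)

lemma sec_ann: "ann q (sec \<alpha> f) = sec \<alpha> (\<lambda>i. complex_of_real (sqrt (real (Suc i))) * f (Suc i))"
  by (rule ext) (simp add: ann_def sec_def add.commute)

lemma sec_cre: "cre q (sec \<alpha> f) = sec \<alpha> (\<lambda>i. complex_of_real (sqrt (real i)) * f (i - 1))"
  by (rule ext) (simp add: cre_def sec_def)

lemma sector_cases: "n(q := 0) = \<alpha>(q := 0) \<Longrightarrow> n = \<alpha>(q := n q)"
  by (metis fun_upd_triv fun_upd_upd)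

lemma has_sum_sector:
  assumes \<alpha>: "\<alpha> \<in> configs K" and F: "\<And>n. n(q := 0) \<noteq> \<alpha>(q := 0) \<Longrightarrow> F n = 0"
  shows "(F has_sum s) (configs K) \<longleftrightarrow> ((\<lambda>i. F (\<alpha>(q := i))) has_sum s) UNIV"
proof -
  have inj: "inj_on (\<lambda>i. \<alpha>(q := i)) UNIV" by (intro inj_onI) (metis fun_upd_same)
  have "(F has_sum s) (configs K) \<longleftrightarrow> (F has_sum s) (range (\<lambda>i. \<alpha>(q := i)))"
  proof (rule has_sum_cong_neutral)
    show "F n = 0" if "n \<in> configs K - range (\<lambda>i. \<alpha>(q := i))" for n
      using that F[of n] sector_cases[of n \<alpha>] by blast
    show "F n = 0" if "n \<in> range (\<lambda>i. \<alpha>(q := i)) - configs K" for n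
      using that configs_upd[OF \<alpha> q_in] by blast
  qed simp
  also have "\<dots> \<longleftrightarrow> ((\<lambda>i. F (\<alpha>(q := i))) has_sum s) UNIV"
    using has_sum_reindex[OF inj, of F s] by (simp add: o_def)
  finally show ?thesis .
qed

lemma infsum_sector:
  assumes "\<alpha> \<in> configs K" "\<And>n. n(q := 0) \<noteq> \<alpha>(q := 0) \<Longrightarrow> F n = 0"
  shows "infsum F (configs K) = (\<Sum>\<^sub>\<infinity>i. F (\<alpha>(q := i)))"
    and "F summable_on configs K \<longleftrightarrow> (\<lambda>i. F (\<alpha>(q := i))) summable_on UNIV"
proof -
  show s: "F summable_on configs K \<longleftrightarrow> (\<lambda>i. F (\<alpha>(q := i))) summable_on UNIV"
    unfolding summable_on_def using has_sum_sector[OF assms] by simp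
  show "infsum F (configs K) = (\<Sum>\<^sub>\<infinity>i. F (\<alpha>(q := i)))"
  proof (cases "F summable_on configs K")
    case True
    then have "((\<lambda>i. F (\<alpha>(q := i))) has_sum infsum F (configs K)) UNIV"
      using has_sum_sector[where F=F and s="infsum F (configs K)", OF assms] by simp
    then show ?thesis by (simp add: infsumI)
  next
    case False
    then show ?thesis using s by (simp add: infsum_not_exists)
  qed
qed

lemma l2_sec: "\<alpha> \<in> configs K \<Longrightarrow> l2 (configs K) (sec \<alpha> f) \<longleftrightarrow> l2 UNIV f"
  unfolding l2_def by (subst infsum_sector(2)[where \<alpha>=\<alpha>]) (auto simp: sec_def)

lemma sqnorm_sec: "\<alpha> \<in> configs K \<Longrightarrow> sqnorm (configs K) (sec \<alpha> f) = sqnorm UNIV f"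
  unfolding sqnorm_def by (subst infsum_sector(1)[where \<alpha>=\<alpha>]) (auto simp: sec_def)

lemma ip_sec: "\<alpha> \<in> configs K \<Longrightarrow> ip (configs K) (sec \<alpha> f) \<psi> = ip UNIV f (\<lambda>i. \<psi> (\<alpha>(q := i)))"
  unfolding ip_def by (subst infsum_sector(1)[where \<alpha>=\<alpha>]) (auto simp: sec_def)

lemma l2_restrict_sector:
  assumes \<alpha>: "\<alpha> \<in> configs K" and \<psi>: "l2 (configs K) \<psi>"
  shows "l2 UNIV (\<lambda>i. \<psi> (\<alpha>(q := i)))"
proof -
  have inj: "inj_on (\<lambda>i. \<alpha>(q := i)) UNIV" by (intro inj_onI) (metis fun_upd_same)
  have "(\<lambda>n. (cmod (\<psi> n))\<^sup>2) summable_on range (\<lambda>i. \<alpha>(q := i))"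
    using \<psi> configs_upd[OF \<alpha> q_in] unfolding l2_def by (elim summable_on_subset) auto
  then show ?thesis unfolding l2_def using summable_on_reindex[OF inj, of "\<lambda>n. (cmod (\<psi> n))\<^sup>2"] by (simp add: o_def)
qed

lemma \<Phi>_l2: "\<alpha> \<in> configs K \<Longrightarrow> l2 (configs K) (\<Phi> \<alpha>)"
  unfolding \<Phi>_def by (simp add: l2_sec rapid_l2 rapid_dsp)

lemma orthonormal_\<Phi>: "orthonormal (configs K) (configs K) \<Phi>"
  unfolding orthonormal_def
proof (intro conjI ballI \<Phi>_l2)
  fix \<alpha> \<gamma> assume \<alpha>: "\<alpha> \<in> configs K" and "\<gamma> \<in> configs K"
  have "ip (configs K) (\<Phi> \<alpha>) (\<Phi> \<gamma>) = ip UNIV (dsp z (\<alpha> q)) (\<lambda>i. \<Phi> \<gamma> (\<alpha>(q := i)))"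
    by (subst \<Phi>_def) (rule ip_sec[OF \<alpha>])
  also have "\<dots> = (if \<alpha> = \<gamma> then 1 else 0)"
  proof (cases "\<alpha>(q := 0) = \<gamma>(q := 0)")
    case True
    then have "(\<lambda>i. \<Phi> \<gamma> (\<alpha>(q := i))) = dsp z (\<gamma> q)" by (auto simp: \<Phi>_def sec_def)
    moreover have "\<alpha> = \<gamma> \<longleftrightarrow> \<alpha> q = \<gamma> q"
      using sector_cases[OF True] by (metis fun_upd_triv)
    ultimately show ?thesis by (simp add: dsp_ip)
  next
    case False
    then have "(\<lambda>i. \<Phi> \<gamma> (\<alpha>(q := i))) = (\<lambda>i. 0)" by (auto simp: \<Phi>_def sec_def)
    then show ?thesis using False by (auto simp: ip_def)
  qed
  finally show "ip (configs K) (\<Phi> \<alpha>) (\<Phi> \<gamma>) = (if \<alpha> = \<gamma> then 1 else 0)" .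
qed

lemma \<Phi>_complete:
  assumes \<psi>: "l2 (configs K) \<psi>" and 0: "\<forall>n. n \<notin> configs K \<longrightarrow> \<psi> n = 0"
    and orth: "\<forall>\<alpha>\<in>configs K. ip (configs K) (\<Phi> \<alpha>) \<psi> = 0"
  shows "\<psi> = (\<lambda>n. 0)"
proof
  fix n
  show "\<psi> n = 0"
  proof (cases "n \<in> configs K")
    case True
    have "ip UNIV (dsp z l) (\<lambda>i. \<psi> (n(q := i))) = 0" for l
    proof -
      have nl: "n(q := l) \<in> configs K" by (rule configs_upd[OF True q_in])
      then show ?thesis using orth ip_sec[OF nl, of "dsp z l" \<psi>] by (auto simp: \<Phi>_def)
    qed
    from dsp_complete[OF l2_restrict_sector[OF True \<psi>] this, of "n q"] show ?thesis by simp
  qed (use 0 in simp)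
qed

lemma H_configs:
  assumes "n \<in> configs K"
  shows "H \<psi> n = complex_of_real (cfg_energy n) * \<psi> n + (cnj \<kappa> * ann q \<psi> n + \<kappa> * cre q \<psi> n)"
proof -
  have "(\<Sum>\<^sub>\<infinity>k\<in>K. complex_of_real (w k) * cre k (ann k \<psi>) n)
      = (\<Sum>\<^sub>\<infinity>k\<in>{k. n k \<noteq> 0}. complex_of_real (w k * real (n k)) * \<psi> n)"
    using assms by (intro infsum_cong_neutral) (auto simp: cre_ann configs_def)
  also have "\<dots> = complex_of_real (cfg_energy n) * \<psi> n"
    using assms by (simp add: configs_def cfg_energy_def sum_distrib_right)
  finally show ?thesis by (simp add: H_def)
qed

lemma cfg_energy_upd:
  assumes "n \<in> configs K" "k \<in> K"
  shows "cfg_energy (n(k := i)) = cfg_energy n + w k * (real i - real (n k))"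
proof -
  let ?A = "insert k {k. n k \<noteq> 0}"
  have fin: "finite ?A" using assms by (simp add: configs_def)
  have "cfg_energy (n(k := i)) = (\<Sum>j\<in>?A. w j * real ((n(k := i)) j))"
    unfolding cfg_energy_def using fin by (intro sum.mono_neutral_left) auto
  also have "\<dots> = w k * real i + (\<Sum>j\<in>?A - {k}. w j * real (n j))"
    using fin by (subst sum.remove[of _ k]) (auto intro!: sum.cong)
  also have "(\<Sum>j\<in>?A - {k}. w j * real (n j)) = (\<Sum>j\<in>?A. w j * real (n j)) - w k * real (n k)"
    using fin by (subst sum.remove[of ?A k]) auto
  also have "(\<Sum>j\<in>?A. w j * real (n j)) = cfg_energy n"
    unfolding cfg_energy_def using fin by (intro sum.mono_neutral_right) auto
  finally show ?thesis unfolding right_diff_distrib by linarith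
qed

definition hq :: "(nat \<Rightarrow> complex) \<Rightarrow> nat \<Rightarrow> complex" where
  "hq f i = complex_of_real (w q) * (of_nat i * f i)
     + (cnj \<kappa> * (complex_of_real (sqrt (real (Suc i))) * f (Suc i))
        + \<kappa> * (complex_of_real (sqrt (real i)) * f (i - 1)))"

lemma \<kappa>_eq: "\<kappa> = - complex_of_real (w q) * z"
  using w_pos[OF q_in] by (simp add: z_def)

lemma hq_dsp: "hq (dsp z l) i = complex_of_real (w q * (real l - (cmod z)\<^sup>2)) * dsp z l i"
proof -
  define r where "r = (\<lambda>i. complex_of_real (sqrt (real i)))"
  define D where "D = dsp z l"
  define D' where "D' = dsp z (l - 1)"
  have rr: "r i * r i = of_nat i" for i unfolding r_def by simp
  have lower: "r (Suc i) * D (Suc i) = r l * D' i + z * D i" for i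
    using dsp_lower[of i z l] unfolding r_def D_def D'_def .
  have num: "of_nat i * D i = of_nat l * D i + cnj z * (r l * D' i) + z * (r i * D (i - 1))"
  proof (cases i)
    case 0
    show ?thesis
    proof (cases l)
      case (Suc k)
      have "0 = r l * D 0 + cnj z * D' 0"
        using dsp_raise[of 0 z k] Suc unfolding r_def D_def D'_def by simp
      then have "0 = r l * (r l * D 0 + cnj z * D' 0)" by simp
      also have "\<dots> = (r l * r l) * D 0 + cnj z * (r l * D' 0)" by (simp add: algebra_simps)
      finally show ?thesis using 0 by (simp add: rr) (simp add: r_def)
    qed (use 0 in \<open>simp add: r_def\<close>)
  next
    case (Suc j)
    have "of_nat i * D i = r i * (r i * D i)" by (simp add: rr flip: mult.assoc)
    also have "\<dots> = r i * (r l * D' j) + z * (r i * D j)" using lower[of j] Suc by (simp add: algebra_simps)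
    also have "r i * (r l * D' j) = of_nat l * D i + cnj z * (r l * D' i)"
    proof (cases l)
      case (Suc k)
      have "r i * D' j = r l * D i + cnj z * D' i"
        using dsp_raise[of i z k] Suc \<open>i = Suc j\<close> unfolding r_def D_def D'_def by simp
      then have "r l * (r i * D' j) = r l * (r l * D i + cnj z * D' i)" by simp
      also have "\<dots> = (r l * r l) * D i + cnj z * (r l * D' i)" by (simp add: algebra_simps)
      finally show ?thesis unfolding rr by (simp add: mult.left_commute)
    qed (simp add: r_def)
    finally show ?thesis using Suc by simp
  qed
  have zz: "complex_of_real ((cmod z)\<^sup>2) = z * cnj z" by (rule complex_norm_square)
  have "hq D i = complex_of_real (w q) * (of_nat i * D i - cnj z * (r (Suc i) * D (Suc i)) - z * (r i * D (i - 1)))"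
    unfolding hq_def r_def[symmetric] by (subst (1 2) \<kappa>_eq) (simp add: algebra_simps r_def)
  also have "\<dots> = complex_of_real (w q) * (of_nat l - z * cnj z) * D i"
    unfolding num lower by (simp add: algebra_simps)
  finally show ?thesis unfolding D_def by (simp add: zz del: of_real_power)
qed

text \<open>The mode \<open>q\<close> is taken out of the energy of \<alpha> because its number
  operator is already part of \<open>hq\<close>.\<close>

lemma H_sector:
  assumes "\<alpha> \<in> configs K"
  shows "H \<psi> (\<alpha>(q := i)) = complex_of_real (cfg_energy \<alpha> - w q * real (\<alpha> q)) * \<psi> (\<alpha>(q := i))
     + hq (\<lambda>i. \<psi> (\<alpha>(q := i))) i"
  unfolding H_configs[OF configs_upd[OF assms q_in]] cfg_energy_upd[OF assms q_in] hq_def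
  by (simp add: ann_def cre_def algebra_simps)

lemma H_\<Phi>:
  assumes \<alpha>: "\<alpha> \<in> configs K"
  shows "H (\<Phi> \<alpha>) = (\<lambda>n. complex_of_real (En \<alpha>) * \<Phi> \<alpha> n)"
proof
  fix n
  show "H (\<Phi> \<alpha>) n = complex_of_real (En \<alpha>) * \<Phi> \<alpha> n"
  proof (cases "n(q := 0) = \<alpha>(q := 0)")
    case True
    then have n: "n = \<alpha>(q := n q)" by (rule sector_cases)
    have "H (\<Phi> \<alpha>) (\<alpha>(q := n q)) = complex_of_real (En \<alpha>) * \<Phi> \<alpha> (\<alpha>(q := n q))"
      unfolding H_sector[OF \<alpha>] by (simp add: \<Phi>_def hq_dsp En_def algebra_simps)
    then show ?thesis using n by simp
  next
    case False
    then have "H (\<Phi> \<alpha>) n = 0"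
      by (simp add: H_def cre_ann \<Phi>_def sec_ann sec_cre) (simp add: sec_def)
    then show ?thesis using False by (simp add: \<Phi>_def sec_def)
  qed
qed

text \<open>All decay comes from \<open>d\<close>. Square-summability makes \<open>f\<close>
  bounded, which suffices for the number, annihilation and creation series to converge separately;
  each is then transposed on its own, with no condition on \<open>hq f\<close>.\<close>

lemma hq_symmetric:
  assumes d: "rapid d" and f: "l2 UNIV f"
  shows "ip UNIV d (hq f) = ip UNIV (hq d) f"
proof -
  let ?ann = "\<lambda>f i. complex_of_real (sqrt (real (Suc i))) * f (Suc i)"
  let ?cre = "\<lambda>f i. complex_of_real (sqrt (real i)) * f (i - 1)"
  have fb: "cmod (f i) \<le> sqrt (sqnorm UNIV f)" for i
    using l2_bounded[OF f, of i] by (intro real_le_rsqrt) auto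
  have rn: "rapid (\<lambda>i. of_nat i * d i)"
    by (rule rapid_mono[OF rapid_linear_growth[OF d]]) (simp only: norm_mult norm_of_nat, intro mult_right_mono, auto)
  have rc: "rapid (\<lambda>i. cnj (g i))" if "rapid g" for g
    by (rule rapid_mono[OF that]) simp
  have rsq: "rapid (\<lambda>i. complex_of_real (sqrt (real i)) * d i)"
    by (rule rapid_mono[OF rapid_linear_growth[OF d]])
       (simp only: norm_mult norm_of_nat norm_of_real, intro mult_right_mono, use sqrt_real_le in \<open>auto intro: add_increasing\<close>)
  have rsq': "rapid (\<lambda>i. complex_of_real (sqrt (real (Suc i))) * d i)"
    by (rule rapid_mono[OF rapid_linear_growth[OF d]])
       (simp only: norm_mult norm_of_nat norm_of_real, intro mult_right_mono, use sqrt_real_le[of "Suc _"] in auto)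
  have s1: "(\<lambda>i. cnj (d i) * (of_nat i * f i)) summable_on UNIV"
    using rapid_mult_bounded_summable[OF rc[OF rn], of f, OF fb] by (simp add: mult_ac)
  have s2: "(\<lambda>i. cnj (d i) * ?ann f i) summable_on UNIV"
    using rapid_mult_bounded_summable[OF rc[OF rsq'], of "\<lambda>i. f (Suc i)", OF fb] by (simp add: mult_ac del: of_nat_Suc)
  have s3: "(\<lambda>i. cnj (d i) * ?cre f i) summable_on UNIV"
    using rapid_mult_bounded_summable[OF rc[OF rsq], of "\<lambda>i. f (i - 1)", OF fb] by (simp add: mult_ac)
  have "ip UNIV d (hq f) = (\<Sum>\<^sub>\<infinity>i. complex_of_real (w q) * (cnj (d i) * (of_nat i * f i))
      + (cnj \<kappa> * (cnj (d i) * ?ann f i) + \<kappa> * (cnj (d i) * ?cre f i)))"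
    unfolding ip_def hq_def by (intro infsum_cong) (simp add: algebra_simps)
  also have "\<dots> = complex_of_real (w q) * (\<Sum>\<^sub>\<infinity>i. cnj (d i) * (of_nat i * f i))
      + (cnj \<kappa> * (\<Sum>\<^sub>\<infinity>i. cnj (d i) * ?ann f i) + \<kappa> * (\<Sum>\<^sub>\<infinity>i. cnj (d i) * ?cre f i))"
    by (intro infsumI has_sum_add has_sum_cmult_right has_sum_infsum s1 s2 s3)
  also have "(\<Sum>\<^sub>\<infinity>i. cnj (d i) * (of_nat i * f i)) = ip UNIV (\<lambda>i. of_nat i * d i) f"
    unfolding ip_def by (intro infsum_cong) simp
  also have "(\<Sum>\<^sub>\<infinity>i. cnj (d i) * ?ann f i) = ip UNIV (?cre d) f"
    unfolding ip_cre_ann unfolding ip_def ..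
  also have "(\<Sum>\<^sub>\<infinity>i. cnj (d i) * ?cre f i) = ip UNIV (?ann d) f"
    using ip_cre_ann[of f d] ip_commute[of UNIV d "?cre f"] ip_commute[of UNIV "?ann d" f]
    unfolding ip_def by simp
  also have "complex_of_real (w q) * ip UNIV (\<lambda>i. of_nat i * d i) f + (cnj \<kappa> * ip UNIV (?cre d) f + \<kappa> * ip UNIV (?ann d) f)
      = ip UNIV (\<lambda>i. complex_of_real (w q) * (of_nat i * d i) + (\<kappa> * ?cre d i + cnj \<kappa> * ?ann d i)) f"
  proof -
    have comb: "complex_of_real (w q) * ip UNIV N f + (cnj \<kappa> * ip UNIV C f + \<kappa> * ip UNIV A f)
      = ip UNIV (\<lambda>i. complex_of_real (w q) * N i + (\<kappa> * C i + cnj \<kappa> * A i)) f"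
      if "l2 UNIV N" "l2 UNIV C" "l2 UNIV A" for N C A
      using that f by (simp add: ip_add_left ip_scale_left l2_add l2_scale)
    show ?thesis by (rule comb[OF rapid_l2[OF rn] rapid_l2[OF rapid_cre[OF d]] rapid_l2[OF rapid_ann[OF d]]])
  qed
  also have "\<dots> = ip UNIV (hq d) f"
    unfolding hq_def by (simp only: add.commute)
  finally show ?thesis .
qed

text \<open>\<open>\<Phi> \<alpha>\<close> lives in one sector, on which \<psi> restricts to an
  eigenvector of \<open>hq\<close>. Transferring \<open>hq\<close> to the displaced state yields two
  eigenvalues for the same non-zero overlap.\<close>

lemma eigenvector_orthogonal:
  assumes \<psi>: "l2 (configs K) \<psi>" and eig: "H \<psi> = (\<lambda>n. complex_of_real E * \<psi> n)"
    and \<alpha>: "\<alpha> \<in> configs K" and ne: "ip (configs K) (\<Phi> \<alpha>) \<psi> \<noteq> 0"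
  shows "E = En \<alpha>"
proof -
  define f where "f = (\<lambda>i. \<psi> (\<alpha>(q := i)))"
  have f: "l2 UNIV f" unfolding f_def by (rule l2_restrict_sector[OF \<alpha> \<psi>])
  have h: "hq f = (\<lambda>i. complex_of_real (E - (cfg_energy \<alpha> - w q * real (\<alpha> q))) * f i)"
  proof
    fix i
    have "complex_of_real E * f i = complex_of_real (cfg_energy \<alpha> - w q * real (\<alpha> q)) * f i + hq f i"
      using H_sector[OF \<alpha>, of \<psi> i] fun_cong[OF eig, of "\<alpha>(q := i)"] unfolding f_def by simp
    then show "hq f i = complex_of_real (E - (cfg_energy \<alpha> - w q * real (\<alpha> q))) * f i"
      by (simp add: algebra_simps)
  qed
  define I where "I = ip UNIV (dsp z (\<alpha> q)) f"
  have I: "I \<noteq> 0" using ne ip_sec[OF \<alpha>, of "dsp z (\<alpha> q)" \<psi>] unfolding I_def f_def \<Phi>_def by simp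
  have "complex_of_real (E - (cfg_energy \<alpha> - w q * real (\<alpha> q))) * I = ip UNIV (dsp z (\<alpha> q)) (hq f)"
    unfolding h I_def ip_scale_right ..
  also have "\<dots> = ip UNIV (hq (dsp z (\<alpha> q))) f" by (rule hq_symmetric[OF rapid_dsp f])
  also have "hq (dsp z (\<alpha> q)) = (\<lambda>i. complex_of_real (w q * (real (\<alpha> q) - (cmod z)\<^sup>2)) * dsp z (\<alpha> q) i)"
    by (rule ext) (rule hq_dsp)
  also have "ip UNIV \<dots> f = complex_of_real (w q * (real (\<alpha> q) - (cmod z)\<^sup>2)) * I"
    unfolding I_def ip_scale_left by simp
  finally have "E - (cfg_energy \<alpha> - w q * real (\<alpha> q)) = w q * (real (\<alpha> q) - (cmod z)\<^sup>2)"
    using I mult_right_cancel of_real_eq_iff by blast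
  then show ?thesis unfolding En_def by (simp add: algebra_simps)
qed

text \<open>Ensures that the choice made in \<open>exp_op\<close> is a genuine eigenbasis; the
  displaced states, enumerated by the naturals, are the witness.\<close>

lemma ex_eigenbasis: "\<exists>p. eigenbasis K H (fst p) (snd p)"
proof -
  let ?e = "from_nat_into (configs K)"
  have inf: "infinite (configs K)"
  proof -
    have "inj (\<lambda>i. (\<lambda>_. 0 :: nat)(q := i))" by (intro injI) (metis fun_upd_same)
    moreover have "range (\<lambda>i. (\<lambda>_. 0 :: nat)(q := i)) \<subseteq> configs K"
      using q_in by (auto simp: configs_def split: if_splits)
    ultimately show ?thesis by (rule infinite_super[OF _ range_inj_infinite, rotated])
  qed
  have bij: "bij_betw ?e UNIV (configs K)"
    by (rule bij_betw_from_nat_into[OF countable_configs[OF countable_K] inf])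
  then have e: "?e i \<in> configs K" for i by (auto simp: bij_betw_def)
  have "eigenbasis K H (\<lambda>i. \<Phi> (?e i)) (\<lambda>i. En (?e i))"
    unfolding eigenbasis_def
  proof (intro conjI allI ballI impI)
    fix i j
    show "\<Phi> (?e i) \<in> fock K"
    proof -
      have "\<Phi> (?e i) n = 0" if "n \<notin> configs K" for n
        using that e[of i] configs_upd_iff[OF q_in, of n 0] configs_upd_iff[OF q_in, of "?e i" 0]
        by (auto simp: \<Phi>_def sec_def)
      then show ?thesis using \<Phi>_l2[OF e[of i]] by (auto simp: fock_def l2_def)
    qed
    have "?e i = ?e j \<longleftrightarrow> i = j" using bij by (auto simp: bij_betw_def inj_on_def)
    then show "fock_inner K (\<Phi> (?e i)) (\<Phi> (?e j)) = (if i = j then 1 else 0)"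
      using orthonormal_\<Phi> e unfolding orthonormal_def fock_inner_ip by simp
    show "H (\<Phi> (?e i)) = (\<lambda>n. complex_of_real (En (?e i)) * \<Phi> (?e i) n)" by (rule H_\<Phi>[OF e])
  next
    fix \<psi> assume \<psi>: "\<psi> \<in> fock K" and orth: "\<forall>i. fock_inner K (\<Phi> (?e i)) \<psi> = 0"
    have "\<forall>\<alpha>\<in>configs K. ip (configs K) (\<Phi> \<alpha>) \<psi> = 0"
      using orth bij unfolding fock_inner_ip bij_betw_def by (metis imageE)
    then show "\<psi> = (\<lambda>n. 0)" using \<psi> by (intro \<Phi>_complete) (auto simp: fock_def l2_def)
  qed
  then show ?thesis by (intro exI[of _ "(\<lambda>i. \<Phi> (?e i), \<lambda>i. En (?e i))"]) simp
qed

end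

text \<open>Each factor is below its geometric series, hence below 1 + x/(1-c) and below exp
  (x/(1-c)). The product becomes the exponential of a sum, with a bound independent of
  \<open>F\<close> and \<open>M\<close>.\<close>

lemma summable_scaled_prod_bound:
  fixes x :: "'a \<Rightarrow> real"
  assumes x: "\<And>k. k \<in> K \<Longrightarrow> 0 \<le> x k" "\<And>k. k \<in> K \<Longrightarrow> x k \<le> c" and c: "c < 1" and s: "x summable_on K"
    and F: "finite F" "F \<subseteq> K"
  shows "(\<Prod>k\<in>F. \<Sum>j\<le>M. x k ^ j) \<le> exp (infsum x K / (1 - c))"
proof -
  have "(\<Prod>k\<in>F. \<Sum>j\<le>M. x k ^ j) \<le> (\<Prod>k\<in>F. exp (x k / (1 - c)))"
  proof (rule prod_mono)
    fix k assume k: "k \<in> F"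
    then have xk: "0 \<le> x k" "x k \<le> c" "x k < 1" using x F c by force+
    have "(\<Sum>j\<le>M. x k ^ j) \<le> (\<Sum>j. x k ^ j)"
      using xk by (intro sum_le_suminf summable_geometric) auto
    also have "\<dots> = 1 / (1 - x k)" using xk by (intro suminf_geometric) auto
    also have "\<dots> = 1 + x k / (1 - x k)" using xk by (simp add: field_simps)
    also have "\<dots> \<le> 1 + x k / (1 - c)" using xk c by (intro add_left_mono divide_left_mono) auto
    also have "\<dots> \<le> exp (x k / (1 - c))" by (rule exp_ge_add_one_self)
    finally show "0 \<le> (\<Sum>j\<le>M. x k ^ j) \<and> (\<Sum>j\<le>M. x k ^ j) \<le> exp (x k / (1 - c))"
      using xk by (auto intro: sum_nonneg)
  qed
  also have "\<dots> = exp ((\<Sum>k\<in>F. x k) / (1 - c))" by (simp add: exp_sum F sum_divide_distrib)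
  also have "\<dots> \<le> exp (infsum x K / (1 - c))"
    using c F s x by (simp, intro divide_right_mono finite_sum_le_infsum) auto
  finally show ?thesis .
qed

lemma l2_mult_infsum_le:
  assumes "l2 X \<phi>" "l2 X \<psi>"
  shows "(\<Sum>\<^sub>\<infinity>n\<in>X. cmod (\<phi> n) * cmod (\<psi> n)) \<le> (sqnorm X \<phi> + sqnorm X \<psi>) / 2"
proof -
  have s: "(\<lambda>n. ((cmod (\<phi> n))\<^sup>2 + (cmod (\<psi> n))\<^sup>2) / 2) summable_on X"
    using assms unfolding l2_def divide_inverse by (intro summable_on_cmult_left summable_on_add)
  have "(\<Sum>\<^sub>\<infinity>n\<in>X. cmod (\<phi> n) * cmod (\<psi> n)) \<le> (\<Sum>\<^sub>\<infinity>n\<in>X. ((cmod (\<phi> n))\<^sup>2 + (cmod (\<psi> n))\<^sup>2) / 2)"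
    using mult_le_weighted_squares[of 1] by (intro infsum_mono l2_mult_summable assms s) simp
  also have "\<dots> = (sqnorm X \<phi> + sqnorm X \<psi>) / 2"
    using assms unfolding l2_def sqnorm_def divide_inverse by (simp only: infsum_cmult_left' infsum_add)
  finally show ?thesis .
qed

section \<open>Partition function, mean occupation numbers and the Gibbs trace\<close>

context source_gas begin

lemma cfg_energy_nonneg: "n \<in> configs K \<Longrightarrow> 0 \<le> cfg_energy n"
  unfolding cfg_energy_def using w_pos by (intro sum_nonneg) (force simp: configs_def)

text \<open>Finitely many configurations involve finitely many modes \<open>F\<close> and occupation
  numbers up to some \<open>M\<close>. Their total weight is therefore part of an expanded product
  of truncated geometric series.\<close>

lemma weight_summable:
  assumes t: "t > 0"
  shows "(\<lambda>n. exp (- t * cfg_energy n)) summable_on configs K"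
proof (rule nonneg_bdd_above_summable_on)
  obtain m where m: "m > 0" "\<And>k. k \<in> K \<Longrightarrow> m \<le> w k" using gap by blast
  define x where "x k = exp (- (t * w k))" for k
  define c where "c = exp (- (t * m))"
  have c: "c < 1" using m t by (simp add: c_def)
  have xc: "x k \<le> c" if "k \<in> K" for k using m(2)[OF that] t by (simp add: x_def c_def)
  show "bdd_above (sum (\<lambda>n. exp (- t * cfg_energy n)) ` {F. F \<subseteq> configs K \<and> finite F})"
  proof (rule bdd_aboveI2, clarify)
    fix G assume G: "G \<subseteq> configs K" "finite G"
    define F where "F = (\<Union>n\<in>G. {k. n k \<noteq> 0})"
    have F: "finite F" "F \<subseteq> K" using G by (auto simp: F_def configs_def)
    define M where "M = Max (insert 0 ((\<lambda>(n, k). n k) ` (G \<times> F)))"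
    have M: "n k \<le> M" if "n \<in> G" for n k
    proof (cases "n k = 0")
      case False
      then have "k \<in> F" using that by (auto simp: F_def)
      then have "n k \<in> (\<lambda>(n, k). n k) ` (G \<times> F)" using that by force
      then show ?thesis unfolding M_def using G F by (intro Max_ge) auto
    qed simp
    have inj: "inj_on (\<lambda>n. restrict n F) G"
    proof (rule inj_onI)
      fix n m assume nm: "n \<in> G" "m \<in> G" and eq: "restrict n F = restrict m F"
      show "n = m"
      proof
        fix k show "n k = m k"
        proof (cases "k \<in> F")
          case True
          then show ?thesis using fun_cong[OF eq, of k] by simp
        next
          case False
          then have "n k = 0" "m k = 0" using nm unfolding F_def by blast+
          then show ?thesis by simp
        qed
      qed
    qed
    have e: "exp (- t * cfg_energy n) = (\<Prod>k\<in>F. x k ^ (restrict n F) k)" if n: "n \<in> G" for n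
    proof -
      have "cfg_energy n = (\<Sum>k\<in>F. w k * real (n k))"
        unfolding cfg_energy_def using F n by (intro sum.mono_neutral_left) (auto simp: F_def)
      then have "exp (- t * cfg_energy n) = (\<Prod>k\<in>F. exp (- t * (w k * real (n k))))"
        using F by (simp add: sum_distrib_left exp_sum flip: sum_negf)
      also have "\<dots> = (\<Prod>k\<in>F. x k ^ (restrict n F) k)"
        by (intro prod.cong) (auto simp: x_def simp flip: exp_of_nat_mult simp: mult_ac)
      finally show ?thesis .
    qed
    have "(\<Sum>n\<in>G. exp (- t * cfg_energy n)) = (\<Sum>g\<in>(\<lambda>n. restrict n F) ` G. \<Prod>k\<in>F. x k ^ g k)"
      using e by (simp add: sum.reindex[OF inj] o_def)
    also have "\<dots> \<le> (\<Sum>g\<in>(\<Pi>\<^sub>E k\<in>F. {..M}). \<Prod>k\<in>F. x k ^ g k)"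
      using F M by (intro sum_mono2 finite_PiE) (auto simp: x_def intro!: prod_nonneg)
    also have "\<dots> = (\<Prod>k\<in>F. \<Sum>j\<le>M. x k ^ j)"
      using F by (simp add: prod_sum_PiE)
    also have "\<dots> \<le> exp (infsum x K / (1 - c))"
      using exp_summable[OF t] F c xc by (intro summable_scaled_prod_bound) (auto simp: x_def)
    finally show "(\<Sum>n\<in>G. exp (- t * cfg_energy n)) \<le> exp (infsum x K / (1 - c))" .
  qed
qed simp

text \<open>From x <= exp x the occupation number is at most a constant times
  \<open>exp (t / 2 * cfg_energy n)\<close>, so half of the weight pays for it.\<close>

lemma weight_occupation_summable:
  assumes t: "t > 0" and k: "k \<in> K"
  shows "(\<lambda>n. exp (- t * cfg_energy n) * real (n k)) summable_on configs K"
proof (rule summable_on_comparison_test)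
  show "(\<lambda>n. (2 / (t * w k)) * exp (- (t / 2) * cfg_energy n)) summable_on configs K"
    using t by (intro summable_on_cmult_right weight_summable) auto
  fix n assume n: "n \<in> configs K"
  have tw: "t * w k > 0" using t w_pos[OF k] by simp
  have "cfg_energy (n(k := 0)) \<ge> 0" using n k by (intro cfg_energy_nonneg configs_upd)
  then have E: "w k * real (n k) \<le> cfg_energy n" using cfg_energy_upd[OF n k, of 0] by simp
  have "t * w k / 2 * real (n k) \<le> exp (t * w k / 2 * real (n k))"
    using exp_ge_add_one_self[of "t * w k / 2 * real (n k)"] by linarith
  also have "\<dots> \<le> exp (t / 2 * cfg_energy n)" using mult_left_mono[OF E, of "t / 2"] t by simp
  finally have "real (n k) \<le> 2 / (t * w k) * exp (t / 2 * cfg_energy n)"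
    using t w_pos[OF k] by (simp add: field_simps)
  then have "exp (- t * cfg_energy n) * real (n k) \<le> exp (- t * cfg_energy n) * (2 / (t * w k) * exp (t / 2 * cfg_energy n))"
    by (intro mult_left_mono) auto
  also have "\<dots> = 2 / (t * w k) * (exp (- t * cfg_energy n) * exp (t / 2 * cfg_energy n))" by simp
  also have "exp (- t * cfg_energy n) * exp (t / 2 * cfg_energy n) = exp (- (t / 2) * cfg_energy n)"
    by (simp flip: exp_add)
  finally show "exp (- t * cfg_energy n) * real (n k) \<le> (2 / (t * w k)) * exp (- (t / 2) * cfg_energy n)" .
qed simp

definition Z :: "real \<Rightarrow> real" where "Z t = (\<Sum>\<^sub>\<infinity>n\<in>configs K. exp (- t * cfg_energy n))"

lemma Z_pos: "t > 0 \<Longrightarrow> Z t > 0"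
proof -
  assume t: "t > 0"
  have "(\<lambda>_. 0) \<in> configs K" by (simp add: configs_def)
  then have "exp (- t * cfg_energy (\<lambda>_. 0)) \<le> Z t"
    unfolding Z_def using finite_sum_le_infsum[OF weight_summable[OF t], of "{\<lambda>_. 0}"] by simp
  then show ?thesis by (rule less_le_trans[OF exp_gt_zero])
qed

text \<open>Shifting one occupation number by one multiplies the weight by \<open>x = e\<^sup>-\<^sup>t\<^sup>w\<close>; hence the
  unnormalized mean \<open>N\<close> of the occupation number satisfies \<open>N = x (N + Z)\<close>.\<close>

lemma mean_occupation:
  assumes t: "t > 0" and k: "k \<in> K"
  shows "(\<Sum>\<^sub>\<infinity>n\<in>configs K. exp (- t * cfg_energy n) * real (n k)) = Z t * (1 / (exp (t * w k) - 1))"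
proof -
  let ?f = "\<lambda>n. exp (- t * cfg_energy n) * real (n k)"
  let ?s = "\<lambda>n :: config. n(k := Suc (n k))"
  define N where "N = infsum ?f (configs K)"
  define x where "x = exp (- t * w k)"
  have inj: "inj_on ?s (configs K)"
  proof (rule inj_onI)
    fix n m :: config assume "?s n = ?s m"
    then have "Suc (n k) = Suc (m k)" "\<And>j. j \<noteq> k \<Longrightarrow> n j = m j"
      by (metis fun_upd_same, metis fun_upd_other)
    then show "n = m" by (metis ext nat.inject)
  qed
  have "N = infsum ?f (?s ` configs K)"
    unfolding N_def
  proof (rule infsum_cong_neutral)
    show "?f n = 0" if "n \<in> ?s ` configs K - configs K" for n
      using that configs_upd[OF _ k] by blast
    show "?f n = 0" if n: "n \<in> configs K - ?s ` configs K" for n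
    proof (rule ccontr)
      assume "?f n \<noteq> 0"
      then have "n = ?s (n(k := n k - 1))" by (auto simp: fun_eq_iff)
      then show False using n configs_upd[of n K k "n k - 1"] k by blast
    qed
  qed simp
  also have "\<dots> = (\<Sum>\<^sub>\<infinity>n\<in>configs K. ?f (?s n))" by (subst infsum_reindex[OF inj]) (simp add: o_def)
  also have "\<dots> = (\<Sum>\<^sub>\<infinity>n\<in>configs K. x * (?f n + exp (- t * cfg_energy n)))"
  proof (rule infsum_cong)
    fix n assume n: "n \<in> configs K"
    have "exp (- t * cfg_energy (?s n)) = x * exp (- t * cfg_energy n)"
      unfolding cfg_energy_upd[OF n k] x_def by (simp add: algebra_simps flip: exp_add)
    then show "?f (?s n) = x * (?f n + exp (- t * cfg_energy n))" by (simp add: algebra_simps)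
  qed
  also have "\<dots> = x * (N + Z t)"
    unfolding N_def Z_def using weight_summable[OF t] weight_occupation_summable[OF t k]
    by (simp add: infsum_cmult_right' infsum_add)
  finally have N: "N = x * (N + Z t)" .
  have tw: "t * w k > 0" using t w_pos[OF k] by simp
  have ex: "exp (t * w k) * x = 1" by (simp add: x_def flip: exp_add)
  have "exp (t * w k) * N = (exp (t * w k) * x) * (N + Z t)" using N by (metis mult.assoc)
  then have "(exp (t * w k) - 1) * N = Z t" unfolding ex by (simp add: algebra_simps)
  moreover have "exp (t * w k) - 1 \<noteq> 0" using t w_pos[OF k] by simp
  ultimately show ?thesis unfolding N_def by (simp add: field_simps)
qed

text \<open>The operator exponential does not depend on the choice of the eigenbasis: by
  \<open>eigenvector_orthogonal\<close>, each eigenvector of another basis is a combination of those \<open>\<Phi> \<alpha>\<close>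
  which have the same eigenvalue.\<close>

lemma exp_op_eq:
  assumes t: "t > 0" and \<psi>: "l2 (configs K) \<psi>" and n: "n \<in> configs K"
  shows "exp_op K (-t) H \<psi> n
     = (\<Sum>\<^sub>\<infinity>\<alpha>\<in>configs K. complex_of_real (exp (-t * En \<alpha>)) * ip (configs K) (\<Phi> \<alpha>) \<psi> * \<Phi> \<alpha> n)"
proof -
  define p where "p = (SOME p. eigenbasis K H (fst p) (snd p))"
  define \<Psi> where "\<Psi> = fst p"
  define E where "E = snd p"
  have eb: "eigenbasis K H \<Psi> E"
    unfolding \<Psi>_def E_def p_def by (rule someI_ex[OF ex_eigenbasis])
  let ?X = "configs K"
  have \<Psi>l2: "l2 ?X (\<Psi> i)" for i using eb unfolding eigenbasis_def fock_def l2_def by blast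
  have on\<Psi>: "orthonormal ?X UNIV \<Psi>"
    unfolding orthonormal_def using eb \<Psi>l2 unfolding eigenbasis_def fock_inner_ip by simp
  have complete\<Psi>: "\<phi> = (\<lambda>n. 0)" if "l2 ?X \<phi>" "\<forall>n. n \<notin> ?X \<longrightarrow> \<phi> n = 0" "\<forall>i\<in>UNIV. ip ?X (\<Psi> i) \<phi> = 0" for \<phi>
  proof -
    have "\<phi> \<in> fock K" using that unfolding fock_def l2_def by blast
    then show ?thesis using eb that unfolding eigenbasis_def fock_inner_ip by blast
  qed
  have eig: "H (\<Psi> i) = (\<lambda>n. complex_of_real (E i) * \<Psi> i n)" for i
    using eb unfolding eigenbasis_def by blast
  define a where "a \<alpha> = ip ?X (\<Phi> \<alpha>) \<psi>" for \<alpha>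
  have a: "l2 ?X a" unfolding l2_def a_def by (rule bessel_summable[OF orthonormal_\<Phi> \<psi>])
  define c where "c \<alpha> = complex_of_real (exp (-t * En \<alpha>)) * a \<alpha>" for \<alpha>
  \<comment> \<open>\<open>En\<close> is bounded below by \<open>- w q * (cmod z)\<^sup>2\<close>,
    so the exponential factors are bounded and the damped coefficients stay square-summable.\<close>
  define B where "B = exp (t * (w q * (cmod z)\<^sup>2))"
  have c: "l2 ?X c" unfolding l2_def
  proof (rule summable_on_comparison_test)
    show "(\<lambda>\<alpha>. B\<^sup>2 * (cmod (a \<alpha>))\<^sup>2) summable_on ?X"
      using a unfolding l2_def by (rule summable_on_cmult_right)
    fix \<alpha> assume \<alpha>: "\<alpha> \<in> ?X"
    have "exp (-t * En \<alpha>) \<le> B" using cfg_energy_nonneg[OF \<alpha>] t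
      by (simp add: B_def En_def right_diff_distrib)
    then show "(cmod (c \<alpha>))\<^sup>2 \<le> B\<^sup>2 * (cmod (a \<alpha>))\<^sup>2"
      unfolding c_def norm_mult power_mult_distrib by (intro mult_right_mono power_mono) auto
  qed simp
  \<comment> \<open>The candidate for the image of \<psi>, built in the basis \<Phi>. Its
    coefficients in the chosen basis \<Psi> are those prescribed by \<open>exp_op\<close>, and
    Parseval for \<Psi> identifies the two.\<close>
  define y where "y = (\<lambda>n. \<Sum>\<^sub>\<infinity>\<alpha>\<in>?X. c \<alpha> * \<Phi> \<alpha> n)"
  have y: "l2 ?X y" unfolding y_def by (rule orthonormal_series_l2[OF orthonormal_\<Phi> c])
  have coeff: "ip ?X (\<Psi> i) y = complex_of_real (exp (-t * E i)) * ip ?X (\<Psi> i) \<psi>" for i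
  proof -
    have "((\<lambda>\<alpha>. a \<alpha> * ip ?X (\<Psi> i) (\<Phi> \<alpha>)) has_sum ip ?X (\<Psi> i) (\<lambda>n. \<Sum>\<^sub>\<infinity>\<alpha>\<in>?X. a \<alpha> * \<Phi> \<alpha> n)) ?X"
      by (rule orthonormal_series_ip[OF orthonormal_\<Phi> a \<Psi>l2])
    also have "ip ?X (\<Psi> i) (\<lambda>n. \<Sum>\<^sub>\<infinity>\<alpha>\<in>?X. a \<alpha> * \<Phi> \<alpha> n) = ip ?X (\<Psi> i) \<psi>"
      unfolding ip_def[of _ "\<Psi> i"] a_def
      by (intro infsum_cong) (simp add: parseval_pointwise[OF orthonormal_\<Phi> \<Phi>_complete \<psi>])
    finally have h: "((\<lambda>\<alpha>. complex_of_real (exp (-t * E i)) * (a \<alpha> * ip ?X (\<Psi> i) (\<Phi> \<alpha>)))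
        has_sum complex_of_real (exp (-t * E i)) * ip ?X (\<Psi> i) \<psi>) ?X"
      by (rule has_sum_cmult_right)
    have eq: "complex_of_real (exp (-t * E i)) * (a \<alpha> * ip ?X (\<Psi> i) (\<Phi> \<alpha>)) = c \<alpha> * ip ?X (\<Psi> i) (\<Phi> \<alpha>)"
      if "\<alpha> \<in> ?X" for \<alpha>
    proof (cases "ip ?X (\<Psi> i) (\<Phi> \<alpha>) = 0")
      case False
      then have "ip ?X (\<Phi> \<alpha>) (\<Psi> i) \<noteq> 0" using ip_commute[of ?X "\<Psi> i" "\<Phi> \<alpha>"] by auto
      then have "E i = En \<alpha>" by (rule eigenvector_orthogonal[OF \<Psi>l2 eig that])
      then show ?thesis by (simp add: c_def)
    qed simp
    have "((\<lambda>\<alpha>. c \<alpha> * ip ?X (\<Psi> i) (\<Phi> \<alpha>)) has_sum complex_of_real (exp (-t * E i)) * ip ?X (\<Psi> i) \<psi>) ?X"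
      by (rule iffD1[OF has_sum_cong h]) (rule eq)
    moreover have "((\<lambda>\<alpha>. c \<alpha> * ip ?X (\<Psi> i) (\<Phi> \<alpha>)) has_sum ip ?X (\<Psi> i) y) ?X"
      unfolding y_def by (rule orthonormal_series_ip[OF orthonormal_\<Phi> c \<Psi>l2])
    ultimately show ?thesis by (rule has_sum_unique[rotated])
  qed
  have "exp_op K (-t) H \<psi> n = (\<Sum>\<^sub>\<infinity>i. complex_of_real (exp (-t * E i)) * ip ?X (\<Psi> i) \<psi> * \<Psi> i n)"
    unfolding exp_op_def Let_def p_def[symmetric] \<Psi>_def E_def fock_inner_ip ..
  also have "\<dots> = (\<Sum>\<^sub>\<infinity>i. ip ?X (\<Psi> i) y * \<Psi> i n)" by (simp only: coeff)
  also have "\<dots> = y n" by (rule parseval_pointwise[OF on\<Psi> complete\<Psi> y n])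
  finally show ?thesis unfolding y_def c_def a_def .
qed

text \<open>\<open>B \<alpha>\<close> plays the part of the adjoint of \<open>A\<close> applied to
  \<open>\<Phi> \<alpha>\<close>. The bound by an occupation number plus a constant is weak enough
  for \<open>ann\<close>, \<open>cre\<close> and the number operator, yet summable against the
  weights; it justifies exchanging the traces over number states and over eigenstates.\<close>

lemma op_trace_exp_op:
  assumes t: "t > 0"
    and A: "\<And>n. n \<in> configs K \<Longrightarrow> l2 (configs K) (A (ket n))"
    and AB: "\<And>\<alpha> n. \<alpha> \<in> configs K \<Longrightarrow> n \<in> configs K \<Longrightarrow> ip (configs K) (\<Phi> \<alpha>) (A (ket n)) = cnj (B \<alpha> n)"
    and BS: "\<And>\<alpha>. \<alpha> \<in> configs K \<Longrightarrow> (\<lambda>n. cmod (B \<alpha> n) * cmod (\<Phi> \<alpha> n)) summable_on configs K"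
    and Bb: "\<And>\<alpha>. \<alpha> \<in> configs K \<Longrightarrow> (\<Sum>\<^sub>\<infinity>n\<in>configs K. cmod (B \<alpha> n) * cmod (\<Phi> \<alpha> n)) \<le> real (\<alpha> k) + C"
    and k: "k \<in> K"
    and v: "\<And>\<alpha>. \<alpha> \<in> configs K \<Longrightarrow> ip (configs K) (B \<alpha>) (\<Phi> \<alpha>) = v \<alpha>"
  shows "op_trace K (exp_op K (-t) H \<circ> A) = (\<Sum>\<^sub>\<infinity>\<alpha>\<in>configs K. complex_of_real (exp (-t * En \<alpha>)) * v \<alpha>)"
proof -
  let ?X = "configs K"
  let ?f = "\<lambda>\<alpha> n. complex_of_real (exp (-t * En \<alpha>)) * cnj (B \<alpha> n) * \<Phi> \<alpha> n"
  have e: "exp (-t * En \<alpha>) = exp (t * (w q * (cmod z)\<^sup>2)) * exp (-t * cfg_energy \<alpha>)" for \<alpha>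
    by (simp add: En_def algebra_simps flip: exp_add)
  have "(\<lambda>p. norm (case p of (\<alpha>, n) \<Rightarrow> ?f \<alpha> n)) summable_on (?X \<times> ?X)"
  proof (subst Infinite_Sum.abs_summable_on_Sigma_iff, intro conjI ballI)
    fix \<alpha> assume \<alpha>: "\<alpha> \<in> ?X"
    show "(\<lambda>n. norm (case (\<alpha>, n) of (\<alpha>, n) \<Rightarrow> ?f \<alpha> n)) summable_on ?X"
      using summable_on_cmult_right[OF BS[OF \<alpha>], of "exp (-t * En \<alpha>)"] by (simp add: norm_mult mult.assoc)
  next
    have "(\<lambda>\<alpha>. exp (-t * En \<alpha>) * (real (\<alpha> k) + C)) summable_on ?X"
    proof -
      have "(\<lambda>\<alpha>. exp (t * (w q * (cmod z)\<^sup>2)) * (exp (-t * cfg_energy \<alpha>) * real (\<alpha> k) + C * exp (-t * cfg_energy \<alpha>))) summable_on ?X"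
        by (intro summable_on_cmult_right summable_on_add weight_summable weight_occupation_summable t k)
      then show ?thesis unfolding e by (simp add: algebra_simps)
    qed
    then show "(\<lambda>\<alpha>. norm (\<Sum>\<^sub>\<infinity>n\<in>?X. norm (case (\<alpha>, n) of (\<alpha>, n) \<Rightarrow> ?f \<alpha> n))) summable_on ?X"
    proof (rule summable_on_comparison_test)
      fix \<alpha> assume \<alpha>: "\<alpha> \<in> ?X"
      have "(\<Sum>\<^sub>\<infinity>n\<in>?X. norm (?f \<alpha> n)) = exp (-t * En \<alpha>) * (\<Sum>\<^sub>\<infinity>n\<in>?X. cmod (B \<alpha> n) * cmod (\<Phi> \<alpha> n))"
        by (subst infsum_cmult_right'[symmetric]) (simp add: norm_mult mult.assoc)
      then show "norm (\<Sum>\<^sub>\<infinity>n\<in>?X. norm (case (\<alpha>, n) of (\<alpha>, n) \<Rightarrow> ?f \<alpha> n)) \<le> exp (-t * En \<alpha>) * (real (\<alpha> k) + C)"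
        using Bb[OF \<alpha>] by (simp add: infsum_nonneg abs_mult)
    qed simp
  qed
  then have sum: "(\<lambda>(\<alpha>, n). ?f \<alpha> n) summable_on (?X \<times> ?X)" by (rule abs_summable_summable)
  have "op_trace K (exp_op K (-t) H \<circ> A) = (\<Sum>\<^sub>\<infinity>n\<in>?X. exp_op K (-t) H (A (ket n)) n)"
    unfolding op_trace_def fock_inner_ip
  proof (rule infsum_cong)
    fix n assume n: "n \<in> ?X"
    have "ip ?X (ket n) ((exp_op K (-t) H \<circ> A) (ket n)) = cnj (ip ?X ((exp_op K (-t) H \<circ> A) (ket n)) (ket n))"
      by (rule ip_commute)
    then show "ip ?X (ket n) ((exp_op K (-t) H \<circ> A) (ket n)) = exp_op K (-t) H (A (ket n)) n"
      unfolding ket_eq ip_kronecker[OF n] by (simp add: ket_eq)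
  qed
  also have "\<dots> = (\<Sum>\<^sub>\<infinity>n\<in>?X. \<Sum>\<^sub>\<infinity>\<alpha>\<in>?X. ?f \<alpha> n)"
    by (intro infsum_cong) (simp add: exp_op_eq[OF t A] AB cong: infsum_cong)
  also have "\<dots> = (\<Sum>\<^sub>\<infinity>\<alpha>\<in>?X. \<Sum>\<^sub>\<infinity>n\<in>?X. ?f \<alpha> n)"
    by (rule infsum_swap_banach[OF sum, symmetric])
  also have "\<dots> = (\<Sum>\<^sub>\<infinity>\<alpha>\<in>?X. complex_of_real (exp (-t * En \<alpha>)) * v \<alpha>)"
  proof (rule infsum_cong)
    fix \<alpha> assume \<alpha>: "\<alpha> \<in> ?X"
    have "(\<Sum>\<^sub>\<infinity>n\<in>?X. ?f \<alpha> n) = complex_of_real (exp (-t * En \<alpha>)) * ip ?X (B \<alpha>) (\<Phi> \<alpha>)"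
      unfolding ip_def by (subst infsum_cmult_right'[symmetric]) (simp add: mult.assoc)
    then show "(\<Sum>\<^sub>\<infinity>n\<in>?X. ?f \<alpha> n) = complex_of_real (exp (-t * En \<alpha>)) * v \<alpha>" using v[OF \<alpha>] by simp
  qed
  finally show ?thesis .
qed

section \<open>Gibbs averages computed in the displaced states\<close>

lemma ip_dsp_ann: "ip UNIV (dsp z l) (\<lambda>i. complex_of_real (sqrt (real (Suc i))) * dsp z l (Suc i)) = z"
  unfolding dsp_lower
  by (simp add: ip_add_right ip_scale_right l2_scale rapid_l2 rapid_dsp dsp_ip)
     (cases l; simp)

lemma sqnorm_dsp: "sqnorm UNIV (dsp z l) = 1"
proof -
  have "complex_of_real (sqnorm UNIV (dsp z l)) = 1" unfolding ip_self[symmetric] by (simp add: dsp_ip)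
  then show ?thesis by simp
qed

lemma sqnorm_dsp_ann:
  "sqnorm UNIV (\<lambda>i. complex_of_real (sqrt (real (Suc i))) * dsp z l (Suc i)) = real l + (cmod z)\<^sup>2"
proof -
  have "ip UNIV (\<lambda>i. complex_of_real (sqrt (real (Suc i))) * dsp z l (Suc i))
     (\<lambda>i. complex_of_real (sqrt (real (Suc i))) * dsp z l (Suc i)) = of_nat l + z * cnj z"
    unfolding dsp_lower
    by (simp add: ip_add_right ip_scale_right ip_add_left ip_scale_left l2_add l2_scale rapid_l2 rapid_dsp dsp_ip)
       (cases l; simp add: mult.commute del: of_nat_Suc)
  also have "\<dots> = complex_of_real (real l + (cmod z)\<^sup>2)" by (simp add: complex_norm_square del: of_real_power)
  finally show ?thesis unfolding ip_self of_real_eq_iff .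
qed

lemma sqnorm_dsp_cre:
  "sqnorm UNIV (\<lambda>i. complex_of_real (sqrt (real i)) * dsp z l (i - 1)) = real (Suc l) + (cmod z)\<^sup>2"
proof -
  have "ip UNIV (\<lambda>i. complex_of_real (sqrt (real i)) * dsp z l (i - 1))
     (\<lambda>i. complex_of_real (sqrt (real i)) * dsp z l (i - 1)) = of_nat (Suc l) + z * cnj z"
    unfolding dsp_raise
    by (simp add: ip_add_right ip_scale_right ip_add_left ip_scale_left l2_add l2_scale rapid_l2 rapid_dsp dsp_ip del: of_nat_Suc)
  also have "\<dots> = complex_of_real (real (Suc l) + (cmod z)\<^sup>2)" by (simp add: complex_norm_square del: of_real_power)
  finally show ?thesis unfolding ip_self of_real_eq_iff .
qed

lemma trace_id:
  assumes t: "t > 0"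
  shows "op_trace K (exp_op K (-t) H) = complex_of_real (exp (t * (w q * (cmod z)\<^sup>2)) * Z t)"
proof -
  have "op_trace K (exp_op K (-t) H \<circ> id) = (\<Sum>\<^sub>\<infinity>\<alpha>\<in>configs K. complex_of_real (exp (-t * En \<alpha>)) * 1)"
  proof (rule op_trace_exp_op[OF t, where k = q and B = \<Phi> and C = 1])
    fix \<alpha> assume \<alpha>: "\<alpha> \<in> configs K"
    have sq: "sqnorm (configs K) (\<Phi> \<alpha>) = 1" unfolding \<Phi>_def sqnorm_sec[OF \<alpha>] by (rule sqnorm_dsp)
    show "(\<lambda>n. cmod (\<Phi> \<alpha> n) * cmod (\<Phi> \<alpha> n)) summable_on configs K"
      by (rule l2_mult_summable[OF \<Phi>_l2[OF \<alpha>] \<Phi>_l2[OF \<alpha>]])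
    show "(\<Sum>\<^sub>\<infinity>n\<in>configs K. cmod (\<Phi> \<alpha> n) * cmod (\<Phi> \<alpha> n)) \<le> real (\<alpha> q) + 1"
      using l2_mult_infsum_le[OF \<Phi>_l2[OF \<alpha>] \<Phi>_l2[OF \<alpha>]] sq by simp
    show "ip (configs K) (\<Phi> \<alpha>) (\<Phi> \<alpha>) = 1" unfolding ip_self sq by simp
  qed (auto simp: ket_eq ip_kronecker l2_kronecker q_in)
  also have "\<dots> = (\<Sum>\<^sub>\<infinity>\<alpha>\<in>configs K. complex_of_real (exp (t * (w q * (cmod z)\<^sup>2)) * exp (-t * cfg_energy \<alpha>)))"
    by (intro infsum_cong) (simp add: En_def algebra_simps flip: exp_add)
  also have "\<dots> = complex_of_real (exp (t * (w q * (cmod z)\<^sup>2)) * Z t)"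
    unfolding infsum_complex_of_real by (simp add: Z_def infsum_cmult_right')
  finally show ?thesis by simp
qed

text \<open>Used with \<open>f = 0\<close> for \<open>ann\<close> and \<open>cre\<close>, whose
  means are the same in every displaced state, and with \<open>f = 1\<close> for the number
  operators. The shift of the energies by the source cancels between numerator and
  denominator.\<close>

lemma gibbs_const:
  assumes t: "t > 0"
    and tr: "op_trace K (exp_op K (-t) H \<circ> A) = (\<Sum>\<^sub>\<infinity>\<alpha>\<in>configs K. complex_of_real (exp (-t * En \<alpha>)) * (of_nat (f * \<alpha> k) + c))"
    and k: "k \<in> K"
  shows "gibbs K t H A = of_nat f * complex_of_real (1 / (exp (t * w k) - 1)) + c"
proof -
  let ?B = "exp (t * (w q * (cmod z)\<^sup>2))"
  have e: "exp (-t * En \<alpha>) = ?B * exp (-t * cfg_energy \<alpha>)" for \<alpha>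
    by (simp add: En_def algebra_simps flip: exp_add)
  have "((\<lambda>\<alpha>. exp (-t * cfg_energy \<alpha>) * real (\<alpha> k)) has_sum Z t * (1 / (exp (t * w k) - 1))) (configs K)"
    unfolding mean_occupation[OF t k, symmetric] using weight_occupation_summable[OF t k] by (rule has_sum_infsum)
  then have h1: "((\<lambda>\<alpha>. complex_of_real (exp (-t * cfg_energy \<alpha>) * real (\<alpha> k))) has_sum complex_of_real (Z t * (1 / (exp (t * w k) - 1)))) (configs K)"
    by (rule has_sum_of_real)
  have "((\<lambda>\<alpha>. exp (-t * cfg_energy \<alpha>)) has_sum Z t) (configs K)"
    using weight_summable[OF t] by (simp add: has_sum_iff Z_def)
  then have h2: "((\<lambda>\<alpha>. complex_of_real (exp (-t * cfg_energy \<alpha>))) has_sum complex_of_real (Z t)) (configs K)"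
    by (rule has_sum_of_real)
  have "((\<lambda>\<alpha>. complex_of_real ?B * (of_nat f * complex_of_real (exp (-t * cfg_energy \<alpha>) * real (\<alpha> k)) + c * complex_of_real (exp (-t * cfg_energy \<alpha>))))
     has_sum complex_of_real ?B * (of_nat f * complex_of_real (Z t * (1 / (exp (t * w k) - 1))) + c * complex_of_real (Z t))) (configs K)"
    by (intro has_sum_cmult_right has_sum_add h1 h2)
  moreover have "complex_of_real ?B * (of_nat f * complex_of_real (exp (-t * cfg_energy \<alpha>) * real (\<alpha> k)) + c * complex_of_real (exp (-t * cfg_energy \<alpha>)))
      = complex_of_real (exp (-t * En \<alpha>)) * (of_nat (f * \<alpha> k) + c)" for \<alpha>
    unfolding e by (simp add: algebra_simps)
  ultimately have "op_trace K (exp_op K (-t) H \<circ> A) = complex_of_real ?B * (of_nat f * complex_of_real (Z t * (1 / (exp (t * w k) - 1))) + c * complex_of_real (Z t))"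
    unfolding tr by (simp add: infsumI)
  also have "\<dots> = complex_of_real (?B * Z t) * (of_nat f * complex_of_real (1 / (exp (t * w k) - 1)) + c)"
    by (simp add: algebra_simps)
  finally have "op_trace K (exp_op K (-t) H \<circ> A) = complex_of_real (?B * Z t) * (of_nat f * complex_of_real (1 / (exp (t * w k) - 1)) + c)" .
  moreover have "complex_of_real (?B * Z t) \<noteq> 0"
    using Z_pos[OF t] by simp
  ultimately show ?thesis unfolding gibbs_def trace_id[OF t] by simp
qed

lemma gibbs_ann:
  assumes t: "t > 0"
  shows "gibbs K t H (ann q) = z"
proof -
  have "op_trace K (exp_op K (-t) H \<circ> ann q) = (\<Sum>\<^sub>\<infinity>\<alpha>\<in>configs K. complex_of_real (exp (-t * En \<alpha>)) * z)"
  proof (rule op_trace_exp_op[OF t, where k = q and B = "\<lambda>\<alpha>. cre q (\<Phi> \<alpha>)" and C = "2 + (cmod z)\<^sup>2"])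
    fix \<alpha> assume \<alpha>: "\<alpha> \<in> configs K"
    let ?c = "\<lambda>i. complex_of_real (sqrt (real i)) * dsp z (\<alpha> q) (i - 1)"
    have c: "cre q (\<Phi> \<alpha>) = sec \<alpha> ?c" unfolding \<Phi>_def by (rule sec_cre)
    have lc: "l2 (configs K) (cre q (\<Phi> \<alpha>))" unfolding c l2_sec[OF \<alpha>] by (intro rapid_l2 rapid_cre rapid_dsp)
    show "(\<lambda>n. cmod (cre q (\<Phi> \<alpha>) n) * cmod (\<Phi> \<alpha> n)) summable_on configs K"
      by (rule l2_mult_summable[OF lc \<Phi>_l2[OF \<alpha>]])
    show "(\<Sum>\<^sub>\<infinity>n\<in>configs K. cmod (cre q (\<Phi> \<alpha>) n) * cmod (\<Phi> \<alpha> n)) \<le> real (\<alpha> q) + (2 + (cmod z)\<^sup>2)"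
    proof -
      have s1: "sqnorm (configs K) (cre q (\<Phi> \<alpha>)) = real (Suc (\<alpha> q)) + (cmod z)\<^sup>2"
        unfolding c sqnorm_sec[OF \<alpha>] by (rule sqnorm_dsp_cre)
      have s2: "sqnorm (configs K) (\<Phi> \<alpha>) = 1" unfolding \<Phi>_def sqnorm_sec[OF \<alpha>] by (rule sqnorm_dsp)
      have "(real (Suc (\<alpha> q)) + (cmod z)\<^sup>2 + 1) / 2 \<le> real (\<alpha> q) + (2 + (cmod z)\<^sup>2)"
        using zero_le_power2[of "cmod z"] by simp
      then show ?thesis using l2_mult_infsum_le[OF lc \<Phi>_l2[OF \<alpha>]] unfolding s1 s2 by linarith
    qed
    show "ip (configs K) (cre q (\<Phi> \<alpha>)) (\<Phi> \<alpha>) = z"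
      unfolding c ip_sec[OF \<alpha>] ip_cre_ann using ip_dsp_ann[of "\<alpha> q"] by (simp add: \<Phi>_def)
  qed (auto simp: l2_ann_ket ip_ann_ket q_in)
  then show ?thesis using gibbs_const[OF t _ q_in, of "ann q" 0 z] by simp
qed

lemma gibbs_cre:
  assumes t: "t > 0"
  shows "gibbs K t H (cre q) = cnj z"
proof -
  have "op_trace K (exp_op K (-t) H \<circ> cre q) = (\<Sum>\<^sub>\<infinity>\<alpha>\<in>configs K. complex_of_real (exp (-t * En \<alpha>)) * cnj z)"
  proof (rule op_trace_exp_op[OF t, where k = q and B = "\<lambda>\<alpha>. ann q (\<Phi> \<alpha>)" and C = "2 + (cmod z)\<^sup>2"])
    fix \<alpha> assume \<alpha>: "\<alpha> \<in> configs K"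
    let ?c = "\<lambda>i. complex_of_real (sqrt (real (Suc i))) * dsp z (\<alpha> q) (Suc i)"
    have c: "ann q (\<Phi> \<alpha>) = sec \<alpha> ?c" unfolding \<Phi>_def by (rule sec_ann)
    have lc: "l2 (configs K) (ann q (\<Phi> \<alpha>))" unfolding c l2_sec[OF \<alpha>] by (intro rapid_l2 rapid_ann rapid_dsp)
    show "(\<lambda>n. cmod (ann q (\<Phi> \<alpha>) n) * cmod (\<Phi> \<alpha> n)) summable_on configs K"
      by (rule l2_mult_summable[OF lc \<Phi>_l2[OF \<alpha>]])
    show "(\<Sum>\<^sub>\<infinity>n\<in>configs K. cmod (ann q (\<Phi> \<alpha>) n) * cmod (\<Phi> \<alpha> n)) \<le> real (\<alpha> q) + (2 + (cmod z)\<^sup>2)"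
    proof -
      have s1: "sqnorm (configs K) (ann q (\<Phi> \<alpha>)) = real (\<alpha> q) + (cmod z)\<^sup>2"
        unfolding c sqnorm_sec[OF \<alpha>] by (rule sqnorm_dsp_ann)
      have s2: "sqnorm (configs K) (\<Phi> \<alpha>) = 1" unfolding \<Phi>_def sqnorm_sec[OF \<alpha>] by (rule sqnorm_dsp)
      have "(real (\<alpha> q) + (cmod z)\<^sup>2 + 1) / 2 \<le> real (\<alpha> q) + (2 + (cmod z)\<^sup>2)"
        using zero_le_power2[of "cmod z"] by simp
      then show ?thesis using l2_mult_infsum_le[OF lc \<Phi>_l2[OF \<alpha>]] unfolding s1 s2 by linarith
    qed
    have "ip (configs K) (\<Phi> \<alpha>) (ann q (\<Phi> \<alpha>)) = z"
      using ip_dsp_ann[of "\<alpha> q"] unfolding c by (subst \<Phi>_def) (simp add: ip_sec[OF \<alpha>] del: of_nat_Suc)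
    then show "ip (configs K) (ann q (\<Phi> \<alpha>)) (\<Phi> \<alpha>) = cnj z"
      using ip_commute[of "configs K" "ann q (\<Phi> \<alpha>)" "\<Phi> \<alpha>"] by simp
  qed (auto simp: l2_cre_ket ip_cre_ket q_in)
  then show ?thesis using gibbs_const[OF t _ q_in, of "cre q" 0 "cnj z"] by simp
qed

lemma cre_ann_ket: "(cre k \<circ> ann k) (ket n) = (\<lambda>m. of_nat (n k) * ket n m)"
  by (rule ext) (auto simp: cre_ann ket_def)

lemma gibbs_number:
  assumes t: "t > 0" and k: "k \<in> K"
  shows "gibbs K t H (cre k \<circ> ann k)
    = complex_of_real (1 / (exp (t * w k) - 1) + (if k = q then (cmod z)\<^sup>2 else 0))"
proof -
  define c where "c = (if k = q then (cmod z)\<^sup>2 else 0)"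
  have c0: "c \<ge> 0" by (simp add: c_def)
  have "op_trace K (exp_op K (-t) H \<circ> (cre k \<circ> ann k))
     = (\<Sum>\<^sub>\<infinity>\<alpha>\<in>configs K. complex_of_real (exp (-t * En \<alpha>)) * (of_nat (1 * \<alpha> k) + complex_of_real c))"
  proof (rule op_trace_exp_op[OF t, where k = k and B = "\<lambda>\<alpha> n. of_nat (n k) * \<Phi> \<alpha> n" and C = c])
    fix \<alpha> assume \<alpha>: "\<alpha> \<in> configs K"
    let ?g = "\<lambda>n. sqrt (real (n k)) * \<Phi> \<alpha> n"
    \<comment> \<open>For \<open>k = q\<close> the mean is the squared norm of the annihilated
      state, reindexed from \<open>Suc i\<close> to \<open>i\<close> because the term at 0 vanishes.
      In any other mode the occupation number is sharp.\<close>
    have g: "((\<lambda>n. real (n k) * (cmod (\<Phi> \<alpha> n))\<^sup>2) has_sum real (\<alpha> k) + c) (configs K)"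
    proof (cases "k = q")
      case True
      have l: "l2 (configs K) (ann q (\<Phi> \<alpha>))"
        unfolding \<Phi>_def sec_ann l2_sec[OF \<alpha>] by (intro rapid_l2 rapid_ann rapid_dsp)
      let ?f = "\<lambda>i. complex_of_real (sqrt (real (Suc i))) * dsp z (\<alpha> q) (Suc i)"
      let ?h = "\<lambda>i. real i * (cmod (dsp z (\<alpha> q) i))\<^sup>2"
      have "((\<lambda>i. (cmod (?f i))\<^sup>2) has_sum real (\<alpha> q) + (cmod z)\<^sup>2) UNIV"
        unfolding sqnorm_dsp_ann[symmetric] sqnorm_def
        using rapid_l2[OF rapid_ann[OF rapid_dsp[of z "\<alpha> q"]]] unfolding l2_def by (rule has_sum_infsum)
      then have "((\<lambda>i. ?h (Suc i)) has_sum real (\<alpha> q) + (cmod z)\<^sup>2) UNIV"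
        by (simp add: norm_mult power_mult_distrib del: of_nat_Suc)
      then have "(?h has_sum real (\<alpha> q) + (cmod z)\<^sup>2) (range Suc)"
        using has_sum_reindex[of Suc UNIV ?h] by (simp add: o_def)
      then have "(?h has_sum real (\<alpha> q) + (cmod z)\<^sup>2) UNIV"
        by (rule has_sum_cong_neutral[THEN iffD1, rotated -1]) (auto simp: image_iff, metis not0_implies_Suc)
      then have "((\<lambda>n. real (n q) * (cmod (\<Phi> \<alpha> n))\<^sup>2) has_sum real (\<alpha> q) + (cmod z)\<^sup>2) (configs K)"
        by (subst has_sum_sector[OF \<alpha>]) (auto simp: \<Phi>_def sec_def)
      then show ?thesis using True by (simp add: c_def)
    next
      case False
      have "((\<lambda>n. (cmod (\<Phi> \<alpha> n))\<^sup>2) has_sum 1) (configs K)"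
        using \<Phi>_l2[OF \<alpha>] sqnorm_sec[OF \<alpha>, of "dsp z (\<alpha> q)"]
        by (simp add: has_sum_iff l2_def sqnorm_def \<Phi>_def sqnorm_dsp[unfolded sqnorm_def])
      then have "((\<lambda>n. real (\<alpha> k) * (cmod (\<Phi> \<alpha> n))\<^sup>2) has_sum real (\<alpha> k) * 1) (configs K)"
        by (rule has_sum_cmult_right)
      moreover have "real (\<alpha> k) * (cmod (\<Phi> \<alpha> n))\<^sup>2 = real (n k) * (cmod (\<Phi> \<alpha> n))\<^sup>2" for n
      proof (cases "n(q := 0) = \<alpha>(q := 0)")
        case True
        then have "n k = \<alpha> k" using False by (metis fun_upd_other)
        then show ?thesis by simp
      qed (simp add: \<Phi>_def sec_def)
      ultimately show ?thesis using False by (simp add: c_def)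
    qed
    have eq: "cmod (of_nat (n k) * \<Phi> \<alpha> n) * cmod (\<Phi> \<alpha> n) = real (n k) * (cmod (\<Phi> \<alpha> n))\<^sup>2" for n
      by (simp add: norm_mult power2_eq_square)
    show "(\<lambda>n. cmod (of_nat (n k) * \<Phi> \<alpha> n) * cmod (\<Phi> \<alpha> n)) summable_on configs K"
      unfolding eq using g by (auto simp: has_sum_iff)
    show "(\<Sum>\<^sub>\<infinity>n\<in>configs K. cmod (of_nat (n k) * \<Phi> \<alpha> n) * cmod (\<Phi> \<alpha> n)) \<le> real (\<alpha> k) + c"
      unfolding eq using g by (simp add: has_sum_iff)
    have p: "cnj (of_nat (n k) * \<Phi> \<alpha> n) * \<Phi> \<alpha> n = complex_of_real (real (n k) * (cmod (\<Phi> \<alpha> n))\<^sup>2)" for n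
      unfolding of_real_mult complex_norm_square by simp
    then show "ip (configs K) (\<lambda>n. of_nat (n k) * \<Phi> \<alpha> n) (\<Phi> \<alpha>) = of_nat (1 * \<alpha> k) + complex_of_real c"
      unfolding ip_def p infsumI[OF has_sum_of_real[OF g]] by simp
  next
    fix n assume n: "n \<in> configs K"
    show "l2 (configs K) ((cre k \<circ> ann k) (ket n))"
      unfolding cre_ann_ket unfolding ket_eq by (intro l2_scale l2_kronecker)
    fix \<alpha>
    show "ip (configs K) (\<Phi> \<alpha>) ((cre k \<circ> ann k) (ket n)) = cnj (of_nat (n k) * \<Phi> \<alpha> n)"
      unfolding cre_ann_ket ip_scale_right unfolding ket_eq ip_kronecker[OF n] by simp
  qed (rule k)
  from gibbs_const[OF t this k] show ?thesis by (simp add: c_def)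
qed

end

lemma ip_scale_op: "fock_inner K \<phi> (op_scale c A \<psi>) = c * fock_inner K \<phi> (A \<psi>)"
  unfolding fock_inner_ip op_scale_def by (rule ip_scale_right)

lemma gibbs_scale: "gibbs K t H (op_scale c A) = c * gibbs K t H A"
proof -
  have "exp_op K (-t) H (op_scale c A \<psi>) n = c * exp_op K (-t) H (A \<psi>) n" for \<psi> n
    unfolding exp_op_def Let_def ip_scale_op
    by (subst infsum_cmult_right'[symmetric]) (simp add: mult.left_commute mult.assoc)
  then have "fock_inner K \<phi> (exp_op K (-t) H (op_scale c A \<psi>)) = c * fock_inner K \<phi> (exp_op K (-t) H (A \<psi>))" for \<phi> \<psi>
    unfolding fock_inner_def by (subst infsum_cmult_right'[symmetric]) (simp add: mult.left_commute)
  then have "op_trace K (exp_op K (-t) H \<circ> op_scale c A) = c * op_trace K (exp_op K (-t) H \<circ> A)"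
    unfolding op_trace_def o_def by (subst infsum_cmult_right'[symmetric]) simp
  then show ?thesis by (simp add: gibbs_def)
qed

text \<open>The trace sees an observable only through its matrix elements between number states.
  This is how the space averages of the fields may be replaced by occupation numbers.\<close>

lemma gibbs_cong:
  assumes "\<And>n m. n \<in> configs K \<Longrightarrow> m \<in> configs K \<Longrightarrow> A (ket n) m = B (ket n) m"
  shows "gibbs K t H A = gibbs K t H B"
proof -
  have "fock_inner K \<phi> (A (ket n)) = fock_inner K \<phi> (B (ket n))" if "n \<in> configs K" for \<phi> n
    unfolding fock_inner_def using assms[OF that] by (intro infsum_cong) simp
  then have "exp_op K (-t) H (A (ket n)) = exp_op K (-t) H (B (ket n))" if "n \<in> configs K" for n
    unfolding exp_op_def Let_def using that by simp
  then have "op_trace K (exp_op K (-t) H \<circ> A) = op_trace K (exp_op K (-t) H \<circ> B)"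
    unfolding op_trace_def o_def by (intro infsum_cong) simp
  then show ?thesis by (simp add: gibbs_def)
qed

section \<open>Fourier modes in the box\<close>

lemma integral_cis_period:
  fixes c L :: real
  assumes L: "L > 0" and c: "c * L = 2 * pi * of_int n"
  shows "(LINT t|lborel. indicator {0..L} t *\<^sub>R cis (c * t)) = (if c = 0 then complex_of_real L else 0)"
proof (cases "c = 0")
  case True
  then show ?thesis using L by (simp add: scaleR_conv_of_real)
next
  case False
  define F where "F t = cis (c * t) / (\<i> * complex_of_real c)" for t
  have "(LINT t|lborel. indicator {0..L} t *\<^sub>R cis (c * t)) = F L - F 0"
  proof (rule integral_FTC_Icc)
    fix t
    have "((\<lambda>t. cis (c * t)) has_vector_derivative (c *\<^sub>R (\<i> * cis (c * t)))) (at t within {0..L})"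
      by (auto intro!: derivative_eq_intros simp: has_vector_derivative_def scaleR_conv_of_real)
    then have "(F has_vector_derivative (c *\<^sub>R (\<i> * cis (c * t))) / (\<i> * complex_of_real c)) (at t within {0..L})"
      unfolding F_def by (rule has_vector_derivative_divide)
    then show "(F has_vector_derivative cis (c * t)) (at t within {0..L})"
      using False by (simp add: scaleR_conv_of_real)
  qed (use L in \<open>auto intro!: continuous_intros\<close>)
  also have "F L = F 0"
    unfolding F_def c using cis_multiple_2pi[of "of_int n"] by (simp add: mult.commute)
  finally show ?thesis using False by simp
qed

text \<open>A dual momentum completes whole periods along every side, so any non-zero component
  annihilates its factor of the product integral. For \<open>d = 0\<close> the side lengths multiply
  to V because the exponents add up to 1.\<close>

lemma integral_Box_cis:
  assumes V: "V > 0" and a: "(\<Sum>j\<in>UNIV. a $ j) = 1" and d: "d \<in> dual_lattice a V"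
  shows "(LINT x:Box a V|lborel. cis (d \<bullet> x)) = (if d = 0 then complex_of_real V else 0)"
proof -
  define u :: "real^3" where "u = (\<chi> j. V powr (a $ j))"
  obtain n where n: "d = momentum a V n" using d unfolding dual_lattice_def by blast
  have Bas: "(Basis :: (real^3) set) = range (\<lambda>j. axis j 1)" by (auto simp: Basis_vec_def)
  have inj: "inj (\<lambda>j :: 3. axis j (1 :: real))" by (auto simp: inj_on_def axis_eq_axis)
  have ub: "u \<bullet> b > 0" if "b \<in> Basis" for b using that V by (auto simp: Bas u_def inner_axis)
  have per: "\<exists>m. (d \<bullet> b) * (u \<bullet> b) = 2 * pi * of_int m" if b: "b \<in> Basis" for b
  proof -
    obtain j where "b = axis j 1" using b unfolding Bas by blast
    then show ?thesis using V by (intro exI[of _ "n $ j"]) (simp add: inner_axis n momentum_def u_def)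
  qed
  interpret product_sigma_finite "\<lambda>b :: real^3. lborel :: real measure"
    by standard
  let ?s = "\<lambda>f. \<Sum>b\<in>(Basis :: (real^3) set). f b *\<^sub>R b"
  let ?g = "\<lambda>b t. indicator {0..u \<bullet> b} t *\<^sub>R cis ((d \<bullet> b) * t)"
  have Box: "indicator (Box a V) (?s f) *\<^sub>R cis (d \<bullet> ?s f) = (\<Prod>b\<in>Basis. ?g b (f b))" for f
  proof -
    have sb: "?s f \<bullet> b = f b" if "b \<in> Basis" for b
      using that by (simp add: inner_sum_left inner_Basis if_distrib cong: if_cong)
    have "?s f \<in> Box a V \<longleftrightarrow> (\<forall>b\<in>Basis. f b \<in> {0..u \<bullet> b})"
      unfolding Box_def u_def[symmetric] mem_box using sb by auto
    then have "indicator (Box a V) (?s f) = (\<Prod>b\<in>(Basis :: (real^3) set). indicator {0..u \<bullet> b} (f b) :: real)"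
      by (auto simp: indicator_def)
    moreover have "cis (d \<bullet> ?s f) = (\<Prod>b\<in>Basis. cis ((d \<bullet> b) * f b))"
    proof -
      have "d \<bullet> ?s f = (\<Sum>b\<in>Basis. (d \<bullet> b) * f b)" by (simp add: inner_sum_right mult.commute)
      then show ?thesis by (simp add: cis_conv_exp sum_distrib_left exp_sum)
    qed
    ultimately show ?thesis by (simp add: scaleR_conv_of_real prod.distrib)
  qed
  have "(LINT x:Box a V|lborel. cis (d \<bullet> x)) = (LINT f|(\<Pi>\<^sub>M b\<in>Basis. lborel). indicator (Box a V) (?s f) *\<^sub>R cis (d \<bullet> ?s f))"
  proof -
    have [measurable]: "(\<lambda>x. cis (d \<bullet> x)) \<in> borel_measurable borel"
      by (intro borel_measurable_continuous_onI continuous_intros)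
    show ?thesis unfolding set_lebesgue_integral_def
      by (subst lborel_eq, subst integral_distr) (auto simp: Box_def)
  qed
  also have "\<dots> = (\<Prod>b\<in>(Basis :: (real^3) set). LINT t|lborel. ?g b t)"
    unfolding Box
  proof (rule product_integral_prod)
    show "integrable lborel (?g b)" if "b \<in> Basis" for b
      by (rule borel_integrable_compact) (auto intro!: continuous_intros)
  qed simp
  also have "\<dots> = (\<Prod>b\<in>(Basis :: (real^3) set). if d \<bullet> b = 0 then complex_of_real (u \<bullet> b) else 0)"
  proof (rule prod.cong)
    fix b :: "real^3" assume b: "b \<in> Basis"
    obtain m where "(d \<bullet> b) * (u \<bullet> b) = 2 * pi * of_int m" using per[OF b] by blast
    from integral_cis_period[OF ub[OF b] this]
    show "(LINT t|lborel. ?g b t) = (if d \<bullet> b = 0 then complex_of_real (u \<bullet> b) else 0)" .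
  qed simp
  also have "\<dots> = (if d = 0 then complex_of_real V else 0)"
  proof (cases "d = 0")
    case True
    have "(\<Prod>b\<in>(Basis :: (real^3) set). u \<bullet> b) = (\<Prod>j\<in>UNIV. u $ j)"
      unfolding Bas by (subst prod.reindex[OF inj]) (simp add: inner_axis)
    also have "\<dots> = V" using V a powr_sum[where x = V and A = "UNIV :: 3 set" and f = "\<lambda>j. a $ j"]
      by (simp add: u_def)
    finally show ?thesis using True by (simp flip: of_real_prod)
  next
    case False
    then obtain b where "b \<in> Basis" "d \<bullet> b \<noteq> 0" using euclidean_all_zero_iff by blast
    then show ?thesis using False by auto
  qed
  finally show ?thesis .
qed

lemma dual_lattice_diff: "k \<in> dual_lattice a V \<Longrightarrow> p \<in> dual_lattice a V \<Longrightarrow> k - p \<in> dual_lattice a V"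
proof -
  assume "k \<in> dual_lattice a V" "p \<in> dual_lattice a V"
  then obtain n m where "k = momentum a V n" "p = momentum a V m" unfolding dual_lattice_def by blast
  then have "k - p = momentum a V (n - m)" by (simp add: momentum_def vec_eq_iff diff_divide_distrib right_diff_distrib)
  then show ?thesis unfolding dual_lattice_def by blast
qed

lemma integrable_Box_cis: "set_integrable lborel (Box a V) (\<lambda>x. cis (d \<bullet> x))"
  unfolding set_integrable_def Box_def
  by (rule borel_integrable_compact) (auto intro!: continuous_intros)

text \<open>The sign \<open>e\<close> covers annihilation (\<open>-1\<close>) and creation
  (\<open>1\<close>) at once. Finiteness of the contributing modes allows sum and integral to be
  exchanged; orthogonality of the plane waves then singles out \<open>p\<close>.\<close>

lemma space_avg_modes:
  fixes B :: "real^3 \<Rightarrow> oper"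
  assumes V: "V > 0" and a: "(\<Sum>j\<in>UNIV. a $ j) = 1" and p: "p \<in> dual_lattice a V"
    and fin: "finite {k \<in> dual_lattice a V. B k \<psi> n \<noteq> 0}"
    and e: "e = 1 \<or> e = - 1"
  shows "space_avg a V (\<lambda>x. op_scale (cis (e * (p \<bullet> x))) (\<lambda>\<psi> n. \<Sum>\<^sub>\<infinity>k\<in>dual_lattice a V.
     B k \<psi> n * (cis (- e * (k \<bullet> x)) / complex_of_real (sqrt V)))) \<psi> n = B p \<psi> n / complex_of_real (sqrt V)"
proof -
  let ?F = "{k \<in> dual_lattice a V. B k \<psi> n \<noteq> 0}"
  let ?s = "complex_of_real (sqrt V)"
  have eq: "cis (e * (p \<bullet> x)) * (\<Sum>\<^sub>\<infinity>k\<in>dual_lattice a V. B k \<psi> n * (cis (- e * (k \<bullet> x)) / ?s))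
     = (\<Sum>k\<in>?F. B k \<psi> n / ?s * cis ((e *\<^sub>R (p - k)) \<bullet> x))" for x
  proof -
    have "(\<Sum>\<^sub>\<infinity>k\<in>dual_lattice a V. B k \<psi> n * (cis (- e * (k \<bullet> x)) / ?s)) = (\<Sum>\<^sub>\<infinity>k\<in>?F. B k \<psi> n * (cis (- e * (k \<bullet> x)) / ?s))"
      by (intro infsum_cong_neutral) auto
    also have "\<dots> = (\<Sum>k\<in>?F. B k \<psi> n * (cis (- e * (k \<bullet> x)) / ?s))" using fin by simp
    finally have "cis (e * (p \<bullet> x)) * (\<Sum>\<^sub>\<infinity>k\<in>dual_lattice a V. B k \<psi> n * (cis (- e * (k \<bullet> x)) / ?s))
      = (\<Sum>k\<in>?F. cis (e * (p \<bullet> x)) * (B k \<psi> n * (cis (- e * (k \<bullet> x)) / ?s)))"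
      by (simp add: sum_distrib_left)
    also have "\<dots> = (\<Sum>k\<in>?F. B k \<psi> n / ?s * cis ((e *\<^sub>R (p - k)) \<bullet> x))"
    proof (rule sum.cong)
      fix k
      have "cis ((e *\<^sub>R (p - k)) \<bullet> x) = cis (e * (p \<bullet> x)) * cis (- e * (k \<bullet> x))"
        unfolding cis_mult by (simp add: inner_diff_left algebra_simps)
      then show "cis (e * (p \<bullet> x)) * (B k \<psi> n * (cis (- e * (k \<bullet> x)) / ?s)) = B k \<psi> n / ?s * cis ((e *\<^sub>R (p - k)) \<bullet> x)"
        by simp
    qed simp
    finally show ?thesis .
  qed
  have int: "(LINT x:Box a V|lborel. cis ((e *\<^sub>R (p - k)) \<bullet> x)) = (if k = p then complex_of_real V else 0)" if "k \<in> ?F" for k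
  proof -
    have "e *\<^sub>R (p - k) \<in> dual_lattice a V"
      using e dual_lattice_diff[OF p, of k] dual_lattice_diff[OF _ p, of k] that by auto
    then show ?thesis using integral_Box_cis[OF V a] e by (auto simp: scaleR_conv_of_real)
  qed
  have "(LINT x:Box a V|lborel. (\<Sum>k\<in>?F. B k \<psi> n / ?s * cis ((e *\<^sub>R (p - k)) \<bullet> x)))
      = (\<Sum>k\<in>?F. B k \<psi> n / ?s * (LINT x:Box a V|lborel. cis ((e *\<^sub>R (p - k)) \<bullet> x)))"
  proof -
    define g where "g k x = indicator (Box a V) x *\<^sub>R cis ((e *\<^sub>R (p - k)) \<bullet> x)" for k x
    have g: "integrable lborel (g k)" for k
      using integrable_Box_cis[of a V] unfolding set_integrable_def g_def[abs_def] .
    have "(LINT x:Box a V|lborel. (\<Sum>k\<in>?F. B k \<psi> n / ?s * cis ((e *\<^sub>R (p - k)) \<bullet> x)))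
        = (LINT x|lborel. (\<Sum>k\<in>?F. B k \<psi> n / ?s * g k x))"
      unfolding set_lebesgue_integral_def g_def
      by (intro Bochner_Integration.integral_cong) (simp_all add: scaleR_sum_right)
    also have "\<dots> = (\<Sum>k\<in>?F. B k \<psi> n / ?s * (LINT x|lborel. g k x))"
      using g by (subst Bochner_Integration.integral_sum) simp_all
    finally show ?thesis unfolding g_def set_lebesgue_integral_def .
  qed
  also have "\<dots> = (\<Sum>k\<in>?F. if k = p then B p \<psi> n / ?s * complex_of_real V else 0)"
  proof (rule sum.cong)
    fix k assume "k \<in> ?F"
    then show "B k \<psi> n / ?s * (LINT x:Box a V|lborel. cis ((e *\<^sub>R (p - k)) \<bullet> x))
        = (if k = p then B p \<psi> n / ?s * complex_of_real V else 0)"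
      unfolding int[OF \<open>k \<in> ?F\<close>] by simp
  qed simp
  also have "\<dots> = B p \<psi> n / ?s * complex_of_real V" using fin p by (simp add: sum.delta)
  finally show ?thesis unfolding space_avg_def op_scale_def eq using V by simp
qed

lemma odlro_obs_at_ket:
  assumes V: "V > 0" and a: "(\<Sum>j\<in>UNIV. a $ j) = 1" and p: "p \<in> dual_lattice a V"
    and n: "n \<in> configs (dual_lattice a V)" and m: "m \<in> configs (dual_lattice a V)"
  shows "odlro_obs_at a V p (ket n) m = occ_obs V p (ket n) m"
proof -
  let ?K = "dual_lattice a V"
  let ?s = "complex_of_real (sqrt V)"
  have f1: "bose_field a V x = (\<lambda>\<psi> n. \<Sum>\<^sub>\<infinity>k\<in>?K. ann k \<psi> n * (cis (- (-1) * (k \<bullet> x)) / ?s))" for x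
    by (intro ext) (simp add: bose_field_def)
  have f2: "bose_field_adj a V x = (\<lambda>\<psi> n. \<Sum>\<^sub>\<infinity>k\<in>?K. cre k \<psi> n * (cis (- 1 * (k \<bullet> x)) / ?s))" for x
    by (intro ext) (simp add: bose_field_adj_def)
  have inner: "space_avg a V (\<lambda>x. op_scale (cis (- (p \<bullet> x))) (bose_field a V x)) (ket n) = (\<lambda>j. ann p (ket n) j / ?s)"
  proof
    fix j
    have "finite {k. n k \<noteq> 0}" using n by (simp add: configs_def)
    then have "finite {k \<in> ?K. ann k (ket n) j \<noteq> 0}"
      by (rule rev_finite_subset) (use ann_ket_support[of _ n j] in auto)
    from space_avg_modes[where B = ann, OF V a p this, of "- 1"]
    show "space_avg a V (\<lambda>x. op_scale (cis (- (p \<bullet> x))) (bose_field a V x)) (ket n) j = ann p (ket n) j / ?s"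
      unfolding f1 by simp
  qed
  let ?\<psi> = "\<lambda>j. ann p (ket n) j / ?s"
  \<comment> \<open>Whatever the family it acts on, \<open>cre k\<close> vanishes at
    \<open>m\<close> unless the mode \<open>k\<close> is occupied in \<open>m\<close>; so finiteness
    comes here from the target configuration.\<close>
  have "finite {k. m k \<noteq> 0}" using m by (simp add: configs_def)
  then have "finite {k \<in> ?K. cre k ?\<psi> m \<noteq> 0}"
    by (rule rev_finite_subset) (auto simp: cre_def)
  from space_avg_modes[where B = cre, OF V a p this, of 1]
  have "space_avg a V (\<lambda>x. op_scale (cis (p \<bullet> x)) (bose_field_adj a V x)) ?\<psi> m = cre p ?\<psi> m / ?s"
    unfolding f2 by simp
  also have "cre p ?\<psi> m = cre p (ann p (ket n)) m / ?s" by (simp add: cre_def)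
  also have "\<dots> / ?s = 1 / complex_of_real V * cre p (ann p (ket n)) m"
    using V by (simp flip: of_real_mult)
  finally show ?thesis unfolding odlro_obs_at_def occ_obs_def op_scale_def o_def inner[unfolded op_scale_def] by simp
qed

lemma odlro_obs_eq_at_0: "odlro_obs a V = odlro_obs_at a V 0"
  unfolding odlro_obs_def odlro_obs_at_def op_scale_def by simp

section \<open>Lattice sums\<close>

definition occ :: "real \<Rightarrow> real \<Rightarrow> real^3 \<Rightarrow> real" where
  "occ \<beta> \<mu> k = 1 / (exp (\<beta> * (energy k - \<mu>)) - 1)"

lemma energy_norm: "energy k = (norm k)\<^sup>2"
  by (simp add: energy_def norm_vec_def L2_set_def sum_nonneg)

lemma energy_nonneg [simp]: "0 \<le> energy k"
  by (simp add: energy_norm)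

text \<open>The bounds e^y - 1 >= y and e^y - 1 >= y^2/2 cover the powers from 1 to 2. A power below
  1 decays too slowly to be compared at small y, hence the lower bound \<open>m\<close> and the term
  \<open>m powr (p - 1)\<close>.\<close>

lemma powr_le_expm1:
  fixes y m p :: real
  assumes y: "y > 0" and p: "0 < p" "p \<le> 2" and m: "p \<ge> 1 \<or> (m > 0 \<and> y \<ge> m)"
  shows "1 / (exp y - 1) \<le> (2 + m powr (p - 1)) * y powr (- p)"
proof -
  have e1: "y \<le> exp y - 1" using exp_ge_add_one_self[of y] by linarith
  have e2: "y\<^sup>2 / 2 \<le> exp y - 1" using exp_lower_Taylor_quadratic[of y] y by simp
  have "y powr p \<le> (2 + m powr (p - 1)) * (exp y - 1)"
  proof (cases "p \<ge> 1")
    case True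
    have "y powr p \<le> 2 * (exp y - 1)"
    proof (cases "y \<le> 1")
      case True
      have "y powr p \<le> y powr 1" using True \<open>p \<ge> 1\<close> y by (intro powr_mono') auto
      then show ?thesis using e1 y by simp
    next
      case False
      then have "y powr p \<le> y powr 2" using p by (intro powr_mono) auto
      then show ?thesis using e2 y by (simp add: powr_numeral)
    qed
    moreover have "0 \<le> m powr (p - 1) * (exp y - 1)" using y by simp
    ultimately show ?thesis by (simp add: distrib_right)
  next
    case False
    then have m: "m > 0" "y \<ge> m" using m by auto
    have "y powr p = y powr (p - 1) * y" using y by (simp add: powr_diff)
    also have "\<dots> \<le> m powr (p - 1) * (exp y - 1)"
      using False m y e1 by (intro mult_mono powr_mono2') auto
    also have "\<dots> \<le> (2 + m powr (p - 1)) * (exp y - 1)"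
      using y by (intro mult_right_mono) auto
    finally show ?thesis .
  qed
  moreover have "y powr p > 0" "exp y - 1 > 0" using y by auto
  ultimately show ?thesis by (simp add: powr_minus field_simps)
qed

text \<open>Each summand is at most the whole sum. This replaces an inverse power of the energy by a
  product over the coordinates, so that lattice sums factorize.\<close>

lemma prod_powr_le_sum_powr:
  fixes t :: "'i \<Rightarrow> real" and u :: real
  assumes "finite S" "S \<noteq> {}" and t: "\<And>i. i \<in> S \<Longrightarrow> 0 < t i" and u: "u \<ge> 0"
  shows "(\<Sum>i\<in>S. t i) powr (- (u * real (card S))) \<le> (\<Prod>i\<in>S. t i powr (- u))"
proof -
  define T where "T = (\<Sum>i\<in>S. t i)"
  have T: "t i \<le> T" if "i \<in> S" for i
    unfolding T_def using assms(1) that t by (intro member_le_sum) (auto intro: less_imp_le)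
  have T0: "T > 0" unfolding T_def using assms by (intro sum_pos) auto
  have "T powr (- (u * real (card S))) = (T powr (- u)) ^ card S"
    using T0 by (simp add: powr_realpow[symmetric] powr_powr)
  also have "\<dots> = (\<Prod>i\<in>S. T powr (- u))" by simp
  also have "\<dots> \<le> (\<Prod>i\<in>S. t i powr (- u))"
    using T t u by (intro prod_mono conjI powr_mono2') auto
  finally show ?thesis unfolding T_def .
qed

lemma summable_int_powr:
  assumes s: "s > 1"
  shows "(\<lambda>m::int. \<bar>real_of_int m\<bar> powr (- s)) summable_on - {0}"
proof -
  have nat: "(\<lambda>n::nat. real n powr (- s)) summable_on UNIV"
    using s summable_real_powr_iff[of "-s"] by (intro summable_nonneg_imp_summable_on) auto
  have pos: "(\<lambda>m::int. \<bar>real_of_int m\<bar> powr (- s)) summable_on range int"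
    using nat by (subst summable_on_reindex) (auto simp: o_def)
  have neg: "(\<lambda>m::int. \<bar>real_of_int m\<bar> powr (- s)) summable_on range (\<lambda>n. - int n)"
    using nat by (subst summable_on_reindex) (auto simp: o_def inj_on_def)
  have "range int \<union> range (\<lambda>n. - int n) = UNIV"
  proof -
    have "m \<in> range int \<union> range (\<lambda>n. - int n)" for m
      by (cases m rule: int_cases2) auto
    then show ?thesis by blast
  qed
  then have "(\<lambda>m::int. \<bar>real_of_int m\<bar> powr (- s)) summable_on UNIV"
    using summable_on_union[OF pos neg] by simp
  then show ?thesis by (rule summable_on_subset) simp
qed

lemma sum_prod_vec_le:
  fixes f :: "'n::finite \<Rightarrow> 'b \<Rightarrow> real"
  assumes f: "\<And>i. f i summable_on B i" "\<And>i x. x \<in> B i \<Longrightarrow> 0 \<le> f i x"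
    and G: "finite G" "\<And>n i. n \<in> G \<Longrightarrow> n $ i \<in> B i"
  shows "(\<Sum>n\<in>G. \<Prod>i\<in>UNIV. f i (n $ i)) \<le> (\<Prod>i\<in>UNIV. infsum (f i) (B i))"
proof -
  define B' where "B' i = (\<lambda>n. n $ i) ` G" for i
  have B': "finite (B' i)" "B' i \<subseteq> B i" for i using G by (auto simp: B'_def)
  have inj: "inj_on vec_nth G" by (auto simp: inj_on_def vec_eq_iff)
  have "(\<Sum>n\<in>G. \<Prod>i\<in>UNIV. f i (n $ i)) = (\<Sum>g\<in>vec_nth ` G. \<Prod>i\<in>UNIV. f i (g i))"
    by (simp add: sum.reindex[OF inj] o_def)
  also have "\<dots> \<le> (\<Sum>g\<in>(\<Pi>\<^sub>E i\<in>UNIV. B' i). \<Prod>i\<in>UNIV. f i (g i))"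
  proof (rule sum_mono2)
    show "finite (\<Pi>\<^sub>E i\<in>UNIV. B' i)" using B' by (intro finite_PiE) auto
    show "vec_nth ` G \<subseteq> (\<Pi>\<^sub>E i\<in>UNIV. B' i)" by (auto simp: B'_def)
    fix g assume "g \<in> (\<Pi>\<^sub>E i\<in>UNIV. B' i) - vec_nth ` G"
    then have "g i \<in> B i" for i using B'(2)[of i] by (auto simp: PiE_iff)
    then show "0 \<le> (\<Prod>i\<in>UNIV. f i (g i))" using f by (intro prod_nonneg) auto
  qed
  also have "\<dots> = (\<Prod>i\<in>UNIV. \<Sum>x\<in>B' i. f i x)"
    using B' by (simp add: prod_sum_PiE)
  also have "\<dots> \<le> (\<Prod>i\<in>UNIV. infsum (f i) (B i))"
    using f B' by (intro prod_mono conjI sum_nonneg finite_sum_le_infsum) blast+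
  finally show ?thesis .
qed

section \<open>Lattice sums sorted by the set of non-zero coordinates\<close>

definition cls :: "3 set \<Rightarrow> (int^3) set" where
  "cls S = {n. \<forall>i. n $ i \<noteq> 0 \<longleftrightarrow> i \<in> S}"

lemma Union_cls: "(\<Union>S\<in>UNIV. cls S) = UNIV"
proof -
  have "n \<in> cls {i. n $ i \<noteq> 0}" for n by (simp add: cls_def)
  then show ?thesis by blast
qed

lemma disjoint_cls: "S \<noteq> T \<Longrightarrow> cls S \<inter> cls T = {}"
  by (auto simp: cls_def)

text \<open>For \<open>s > 1\<close> this is twice the Riemann zeta function at
  \<open>s\<close>.\<close>

definition zeta_int :: "real \<Rightarrow> real" where
  "zeta_int s = (\<Sum>\<^sub>\<infinity>m::int\<in>- {0}. \<bar>real_of_int m\<bar> powr (- s))"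

lemma cls_sum_bound:
  fixes F :: "int^3 \<Rightarrow> real" and L :: "3 \<Rightarrow> real"
  assumes s: "s > 1" and C: "C \<ge> 0"
    and F0: "\<And>n. n \<in> cls S \<Longrightarrow> 0 \<le> F n"
    and F: "\<And>n. n \<in> cls S \<Longrightarrow> F n \<le> C * (\<Prod>i\<in>S. L i * \<bar>real_of_int (n $ i)\<bar> powr (- s))"
    and L: "\<And>i. 0 \<le> L i"
  shows "F summable_on cls S" and "infsum F (cls S) \<le> C * ((\<Prod>i\<in>S. L i) * zeta_int s ^ card S)"
proof -
  \<comment> \<open>A coordinate outside \<open>S\<close> can only be 0: the factor 1 on the index
    set \<open>{0}\<close> turns the product over \<open>S\<close> into a product over all
    coordinates.\<close>
  define f where "f i m = (if i \<in> S then L i * \<bar>real_of_int m\<bar> powr (- s) else 1)" for i :: 3 and m :: int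
  define B where "B i = (if i \<in> S then - {0::int} else {0})" for i :: 3
  have split: "(\<Prod>i\<in>UNIV. if i \<in> S then h i else 1) = (\<Prod>i\<in>S. h i)" for h :: "3 \<Rightarrow> real"
    by (simp add: prod.If_cases)
  have fs: "f i summable_on B i" for i
    using summable_on_cmult_right[OF summable_int_powr[OF s]] by (simp add: f_def[abs_def] B_def)
  have fi: "infsum (f i) (B i) = (if i \<in> S then L i * zeta_int s else 1)" for i
    by (simp add: f_def[abs_def] B_def zeta_int_def infsum_cmult_right')
  have fP: "(\<Prod>i\<in>S. L i * \<bar>real_of_int (n $ i)\<bar> powr (- s)) = (\<Prod>i\<in>UNIV. f i (n $ i))" for n :: "int^3"
    unfolding f_def by (rule split[symmetric])
  have bd: "sum F G \<le> C * ((\<Prod>i\<in>S. L i) * zeta_int s ^ card S)" if G: "finite G" "G \<subseteq> cls S" for G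
  proof -
    have "sum F G \<le> (\<Sum>n\<in>G. C * (\<Prod>i\<in>UNIV. f i (n $ i)))"
      using F G unfolding fP by (intro sum_mono) auto
    also have "\<dots> = C * (\<Sum>n\<in>G. \<Prod>i\<in>UNIV. f i (n $ i))" by (simp add: sum_distrib_left)
    also have "\<dots> \<le> C * (\<Prod>i\<in>UNIV. infsum (f i) (B i))"
    proof (intro mult_left_mono C sum_prod_vec_le fs G)
      show "0 \<le> f i x" for i x using L by (simp add: f_def)
      show "n $ i \<in> B i" if "n \<in> G" for n i using that G by (auto simp: B_def cls_def)
    qed
    also have "(\<Prod>i\<in>UNIV. infsum (f i) (B i)) = (\<Prod>i\<in>S. L i * zeta_int s)"
      unfolding fi by (rule split)
    finally show ?thesis by (simp add: prod.distrib)
  qed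
  show sm: "F summable_on cls S"
    using F0 bd by (intro nonneg_bdd_above_summable_on bdd_aboveI2[where M="C * ((\<Prod>i\<in>S. L i) * zeta_int s ^ card S)"]) auto
  show "infsum F (cls S) \<le> C * ((\<Prod>i\<in>S. L i) * zeta_int s ^ card S)"
    using sm bd by (rule infsum_le_finite_sums)
qed

locale anisotropic_box =
  fixes a :: "real^3" and \<beta> :: real
  assumes beta: "\<beta> > 0"
    and a12: "a $ 1 \<ge> a $ 2" and a23: "a $ 2 \<ge> a $ 3" and a3: "a $ 3 > 0"
    and a_sum: "a $ 1 + a $ 2 + a $ 3 = 1"
begin

lemma a_pos: "a $ i > 0"
  using a12 a23 a3 exhaust_3[of i] by auto

lemma momentum_nth: "momentum a V n $ j = 2 * pi / V powr (a $ j) * of_int (n $ j)"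
  by (simp add: momentum_def)

lemma inj_momentum: "V > 0 \<Longrightarrow> inj (momentum a V)"
proof (rule injI)
  fix n m assume V: "V > 0" and eq: "momentum a V n = momentum a V m"
  have "n $ j = m $ j" for j
    using arg_cong[OF eq, of "\<lambda>k. k $ j"] V by (simp add: momentum_nth)
  then show "n = m" by (simp add: vec_eq_iff)
qed

lemma momentum_zero: "momentum a V 0 = 0"
  by (simp add: vec_eq_iff momentum_nth)

lemma zero_in_lattice: "0 \<in> dual_lattice a V"
  unfolding dual_lattice_def by (metis momentum_zero rangeI)

lemma prod_L: "V > 0 \<Longrightarrow> (\<Prod>i\<in>UNIV. V powr (a $ i)) = V"
  using a_sum powr_sum[where x = V and A = "UNIV :: 3 set" and f = "\<lambda>i. a $ i"] by (simp add: sum_3)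

text \<open>Both sources of extra decay, a chemical potential that stays away from \<open>0\<close> and a cutoff at
  small momenta, bound the exponent from below.\<close>

lemma occ_cls_bound:
  fixes s m :: real
  assumes V: "V > 0" and S: "S \<noteq> {}" and n: "n \<in> cls S" and \<mu>: "\<mu> \<le> 0"
    and s: "s > 0" "s * real (card S) \<le> 4"
    and m: "s * real (card S) \<ge> 2 \<or> (m > 0 \<and> \<beta> * (energy (momentum a V n) - \<mu>) \<ge> m)"
  shows "occ \<beta> \<mu> (momentum a V n) \<le> (2 + m powr (s * real (card S) / 2 - 1)) * (\<Prod>i\<in>S. (sqrt \<beta> * 2 * pi) powr (- s)
     * ((V powr (a $ i)) powr s * \<bar>real_of_int (n $ i)\<bar> powr (- s)))"
proof -
  let ?k = "momentum a V n"
  \<comment> \<open>The energy is quadratic, so this power gives each coordinate the exponent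
    \<open>- s\<close>. The condition \<open>?p \<le> 2\<close> is the bound 4 on
    \<open>s * card S\<close>, and the case \<open>?p \<ge> 1\<close> is the alternative
    \<open>s * card S \<ge> 2\<close>.\<close>
  let ?p = "s * real (card S) / 2"
  let ?C = "2 + m powr (?p - 1)"
  let ?t = "\<lambda>i. \<beta> * (?k $ i)\<^sup>2"
  have cS: "card S > 0" using S by (simp add: card_gt_0_iff)
  have nz: "n $ i \<noteq> 0" if "i \<in> S" for i using n that by (auto simp: cls_def)
  have kz: "?k $ i = 0" if "i \<notin> S" for i using n that by (auto simp: cls_def momentum_nth)
  have t: "?t i > 0" if "i \<in> S" for i using nz[OF that] V beta by (simp add: momentum_nth)
  have "energy ?k = (\<Sum>i\<in>S. (?k $ i)\<^sup>2)"
    unfolding energy_def using kz by (intro sum.mono_neutral_right) auto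
  then have E: "\<beta> * energy ?k = (\<Sum>i\<in>S. ?t i)" by (simp add: sum_distrib_left)
  have E0: "\<beta> * energy ?k > 0" unfolding E using t S by (intro sum_pos) auto
  let ?y = "\<beta> * (energy ?k - \<mu>)"
  have yE: "\<beta> * energy ?k \<le> ?y" using beta \<mu> by simp
  have "occ \<beta> \<mu> ?k \<le> ?C * ?y powr (- ?p)"
    unfolding occ_def using s m E0 yE cS by (intro powr_le_expm1) auto
  also have "\<dots> \<le> ?C * (\<beta> * energy ?k) powr (- ?p)"
    using E0 yE s by (intro mult_left_mono powr_mono2' yE) (auto simp del: mult_le_cancel_left_pos mult_le_cancel_left)
  also have "(\<beta> * energy ?k) powr (- ?p) \<le> (\<Prod>i\<in>S. ?t i powr (- (s / 2)))"
    unfolding E using prod_powr_le_sum_powr[of S ?t "s / 2"] t S s by simp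
  also have "(\<Prod>i\<in>S. ?t i powr (- (s / 2))) = (\<Prod>i\<in>S. (sqrt \<beta> * 2 * pi) powr (- s)
     * ((V powr (a $ i)) powr s * \<bar>real_of_int (n $ i)\<bar> powr (- s)))"
  proof (rule prod.cong)
    fix i assume i: "i \<in> S"
    let ?L = "V powr (a $ i)"
    have L: "?L > 0" using V by simp
    have "?t i = (sqrt \<beta> * 2 * pi / ?L * \<bar>real_of_int (n $ i)\<bar>) powr 2"
      using beta L nz[OF i] by (simp add: momentum_nth power_mult_distrib power_divide)
    also have "\<dots> powr (- (s / 2)) = (sqrt \<beta> * 2 * pi / ?L * \<bar>real_of_int (n $ i)\<bar>) powr (- s)"
      by (simp add: powr_powr)
    also have "\<dots> = (sqrt \<beta> * 2 * pi) powr (- s) * (?L powr s * \<bar>real_of_int (n $ i)\<bar> powr (- s))"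
      using beta L by (simp add: powr_mult powr_divide powr_minus divide_inverse inverse_powr)
    finally show "?t i powr (- (s / 2)) = (sqrt \<beta> * 2 * pi) powr (- s) * (?L powr s * \<bar>real_of_int (n $ i)\<bar> powr (- s))" .
  qed simp
  finally show ?thesis by (simp add: mult_left_mono)
qed

lemma cls_empty: "cls {} = {0}"
  by (auto simp: cls_def vec_eq_iff)

lemma occ_nonneg: "\<mu> \<le> 0 \<Longrightarrow> 0 \<le> occ \<beta> \<mu> k"
  using beta energy_nonneg[of k] by (simp add: occ_def mult_nonneg_nonneg del: energy_nonneg)

lemma occ_mono:
  assumes "\<mu> \<le> \<mu>'" "energy k' \<le> energy k" "\<mu>' < energy k'"
  shows "occ \<beta> \<mu> k \<le> occ \<beta> \<mu>' k'"
  unfolding occ_def using assms beta by (intro divide_left_mono mult_pos_pos) auto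

lemma occ_cls_sum:
  fixes s m :: real
  assumes V: "V > 0" and S: "S \<noteq> {}" and \<mu>: "\<mu> \<le> 0"
    and s: "s > 1" "s * real (card S) \<le> 4"
    and m: "s * real (card S) \<ge> 2 \<or> (m > 0 \<and> (\<forall>n\<in>cls S. momentum a V n \<in> D \<longrightarrow> \<beta> * (energy (momentum a V n) - \<mu>) \<ge> m))"
  shows "(\<lambda>n. occ \<beta> \<mu> (momentum a V n) * indicator D (momentum a V n)) summable_on cls S" (is ?A)
    and "(\<Sum>\<^sub>\<infinity>n\<in>cls S. occ \<beta> \<mu> (momentum a V n) * indicator D (momentum a V n))
      \<le> (2 + m powr (s * real (card S) / 2 - 1)) * ((sqrt \<beta> * 2 * pi) powr (- s) * zeta_int s) ^ card S * V powr (s * (\<Sum>i\<in>S. a $ i))" (is ?B)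
proof -
  let ?F = "\<lambda>n. occ \<beta> \<mu> (momentum a V n) * indicator D (momentum a V n)"
  let ?C = "2 + m powr (s * real (card S) / 2 - 1)"
  let ?L = "\<lambda>i. (sqrt \<beta> * 2 * pi) powr (- s) * (V powr (a $ i)) powr s"
  have bound: "?F n \<le> ?C * (\<Prod>i\<in>S. ?L i * \<bar>real_of_int (n $ i)\<bar> powr (- s))" if n: "n \<in> cls S" for n
  proof (cases "momentum a V n \<in> D")
    case True
    have "s * real (card S) \<ge> 2 \<or> (m > 0 \<and> \<beta> * (energy (momentum a V n) - \<mu>) \<ge> m)"
      using m n True by blast
    then show ?thesis using occ_cls_bound[OF V S n \<mu> _ s(2), of m] s True by (simp add: mult.assoc)
  next
    case False
    then show ?thesis by (simp add: prod_nonneg)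
  qed
  have nn: "0 \<le> ?F n" for n using occ_nonneg[OF \<mu>] by simp
  show ?A by (rule cls_sum_bound(1)[OF s(1) _ nn bound]) auto
  have "infsum ?F (cls S) \<le> ?C * ((\<Prod>i\<in>S. ?L i) * zeta_int s ^ card S)"
    by (rule cls_sum_bound(2)[OF s(1) _ nn bound]) auto
  also have "(\<Prod>i\<in>S. ?L i) = ((sqrt \<beta> * 2 * pi) powr (- s)) ^ card S * V powr (s * (\<Sum>i\<in>S. a $ i))"
    using V by (simp add: prod.distrib powr_powr powr_sum[symmetric] sum_distrib_left mult.commute)
  finally show ?B by (simp add: power_mult_distrib mult_ac)
qed

definition cls_density :: "real \<Rightarrow> (real^3) set \<Rightarrow> real \<Rightarrow> 3 set \<Rightarrow> real" where
  "cls_density V D \<mu> S = 1 / V * (\<Sum>\<^sub>\<infinity>n\<in>cls S. occ \<beta> \<mu> (momentum a V n) * indicator D (momentum a V n))"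

lemma cls_density_nonneg: "V > 0 \<Longrightarrow> \<mu> \<le> 0 \<Longrightarrow> 0 \<le> cls_density V D \<mu> S"
  unfolding cls_density_def by (intro mult_nonneg_nonneg infsum_nonneg) (auto simp: occ_nonneg)

text \<open>\<open>s\<close> has to exceed \<open>1\<close> for the sums over the integers to converge, and \<open>s \<Sum>\<^sub>i\<^sub>\<in>\<^sub>S a\<^sub>i < 1\<close> makes
  the bound smaller than the volume.\<close>

lemma cls_density_tendsto_0:
  fixes s m :: real
  assumes S: "S \<noteq> {}" and s: "s > 1" "s * real (card S) \<le> 4" "s * (\<Sum>i\<in>S. a $ i) < 1"
    and \<mu>: "\<forall>\<^sub>F V in at_top. \<mu> V \<le> 0"
    and m: "s * real (card S) \<ge> 2 \<or> (m > 0 \<and> (\<forall>\<^sub>F V in at_top. \<forall>k\<in>D. \<beta> * (energy k - \<mu> V) \<ge> m))"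
  shows "((\<lambda>V. cls_density V D (\<mu> V) S) \<longlongrightarrow> 0) at_top"
proof -
  define e where "e = s * (\<Sum>i\<in>S. a $ i)"
  define C where "C = (2 + m powr (s * real (card S) / 2 - 1)) * ((sqrt \<beta> * 2 * pi) powr (- s) * zeta_int s) ^ card S"
  have lim: "((\<lambda>V. C * V powr (e - 1)) \<longlongrightarrow> C * 0) at_top"
    using s(3) unfolding e_def[symmetric] by (intro tendsto_mult tendsto_const tendsto_neg_powr filterlim_ident) simp
  have ev: "\<forall>\<^sub>F V in at_top. s * real (card S) \<ge> 2 \<or> (m > 0 \<and> (\<forall>k\<in>D. \<beta> * (energy k - \<mu> V) \<ge> m))"
    using m by (auto elim: eventually_mono)
  have up: "\<forall>\<^sub>F V in at_top. cls_density V D (\<mu> V) S \<le> C * V powr (e - 1)"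
    using \<mu> ev eventually_gt_at_top[of 0]
  proof eventually_elim
    case (elim V)
    have "(\<Sum>\<^sub>\<infinity>n\<in>cls S. occ \<beta> (\<mu> V) (momentum a V n) * indicator D (momentum a V n)) \<le> C * V powr e"
      unfolding C_def e_def using elim s by (intro occ_cls_sum(2) S) auto
    then have "cls_density V D (\<mu> V) S \<le> 1 / V * (C * V powr e)"
      unfolding cls_density_def using elim by (intro mult_left_mono) auto
    also have "\<dots> = C * V powr (e - 1)" using elim by (simp add: powr_diff)
    finally show ?case .
  qed
  have low: "\<forall>\<^sub>F V in at_top. 0 \<le> cls_density V D (\<mu> V) S"
    using \<mu> eventually_gt_at_top[of 0] by eventually_elim (rule cls_density_nonneg)
  from tendsto_sandwich[OF low up tendsto_const] lim show ?thesis by simp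
qed

lemma sum_a_lt_1: "S \<noteq> UNIV \<Longrightarrow> (\<Sum>i\<in>S. a $ i) < 1"
proof -
  assume "S \<noteq> UNIV"
  then have "(\<Sum>i\<in>S. a $ i) < (\<Sum>i\<in>UNIV. a $ i)"
  proof -
    obtain i where "i \<notin> S" using \<open>S \<noteq> UNIV\<close> by blast
    then show ?thesis using a_pos less_imp_le[OF a_pos] by (intro sum_strict_mono2[where b = i]) auto
  qed
  then show ?thesis using a_sum by (simp add: sum_3)
qed

text \<open>With two coordinates every \<open>s > 1\<close> already gives
  \<open>s * card S \<ge> 2\<close>, so the 1/y singularity is summable up to zero potential. The
  exponents of a pair add up to A < 1; \<open>s\<close> is the midpoint of 1 and 1/A, capped at
  2.\<close>

lemma cls_density_pair:
  assumes S: "card S = 2" and \<mu>: "\<forall>\<^sub>F V in at_top. \<mu> V \<le> 0"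
  shows "((\<lambda>V. cls_density V D (\<mu> V) S) \<longlongrightarrow> 0) at_top"
proof -
  have ne: "S \<noteq> {}" "S \<noteq> UNIV" using S by auto
  define A where "A = (\<Sum>i\<in>S. a $ i)"
  have A: "0 < A" "A < 1" using sum_a_lt_1[OF ne(2)] a_pos ne by (auto simp: A_def intro!: sum_pos)
  define s where "s = min 2 ((1 + 1 / A) / 2)"
  have s: "s > 1" "s \<le> 2" "s * A < 1"
  proof -
    have "1 / A > 1" using A by simp
    then show "s > 1" "s \<le> 2" by (auto simp: s_def)
    have "s * A \<le> (1 + 1 / A) / 2 * A" unfolding s_def using A by (intro mult_right_mono min.cobounded2) auto
    also have "\<dots> < 1" using A by (simp add: field_simps)
    finally show "s * A < 1" .
  qed
  show ?thesis using cls_density_tendsto_0[OF ne(1) s(1) _ _ \<mu>, of 1 D] s S by (auto simp: A_def)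
qed

text \<open>One coordinate without a gap requires \<open>s\<close> to be at least 2, and
  \<open>s = 2\<close> satisfies \<open>s * a $ i < 1\<close> precisely when the side is shorter
  than the square root of the volume scale.\<close>

lemma cls_density_single_short:
  assumes i: "a $ i < 1 / 2" and \<mu>: "\<forall>\<^sub>F V in at_top. \<mu> V \<le> 0"
  shows "((\<lambda>V. cls_density V D (\<mu> V) {i}) \<longlongrightarrow> 0) at_top"
  using cls_density_tendsto_0[of "{i}" 2 \<mu> 1 D] i \<mu> by simp

text \<open>Away from the singularity any \<open>s > 1\<close> will do, so \<open>s\<close> only has
  to stay below 1/A; the cap 4/3 keeps \<open>s * card S\<close> at most 4.\<close>

lemma cls_density_gap:
  assumes S: "S \<noteq> {}" "S \<noteq> UNIV" and \<mu>: "\<forall>\<^sub>F V in at_top. \<mu> V \<le> 0"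
    and m: "m > 0" "\<forall>\<^sub>F V in at_top. \<forall>k\<in>D. \<beta> * (energy k - \<mu> V) \<ge> m"
  shows "((\<lambda>V. cls_density V D (\<mu> V) S) \<longlongrightarrow> 0) at_top"
proof -
  define A where "A = (\<Sum>i\<in>S. a $ i)"
  have A: "0 < A" "A < 1" using sum_a_lt_1[OF S(2)] a_pos S by (auto simp: A_def intro!: sum_pos)
  define s where "s = min (4 / 3) ((1 + 1 / A) / 2)"
  have s: "s > 1" "s \<le> 4 / 3" "s * A < 1"
  proof -
    have "1 / A > 1" using A by simp
    then show "s > 1" "s \<le> 4 / 3" by (auto simp: s_def)
    have "s * A \<le> (1 + 1 / A) / 2 * A" unfolding s_def using A by (intro mult_right_mono min.cobounded2) auto
    also have "\<dots> < 1" using A by (simp add: field_simps)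
    finally show "s * A < 1" .
  qed
  have "card S \<le> 3" using card_mono[of UNIV S] by simp
  then have "s * real (card S) \<le> 4 / 3 * 3" using s by (intro mult_mono) auto
  then show ?thesis using cls_density_tendsto_0[OF S(1) s(1) _ _ \<mu>, of m D] s m by (auto simp: A_def)
qed

lemma occ_cls_summable:
  assumes V: "V > 0" and \<mu>: "\<mu> < 0"
  shows "(\<lambda>n. occ \<beta> \<mu> (momentum a V n) * indicator D (momentum a V n)) summable_on cls S"
proof (cases "S = {}")
  case True
  then show ?thesis by (simp add: cls_empty)
next
  case False
  \<comment> \<open>The exponent 4/3 exceeds 1 and multiplies with at most three coordinates to at
    most 4; the negative potential supplies the gap.\<close>
  have "card S \<le> 3" using card_mono[of UNIV S] by simp
  then have "4 / 3 * real (card S) \<le> 4" by simp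
  moreover have "\<beta> * (- \<mu>) > 0" using beta \<mu> by (intro mult_pos_pos) auto
  moreover have "\<beta> * (energy k - \<mu>) \<ge> \<beta> * (- \<mu>)" for k
    using beta by (intro mult_left_mono) auto
  ultimately show ?thesis using occ_cls_sum(1)[OF V False, of \<mu> "4/3" "\<beta> * (- \<mu>)" D] \<mu> by simp
qed

lemma lattice_sum_eq:
  assumes V: "V > 0" and \<mu>: "\<mu> < 0"
  shows "(\<lambda>k. occ \<beta> \<mu> k * indicator D k) summable_on dual_lattice a V"
    and "1 / V * (\<Sum>\<^sub>\<infinity>k\<in>dual_lattice a V. occ \<beta> \<mu> k * indicator D k) = (\<Sum>S\<in>UNIV. cls_density V D \<mu> S)"
proof -
  let ?F = "\<lambda>n. occ \<beta> \<mu> (momentum a V n) * indicator D (momentum a V n)"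
  have inj: "inj_on (momentum a V) UNIV" by (rule inj_momentum[OF V])
  have "?F summable_on (\<Union>S\<in>UNIV. cls S)"
    using disjoint_cls by (intro summable_on_finite_union_disjoint occ_cls_summable V \<mu>) auto
  then have sU: "?F summable_on UNIV" by (simp only: Union_cls)
  show "(\<lambda>k. occ \<beta> \<mu> k * indicator D k) summable_on dual_lattice a V"
    unfolding dual_lattice_def summable_on_reindex[OF inj] using sU by (simp add: o_def)
  have "(\<Sum>\<^sub>\<infinity>k\<in>dual_lattice a V. occ \<beta> \<mu> k * indicator D k) = infsum ?F (\<Union>S\<in>UNIV. cls S)"
    unfolding dual_lattice_def infsum_reindex[OF inj] Union_cls by (simp add: o_def)
  also have "\<dots> = (\<Sum>S\<in>UNIV. infsum ?F (cls S))"
    using disjoint_cls by (intro sum_infsum[symmetric] occ_cls_summable V \<mu>) auto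
  finally show "1 / V * (\<Sum>\<^sub>\<infinity>k\<in>dual_lattice a V. occ \<beta> \<mu> k * indicator D k) = (\<Sum>S\<in>UNIV. cls_density V D \<mu> S)"
    unfolding cls_density_def by (simp add: sum_distrib_left sum_divide_distrib)
qed

text \<open>Since e^(-y) is below 1/(e^y - 1), the Boltzmann factors are dominated by Bose factors
  at inverse temperature \<open>t\<close> and potential -1. The locale is reinterpreted at
  \<open>t\<close> for this, and \<open>exp (t * (\<mu> + 1))\<close> shifts the potential.\<close>

lemma exp_energy_summable:
  assumes V: "V > 0" and t: "t > 0"
  shows "(\<lambda>k. exp (- (t * (energy k - \<mu>)))) summable_on dual_lattice a V"
proof -
  interpret t: anisotropic_box a t using t a12 a23 a3 a_sum by unfold_locales
  have "(\<lambda>k. exp (t * (\<mu> + 1)) * (occ t (-1) k * indicator UNIV k)) summable_on dual_lattice a V"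
    by (intro summable_on_cmult_right t.lattice_sum_eq V) auto
  then show ?thesis
  proof (rule summable_on_comparison_test)
    fix k
    have pos: "exp (t * (energy k - (-1))) - 1 > 0" using t by (simp add: add_nonneg_pos)
    have "- (t * (energy k - \<mu>)) = t * (\<mu> + 1) - t * (energy k - (-1))"
      by (simp add: algebra_simps)
    then have "exp (- (t * (energy k - \<mu>))) = exp (t * (\<mu> + 1)) * (1 / exp (t * (energy k - (-1))))"
      by (simp only: exp_diff times_divide_eq_right mult_1_right)
    also have "\<dots> \<le> exp (t * (\<mu> + 1)) * (occ t (-1) k * indicator UNIV k)"
      unfolding occ_def using pos by (intro mult_left_mono) (auto intro!: divide_left_mono)
    finally show "exp (- (t * (energy k - \<mu>))) \<le> exp (t * (\<mu> + 1)) * (occ t (-1) k * indicator UNIV k)" .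
  qed simp
qed

end

section \<open>Integrals over momentum space\<close>

lemma nn_integral_gaussian_1:
  assumes t: "t > 0"
  shows "(\<integral>\<^sup>+x. ennreal (exp (- t * x\<^sup>2)) \<partial>lborel) = ennreal (sqrt (pi / t))"
proof -
  define \<sigma> where "\<sigma> = 1 / sqrt (2 * t)"
  have \<sigma>: "\<sigma> > 0" "\<sigma>\<^sup>2 = 1 / (2 * t)" using t by (auto simp: \<sigma>_def power_divide)
  have eq: "exp (- t * x\<^sup>2) = sqrt (pi / t) * normal_density 0 \<sigma> x" for x
    using t by (simp add: normal_density_def \<sigma>(2))
  have "emeasure (density lborel (normal_density 0 \<sigma>)) UNIV = 1"
    using prob_space.emeasure_space_1[OF prob_space_normal_density[OF \<sigma>(1), of 0]] by simp
  then have "(\<integral>\<^sup>+x. ennreal (normal_density 0 \<sigma> x) \<partial>lborel) = 1"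
    by (simp add: emeasure_density)
  then show ?thesis unfolding eq using t by (simp add: ennreal_mult nn_integral_cmult)
qed

lemma nn_integral_gaussian_3:
  assumes t: "t > 0"
  shows "(\<integral>\<^sup>+x. ennreal (exp (- t * energy x)) \<partial>lborel) = ennreal (sqrt (pi / t) ^ 3)"
proof -
  have "exp (- t * energy x) = (\<Prod>b\<in>Basis. exp (- t * (x \<bullet> b)\<^sup>2))" for x :: "real^3"
  proof -
    have "energy x = (\<Sum>b\<in>Basis. (x \<bullet> b)\<^sup>2)"
      unfolding energy_norm power2_norm_eq_inner by (subst euclidean_inner) (simp add: power2_eq_square)
    then show ?thesis by (simp add: exp_sum sum_distrib_left flip: sum_negf)
  qed
  then have "(\<integral>\<^sup>+x. ennreal (exp (- t * energy x)) \<partial>lborel)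
      = (\<integral>\<^sup>+x. (\<Prod>b\<in>Basis. ennreal (exp (- t * ((x::real^3) \<bullet> b)\<^sup>2))) \<partial>lborel)"
    by (simp add: prod_ennreal)
  also have "\<dots> = (\<Prod>b\<in>(Basis :: (real^3) set). (\<integral>\<^sup>+x. ennreal (exp (- t * x\<^sup>2)) \<partial>lborel))"
    by (rule nn_integral_lborel_prod) auto
  also have "\<dots> = ennreal (sqrt (pi / t) ^ 3)"
    unfolding nn_integral_gaussian_1[OF t] using t by (simp add: ennreal_power)
  finally show ?thesis .
qed

lemma energy_pos: "k \<noteq> 0 \<Longrightarrow> 0 < energy k"
  by (simp add: energy_norm)

lemma powr_minus_three_halves:
  assumes "x > (0 :: real)" shows "x powr (- (3 / 2)) = (1 / sqrt x) ^ 3"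
proof -
  have "x powr (- (3 / 2)) = (x powr (- (1 / 2))) powr 3" unfolding powr_powr by simp
  also have "x powr (- (1 / 2)) = 1 / sqrt x"
    using assms by (simp add: powr_minus_divide powr_half_sqrt)
  also have "\<dots> powr 3 = \<dots> ^ 3" using assms by (intro powr_numeral) simp
  finally show ?thesis .
qed

lemma occ_measurable [measurable]: "occ \<beta> \<mu> \<in> borel_measurable borel"
  unfolding occ_def[abs_def] energy_norm by measurable

lemma AE_closed_negligible:
  fixes S :: "'a::euclidean_space set"
  assumes "negligible S"
  shows "AE x in lborel. x \<notin> S"
proof -
  have "AE x in lebesgue. x \<notin> S"
    using assms by (intro AE_not_in) (simp add: negligible_iff_null_sets)
  then show ?thesis by (simp add: AE_completion_iff)
qed

text \<open>Rounding away from zero.\<close>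

definition rd :: "real \<Rightarrow> int" where
  "rd t = (if t > 0 then \<lceil>t\<rceil> else \<lfloor>t\<rfloor>)"

lemma rd_measurable [measurable]: "rd \<in> measurable borel (count_space UNIV)"
  unfolding rd_def[abs_def] by measurable

lemma rd_abs: "\<bar>t\<bar> \<le> \<bar>real_of_int (rd t)\<bar>"
proof (cases "t > 0")
  case True
  then show ?thesis using le_of_int_ceiling[of t] by (auto simp: rd_def)
next
  case False
  then show ?thesis using of_int_floor_le[of t] by (auto simp: rd_def)
qed

lemma rd_dist: "\<bar>real_of_int (rd t) - t\<bar> \<le> 1"
  unfolding rd_def by (auto simp: abs_le_iff) linarith+

lemma rd_zero_iff: "rd t = 0 \<longleftrightarrow> t = 0"
proof
  assume "rd t = 0"
  then show "t = 0" using rd_abs[of t] by simp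
qed (simp add: rd_def)

text \<open>The points rounded to \<open>n\<close> form a half-open unit interval on the side of
  \<open>n\<close> facing the origin, so its left end is \<open>n - 1\<close> or \<open>n\<close>
  according to the sign. An open interval inside and a closed one outside determine its
  measure.\<close>

lemma rd_eq_open:
  assumes "n \<noteq> 0" "real_of_int (if n > 0 then n - 1 else n) < t" "t < real_of_int (if n > 0 then n - 1 else n) + 1"
  shows "rd t = n"
proof (cases "n > 0")
  case True
  then have "real_of_int (n - 1) < t" "t < real_of_int n" using assms by auto
  moreover have "0 \<le> real_of_int (n - 1)" using True by simp
  ultimately have "t > 0" "\<lceil>t\<rceil> = n" by (linarith, linarith)
  then show ?thesis by (simp add: rd_def)
next
  case False
  then have "real_of_int n < t" "t < real_of_int n + 1" using assms by auto
  moreover have "n \<le> - 1" using False assms(1) by linarith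
  ultimately have "\<not> t > 0" "\<lfloor>t\<rfloor> = n" by (linarith, linarith)
  then show ?thesis by (simp add: rd_def)
qed

lemma rd_eq_closed:
  assumes "n \<noteq> 0" "rd t = n"
  shows "real_of_int (if n > 0 then n - 1 else n) \<le> t" "t \<le> real_of_int (if n > 0 then n - 1 else n) + 1"
proof -
  have "t > 0 \<longleftrightarrow> n > 0"
  proof (cases "t > 0")
    case True
    then have "t \<le> real_of_int n" using assms le_of_int_ceiling[of t] by (simp add: rd_def)
    then show ?thesis using True by (metis of_int_0_less_iff less_le_trans)
  next
    case False
    then have "n \<le> 0" using assms by (auto simp: rd_def floor_le_iff)
    then show ?thesis using False by simp
  qed
  then show "real_of_int (if n > 0 then n - 1 else n) \<le> t" "t \<le> real_of_int (if n > 0 then n - 1 else n) + 1"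
    using assms(2) unfolding rd_def by (auto split: if_splits)
qed

section \<open>Riemann sums for the Bose integral\<close>

context anisotropic_box begin

text \<open>Off the origin the Bose factor is a geometric series of Gaussians. The integral of term
  j is proportional to (j+1)^(-3/2), summable because the dimension 3 exceeds 2.\<close>

lemma occ0_integrable: "integrable lborel (occ \<beta> 0)"
proof (rule integrableI_nonneg)
  show "AE x in lborel. 0 \<le> occ \<beta> 0 x" by (simp add: occ_nonneg)
  let ?f = "\<lambda>j x. ennreal (exp (- (real (Suc j) * \<beta>) * energy x))"
  have series: "ennreal (occ \<beta> 0 x) = (\<Sum>j. ?f j x)" if "x \<noteq> 0" for x
  proof -
    define r where "r = exp (- (\<beta> * energy x))"
    have E: "\<beta> * energy x > 0" using beta energy_pos[OF that] by (intro mult_pos_pos)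
    have r: "0 < r" "r < 1" using E by (auto simp: r_def)
    have pw: "exp (- (real (Suc j) * \<beta>) * energy x) = r * r ^ j" for j
    proof -
      have "- (real (Suc j) * \<beta>) * energy x = real (Suc j) * (- (\<beta> * energy x))" by simp
      then have "exp (- (real (Suc j) * \<beta>) * energy x) = r ^ Suc j"
        unfolding r_def by (simp only: exp_of_nat_mult)
      then show ?thesis by simp
    qed
    have "(\<lambda>j. r * r ^ j) sums (r * (1 / (1 - r)))"
      using r by (intro sums_mult geometric_sums) auto
    moreover have "r * (1 / (1 - r)) = occ \<beta> 0 x"
    proof -
      have "exp (\<beta> * energy x) = 1 / r" unfolding r_def exp_minus by (simp add: divide_inverse)
      then have "occ \<beta> 0 x = 1 / (1 / r - 1)" by (simp add: occ_def)
      then show ?thesis using r by (simp add: field_simps)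
    qed
    ultimately have "(\<lambda>j. exp (- (real (Suc j) * \<beta>) * energy x)) sums occ \<beta> 0 x" unfolding pw by simp
    then show ?thesis
      by (subst suminf_ennreal2) (auto simp: sums_iff)
  qed
  have "(\<integral>\<^sup>+x. ennreal (occ \<beta> 0 x) \<partial>lborel) = (\<integral>\<^sup>+x. (\<Sum>j. ?f j x) \<partial>lborel)"
    using AE_lborel_singleton[of 0] by (intro nn_integral_cong_AE) (auto simp: series simp del: of_nat_Suc)
  also have "\<dots> = (\<Sum>j. \<integral>\<^sup>+x. ?f j x \<partial>lborel)"
    by (rule nn_integral_suminf) (auto simp: energy_norm)
  also have "\<dots> = (\<Sum>j. ennreal (sqrt (pi / (real (Suc j) * \<beta>)) ^ 3))"
    using beta by (intro suminf_cong nn_integral_gaussian_3) auto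
  also have "\<dots> < top"
  proof -
    have "summable (\<lambda>j. sqrt (pi / \<beta>) ^ 3 * real (Suc j) powr (- (3 / 2)))"
      using summable_real_powr_iff[of "- (3/2)"] by (intro summable_mult) (subst summable_Suc_iff, simp)
    moreover have "sqrt (pi / \<beta>) ^ 3 * real (Suc j) powr (- (3 / 2)) = sqrt (pi / (real (Suc j) * \<beta>)) ^ 3" for j
    proof -
      have "real (Suc j) powr (- (3 / 2)) = (1 / sqrt (real (Suc j))) ^ 3"
        by (rule powr_minus_three_halves) simp
      then show ?thesis
        by (simp add: real_sqrt_divide real_sqrt_mult power_divide power_mult_distrib del: of_nat_Suc)
    qed
    ultimately have "summable (\<lambda>j. sqrt (pi / (real (Suc j) * \<beta>)) ^ 3)" by (simp only:)
    then show ?thesis using beta by (subst less_top[symmetric], intro ennreal_suminf_neq_top) auto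
  qed
  finally show "(\<integral>\<^sup>+x. ennreal (occ \<beta> 0 x) \<partial>lborel) < \<infinity>" by simp
qed simp

lemma occ_le_occ0: "\<mu> \<le> 0 \<Longrightarrow> k \<noteq> 0 \<Longrightarrow> occ \<beta> \<mu> k \<le> occ \<beta> 0 k"
  using energy_pos[of k] by (intro occ_mono) auto

definition rnd :: "real \<Rightarrow> real^3 \<Rightarrow> int^3" where
  "rnd V x = (\<chi> j. rd (x $ j * (V powr (a $ j) / (2 * pi))))"

lemma rnd_measurable [measurable]: "rnd V \<in> measurable borel (count_space UNIV)"
proof (subst measurable_count_space_eq2_countable, intro conjI ballI)
  fix n :: "int^3"
  have [measurable]: "(\<lambda>x :: real^3. x $ j) \<in> borel_measurable borel" for j
    by (intro borel_measurable_continuous_onI continuous_intros)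
  have "rnd V -` {n} \<inter> space borel = (\<Inter>j\<in>UNIV. {x \<in> space borel. rd (x $ j * (V powr (a $ j) / (2 * pi))) = n $ j})"
    by (auto simp: rnd_def vec_eq_iff)
  also have "\<dots> \<in> sets borel"
    by (intro sets.finite_INT) (auto, measurable)
  finally show "rnd V -` {n} \<inter> space borel \<in> sets borel" .
qed auto

lemma momentum_rnd_nth: "momentum a V (rnd V x) $ j
    = 2 * pi / V powr (a $ j) * of_int (rd (x $ j / (2 * pi / V powr (a $ j))))"
  by (simp add: momentum_nth rnd_def)

lemma momentum_rnd_abs:
  assumes V: "V > 0" shows "\<bar>x $ j\<bar> \<le> \<bar>momentum a V (rnd V x) $ j\<bar>"
proof -
  define h where "h = 2 * pi / V powr (a $ j)"
  have h: "h > 0" using V by (simp add: h_def)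
  have "\<bar>x $ j / h\<bar> * h \<le> \<bar>real_of_int (rd (x $ j / h))\<bar> * h"
    using rd_abs[of "x $ j / h"] h by (intro mult_right_mono) auto
  then show ?thesis unfolding momentum_rnd_nth h_def[symmetric] using h by (simp add: abs_mult mult.commute)
qed

lemma momentum_rnd_dist:
  assumes V: "V > 0" shows "\<bar>momentum a V (rnd V x) $ j - x $ j\<bar> \<le> 2 * pi / V powr (a $ j)"
proof -
  define h where "h = 2 * pi / V powr (a $ j)"
  have h: "h > 0" using V by (simp add: h_def)
  have "\<bar>h * of_int (rd (x $ j / h)) - x $ j\<bar> = h * \<bar>real_of_int (rd (x $ j / h)) - x $ j / h\<bar>"
    using h by (simp add: abs_mult[of h, simplified abs_of_pos[OF h], symmetric] right_diff_distrib)
  also have "\<dots> \<le> h * 1" using h rd_dist by (intro mult_left_mono) auto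
  finally show ?thesis unfolding momentum_rnd_nth h_def by simp
qed

lemma energy_momentum_rnd: "V > 0 \<Longrightarrow> energy x \<le> energy (momentum a V (rnd V x))"
  unfolding energy_def using momentum_rnd_abs[of V x] by (intro sum_mono) (simp add: abs_le_square_iff)

lemma momentum_rnd_tendsto: "((\<lambda>V. momentum a V (rnd V x)) \<longlongrightarrow> x) at_top"
proof (rule vec_tendstoI)
  fix j
  have "((\<lambda>V. momentum a V (rnd V x) $ j - x $ j) \<longlongrightarrow> 0) at_top"
  proof (rule tendsto_rabs_zero_cancel, rule tendsto_sandwich[OF _ _ tendsto_const])
    show "\<forall>\<^sub>F V in at_top. \<bar>momentum a V (rnd V x) $ j - x $ j\<bar> \<le> 2 * pi * V powr (- (a $ j))"
      using eventually_gt_at_top[of 0]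
      by eventually_elim (use momentum_rnd_dist in \<open>simp add: powr_minus divide_inverse\<close>)
    have "((\<lambda>V. 2 * pi * V powr (- (a $ j))) \<longlongrightarrow> 2 * pi * 0) at_top"
      using a_pos[of j] by (intro tendsto_mult tendsto_const tendsto_neg_powr filterlim_ident) simp
    then show "((\<lambda>V. 2 * pi * V powr (- (a $ j))) \<longlongrightarrow> 0) at_top" by simp
  qed auto
  from tendsto_add[OF this tendsto_const[of "x $ j"]]
  show "((\<lambda>V. momentum a V (rnd V x) $ j) \<longlongrightarrow> x $ j) at_top" by simp
qed

text \<open>Cells of indices with all coordinates non-zero are boxes of common volume (2 pi)^3/V,
  since the exponents add up to 1. A zero coordinate would give a degenerate cell, whence the
  restriction to \<open>cls UNIV\<close>.\<close>

lemma emeasure_rnd_cell: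
  assumes V: "V > 0" and n: "n \<in> cls UNIV"
  shows "emeasure lborel (rnd V -` {n}) = ennreal ((2 * pi) ^ 3 / V)"
proof -
  define h where "h j = 2 * pi / V powr (a $ j)" for j
  have h: "h j > 0" for j using V by (simp add: h_def)
  define m where "m j = real_of_int (if n $ j > 0 then n $ j - 1 else n $ j)" for j
  define l u :: "real^3" where "l = (\<chi> j. h j * m j)" and "u = (\<chi> j. h j * (m j + 1))"
  have nz: "n $ j \<noteq> 0" for j using n by (simp add: cls_def)
  have rn: "rnd V x $ j = rd (x $ j / h j)" for x j by (simp add: rnd_def h_def)
  have lu: "l $ j \<le> u $ j" "u $ j - l $ j = h j" for j
    using h[of j] by (auto simp: l_def u_def algebra_simps)
  have sub1: "box l u \<subseteq> rnd V -` {n}"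
  proof
    fix x assume "x \<in> box l u"
    then have "h j * m j < x $ j" "x $ j < h j * (m j + 1)" for j by (auto simp: mem_box_cart l_def u_def)
    then have "m j < x $ j / h j" "x $ j / h j < m j + 1" for j using h[of j] by (auto simp: field_simps)
    then have "rnd V x $ j = n $ j" for j unfolding rn by (intro rd_eq_open nz) (auto simp: m_def)
    then show "x \<in> rnd V -` {n}" by (simp add: vec_eq_iff)
  qed
  have sub2: "rnd V -` {n} \<subseteq> cbox l u"
  proof
    fix x assume "x \<in> rnd V -` {n}"
    then have "rd (x $ j / h j) = n $ j" for j using rn[of x j] by simp
    then have "m j \<le> x $ j / h j" "x $ j / h j \<le> m j + 1" for j
      using rd_eq_closed[OF nz] unfolding m_def by auto
    then have "m j * h j \<le> x $ j" "x $ j \<le> (m j + 1) * h j" for j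
      by (simp_all only: pos_le_divide_eq[OF h] pos_divide_le_eq[OF h])
    then have "l $ j \<le> x $ j" "x $ j \<le> u $ j" for j by (simp_all add: l_def u_def mult.commute)
    then show "x \<in> cbox l u" by (simp add: mem_box_cart)
  qed
  have ne: "cbox l u \<noteq> {}" using lu(1) by (simp add: interval_ne_empty_cart)
  have meas: "rnd V -` {n} \<in> sets lborel"
    using measurable_sets[OF rnd_measurable, of "{n}" V] by simp
  have "emeasure lborel (cbox l u) = ennreal (measure lborel (cbox l u))"
    by (rule emeasure_eq_ennreal_measure) (simp add: emeasure_lborel_cbox_eq)
  also have "measure lborel (cbox l u) = (\<Prod>j\<in>UNIV. h j)" using content_cbox_cart[OF ne] lu by simp
  also have "\<dots> = (2 * pi) ^ 3 / V"
    unfolding h_def prod_dividef prod_L[OF V] by simp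
  finally have c: "emeasure lborel (cbox l u) = ennreal ((2 * pi) ^ 3 / V)" .
  have "\<forall>b\<in>Basis. l \<bullet> b \<le> u \<bullet> b" using lu(1) by (auto simp: Basis_vec_def inner_axis)
  then have "emeasure lborel (box l u) = emeasure lborel (cbox l u)"
    by (simp add: emeasure_lborel_box_eq emeasure_lborel_cbox_eq)
  moreover have "emeasure lborel (box l u) \<le> emeasure lborel (rnd V -` {n})"
    using sub1 meas by (intro emeasure_mono) auto
  moreover have "emeasure lborel (rnd V -` {n}) \<le> emeasure lborel (cbox l u)"
    using sub2 by (intro emeasure_mono) auto
  ultimately show ?thesis using c by (metis antisym)
qed

text \<open>On \<open>cls UNIV\<close> the image of Lebesgue measure under rounding is a constant
  multiple of counting measure; the class sum is therefore exactly an integral of a step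
  function.\<close>

lemma integral_rnd:
  fixes g :: "int^3 \<Rightarrow> real"
  assumes V: "V > 0" and g: "g summable_on cls UNIV"
  shows "(LINT x|lborel. indicator (cls UNIV) (rnd V x) * g (rnd V x)) = (2 * pi) ^ 3 / V * infsum g (cls UNIV)"
proof -
  let ?X = "cls UNIV"
  let ?i = "indicator ?X :: int^3 \<Rightarrow> real"
  define c where "c = (2 * pi) ^ 3 / V"
  have c: "c \<ge> 0" using V by (simp add: c_def)
  define M where "M = distr lborel (count_space UNIV) (rnd V)"
  have sM: "sets M = UNIV" "space M = UNIV" by (simp_all add: M_def)
  have mM: "f \<in> borel_measurable M" for f :: "int^3 \<Rightarrow> 'b::topological_space"
    unfolding M_def by simp
  have eM: "emeasure M {n} = ennreal c" if "n \<in> ?X" for n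
    unfolding M_def c_def using emeasure_rnd_cell[OF V that] by (subst emeasure_distr) auto
  have dens: "density M (\<lambda>n. ennreal (?i n)) = density (count_space UNIV) (\<lambda>n. ennreal (c * ?i n))"
  proof (rule measure_eqI_countable[where A = UNIV])
    fix n :: "int^3"
    have "emeasure (density M (\<lambda>n. ennreal (?i n))) {n} = (\<integral>\<^sup>+m. ennreal (?i n) * indicator {n} m \<partial>M)"
      by (subst emeasure_density) (auto simp: sM mM intro!: nn_integral_cong split: split_indicator)
    also have "\<dots> = ennreal (?i n) * emeasure M {n}" by (simp add: sM nn_integral_cmult_indicator)
    also have "\<dots> = ennreal (c * ?i n)" using eM[of n] by (cases "n \<in> ?X") auto
    also have "\<dots> = (\<integral>\<^sup>+m. ennreal (c * ?i n) * indicator {n} m \<partial>count_space UNIV)"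
      by (simp add: nn_integral_cmult_indicator)
    also have "\<dots> = emeasure (density (count_space UNIV) (\<lambda>n. ennreal (c * ?i n))) {n}"
      by (subst emeasure_density) (auto intro!: nn_integral_cong split: split_indicator)
    finally show "emeasure (density M (\<lambda>n. ennreal (?i n))) {n} = emeasure (density (count_space UNIV) (\<lambda>n. ennreal (c * ?i n))) {n}" .
  qed (auto simp: sM)
  have abs: "Infinite_Set_Sum.abs_summable_on g ?X"
    using g summable_on_iff_abs_summable_on_real abs_summable_equivalent by blast
  have "(LINT x|lborel. ?i (rnd V x) * g (rnd V x)) = (LINT n|M. ?i n * g n)"
    unfolding M_def by (subst integral_distr) auto
  also have "\<dots> = (LINT n|density M (\<lambda>n. ennreal (?i n)). g n)"
    by (subst integral_density) (auto simp: mM)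
  also have "\<dots> = (LINT n|count_space UNIV. c * (?i n * g n))"
    unfolding dens using c by (subst integral_density) (auto simp: mult.assoc)
  also have "\<dots> = c * infsetsum g ?X"
    unfolding infsetsum_altdef set_lebesgue_integral_def by simp
  also have "infsetsum g ?X = infsum g ?X" using abs by (rule infsetsum_infsum)
  finally show ?thesis by (simp add: c_def)
qed

text \<open>Because the lattice points are rounded away from the origin and \<open>occ\<close> is radially
  decreasing, the step functions are dominated by \<open>occ \<beta> 0\<close> itself.\<close>

lemma cls_density_tendsto_integral:
  assumes \<mu>: "\<forall>\<^sub>F V in at_top. \<mu> V < 0" and lim: "(\<mu> \<longlongrightarrow> \<mu>0) at_top"
    and D: "D \<in> sets borel" "AE x in lborel. x \<in> interior D \<or> x \<in> interior (- D)"
  shows "((\<lambda>V. cls_density V D (\<mu> V) UNIV) \<longlongrightarrow> 1 / (2 * pi) ^ 3 * (LINT x|lborel. occ \<beta> \<mu>0 x * indicator D x)) at_top"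
proof -
  have \<mu>0: "\<mu>0 \<le> 0" using \<mu> by (intro tendsto_upperbound[OF lim]) (auto elim: eventually_mono)
  define G where "G V x = indicator (cls UNIV) (rnd V x) *
     (occ \<beta> (\<mu> V) (momentum a V (rnd V x)) * indicator D (momentum a V (rnd V x)))" for V and x :: "real^3"
  have ne: "AE x in lborel. (x :: real^3) \<noteq> 0" by (rule AE_lborel_singleton)
  have comp: "AE x in lborel. \<forall>j. (x :: real^3) $ j \<noteq> 0"
    unfolding AE_all_countable
  proof
    fix j :: 3
    show "AE x in lborel. (x :: real^3) $ j \<noteq> 0"
      using AE_closed_negligible[OF negligible_standard_hyperplane_cart[of j]] by simp
  qed
  have "((\<lambda>V. LINT x|lborel. G V x) \<longlongrightarrow> (LINT x|lborel. occ \<beta> \<mu>0 x * indicator D x)) at_top"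
  proof (rule integral_dominated_convergence_at_top)
    show "(\<lambda>x. occ \<beta> \<mu>0 x * indicator D x) \<in> borel_measurable lborel" using D(1) by measurable
    show "G V \<in> borel_measurable lborel" for V
    proof -
      have "(\<lambda>n. indicator (cls UNIV) n * (occ \<beta> (\<mu> V) (momentum a V n) * indicator D (momentum a V n)))
          \<in> borel_measurable (count_space UNIV)" by simp
      from measurable_compose[OF rnd_measurable this] show ?thesis unfolding G_def[abs_def] by simp
    qed
    show "integrable lborel (occ \<beta> 0)" by (rule occ0_integrable)
    show "AE x in lborel. ((\<lambda>V. G V x) \<longlongrightarrow> occ \<beta> \<mu>0 x * indicator D x) at_top"
      using ne comp D(2)
    proof eventually_elim
      case (elim x)
      let ?k = "\<lambda>V. momentum a V (rnd V x)"
      have one: "\<forall>\<^sub>F V in at_top. indicator (cls UNIV) (rnd V x) = (1 :: real)"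
        using eventually_gt_at_top[of 0]
      proof eventually_elim
        case (elim V)
        then have "rnd V x $ j \<noteq> 0" for j
          using \<open>\<forall>j. x $ j \<noteq> 0\<close> by (simp add: rnd_def rd_zero_iff)
        then show ?case by (simp add: cls_def)
      qed
      \<comment> \<open>Almost every \<open>x\<close> is off the boundary of \<open>D\<close>, so
        its rounded neighbours eventually lie on the same side of the boundary.\<close>
      have ind: "\<forall>\<^sub>F V in at_top. indicator D (?k V) = (indicator D x :: real)"
      proof (cases "x \<in> interior D")
        case True
        then have "\<forall>\<^sub>F V in at_top. ?k V \<in> interior D"
          using momentum_rnd_tendsto open_interior by (intro topological_tendstoD) auto
        then show ?thesis using True interior_subset by (auto elim!: eventually_mono simp: subset_iff indicator_def)
      next
        case False
        then have x: "x \<in> interior (- D)" using elim by blast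
        then have "\<forall>\<^sub>F V in at_top. ?k V \<in> interior (- D)"
          using momentum_rnd_tendsto open_interior by (intro topological_tendstoD) auto
        then show ?thesis
        proof (rule eventually_mono)
          fix V assume "?k V \<in> interior (- D)"
          then have "?k V \<in> - D" "x \<in> - D" using x interior_subset[of "- D"] by blast+
          then show "indicator D (?k V) = (indicator D x :: real)" by simp
        qed
      qed
      have E: "energy x > 0" using elim energy_pos[of x] by blast
      have "((\<lambda>V. occ \<beta> (\<mu> V) (?k V) * indicator D x) \<longlongrightarrow> occ \<beta> \<mu>0 x * indicator D x) at_top"
        unfolding occ_def energy_norm
      proof (intro tendsto_intros lim momentum_rnd_tendsto)
        have "0 < (norm x)\<^sup>2" using E by (simp only: energy_norm)
        then have "\<beta> * ((norm x)\<^sup>2 - \<mu>0) > 0" using \<mu>0 by (intro mult_pos_pos[OF beta]) linarith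
        then have "exp (\<beta> * ((norm x)\<^sup>2 - \<mu>0)) > 1" by (simp only: one_less_exp_iff)
        then show "exp (\<beta> * ((norm x)\<^sup>2 - \<mu>0)) - 1 \<noteq> 0" by linarith
      qed
      moreover have "\<forall>\<^sub>F V in at_top. occ \<beta> (\<mu> V) (?k V) * indicator D x = G V x"
        using one ind by eventually_elim (simp add: G_def)
      ultimately show ?case by (rule Lim_transform_eventually)
    qed
    show "\<forall>\<^sub>F V in at_top. AE x in lborel. norm (G V x) \<le> occ \<beta> 0 x"
      using \<mu> eventually_gt_at_top[of 0]
    proof eventually_elim
      case (elim V)
      show ?case using ne
      proof eventually_elim
        fix x :: "real^3" assume x: "x \<noteq> 0"
        let ?k = "momentum a V (rnd V x)"
        have E: "energy x > 0" using x energy_pos[of x] by blast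
        have "occ \<beta> (\<mu> V) ?k \<le> occ \<beta> 0 x"
          using energy_momentum_rnd[of V x] elim E by (intro occ_mono) auto
        moreover have "0 \<le> occ \<beta> (\<mu> V) ?k" "0 \<le> occ \<beta> 0 x" using elim by (auto intro: occ_nonneg)
        ultimately show "norm (G V x) \<le> occ \<beta> 0 x" by (auto simp: G_def indicator_def)
      qed
    qed
  qed
  then have "((\<lambda>V. 1 / (2 * pi) ^ 3 * (LINT x|lborel. G V x)) \<longlongrightarrow> 1 / (2 * pi) ^ 3 * (LINT x|lborel. occ \<beta> \<mu>0 x * indicator D x)) at_top"
    by (intro tendsto_mult tendsto_const)
  moreover have "\<forall>\<^sub>F V in at_top. 1 / (2 * pi) ^ 3 * (LINT x|lborel. G V x) = cls_density V D (\<mu> V) UNIV"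
    using \<mu> eventually_gt_at_top[of 0]
  proof eventually_elim
    case (elim V)
    show ?case unfolding G_def cls_density_def
      using integral_rnd[OF elim(2) occ_cls_summable[OF elim(2,1), of D UNIV]] elim by simp
  qed
  ultimately show ?thesis by (rule Lim_transform_eventually)
qed

lemma bose_integral_eq: "bose_integral \<beta> \<mu> = 1 / (2 * pi) ^ 3 * (LINT x|lborel. occ \<beta> \<mu> x)"
  unfolding bose_integral_def occ_def energy_norm ..

lemma occ_integrable: "\<mu> \<le> 0 \<Longrightarrow> integrable lborel (occ \<beta> \<mu>)"
proof (rule Bochner_Integration.integrable_bound[OF occ0_integrable])
  assume "\<mu> \<le> 0"
  then show "AE x in lborel. norm (occ \<beta> \<mu> x) \<le> norm (occ \<beta> 0 x)"
    using AE_lborel_singleton[of 0] by (auto simp: occ_nonneg occ_le_occ0)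
qed auto

text \<open>With c = exp (\<beta> (\<mu> - \<mu>')) <= 1 the left factor is c/(y - c), at most c/(y
  - 1). The bound is uniform in \<open>k\<close>, so strict monotonicity and decay at minus infinity
  pass to the integral and to lattice sums alike.\<close>

lemma occ_exp_bound:
  assumes "\<mu> \<le> \<mu>'" "\<mu>' < energy k"
  shows "occ \<beta> \<mu> k \<le> exp (\<beta> * (\<mu> - \<mu>')) * occ \<beta> \<mu>' k"
proof -
  define y where "y = exp (\<beta> * (energy k - \<mu>'))"
  define c where "c = exp (\<beta> * (\<mu> - \<mu>'))"
  have y: "y > 1" using assms beta by (simp add: y_def)
  have c: "0 < c" "c \<le> 1" using assms beta by (auto simp: c_def mult_nonneg_nonpos)
  have "exp (\<beta> * (energy k - \<mu>)) = y / c" unfolding y_def c_def by (simp add: algebra_simps flip: exp_diff)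
  then have "occ \<beta> \<mu> k = 1 / (y / c - 1)" unfolding occ_def by (rule arg_cong)
  also have "\<dots> = c / (y - c)" using c y by (simp add: field_simps)
  also have "\<dots> \<le> c / (y - 1)" using y c by (intro divide_left_mono mult_pos_pos) auto
  finally show ?thesis by (simp add: occ_def y_def c_def)
qed

lemma bose_integral_exp_bound:
  assumes "\<mu> \<le> \<mu>'" "\<mu>' \<le> 0"
  shows "bose_integral \<beta> \<mu> \<le> exp (\<beta> * (\<mu> - \<mu>')) * bose_integral \<beta> \<mu>'"
proof -
  have "(LINT x|lborel. occ \<beta> \<mu> x) \<le> (LINT x|lborel. exp (\<beta> * (\<mu> - \<mu>')) * occ \<beta> \<mu>' x)"
  proof (rule integral_mono_AE)
    show "AE x in lborel. occ \<beta> \<mu> x \<le> exp (\<beta> * (\<mu> - \<mu>')) * occ \<beta> \<mu>' x"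
      using AE_lborel_singleton[of 0]
      by eventually_elim (rule occ_exp_bound[OF assms(1) le_less_trans[OF assms(2) energy_pos]])
  qed (use assms occ_integrable in auto)
  also have "\<dots> = exp (\<beta> * (\<mu> - \<mu>')) * (LINT x|lborel. occ \<beta> \<mu>' x)" by simp
  finally have "1 / (2 * pi) ^ 3 * (LINT x|lborel. occ \<beta> \<mu> x)
      \<le> 1 / (2 * pi) ^ 3 * (exp (\<beta> * (\<mu> - \<mu>')) * (LINT x|lborel. occ \<beta> \<mu>' x))"
    by (intro mult_left_mono) auto
  then show ?thesis unfolding bose_integral_eq by (simp add: mult.left_commute)
qed

lemma bose_integral_pos:
  assumes \<mu>: "\<mu> \<le> 0" shows "bose_integral \<beta> \<mu> > 0"
proof -
  have "(LINT x|lborel. occ \<beta> \<mu> x) \<noteq> 0"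
  proof
    assume "(LINT x|lborel. occ \<beta> \<mu> x) = 0"
    then have "AE x in lborel. occ \<beta> \<mu> x = 0"
      using integral_nonneg_eq_0_iff_AE[OF occ_integrable[OF \<mu>]] occ_nonneg[OF \<mu>] by simp
    then have "AE x in (lborel :: (real^3) measure). False"
      using AE_lborel_singleton[of 0]
    proof eventually_elim
      fix x :: "real^3" assume x: "occ \<beta> \<mu> x = 0" "x \<noteq> 0"
      then have "energy x > 0" using energy_pos[of x] by blast
      then show False using x(1) \<mu> beta by (simp add: occ_def)
    qed
    then show False using AE_iff_null[of lborel "\<lambda>x :: real^3. False"] by (auto simp: null_sets_def)
  qed
  moreover have "(LINT x|lborel. occ \<beta> \<mu> x) \<ge> 0" using occ_nonneg[OF \<mu>] by simp
  ultimately show ?thesis unfolding bose_integral_eq by simp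
qed

lemma bose_integral_strict_mono:
  assumes "\<mu> < \<mu>'" "\<mu>' \<le> 0"
  shows "bose_integral \<beta> \<mu> < bose_integral \<beta> \<mu>'"
proof -
  have "bose_integral \<beta> \<mu> \<le> exp (\<beta> * (\<mu> - \<mu>')) * bose_integral \<beta> \<mu>'"
    using assms by (intro bose_integral_exp_bound) auto
  also have "\<dots> < 1 * bose_integral \<beta> \<mu>'"
    using assms beta bose_integral_pos[of \<mu>'] by (intro mult_strict_right_mono) (auto simp: mult_pos_neg)
  finally show ?thesis by simp
qed

text \<open>The endpoint 0 is included, as \<open>occ \<beta> 0\<close> is an integrable majorant;
  this is what later allows the potential to tend to 0 inside the integral.\<close>

lemma bose_integral_continuous: "continuous_on {..0} (bose_integral \<beta>)"
proof (rule continuous_on_sequentiallyI)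
  fix u and l :: real assume u: "\<forall>n. u n \<in> {..0}" and l: "l \<in> {..0}" and lim: "u \<longlonglongrightarrow> l"
  have "(\<lambda>n. LINT x|lborel. occ \<beta> (u n) x) \<longlonglongrightarrow> (LINT x|lborel. occ \<beta> l x)"
  proof (rule integral_dominated_convergence[OF _ _ occ0_integrable])
    show "AE x in lborel. (\<lambda>n. occ \<beta> (u n) x) \<longlonglongrightarrow> occ \<beta> l x"
      using AE_lborel_singleton[of 0]
    proof eventually_elim
      fix x :: "real^3" assume "x \<noteq> 0"
      then have "energy x > 0" using energy_pos[of x] by blast
      then have "exp (\<beta> * (energy x - l)) - 1 \<noteq> 0" using l beta by simp
      then show "(\<lambda>n. occ \<beta> (u n) x) \<longlonglongrightarrow> occ \<beta> l x"
        unfolding occ_def by (intro tendsto_intros lim)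
    qed
    show "AE x in lborel. norm (occ \<beta> (u n) x) \<le> occ \<beta> 0 x" for n
      using AE_lborel_singleton[of 0] u by (auto simp: occ_nonneg occ_le_occ0)
  qed auto
  then show "(\<lambda>n. bose_integral \<beta> (u n)) \<longlonglongrightarrow> bose_integral \<beta> l"
    unfolding bose_integral_eq by (intro tendsto_mult tendsto_const)
qed

lemma cutoff_integral_tendsto:
  "((\<lambda>\<delta>. 1 / (2 * pi) ^ 3 * (LINT x|lborel. occ \<beta> 0 x * indicator {x. \<delta> < norm x} x)) \<longlongrightarrow> rho_c \<beta>) (at_right 0)"
  unfolding rho_c_def bose_integral_eq
proof (intro tendsto_mult tendsto_const)
  show "((\<lambda>\<delta>. LINT x|lborel. occ \<beta> 0 x * indicator {x. \<delta> < norm x} x) \<longlongrightarrow> (LINT x|lborel. occ \<beta> 0 x)) (at_right 0)"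
  proof (rule tendsto_at_right_sequentially[where b = 1])
    fix S :: "nat \<Rightarrow> real" assume S: "\<And>n. 0 < S n" "S \<longlonglongrightarrow> 0"
    show "(\<lambda>n. LINT x|lborel. occ \<beta> 0 x * indicator {x. S n < norm x} x) \<longlonglongrightarrow> (LINT x|lborel. occ \<beta> 0 x)"
    proof (rule integral_dominated_convergence[OF _ _ occ0_integrable])
      show "AE x in lborel. (\<lambda>n. occ \<beta> 0 x * indicator {x. S n < norm x} x) \<longlonglongrightarrow> occ \<beta> 0 x"
        using AE_lborel_singleton[of 0]
      proof eventually_elim
        fix x :: "real^3" assume "x \<noteq> 0"
        then have "\<forall>\<^sub>F n in sequentially. S n < norm x" using order_tendstoD(2)[OF S(2), of "norm x"] by simp
        then have "\<forall>\<^sub>F n in sequentially. occ \<beta> 0 x = occ \<beta> 0 x * indicator {x. S n < norm x} x"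
          by eventually_elim simp
        then show "(\<lambda>n. occ \<beta> 0 x * indicator {x. S n < norm x} x) \<longlonglongrightarrow> occ \<beta> 0 x"
          by (rule Lim_transform_eventually[OF tendsto_const])
      qed
      show "AE x in lborel. norm (occ \<beta> 0 x * indicator {x. S n < norm x} x) \<le> occ \<beta> 0 x" for n
        by (auto simp: occ_nonneg indicator_def)
    qed auto
  qed simp
qed

end

section \<open>The condensate equation in finite volume\<close>

lemma ex1_root_neg:
  fixes D :: "real \<Rightarrow> real"
  assumes mono: "\<And>x y. x < y \<Longrightarrow> y < 0 \<Longrightarrow> D x < D y"
    and cont: "continuous_on {..<0} D"
    and bot: "(D \<longlongrightarrow> 0) at_bot" and \<rho>: "\<rho> > 0" and top: "\<exists>y<0. \<rho> \<le> D y"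
  shows "\<exists>!x. x < 0 \<and> D x = \<rho>"
proof -
  obtain y where y: "y < 0" "\<rho> \<le> D y" using top by blast
  have "\<forall>\<^sub>F x in at_bot. D x < \<rho> \<and> x < y"
    using order_tendstoD(2)[OF bot \<rho>] eventually_gt_at_bot[of y] by eventually_elim simp
  from eventually_happens'[OF trivial_limit_at_bot_linorder this]
  obtain x where x: "D x < \<rho>" "x < y" by blast
  have "continuous_on {x..y} D" by (rule continuous_on_subset[OF cont]) (use y in auto)
  then obtain m where "x \<le> m" "m \<le> y" "D m = \<rho>"
    using IVT'[of D x \<rho> y] x y by auto
  then have "m < 0 \<and> D m = \<rho>" using y by simp
  moreover have "m' = m" if "m' < 0 \<and> D m' = \<rho>" "m < 0 \<and> D m = \<rho>" for m m'
    using that mono[of m m'] mono[of m' m] by (cases m m' rule: linorder_cases) auto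
  ultimately show ?thesis by blast
qed

lemma source_term_strict_mono:
  fixes E c :: real
  assumes "x < y" "y < 0" "0 \<le> E"
  shows "c\<^sup>2 / (E - x)\<^sup>2 \<le> c\<^sup>2 / (E - y)\<^sup>2"
  using assms by (intro divide_left_mono power_mono mult_pos_pos) auto

lemma source_term_at_bot:
  fixes E c :: real
  shows "((\<lambda>x. c\<^sup>2 / (E - x)\<^sup>2) \<longlongrightarrow> 0) at_bot"
proof -
  have "filterlim (\<lambda>x :: real. E - x) at_top at_bot"
    unfolding diff_conv_add_uminus
    by (intro filterlim_tendsto_add_at_top[OF tendsto_const] filterlim_uminus_at_top_at_bot)
  then have "filterlim (\<lambda>x. (E - x)\<^sup>2) at_top at_bot"
    by (intro filterlim_pow_at_top) auto
  then show ?thesis by (intro real_tendsto_divide_at_top[OF tendsto_const])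
qed

context anisotropic_box begin

lemma source_gas_instance:
  assumes V: "V > 0" and \<mu>: "\<mu> < 0" and q: "q \<in> dual_lattice a V"
  shows "source_gas (dual_lattice a V) q (\<lambda>k. energy k - \<mu>)"
proof
  show "countable (dual_lattice a V)" unfolding dual_lattice_def by simp
  show "\<exists>m>0. \<forall>k\<in>dual_lattice a V. m \<le> energy k - \<mu>"
    using \<mu> by (intro exI[of _ "- \<mu>"]) auto
qed (use q exp_energy_summable[OF V] in auto)

lemma hamiltonian_eq:
  assumes V: "V > 0" and \<mu>: "\<mu> < 0" and q: "q \<in> dual_lattice a V"
  shows "hamiltonian a V q \<mu> \<eta>
     = source_gas.H (dual_lattice a V) q (\<lambda>k. energy k - \<mu>) (complex_of_real (sqrt V) * \<eta>)"
  unfolding source_gas.H_def[OF source_gas_instance[OF assms]] hamiltonian_def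
  by (intro ext) (simp add: algebra_simps)

lemma displacement_eq:
  assumes V: "V > 0" and \<mu>: "\<mu> < 0" and q: "q \<in> dual_lattice a V"
  shows "source_gas.z q (\<lambda>k. energy k - \<mu>) (complex_of_real (sqrt V) * \<eta>)
     = - (complex_of_real (sqrt V) * \<eta>) / complex_of_real (energy q - \<mu>)"
  by (rule source_gas.z_def[OF source_gas_instance[OF assms]])

lemma omega_ann_obs:
  assumes V: "V > 0" and \<mu>: "\<mu> < 0" and q: "q \<in> dual_lattice a V"
  shows "omega a \<beta> V q \<mu> \<eta> (ann_obs V q) = - \<eta> / complex_of_real (energy q - \<mu>)"
  unfolding omega_def ann_obs_def gibbs_scale hamiltonian_eq[OF assms]
    source_gas.gibbs_ann[OF source_gas_instance[OF assms] beta] displacement_eq[OF assms]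
  using V by simp

lemma omega_cre_obs:
  assumes V: "V > 0" and \<mu>: "\<mu> < 0" and q: "q \<in> dual_lattice a V"
  shows "omega a \<beta> V q \<mu> \<eta> (cre_obs V q) = - cnj \<eta> / complex_of_real (energy q - \<mu>)"
  unfolding omega_def cre_obs_def gibbs_scale hamiltonian_eq[OF assms]
    source_gas.gibbs_cre[OF source_gas_instance[OF assms] beta] displacement_eq[OF assms]
  using V by simp

lemma omega_number:
  assumes V: "V > 0" and \<mu>: "\<mu> < 0" and q: "q \<in> dual_lattice a V" and k: "k \<in> dual_lattice a V"
  shows "omega a \<beta> V q \<mu> \<eta> (cre k \<circ> ann k)
    = complex_of_real (occ \<beta> \<mu> k + (if k = q then V * ((cmod \<eta>)\<^sup>2 / (energy q - \<mu>)\<^sup>2) else 0))"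
proof -
  have "(cmod (- (complex_of_real (sqrt V) * \<eta>) / complex_of_real (energy q - \<mu>)))\<^sup>2
      = V * ((cmod \<eta>)\<^sup>2 / (energy q - \<mu>)\<^sup>2)"
    using V by (simp add: norm_mult norm_divide power_mult_distrib power_divide del: of_real_diff)
  then show ?thesis
    unfolding omega_def hamiltonian_eq[OF V \<mu> q]
      source_gas.gibbs_number[OF source_gas_instance[OF V \<mu> q] beta k] displacement_eq[OF V \<mu> q]
    by (simp add: occ_def)
qed

lemma omega_occ_obs:
  assumes V: "V > 0" and \<mu>: "\<mu> < 0" and q: "q \<in> dual_lattice a V" and k: "k \<in> dual_lattice a V"
  shows "omega a \<beta> V q \<mu> \<eta> (occ_obs V k)
    = complex_of_real (1 / V * occ \<beta> \<mu> k + (if k = q then (cmod \<eta>)\<^sup>2 / (energy q - \<mu>)\<^sup>2 else 0))"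
proof -
  have "omega a \<beta> V q \<mu> \<eta> (occ_obs V k) = 1 / complex_of_real V * omega a \<beta> V q \<mu> \<eta> (cre k \<circ> ann k)"
    unfolding omega_def occ_obs_def gibbs_scale ..
  also have "\<dots> = complex_of_real (1 / V * (occ \<beta> \<mu> k + (if k = q then V * ((cmod \<eta>)\<^sup>2 / (energy q - \<mu>)\<^sup>2) else 0)))"
    unfolding omega_number[OF assms] by simp
  also have "1 / V * (occ \<beta> \<mu> k + (if k = q then V * ((cmod \<eta>)\<^sup>2 / (energy q - \<mu>)\<^sup>2) else 0))
      = 1 / V * occ \<beta> \<mu> k + (if k = q then (cmod \<eta>)\<^sup>2 / (energy q - \<mu>)\<^sup>2 else 0)"
    using V by (simp add: distrib_left)
  finally show ?thesis .
qed

lemma omega_odlro_at: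
  assumes V: "V > 0" and p: "p \<in> dual_lattice a V"
  shows "omega a \<beta> V q \<mu> \<eta> (odlro_obs_at a V p) = omega a \<beta> V q \<mu> \<eta> (occ_obs V p)"
  unfolding omega_def
  by (rule gibbs_cong) (rule odlro_obs_at_ket[OF V _ p], use a_sum in \<open>simp_all add: sum_3\<close>)

lemma omega_odlro: "V > 0 \<Longrightarrow> omega a \<beta> V q \<mu> \<eta> (odlro_obs a V) = omega a \<beta> V q \<mu> \<eta> (occ_obs V 0)"
  unfolding odlro_obs_eq_at_0 by (rule omega_odlro_at[OF _ zero_in_lattice])

text \<open>The density without the source contribution. The latter is an explicit rational term, so
  thermodynamic limits only concern this function, which depends neither on \<open>q\<close> nor on
  \<eta>.\<close>

definition fdens :: "real \<Rightarrow> real \<Rightarrow> real" where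
  "fdens V \<mu> = 1 / V * (\<Sum>\<^sub>\<infinity>k\<in>dual_lattice a V. occ \<beta> \<mu> k)"

lemma occ_summable: "V > 0 \<Longrightarrow> \<mu> < 0 \<Longrightarrow> occ \<beta> \<mu> summable_on dual_lattice a V"
  using lattice_sum_eq(1)[of V \<mu> UNIV] by simp

lemma fdens_split: "V > 0 \<Longrightarrow> \<mu> < 0 \<Longrightarrow> fdens V \<mu> = (\<Sum>S\<in>UNIV. cls_density V UNIV \<mu> S)"
  using lattice_sum_eq(2)[of V \<mu> UNIV] by (simp add: fdens_def)

lemma fdens_remove:
  assumes V: "V > 0" and \<mu>: "\<mu> < 0" and q: "q \<in> dual_lattice a V"
  shows "fdens V \<mu> = 1 / V * occ \<beta> \<mu> q + 1 / V * (\<Sum>\<^sub>\<infinity>k\<in>dual_lattice a V - {q}. occ \<beta> \<mu> k)"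
proof -
  have "(\<Sum>\<^sub>\<infinity>k\<in>dual_lattice a V. occ \<beta> \<mu> k) = (\<Sum>\<^sub>\<infinity>k\<in>{q} \<union> (dual_lattice a V - {q}). occ \<beta> \<mu> k)"
    using q by (intro arg_cong[where f = "infsum (occ \<beta> \<mu>)"]) auto
  also have "\<dots> = occ \<beta> \<mu> q + (\<Sum>\<^sub>\<infinity>k\<in>dual_lattice a V - {q}. occ \<beta> \<mu> k)"
    using summable_on_subset[OF occ_summable[OF V \<mu>], of "dual_lattice a V - {q}"]
    by (subst infsum_Un_disjoint) auto
  finally show ?thesis by (simp add: fdens_def distrib_left add_divide_distrib)
qed

lemma total_density_eq:
  assumes V: "V > 0" and \<mu>: "\<mu> < 0" and q: "q \<in> dual_lattice a V"
  shows "total_density a \<beta> V q \<mu> \<eta> = complex_of_real (fdens V \<mu> + (cmod \<eta>)\<^sup>2 / (energy q - \<mu>)\<^sup>2)"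
proof -
  let ?s = "\<lambda>k. if k = q then V * ((cmod \<eta>)\<^sup>2 / (energy q - \<mu>)\<^sup>2) else 0"
  have "((\<lambda>k. ?s k) has_sum ?s q) (dual_lattice a V)"
    using q by (intro has_sum_finite_neutralI[of "{q}"]) auto
  then have "((\<lambda>k. occ \<beta> \<mu> k + ?s k) has_sum (V * fdens V \<mu> + ?s q)) (dual_lattice a V)"
    using occ_summable[OF V \<mu>] V by (intro has_sum_add) (simp_all add: fdens_def)
  then have "((\<lambda>k. complex_of_real (occ \<beta> \<mu> k + ?s k)) has_sum complex_of_real (V * fdens V \<mu> + ?s q)) (dual_lattice a V)"
    by (rule has_sum_of_real)
  then have "(\<Sum>\<^sub>\<infinity>k\<in>dual_lattice a V. omega a \<beta> V q \<mu> \<eta> (cre k \<circ> ann k)) = complex_of_real (V * fdens V \<mu> + ?s q)"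
    using omega_number[OF V \<mu> q] by (subst infsum_cong[where g = "\<lambda>k. complex_of_real (occ \<beta> \<mu> k + ?s k)"]) (auto intro: infsumI)
  then have "total_density a \<beta> V q \<mu> \<eta> = complex_of_real (1 / V * (V * fdens V \<mu> + ?s q))"
    unfolding total_density_def by simp
  also have "1 / V * (V * fdens V \<mu> + ?s q) = fdens V \<mu> + (cmod \<eta>)\<^sup>2 / (energy q - \<mu>)\<^sup>2"
    using V by (simp add: distrib_left)
  finally show ?thesis .
qed

text \<open>The quotient \<open>(A Y - 1) / (B Y - 1)\<close> with \<open>A \<ge> B > 1\<close> decreases in \<open>Y\<close>, so it is largest at
  zero momentum.\<close>

lemma occ_ratio_bound:
  assumes "\<mu> \<le> \<mu>'" "\<mu>' < 0"
  shows "occ \<beta> \<mu>' k \<le> (exp (- \<beta> * \<mu>) - 1) / (exp (- \<beta> * \<mu>') - 1) * occ \<beta> \<mu> k"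
proof -
  define A where "A = exp (- \<beta> * \<mu>)"
  define B where "B = exp (- \<beta> * \<mu>')"
  define Y where "Y = exp (\<beta> * energy k)"
  have B: "B > 1" using assms beta by (simp add: B_def mult_pos_neg)
  have AB: "A \<ge> B" using assms beta by (simp add: A_def B_def)
  have Y: "Y \<ge> 1" using beta by (simp add: Y_def)
  have o: "occ \<beta> \<mu> k = 1 / (A * Y - 1)" "occ \<beta> \<mu>' k = 1 / (B * Y - 1)"
    unfolding occ_def A_def B_def Y_def by (simp_all add: algebra_simps flip: exp_add)
  have BY: "B * Y > 1" using B Y by (metis less_1_mult' mult.right_neutral mult_le_cancel_left_pos less_le_trans less_trans zero_less_one)
  then have AY: "A * Y > 1" using mult_right_mono[OF AB, of Y] Y by linarith
  have "(A * Y - 1) * (B - 1) \<le> (A - 1) * (B * Y - 1)"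
  proof -
    have "0 \<le> (A - B) * (Y - 1)" using AB Y by simp
    then show ?thesis by (simp add: algebra_simps)
  qed
  moreover have "1 / x \<le> w / z * (1 / y)" if "y * z \<le> w * x" "x > 0" "y > 0" "z > 0" for w x y z :: real
    using that by (simp add: field_simps)
  ultimately have "1 / (B * Y - 1) \<le> (A - 1) / (B - 1) * (1 / (A * Y - 1))"
    using B BY AY by simp
  then show ?thesis unfolding o A_def B_def .
qed

section \<open>The free density as a function of the chemical potential\<close>

lemma fdens_nonneg: "V > 0 \<Longrightarrow> \<mu> < 0 \<Longrightarrow> 0 \<le> fdens V \<mu>"
  unfolding fdens_def by (intro mult_nonneg_nonneg infsum_nonneg occ_nonneg) auto

lemma fdens_le_scaled:
  assumes "V > 0" "\<mu> < 0" "\<mu>' < 0" "\<And>k. occ \<beta> \<mu> k \<le> c * occ \<beta> \<mu>' k"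
  shows "fdens V \<mu> \<le> c * fdens V \<mu>'"
proof -
  have "(\<Sum>\<^sub>\<infinity>k\<in>dual_lattice a V. occ \<beta> \<mu> k) \<le> (\<Sum>\<^sub>\<infinity>k\<in>dual_lattice a V. c * occ \<beta> \<mu>' k)"
    using assms by (intro infsum_mono occ_summable summable_on_cmult_right) auto
  then have "1 / V * (\<Sum>\<^sub>\<infinity>k\<in>dual_lattice a V. occ \<beta> \<mu> k) \<le> 1 / V * (c * (\<Sum>\<^sub>\<infinity>k\<in>dual_lattice a V. occ \<beta> \<mu>' k))"
    using assms by (intro mult_left_mono) (auto simp: infsum_cmult_right')
  then show ?thesis unfolding fdens_def by (simp only: mult.left_commute)
qed

lemma fdens_ge_mode:
  assumes "V > 0" "\<mu> < 0" "k \<in> dual_lattice a V"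
  shows "1 / V * occ \<beta> \<mu> k \<le> fdens V \<mu>"
  unfolding fdens_def
  using assms finite_sum_le_infsum[OF occ_summable[OF assms(1,2)], of "{k}"] occ_nonneg[of \<mu>]
  by (intro mult_left_mono) auto

lemma fdens_strict_mono:
  assumes V: "V > 0" and "\<mu> < \<mu>'" "\<mu>' < 0"
  shows "fdens V \<mu> < fdens V \<mu>'"
proof -
  have "occ \<beta> \<mu>' 0 > 0" using beta assms by (simp add: occ_def energy_norm mult_pos_neg)
  then have pos: "fdens V \<mu>' > 0"
    using fdens_ge_mode[OF V \<open>\<mu>' < 0\<close> zero_in_lattice] V by (smt (verit) mult_pos_pos zero_less_divide_1_iff)
  have "fdens V \<mu> \<le> exp (\<beta> * (\<mu> - \<mu>')) * fdens V \<mu>'"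
    using assms by (intro fdens_le_scaled occ_exp_bound) (auto intro: less_le_trans[OF _ energy_nonneg])
  also have "\<dots> < 1 * fdens V \<mu>'"
    using assms beta pos by (intro mult_strict_right_mono) (auto simp: mult_pos_neg)
  finally show ?thesis by simp
qed

lemma fdens_at_bot: "V > 0 \<Longrightarrow> (fdens V \<longlongrightarrow> 0) at_bot"
proof (rule tendsto_sandwich[OF _ _ tendsto_const])
  assume V: "V > 0"
  show "\<forall>\<^sub>F \<mu> in at_bot. 0 \<le> fdens V \<mu>"
    using eventually_gt_at_bot[of 0] by eventually_elim (rule fdens_nonneg[OF V])
  show "\<forall>\<^sub>F \<mu> in at_bot. fdens V \<mu> \<le> exp (\<beta> * (\<mu> - (-1))) * fdens V (-1)"
    using eventually_le_at_bot[of "-1"]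
    by eventually_elim (use V in \<open>intro fdens_le_scaled occ_exp_bound, auto intro: less_le_trans[OF _ energy_nonneg]\<close>)
  have "filterlim (\<lambda>\<mu>. \<beta> * (\<mu> - (-1))) at_bot at_bot"
  proof (rule filterlim_tendsto_pos_mult_at_bot[OF tendsto_const beta])
    show "filterlim (\<lambda>\<mu> :: real. \<mu> - (-1)) at_bot at_bot"
      unfolding filterlim_at_bot
    proof
      fix Z :: real
      show "\<forall>\<^sub>F \<mu> in at_bot. \<mu> - (-1) \<le> Z"
        using eventually_le_at_bot[of "Z - 1"] by eventually_elim simp
    qed
  qed
  then have "((\<lambda>\<mu>. exp (\<beta> * (\<mu> - (-1))) * fdens V (-1)) \<longlongrightarrow> 0 * fdens V (-1)) at_bot"
    by (intro tendsto_mult tendsto_const filterlim_compose[OF exp_at_bot])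
  then show "((\<lambda>\<mu>. exp (\<beta> * (\<mu> - (-1))) * fdens V (-1)) \<longlongrightarrow> 0) at_bot" by simp
qed

text \<open>The ratio bound is uniform in the momentum and tends to 1, so the density at a nearby
  potential is squeezed between two multiples of the density at \<mu>, and the series is never
  handled term by term.\<close>

lemma fdens_continuous:
  assumes V: "V > 0" shows "continuous_on {..<0} (fdens V)"
  unfolding continuous_on_eq_continuous_at[OF open_lessThan]
proof
  fix \<mu> :: real assume "\<mu> \<in> {..<0}"
  then have \<mu>: "\<mu> < 0" by simp
  define r where "r \<nu> = (exp (- \<beta> * \<mu>) - 1) / (exp (- \<beta> * \<nu>) - 1)" for \<nu>
  have ne: "exp (- \<beta> * \<nu>) - 1 > 0" if "\<nu> < 0" for \<nu> using that beta by (simp add: mult_pos_neg)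
  have "r \<midarrow>\<mu>\<rightarrow> (exp (- \<beta> * \<mu>) - 1) / (exp (- \<beta> * \<mu>) - 1)"
    unfolding r_def using ne[OF \<mu>] by (intro tendsto_intros) auto
  also have "(exp (- \<beta> * \<mu>) - 1) / (exp (- \<beta> * \<mu>) - 1) = 1"
    by (rule divide_self) (use ne[OF \<mu>] in linarith)
  finally have "r \<midarrow>\<mu>\<rightarrow> 1" .
  then have "(\<lambda>\<nu>. \<bar>r \<nu> - 1\<bar> * fdens V \<mu>) \<midarrow>\<mu>\<rightarrow> \<bar>1 - 1\<bar> * fdens V \<mu>"
    by (intro tendsto_intros)
  then have lim: "(\<lambda>\<nu>. \<bar>r \<nu> - 1\<bar> * fdens V \<mu>) \<midarrow>\<mu>\<rightarrow> 0" by simp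
  have "\<forall>\<^sub>F \<nu> in at \<mu>. \<nu> < 0" using \<mu> by (intro order_tendstoD(2)[OF tendsto_ident_at])
  then have "\<forall>\<^sub>F \<nu> in at \<mu>. \<bar>fdens V \<nu> - fdens V \<mu>\<bar> \<le> \<bar>r \<nu> - 1\<bar> * fdens V \<mu>"
  proof eventually_elim
    case (elim \<nu>)
    show ?case
    proof (cases "\<mu> \<le> \<nu>")
      case True
      have "fdens V \<nu> \<le> r \<nu> * fdens V \<mu>"
        unfolding r_def using V \<mu> elim True by (intro fdens_le_scaled occ_ratio_bound) auto
      moreover have "fdens V \<mu> \<le> fdens V \<nu>"
        using fdens_strict_mono[OF V, of \<mu> \<nu>] True elim by (cases "\<mu> = \<nu>") auto
      ultimately have "\<bar>fdens V \<nu> - fdens V \<mu>\<bar> \<le> (r \<nu> - 1) * fdens V \<mu>" by (simp add: algebra_simps)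
      also have "\<dots> \<le> \<bar>r \<nu> - 1\<bar> * fdens V \<mu>" using fdens_nonneg[OF V \<mu>] by (intro mult_right_mono) auto
      finally show ?thesis .
    next
      case False
      have "fdens V \<mu> \<le> (exp (- \<beta> * \<nu>) - 1) / (exp (- \<beta> * \<mu>) - 1) * fdens V \<nu>"
        using V \<mu> elim False by (intro fdens_le_scaled occ_ratio_bound) auto
      then have "r \<nu> * fdens V \<mu> \<le> fdens V \<nu>"
        unfolding r_def using ne[OF \<mu>] ne[OF elim] by (simp add: field_simps)
      moreover have "fdens V \<nu> \<le> fdens V \<mu>" using fdens_strict_mono[OF V, of \<nu> \<mu>] False \<mu> by auto
      ultimately have "\<bar>fdens V \<nu> - fdens V \<mu>\<bar> \<le> (1 - r \<nu>) * fdens V \<mu>" by (simp add: algebra_simps)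
      also have "\<dots> \<le> \<bar>r \<nu> - 1\<bar> * fdens V \<mu>" using fdens_nonneg[OF V \<mu>] by (intro mult_right_mono) auto
      finally show ?thesis .
    qed
  qed
  then have "(\<lambda>\<nu>. \<bar>fdens V \<nu> - fdens V \<mu>\<bar>) \<midarrow>\<mu>\<rightarrow> 0"
    by (intro tendsto_sandwich[OF _ _ tendsto_const lim]) auto
  then have "(\<lambda>\<nu>. fdens V \<nu> - fdens V \<mu>) \<midarrow>\<mu>\<rightarrow> 0" by (rule tendsto_rabs_zero_cancel)
  then show "isCont (fdens V) \<mu>" unfolding isCont_def by (rule LIM_zero_cancel)
qed

lemma condensate_equation_ex1:
  assumes V: "V > 0" and \<rho>: "\<rho> > 0" and q: "q \<in> dual_lattice a V"
  shows "\<exists>!\<mu>. \<mu> < 0 \<and> total_density a \<beta> V q \<mu> \<eta> = complex_of_real \<rho>"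
proof -
  let ?D = "\<lambda>\<mu>. fdens V \<mu> + (cmod \<eta>)\<^sup>2 / (energy q - \<mu>)\<^sup>2"
  have "\<exists>!\<mu>. \<mu> < 0 \<and> ?D \<mu> = \<rho>"
  proof (rule ex1_root_neg)
    show "?D x < ?D y" if "x < y" "y < 0" for x y
      using fdens_strict_mono[OF V that] source_term_strict_mono[OF that, of "energy q" "cmod \<eta>"] by simp
    have "energy q - x \<noteq> 0" if "x < 0" for x using that energy_nonneg[of q] by linarith
    then show "continuous_on {..<0} ?D"
      by (intro continuous_intros fdens_continuous[OF V]) auto
    show "(?D \<longlongrightarrow> 0) at_bot"
      using tendsto_add[OF fdens_at_bot[OF V] source_term_at_bot[of "cmod \<eta>" "energy q"]] by simp
    \<comment> \<open>At this potential \<open>exp (- \<beta> * y) - 1 = 1 / (V * \<rho>)\<close>,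
      so the zero mode alone carries the density \<open>\<rho>\<close>.\<close>
    define y where "y = - ln (1 + 1 / (V * \<rho>)) / \<beta>"
    have "0 < ln (1 + 1 / (V * \<rho>))" using V \<rho> by (intro ln_gt_zero) simp
    then have y: "y < 0" using beta by (simp add: y_def)
    have "1 / V * occ \<beta> y 0 = \<rho>"
      using V \<rho> beta by (simp add: occ_def energy_norm y_def add_pos_pos)
    then have "\<rho> \<le> fdens V y" using fdens_ge_mode[OF V y zero_in_lattice] by simp
    also have "\<dots> \<le> ?D y" by simp
    finally show "\<exists>y<0. \<rho> \<le> ?D y" using y by blast
  qed (rule \<rho>)
  moreover have "\<mu> < 0 \<and> total_density a \<beta> V q \<mu> \<eta> = complex_of_real \<rho> \<longleftrightarrow> \<mu> < 0 \<and> ?D \<mu> = \<rho>" for \<mu>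
  proof (cases "\<mu> < 0")
    case True
    show ?thesis unfolding total_density_eq[OF V True q] of_real_eq_iff ..
  qed simp
  ultimately show ?thesis by simp
qed

lemma chem_pot_solves:
  assumes V: "V > 0" and \<rho>: "\<rho> > 0" and q: "q \<in> dual_lattice a V"
  shows "chem_pot a \<beta> \<rho> V q \<eta> < 0"
    and "fdens V (chem_pot a \<beta> \<rho> V q \<eta>) + (cmod \<eta>)\<^sup>2 / (energy q - chem_pot a \<beta> \<rho> V q \<eta>)\<^sup>2 = \<rho>"
proof -
  have *: "chem_pot a \<beta> \<rho> V q \<eta> < 0 \<and> total_density a \<beta> V q (chem_pot a \<beta> \<rho> V q \<eta>) \<eta> = complex_of_real \<rho>"
    unfolding chem_pot_def by (rule theI'[OF condensate_equation_ex1[OF assms]])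
  then show n: "chem_pot a \<beta> \<rho> V q \<eta> < 0" by simp
  show "fdens V (chem_pot a \<beta> \<rho> V q \<eta>) + (cmod \<eta>)\<^sup>2 / (energy q - chem_pot a \<beta> \<rho> V q \<eta>)\<^sup>2 = \<rho>"
    using * unfolding total_density_eq[OF V n q] of_real_eq_iff by simp
qed

text \<open>One half of the trap for the chemical potential: evaluating the equation at a fixed
  trial potential decides on which side the solution lies. Pointwise limits of the density then
  control a potential that varies with the volume.\<close>

lemma chem_pot_greater:
  assumes V: "V > 0" and \<rho>: "\<rho> > 0" and q: "q \<in> dual_lattice a V"
    and \<mu>: "\<mu> < 0" "fdens V \<mu> + (cmod \<eta>)\<^sup>2 / (energy q - \<mu>)\<^sup>2 < \<rho>"
  shows "\<mu> < chem_pot a \<beta> \<rho> V q \<eta>"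
proof (rule ccontr)
  assume "\<not> ?thesis"
  then have "chem_pot a \<beta> \<rho> V q \<eta> < \<mu> \<or> chem_pot a \<beta> \<rho> V q \<eta> = \<mu>" by linarith
  then show False
    using chem_pot_solves(2)[OF V \<rho> q, of \<eta>] \<mu> fdens_strict_mono[OF V, of "chem_pot a \<beta> \<rho> V q \<eta>" \<mu>]
      source_term_strict_mono[of "chem_pot a \<beta> \<rho> V q \<eta>" \<mu> "energy q" "cmod \<eta>"] by auto
qed

lemma chem_pot_less:
  assumes V: "V > 0" and \<rho>: "\<rho> > 0" and q: "q \<in> dual_lattice a V"
    and \<mu>: "\<mu> < 0" "fdens V \<mu> + (cmod \<eta>)\<^sup>2 / (energy q - \<mu>)\<^sup>2 > \<rho>"
  shows "chem_pot a \<beta> \<rho> V q \<eta> < \<mu>"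
proof (rule ccontr)
  assume "\<not> ?thesis"
  then have "chem_pot a \<beta> \<rho> V q \<eta> > \<mu> \<or> chem_pot a \<beta> \<rho> V q \<eta> = \<mu>" by linarith
  then show False
    using chem_pot_solves[OF V \<rho> q, of \<eta>] \<mu> fdens_strict_mono[OF V, of \<mu> "chem_pot a \<beta> \<rho> V q \<eta>"]
      source_term_strict_mono[of \<mu> "chem_pot a \<beta> \<rho> V q \<eta>" "energy q" "cmod \<eta>"] by auto
qed

lemma chem_pot_no_source:
  assumes V: "V > 0" and q: "q \<in> dual_lattice a V"
  shows "chem_pot a \<beta> \<rho> V q 0 = chem_pot_free a \<beta> \<rho> V"
proof -
  have "(\<mu> < 0 \<and> total_density a \<beta> V q \<mu> 0 = complex_of_real \<rho>)
      \<longleftrightarrow> (\<mu> < 0 \<and> total_density a \<beta> V 0 \<mu> 0 = complex_of_real \<rho>)" for \<mu>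
    using total_density_eq[OF V _ q, of \<mu> 0] total_density_eq[OF V _ zero_in_lattice, of \<mu> 0] by auto
  then show ?thesis unfolding chem_pot_free_def chem_pot_def by simp
qed

lemma chem_pot_free_solves:
  assumes V: "V > 0" and \<rho>: "\<rho> > 0"
  shows "chem_pot_free a \<beta> \<rho> V < 0" "fdens V (chem_pot_free a \<beta> \<rho> V) = \<rho>"
  using chem_pot_solves[OF V \<rho> zero_in_lattice, of 0] unfolding chem_pot_free_def by auto

lemma free_occ_eq:
  assumes V: "V > 0" and \<rho>: "\<rho> > 0" and k: "k \<in> dual_lattice a V"
  shows "free_occ a \<beta> \<rho> V k = complex_of_real (1 / V * occ \<beta> (chem_pot_free a \<beta> \<rho> V) k)"
  unfolding free_occ_def omega_rho_def chem_pot_free_def[symmetric]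
    omega_occ_obs[OF V chem_pot_free_solves(1)[OF V \<rho>] zero_in_lattice k] by simp

text \<open>Eventually the potential is below \<open>\<mu>0 / 2\<close>, where the zero mode gives a
  bound, uniform in the momentum, on a single occupation number; division by V removes it.\<close>

lemma mode_density_tendsto_0:
  assumes lim: "(\<mu> \<longlongrightarrow> \<mu>0) at_top" and \<mu>0: "\<mu>0 < 0"
  shows "((\<lambda>V. 1 / V * occ \<beta> (\<mu> V) (k V)) \<longlongrightarrow> 0) at_top"
proof (rule tendsto_sandwich[OF _ _ tendsto_const])
  have ev: "\<forall>\<^sub>F V in at_top. \<mu> V < \<mu>0 / 2" using \<mu>0 by (intro order_tendstoD(2)[OF lim]) simp
  show "\<forall>\<^sub>F V in at_top. 0 \<le> 1 / V * occ \<beta> (\<mu> V) (k V)"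
    using ev eventually_gt_at_top[of 0] by eventually_elim (use \<mu>0 in \<open>auto intro!: divide_nonneg_pos occ_nonneg\<close>)
  show "\<forall>\<^sub>F V in at_top. 1 / V * occ \<beta> (\<mu> V) (k V) \<le> 1 / V * occ \<beta> (\<mu>0 / 2) 0"
    using ev eventually_gt_at_top[of 0]
    by eventually_elim (use \<mu>0 in \<open>intro mult_left_mono occ_mono, auto simp: energy_norm\<close>)
  have "((\<lambda>V :: real. 1 / V) \<longlongrightarrow> 0) at_top"
    by (intro real_tendsto_divide_at_top[OF tendsto_const] filterlim_ident)
  from tendsto_mult[OF this tendsto_const[of "occ \<beta> (\<mu>0 / 2) 0"]]
  show "((\<lambda>V. 1 / V * occ \<beta> (\<mu>0 / 2) 0) \<longlongrightarrow> 0) at_top" by simp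
qed

lemma cls_density_empty: "cls_density V D \<mu> {} = 1 / V * (occ \<beta> \<mu> 0 * indicator D 0)"
  unfolding cls_density_def cls_empty by (simp add: momentum_zero)

text \<open>A fixed negative potential provides the gap for all planes and axes, and the origin is a
  single mode; only the bulk class survives.\<close>

lemma fdens_tendsto:
  assumes \<mu>: "\<mu> < 0"
  shows "((\<lambda>V. fdens V \<mu>) \<longlongrightarrow> bose_integral \<beta> \<mu>) at_top"
proof -
  have lims: "((\<lambda>V. cls_density V UNIV \<mu> S) \<longlongrightarrow> (if S = UNIV then bose_integral \<beta> \<mu> else 0)) at_top" for S
  proof -
    consider "S = UNIV" | "S = {}" | "S \<noteq> {}" "S \<noteq> UNIV" by blast
    then show ?thesis
    proof cases
      case 1
      have "((\<lambda>V. cls_density V UNIV \<mu> UNIV) \<longlongrightarrow> 1 / (2 * pi) ^ 3 * (LINT x|lborel. occ \<beta> \<mu> x * indicator UNIV x)) at_top"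
        using \<mu> by (intro cls_density_tendsto_integral) auto
      then show ?thesis using 1 by (simp add: bose_integral_eq)
    next
      case 2
      then show ?thesis using mode_density_tendsto_0[OF tendsto_const \<mu>, of "\<lambda>_. 0"] by (simp add: cls_density_empty)
    next
      case 3
      have "\<beta> * (energy k - \<mu>) \<ge> \<beta> * (- \<mu>)" for k using beta by (intro mult_left_mono) auto
      moreover have "\<beta> * (- \<mu>) > 0" using beta \<mu> by (intro mult_pos_pos) auto
      ultimately show ?thesis
        using cls_density_gap[OF 3, of "\<lambda>_. \<mu>" "\<beta> * (- \<mu>)" UNIV] 3 \<mu> by simp
    qed
  qed
  have "((\<lambda>V. \<Sum>S\<in>UNIV. cls_density V UNIV \<mu> S) \<longlongrightarrow> (\<Sum>S\<in>(UNIV :: 3 set set). if S = UNIV then bose_integral \<beta> \<mu> else 0)) at_top"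
    by (rule tendsto_sum) (rule lims)
  moreover have "(\<Sum>S\<in>(UNIV :: 3 set set). if S = UNIV then bose_integral \<beta> \<mu> else 0) = bose_integral \<beta> \<mu>" by simp
  ultimately have lim: "((\<lambda>V. \<Sum>S\<in>UNIV. cls_density V UNIV \<mu> S) \<longlongrightarrow> bose_integral \<beta> \<mu>) at_top" by simp
  have "\<forall>\<^sub>F V in at_top. (\<Sum>S\<in>UNIV. cls_density V UNIV \<mu> S) = fdens V \<mu>"
    using eventually_gt_at_top[of 0] by eventually_elim (simp add: fdens_split \<mu>)
  with lim show ?thesis by (rule Lim_transform_eventually)
qed

end

section \<open>Types of condensation without source\<close>

text \<open>Exponents of order 1/V are exactly the scale of macroscopic occupation, as (e^x - 1)/x
  tends to 1.\<close>

lemma bose_scaling: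
  fixes c :: "real \<Rightarrow> real"
  assumes lim: "(c \<longlongrightarrow> c0) at_top" and c0: "c0 > 0"
  shows "((\<lambda>V. 1 / V * (1 / (exp (c V / V) - 1))) \<longlongrightarrow> 1 / c0) at_top"
proof -
  have x0: "((\<lambda>V. c V / V) \<longlongrightarrow> 0) at_top"
    by (rule real_tendsto_divide_at_top[OF lim filterlim_ident])
  have pos: "\<forall>\<^sub>F V in at_top. c V > 0 \<and> V > 0"
    using order_tendstoD(1)[OF lim c0] eventually_gt_at_top[of 0] by eventually_elim simp
  have "filterlim (\<lambda>V. c V / V) (at 0) at_top"
    unfolding filterlim_at using x0 pos by (auto elim: eventually_mono)
  from filterlim_compose[OF lim_exp_minus_1 this]
  have "((\<lambda>V. (exp (c V / V) - 1) / (c V / V)) \<longlongrightarrow> 1) at_top" .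
  then have "((\<lambda>V. 1 / (c V * ((exp (c V / V) - 1) / (c V / V)))) \<longlongrightarrow> 1 / (c0 * 1)) at_top"
    using c0 by (intro tendsto_intros lim) auto
  then have "((\<lambda>V. 1 / (c V * ((exp (c V / V) - 1) / (c V / V)))) \<longlongrightarrow> 1 / c0) at_top" by simp
  moreover have "\<forall>\<^sub>F V in at_top. 1 / (c V * ((exp (c V / V) - 1) / (c V / V))) = 1 / V * (1 / (exp (c V / V) - 1))"
    using pos by eventually_elim (simp add: field_simps)
  ultimately show ?thesis by (rule Lim_transform_eventually)
qed

text \<open>The limiting value dominates already in finite volume, so infinitely many modes can be
  compared at once.\<close>

lemma bose_scaling_le:
  fixes c V :: real
  assumes "c > 0" "V > 0"
  shows "1 / V * (1 / (exp (c / V) - 1)) \<le> 1 / c"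
proof -
  have "c / V \<le> exp (c / V) - 1" using exp_ge_add_one_self[of "c / V"] by linarith
  then have "1 / (exp (c / V) - 1) \<le> 1 / (c / V)" using assms by (intro divide_left_mono mult_pos_pos) auto
  then have "1 / V * (1 / (exp (c / V) - 1)) \<le> 1 / V * (1 / (c / V))" using assms by (intro mult_left_mono) auto
  then show ?thesis using assms by simp
qed

context anisotropic_box begin

text \<open>At any fixed negative potential the limiting density stays below \<rho>, so the solution
  must eventually lie above it; from above it is confined by 0.\<close>

lemma chem_pot_free_tendsto_0:
  assumes \<rho>: "\<rho> > rho_c \<beta>"
  shows "(chem_pot_free a \<beta> \<rho> \<longlongrightarrow> 0) at_top"
proof -
  have \<rho>0: "\<rho> > 0" using \<rho> bose_integral_pos[of 0] by (simp add: rho_c_def)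
  show ?thesis
  proof (rule order_tendstoI)
    fix l :: real assume l: "l < 0"
    have "bose_integral \<beta> l < \<rho>" using bose_integral_strict_mono[OF l] \<rho> by (simp add: rho_c_def)
    from order_tendstoD(2)[OF fdens_tendsto[OF l] this] eventually_gt_at_top[of 0]
    show "\<forall>\<^sub>F V in at_top. l < chem_pot_free a \<beta> \<rho> V"
    proof eventually_elim
      case (elim V)
      then show ?case
        unfolding chem_pot_free_def using l by (intro chem_pot_greater \<rho>0 zero_in_lattice) auto
    qed
  next
    fix u :: real assume u: "u > 0"
    show "\<forall>\<^sub>F V in at_top. chem_pot_free a \<beta> \<rho> V < u"
      using eventually_gt_at_top[of 0] by eventually_elim (use chem_pot_free_solves(1)[OF _ \<rho>0] u in force)
  qed
qed

lemma chem_pot_free_neg: "\<rho> > 0 \<Longrightarrow> \<forall>\<^sub>F V in at_top. chem_pot_free a \<beta> \<rho> V < 0"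
  using eventually_gt_at_top[of 0] by eventually_elim (rule chem_pot_free_solves)

lemma rho_c_pos: "rho_c \<beta> > 0"
  unfolding rho_c_def by (rule bose_integral_pos) simp

text \<open>The classes in \<open>T\<close> carry the condensate when all others except the bulk \<open>UNIV\<close> are negligible.\<close>

lemma condensate_in_classes:
  assumes \<rho>: "\<rho> > rho_c \<beta>" and T: "UNIV \<notin> T"
    and negl: "\<And>S. S \<notin> T \<Longrightarrow> S \<noteq> UNIV \<Longrightarrow> ((\<lambda>V. cls_density V UNIV (chem_pot_free a \<beta> \<rho> V) S) \<longlongrightarrow> 0) at_top"
  shows "((\<lambda>V. \<Sum>S\<in>T. cls_density V UNIV (chem_pot_free a \<beta> \<rho> V) S) \<longlongrightarrow> \<rho> - rho_c \<beta>) at_top"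
proof -
  let ?\<mu> = "chem_pot_free a \<beta> \<rho>"
  have \<rho>0: "\<rho> > 0" using \<rho> rho_c_pos by linarith
  have bulk: "((\<lambda>V. cls_density V UNIV (?\<mu> V) UNIV) \<longlongrightarrow> rho_c \<beta>) at_top"
    using cls_density_tendsto_integral[OF chem_pot_free_neg[OF \<rho>0] chem_pot_free_tendsto_0[OF \<rho>], of UNIV]
    by (simp add: rho_c_def bose_integral_eq)
  have lims: "((\<lambda>V. cls_density V UNIV (?\<mu> V) S) \<longlongrightarrow> (if S = UNIV then rho_c \<beta> else 0)) at_top" if "S \<in> - T" for S
    using bulk negl[of S] that by (cases "S = UNIV") auto
  have "((\<lambda>V. \<Sum>S\<in>-T. cls_density V UNIV (?\<mu> V) S) \<longlongrightarrow> (\<Sum>S\<in>-T. if S = UNIV then rho_c \<beta> else 0)) at_top"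
    by (rule tendsto_sum) (rule lims)
  also have "(\<Sum>S\<in>-T. if S = UNIV then rho_c \<beta> else 0) = rho_c \<beta>" using T by simp
  finally have "((\<lambda>V. \<rho> - (\<Sum>S\<in>-T. cls_density V UNIV (?\<mu> V) S)) \<longlongrightarrow> \<rho> - rho_c \<beta>) at_top"
    by (intro tendsto_diff tendsto_const)
  moreover have "\<forall>\<^sub>F V in at_top. \<rho> - (\<Sum>S\<in>-T. cls_density V UNIV (?\<mu> V) S) = (\<Sum>S\<in>T. cls_density V UNIV (?\<mu> V) S)"
    using eventually_gt_at_top[of 0]
  proof eventually_elim
    case (elim V)
    have "\<rho> = (\<Sum>S\<in>UNIV. cls_density V UNIV (?\<mu> V) S)"
      using fdens_split[OF elim chem_pot_free_solves(1)[OF elim \<rho>0]] chem_pot_free_solves(2)[OF elim \<rho>0] by simp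
    also have "\<dots> = (\<Sum>S\<in>T. cls_density V UNIV (?\<mu> V) S) + (\<Sum>S\<in>-T. cls_density V UNIV (?\<mu> V) S)"
      by (subst sum.union_disjoint[symmetric]) (auto simp: Un_commute Compl_partition2)
    finally show ?case by simp
  qed
  ultimately show ?thesis by (rule Lim_transform_eventually)
qed

lemma card_cases_3:
  fixes S :: "3 set"
  assumes "S \<noteq> {}" "S \<noteq> UNIV"
  obtains i where "S = {i}" | "card S = 2"
proof -
  have "card S < 3" using assms psubset_card_mono[of UNIV S] by auto
  moreover have "card S > 0" using assms by (simp add: card_gt_0_iff)
  ultimately have "card S = 1 \<or> card S = 2" by linarith
  then show thesis using that card_1_singletonE by metis
qed

lemma occ_le_inverse: "\<mu> \<le> 0 \<Longrightarrow> k \<noteq> 0 \<Longrightarrow> occ \<beta> \<mu> k \<le> 1 / (\<beta> * energy k)"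
proof -
  assume \<mu>: "\<mu> \<le> 0" and k: "k \<noteq> 0"
  have p: "\<beta> * energy k > 0" using beta energy_pos[OF k] by simp
  have "\<beta> * energy k \<le> \<beta> * (energy k - \<mu>)" using \<mu> beta by simp
  also have "\<dots> \<le> exp (\<beta> * (energy k - \<mu>)) - 1"
    using exp_ge_add_one_self[of "\<beta> * (energy k - \<mu>)"] by linarith
  finally show "occ \<beta> \<mu> k \<le> 1 / (\<beta> * energy k)" unfolding occ_def by (intro frac_le p) simp_all
qed

text \<open>The spacing is finest along the longest side, whose exponent is \<open>a $ 1\<close>,
  and a non-zero integer has modulus at least 1.\<close>

lemma energy_lattice_gap:
  assumes V: "V \<ge> 1" and k: "k \<in> dual_lattice a V" "k \<noteq> 0"
  shows "(2 * pi)\<^sup>2 * V powr (- 2 * a $ 1) \<le> energy k"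
proof -
  obtain n where n: "k = momentum a V n" using k unfolding dual_lattice_def by blast
  obtain j where j: "k $ j \<noteq> 0" using k(2) by (auto simp: vec_eq_iff)
  have a1: "a $ j \<le> a $ 1" using a12 a23 exhaust_3[of j] by auto
  have "n $ j \<noteq> 0" using j by (auto simp: n momentum_nth)
  then have n1: "1 \<le> \<bar>real_of_int (n $ j)\<bar>" by linarith
  have "(2 * pi)\<^sup>2 * V powr (- 2 * a $ 1) = (2 * pi * V powr (- a $ 1))\<^sup>2"
    using V by (simp add: power_mult_distrib powr_power)
  also have "\<dots> \<le> (2 * pi * V powr (- a $ j) * \<bar>real_of_int (n $ j)\<bar>)\<^sup>2"
  proof (rule power_mono)
    have "2 * pi * V powr (- a $ 1) * 1 \<le> 2 * pi * V powr (- a $ j) * \<bar>real_of_int (n $ j)\<bar>"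
      using n1 a1 V by (intro mult_mono powr_mono) auto
    then show "2 * pi * V powr (- a $ 1) \<le> 2 * pi * V powr (- a $ j) * \<bar>real_of_int (n $ j)\<bar>" by simp
  qed simp
  also have "\<dots> = (k $ j)\<^sup>2"
    using V by (simp add: n momentum_nth power_mult_distrib powr_minus divide_inverse)
  also have "\<dots> \<le> energy k" unfolding energy_def by (intro member_le_sum) auto
  finally show ?thesis .
qed

lemma type_I_short_box:
  assumes a1: "a $ 1 < 1 / 2" and \<rho>: "\<rho> > rho_c \<beta>"
  shows "type_I a \<beta> \<rho>"
  unfolding type_I_def
proof (intro conjI allI impI)
  let ?\<mu> = "chem_pot_free a \<beta> \<rho>"
  have \<rho>0: "\<rho> > 0" using \<rho> rho_c_pos by linarith
  have neg: "\<forall>\<^sub>F V in at_top. ?\<mu> V \<le> 0" using chem_pot_free_neg[OF \<rho>0] by (auto elim: eventually_mono)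
  have "((\<lambda>V. \<Sum>S\<in>{{}}. cls_density V UNIV (?\<mu> V) S) \<longlongrightarrow> \<rho> - rho_c \<beta>) at_top"
  proof (rule condensate_in_classes[OF \<rho>])
    fix S :: "3 set" assume "S \<notin> {{}}" "S \<noteq> UNIV"
    then have S: "S \<noteq> {}" "S \<noteq> UNIV" by auto
    show "((\<lambda>V. cls_density V UNIV (?\<mu> V) S) \<longlongrightarrow> 0) at_top"
      using S
    proof (cases rule: card_cases_3)
      case (1 i)
      have "a $ i < 1 / 2" using a1 a12 a23 exhaust_3[of i] by auto
      then show ?thesis unfolding 1 using neg by (rule cls_density_single_short)
    qed (rule cls_density_pair[OF _ neg])
  qed simp
  then have "((\<lambda>V. complex_of_real (1 / V * occ \<beta> (?\<mu> V) 0)) \<longlongrightarrow> complex_of_real (\<rho> - rho_c \<beta>)) at_top"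
    by (intro tendsto_of_real) (simp add: cls_density_empty)
  moreover have "\<forall>\<^sub>F V in at_top. complex_of_real (1 / V * occ \<beta> (?\<mu> V) 0) = free_occ a \<beta> \<rho> V 0"
    using eventually_gt_at_top[of 0] by eventually_elim (simp only: free_occ_eq[OF _ \<rho>0 zero_in_lattice])
  ultimately show "((\<lambda>V. free_occ a \<beta> \<rho> V 0) \<longlongrightarrow> complex_of_real (\<rho> - rho_c \<beta>)) at_top"
    by (rule Lim_transform_eventually)
  fix k assume k: "mode_family a k \<and> (\<forall>\<^sub>F V in at_top. k V \<noteq> 0)"
  \<comment> \<open>By e^y - 1 >= y and the smallest lattice energy, an excited mode has density at
    most \<open>c * V powr (2 * a $ 1 - 1)\<close>, which vanishes for a short box.\<close>
  define c where "c = 1 / (\<beta> * (2 * pi)\<^sup>2)"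
  have "((\<lambda>V. 1 / V * occ \<beta> (?\<mu> V) (k V)) \<longlongrightarrow> 0) at_top"
  proof (rule tendsto_sandwich[OF _ _ tendsto_const])
    show "\<forall>\<^sub>F V in at_top. 0 \<le> 1 / V * occ \<beta> (?\<mu> V) (k V)"
      using neg eventually_gt_at_top[of 0] by eventually_elim (auto intro!: divide_nonneg_pos occ_nonneg)
    show "\<forall>\<^sub>F V in at_top. 1 / V * occ \<beta> (?\<mu> V) (k V) \<le> c * V powr (2 * a $ 1 - 1)"
      using neg eventually_ge_at_top[of 1] conjunct2[OF k]
    proof eventually_elim
      case (elim V)
      have kV: "k V \<in> dual_lattice a V" using k elim by (auto simp: mode_family_def)
      have "occ \<beta> (?\<mu> V) (k V) \<le> 1 / (\<beta> * energy (k V))" using elim by (intro occ_le_inverse)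
      also have "\<dots> \<le> 1 / (\<beta> * ((2 * pi)\<^sup>2 * V powr (- 2 * a $ 1)))"
        using elim beta by (intro frac_le mult_left_mono energy_lattice_gap kV mult_pos_pos) simp_all
      also have "\<dots> = c * V powr (2 * a $ 1)"
        using powr_minus_divide[of V "2 * a $ 1"] by (simp add: c_def)
      finally have "1 / V * occ \<beta> (?\<mu> V) (k V) \<le> 1 / V * (c * V powr (2 * a $ 1))"
        using elim by (intro mult_left_mono) auto
      also have "\<dots> = c * V powr (2 * a $ 1 - 1)" using elim by (simp add: powr_diff)
      finally show ?case .
    qed
    have "((\<lambda>V. c * V powr (2 * a $ 1 - 1)) \<longlongrightarrow> c * 0) at_top"
      using a1 by (intro tendsto_mult tendsto_const tendsto_neg_powr filterlim_ident) simp
    then show "((\<lambda>V. c * V powr (2 * a $ 1 - 1)) \<longlongrightarrow> 0) at_top" by simp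
  qed
  then have "((\<lambda>V. complex_of_real (1 / V * occ \<beta> (?\<mu> V) (k V))) \<longlongrightarrow> complex_of_real 0) at_top"
    by (rule tendsto_of_real)
  moreover have "\<forall>\<^sub>F V in at_top. complex_of_real (1 / V * occ \<beta> (?\<mu> V) (k V)) = free_occ a \<beta> \<rho> V (k V)"
    using eventually_gt_at_top[of 0]
    by eventually_elim (use k in \<open>simp only: mode_family_def free_occ_eq[OF _ \<rho>0]\<close>)
  ultimately show "((\<lambda>V. free_occ a \<beta> \<rho> V (k V)) \<longlongrightarrow> 0) at_top"
    using Lim_transform_eventually by fastforce
qed

lemma energy_momentum_axis:
  "energy (momentum a V (axis 1 m)) = (2 * pi * of_int m / V powr (a $ 1))\<^sup>2"
  unfolding energy_def by (simp add: sum_3 momentum_nth axis_def)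

lemma inj_axis: "inj (\<lambda>m :: int. axis (1 :: 3) m)"
  by (auto simp: inj_on_def axis_eq_axis)

text \<open>If the mode \<open>0\<close> were macroscopically occupied, then so would be, almost equally, each of the
  modes \<open>(2 \<pi> m / V\<^sup>a\<^sup>1, 0, 0)\<close>, because their energies are \<open>o (1 / V)\<close>; arbitrarily many of them exceed
  any density.\<close>

lemma zero_mode_density_tendsto_0:
  assumes a1: "a $ 1 > 1 / 2" and \<rho>: "\<rho> > 0"
  shows "((\<lambda>V. 1 / V * occ \<beta> (chem_pot_free a \<beta> \<rho> V) 0) \<longlongrightarrow> 0) at_top"
proof (rule order_tendstoI)
  let ?\<mu> = "chem_pot_free a \<beta> \<rho>"
  fix l :: real assume l: "l < 0"
  show "\<forall>\<^sub>F V in at_top. l < 1 / V * occ \<beta> (?\<mu> V) 0"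
    using chem_pot_free_neg[OF \<rho>] eventually_gt_at_top[of 0]
  proof eventually_elim
    case (elim V)
    then have "0 \<le> 1 / V * occ \<beta> (?\<mu> V) 0" using occ_nonneg[of "?\<mu> V" 0] by simp
    then show ?case using l by linarith
  qed
next
  let ?\<mu> = "chem_pot_free a \<beta> \<rho>"
  fix e :: real assume e: "e > 0"
  \<comment> \<open>Each of \<open>N\<close> axis modes will be shown to carry at least a quarter of
    the supposed density \<open>e\<close>, so this many would exceed \<rho>.\<close>
  obtain N :: nat where N: "4 * \<rho> / e < real N" using reals_Archimedean2 by blast
  \<comment> \<open>\<open>C * V powr (1 - 2 * a $ 1) < 1\<close> says that the first
    \<open>N\<close> axis energies, times \<beta>, are at most 1/(V e), the scale set by the zero
    mode.\<close>
  define C where "C = \<beta> * (2 * pi * real N)\<^sup>2 * e"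
  have "((\<lambda>V. C * V powr (1 - 2 * a $ 1)) \<longlongrightarrow> C * 0) at_top"
    using a1 by (intro tendsto_mult tendsto_const tendsto_neg_powr filterlim_ident) simp
  then have ev1: "\<forall>\<^sub>F V in at_top. C * V powr (1 - 2 * a $ 1) < 1" by (intro order_tendstoD(2)) auto
  show "\<forall>\<^sub>F V in at_top. 1 / V * occ \<beta> (?\<mu> V) 0 < e"
    using ev1 eventually_ge_at_top[of "2 / e"] eventually_gt_at_top[of 0]
  proof eventually_elim
    case (elim V)
    have \<mu>: "?\<mu> V < 0" using elim \<rho> by (intro chem_pot_free_solves) auto
    show ?case
    proof (rule ccontr)
      assume "\<not> ?thesis"
      then have ge: "e \<le> 1 / V * occ \<beta> (?\<mu> V) 0" by simp
      \<comment> \<open>A zero-mode density of at least \<open>e\<close> forces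
        \<open>exp (- \<beta> * \<mu>) - 1 \<le> x\<close>; hence the potential contributes at most
        \<open>x\<close> to every exponent.\<close>
      define x where "x = 1 / (V * e)"
      have x: "0 < x" "2 * x \<le> 1" using e elim by (auto simp: x_def field_simps)
      have "exp (- \<beta> * ?\<mu> V) - 1 > 0" using \<mu> beta by (simp add: mult_pos_neg)
      moreover have "e \<le> 1 / V * (1 / (exp (- \<beta> * ?\<mu> V) - 1))" using ge by (simp add: occ_def energy_norm)
      ultimately have "exp (- \<beta> * ?\<mu> V) - 1 \<le> x" unfolding x_def using e elim by (simp add: field_simps)
      then have \<mu>x: "- \<beta> * ?\<mu> V \<le> x" using exp_ge_add_one_self[of "- \<beta> * ?\<mu> V"] by linarith
      let ?k = "\<lambda>m :: nat. momentum a V (axis 1 (int m))"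
      have occ_m: "e / 4 \<le> 1 / V * occ \<beta> (?\<mu> V) (?k m)" if m: "m < N" for m
      proof -
        have "energy (?k m) = (2 * pi * real m)\<^sup>2 / V powr (2 * a $ 1)"
          unfolding energy_momentum_axis using elim by (simp add: power_divide powr_power)
        also have "\<dots> \<le> (2 * pi * real N)\<^sup>2 / V powr (2 * a $ 1)"
          using m by (intro divide_right_mono power_mono mult_left_mono) auto
        finally have "\<beta> * energy (?k m) \<le> \<beta> * ((2 * pi * real N)\<^sup>2 / V powr (2 * a $ 1))"
          using beta by (intro mult_left_mono) auto
        also have "\<dots> = C * V powr (1 - 2 * a $ 1) * x"
          using elim e by (simp add: C_def x_def powr_diff)
        also have "\<dots> \<le> 1 * x" using elim x by (intro mult_right_mono) auto
        finally have "\<beta> * (energy (?k m) - ?\<mu> V) \<le> 2 * x" using \<mu>x by (simp add: algebra_simps)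
        moreover define y where "y = \<beta> * (energy (?k m) - ?\<mu> V)"
        moreover have "energy (?k m) - ?\<mu> V > 0" using \<mu> energy_nonneg[of "?k m"] by linarith
        ultimately have y: "0 < y" "y \<le> 2 * x" using beta by simp_all
        \<comment> \<open>Potential and kinetic part give \<open>y \<le> 2 * x \<le> 1\<close>, and
          then \<open>exp y - 1 \<le> 2 * y \<le> 4 * x\<close>; this is the source of the
          quarter.\<close>
        have "exp y \<le> 1 + y + y\<^sup>2" using y x by (intro exp_bound) auto
        also have "y\<^sup>2 \<le> y" using y x power_decreasing[of 1 2 y] by simp
        finally have "exp y - 1 \<le> 4 * x" using y by linarith
        moreover have "exp y - 1 > 0" using y by simp
        ultimately have "1 / (4 * x) \<le> 1 / (exp y - 1)" using x by (intro divide_left_mono mult_pos_pos) auto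
        then have "1 / V * (1 / (4 * x)) \<le> 1 / V * (1 / (exp y - 1))" using elim by (intro mult_left_mono) auto
        moreover have "1 / V * (1 / (4 * x)) = e / 4" using elim e by (simp add: x_def)
        ultimately show ?thesis by (simp add: occ_def y_def)
      qed
      have inj: "inj_on ?k {..<N}"
      proof (rule inj_onI)
        fix i j assume "?k i = ?k j"
        then have "axis (1 :: 3) (int i) = axis 1 (int j)" by (rule injD[OF inj_momentum[OF \<open>0 < V\<close>]])
        then show "i = j" using injD[OF inj_axis] by fastforce
      qed
      have "real N * (e / 4) = (\<Sum>m<N. e / 4)" by simp
      also have "\<dots> \<le> (\<Sum>m<N. 1 / V * occ \<beta> (?\<mu> V) (?k m))" using occ_m by (intro sum_mono) auto
      also have "\<dots> = 1 / V * (\<Sum>k\<in>?k ` {..<N}. occ \<beta> (?\<mu> V) k)"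
        by (simp add: sum.reindex[OF inj] sum_distrib_left)
      also have "\<dots> \<le> fdens V (?\<mu> V)"
        unfolding fdens_def using elim \<mu> occ_summable
        by (intro mult_left_mono finite_sum_le_infsum) (auto simp: dual_lattice_def intro: occ_nonneg)
      also have "\<dots> = \<rho>" using chem_pot_free_solves(2)[OF _ \<rho>] elim by simp
      finally have "real N * (e / 4) \<le> \<rho>" .
      then show False using N e by (simp add: field_simps)
    qed
  qed
qed

lemma mode_density_free_tendsto_0:
  assumes a1: "a $ 1 > 1 / 2" and \<rho>: "\<rho> > 0"
  shows "((\<lambda>V. 1 / V * occ \<beta> (chem_pot_free a \<beta> \<rho> V) (k V)) \<longlongrightarrow> 0) at_top"
proof (rule tendsto_sandwich[OF _ _ tendsto_const zero_mode_density_tendsto_0[OF a1 \<rho>]])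
  show "\<forall>\<^sub>F V in at_top. 0 \<le> 1 / V * occ \<beta> (chem_pot_free a \<beta> \<rho> V) (k V)"
    using chem_pot_free_neg[OF \<rho>] eventually_gt_at_top[of 0]
    by eventually_elim (auto intro!: divide_nonneg_pos occ_nonneg)
  show "\<forall>\<^sub>F V in at_top. 1 / V * occ \<beta> (chem_pot_free a \<beta> \<rho> V) (k V) \<le> 1 / V * occ \<beta> (chem_pot_free a \<beta> \<rho> V) 0"
    using chem_pot_free_neg[OF \<rho>] eventually_gt_at_top[of 0]
    by eventually_elim (intro mult_left_mono occ_mono, auto simp: energy_norm)
qed

text \<open>The complement is computed: momenta beyond the cutoff have the gap
  \<open>\<beta> * \<delta>\<^sup>2\<close>, so only their bulk part converges to something
  non-zero. The low modes carry what is left of the fixed density \<rho>.\<close>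

lemma cutoff_density_tendsto:
  assumes \<rho>: "\<rho> > rho_c \<beta>" and \<delta>: "\<delta> > 0"
  shows "((\<lambda>V. 1 / V * (\<Sum>\<^sub>\<infinity>k\<in>{k \<in> dual_lattice a V. norm k \<le> \<delta>}. occ \<beta> (chem_pot_free a \<beta> \<rho> V) k))
    \<longlongrightarrow> \<rho> - 1 / (2 * pi) ^ 3 * (LINT x|lborel. occ \<beta> 0 x * indicator {x. \<delta> < norm x} x)) at_top"
proof -
  let ?\<mu> = "chem_pot_free a \<beta> \<rho>"
  let ?D = "{k :: real^3. \<delta> < norm k}"
  let ?I = "1 / (2 * pi) ^ 3 * (LINT x|lborel. occ \<beta> 0 x * indicator ?D x)"
  have \<rho>0: "\<rho> > 0" using \<rho> rho_c_pos by linarith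
  have neg: "\<forall>\<^sub>F V in at_top. ?\<mu> V \<le> 0" using chem_pot_free_neg[OF \<rho>0] by (auto elim: eventually_mono)
  have D: "?D = - cball 0 \<delta>" by auto
  have lims: "((\<lambda>V. cls_density V ?D (?\<mu> V) S) \<longlongrightarrow> (if S = UNIV then ?I else 0)) at_top" for S
  proof -
    consider "S = UNIV" | "S = {}" | "S \<noteq> {}" "S \<noteq> UNIV" by blast
    then show ?thesis
    proof cases
      case 1
      have "AE x in lborel. (x :: real^3) \<notin> sphere 0 \<delta>" by (rule AE_closed_negligible[OF negligible_sphere])
      then have "AE x in lborel. x \<in> interior ?D \<or> x \<in> interior (- ?D)"
        unfolding D by eventually_elim (auto simp: interior_open open_Compl interior_cball)
      then have "((\<lambda>V. cls_density V ?D (?\<mu> V) UNIV) \<longlongrightarrow> ?I) at_top"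
        unfolding D by (intro cls_density_tendsto_integral chem_pot_free_neg chem_pot_free_tendsto_0 \<rho> \<rho>0) auto
      then show ?thesis using 1 by simp
    next
      case 2
      then show ?thesis using \<delta> by (simp add: cls_density_empty)
    next
      case 3
      have m: "\<beta> * \<delta>\<^sup>2 > 0" using beta \<delta> by simp
      have "\<forall>\<^sub>F V in at_top. \<forall>k\<in>?D. \<beta> * (energy k - ?\<mu> V) \<ge> \<beta> * \<delta>\<^sup>2"
        using neg
      proof eventually_elim
        case (elim V)
        have "\<delta>\<^sup>2 \<le> energy k - ?\<mu> V" if "k \<in> ?D" for k
        proof -
          have "\<delta>\<^sup>2 \<le> energy k" unfolding energy_norm using that \<delta> by (intro power_mono) auto
          then show ?thesis using elim by linarith
        qed
        then show ?case using beta by (auto intro: mult_left_mono)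
      qed
      from cls_density_gap[OF 3 neg m this] 3 show ?thesis by simp
    qed
  qed
  have "((\<lambda>V. \<Sum>S\<in>UNIV. cls_density V ?D (?\<mu> V) S) \<longlongrightarrow> (\<Sum>S\<in>(UNIV :: 3 set set). if S = UNIV then ?I else 0)) at_top"
    by (rule tendsto_sum) (rule lims)
  then have "((\<lambda>V. \<rho> - (\<Sum>S\<in>UNIV. cls_density V ?D (?\<mu> V) S)) \<longlongrightarrow> \<rho> - ?I) at_top"
    by (intro tendsto_diff tendsto_const) simp
  moreover have "\<forall>\<^sub>F V in at_top. \<rho> - (\<Sum>S\<in>UNIV. cls_density V ?D (?\<mu> V) S)
      = 1 / V * (\<Sum>\<^sub>\<infinity>k\<in>{k \<in> dual_lattice a V. norm k \<le> \<delta>}. occ \<beta> (?\<mu> V) k)"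
    using eventually_gt_at_top[of 0]
  proof eventually_elim
    case (elim V)
    let ?K = "dual_lattice a V"
    let ?A = "{k \<in> ?K. norm k \<le> \<delta>}"
    have \<mu>: "?\<mu> V < 0" by (rule chem_pot_free_solves(1)[OF elim \<rho>0])
    have s: "occ \<beta> (?\<mu> V) summable_on A" if "A \<subseteq> ?K" for A
      using occ_summable[OF elim \<mu>] that by (rule summable_on_subset)
    have "infsum (occ \<beta> (?\<mu> V)) ?K = infsum (occ \<beta> (?\<mu> V)) (?A \<union> (?K \<inter> ?D))"
      by (intro arg_cong[where f = "infsum (occ \<beta> (?\<mu> V))"]) auto
    also have "\<dots> = infsum (occ \<beta> (?\<mu> V)) ?A + infsum (occ \<beta> (?\<mu> V)) (?K \<inter> ?D)"
      by (intro infsum_Un_disjoint s) auto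
    also have "infsum (occ \<beta> (?\<mu> V)) (?K \<inter> ?D) = (\<Sum>\<^sub>\<infinity>k\<in>?K. occ \<beta> (?\<mu> V) k * indicator ?D k)"
      by (intro infsum_cong_neutral) auto
    finally have "fdens V (?\<mu> V) = 1 / V * infsum (occ \<beta> (?\<mu> V)) ?A + 1 / V * (\<Sum>\<^sub>\<infinity>k\<in>?K. occ \<beta> (?\<mu> V) k * indicator ?D k)"
      by (simp add: fdens_def add_divide_distrib)
    then show ?case
      unfolding lattice_sum_eq(2)[OF elim \<mu>] chem_pot_free_solves(2)[OF elim \<rho>0] by simp
  qed
  ultimately show ?thesis by (rule Lim_transform_eventually)
qed

lemma type_III_long_box:
  assumes a1: "a $ 1 > 1 / 2" and \<rho>: "\<rho> > rho_c \<beta>"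
  shows "type_III a \<beta> \<rho>"
  unfolding type_III_def
proof (intro conjI allI impI)
  have \<rho>0: "\<rho> > 0" using \<rho> rho_c_pos by linarith
  fix k assume k: "mode_family a k"
  have "((\<lambda>V. complex_of_real (1 / V * occ \<beta> (chem_pot_free a \<beta> \<rho> V) (k V))) \<longlongrightarrow> complex_of_real 0) at_top"
    by (intro tendsto_of_real mode_density_free_tendsto_0 a1 \<rho>0)
  moreover have "\<forall>\<^sub>F V in at_top. complex_of_real (1 / V * occ \<beta> (chem_pot_free a \<beta> \<rho> V) (k V)) = free_occ a \<beta> \<rho> V (k V)"
    using eventually_gt_at_top[of 0]
    by eventually_elim (use k in \<open>simp only: mode_family_def free_occ_eq[OF _ \<rho>0]\<close>)
  ultimately show "((\<lambda>V. free_occ a \<beta> \<rho> V (k V)) \<longlongrightarrow> 0) at_top"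
    using Lim_transform_eventually by fastforce
next
  let ?g = "\<lambda>\<delta>. \<rho> - 1 / (2 * pi) ^ 3 * (LINT x|lborel. occ \<beta> 0 x * indicator {x. \<delta> < norm x} x)"
  show "iterated_limit (at_right 0) (\<lambda>\<delta> V. 1 / V * (\<Sum>\<^sub>\<infinity>k\<in>{k \<in> dual_lattice a V. norm k \<le> \<delta>}.
      1 / (exp (\<beta> * (energy k - chem_pot_free a \<beta> \<rho> V)) - 1))) (\<rho> - rho_c \<beta>)"
    unfolding iterated_limit_def occ_def[symmetric]
  proof (intro exI[of _ ?g] conjI)
    show "\<forall>\<^sub>F \<delta> in at_right 0. ((\<lambda>V. 1 / V * (\<Sum>\<^sub>\<infinity>k\<in>{k \<in> dual_lattice a V. norm k \<le> \<delta>}. occ \<beta> (chem_pot_free a \<beta> \<rho> V) k)) \<longlongrightarrow> ?g \<delta>) at_top"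
      using eventually_at_right_less[of 0] by eventually_elim (rule cutoff_density_tendsto[OF \<rho>])
    show "(?g \<longlongrightarrow> \<rho> - rho_c \<beta>) (at_right 0)"
      by (intro tendsto_diff tendsto_const cutoff_integral_tendsto)
  qed
qed

section \<open>The critical box\<close>

text \<open>For \<open>a $ 1 = 1 / 2\<close> the modes \<open>(2 \<pi> m / \<surd>V, 0, 0)\<close> have energies of order \<open>1 / V\<close>.  With the
  chemical potential \<open>- B / V\<close>, \<open>line_limit B\<close> is their limiting total density.\<close>

definition line_coeff :: "real \<Rightarrow> int \<Rightarrow> real" where
  "line_coeff B m = \<beta> * ((2 * pi * of_int m)\<^sup>2 + B)"

definition line_limit :: "real \<Rightarrow> real" where
  "line_limit B = (\<Sum>\<^sub>\<infinity>m. 1 / line_coeff B m)"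

lemma line_coeff_pos: "B > 0 \<Longrightarrow> line_coeff B m > 0"
  unfolding line_coeff_def using beta by (intro mult_pos_pos add_nonneg_pos) auto

text \<open>The sum x + B dominates x^(3/4) B^(1/4). The first power leaves |m|^(-3/2), which is
  summable, and the second makes the whole series vanish as B grows.\<close>

lemma line_coeff_bound:
  assumes B: "B > 0" and m: "m \<noteq> 0"
  shows "1 / line_coeff B m \<le> 1 / \<beta> * (2 * pi) powr (- (3 / 2)) * B powr (- (1 / 4)) * \<bar>real_of_int m\<bar> powr (- (3 / 2))"
proof -
  define x where "x = (2 * pi * \<bar>real_of_int m\<bar>)\<^sup>2"
  have x: "x > 0" using m by (simp add: x_def)
  have "x powr (3 / 4) * B powr (1 / 4) \<le> (x + B) powr (3 / 4) * (x + B) powr (1 / 4)"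
    using x B by (intro mult_mono powr_mono2) auto
  also have "\<dots> = x + B" using x B by (simp add: powr_add[symmetric])
  finally have le: "x powr (3 / 4) * B powr (1 / 4) \<le> x + B" .
  have x34: "x powr (3 / 4) = (2 * pi) powr (3 / 2) * \<bar>real_of_int m\<bar> powr (3 / 2)"
  proof -
    have "x = (2 * pi * \<bar>real_of_int m\<bar>) powr 2" using m by (simp add: x_def)
    then have "x powr (3 / 4) = (2 * pi * \<bar>real_of_int m\<bar>) powr (3 / 2)" by (simp only: powr_powr) simp
    then show ?thesis by (simp add: powr_mult)
  qed
  have "1 / line_coeff B m = 1 / (\<beta> * (x + B))" by (simp add: line_coeff_def x_def power_mult_distrib)
  also have "\<dots> \<le> 1 / (\<beta> * (x powr (3 / 4) * B powr (1 / 4)))"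
    using le x B beta by (intro frac_le mult_left_mono mult_pos_pos) auto
  also have "\<dots> = 1 / \<beta> * (2 * pi) powr (- (3 / 2)) * B powr (- (1 / 4)) * \<bar>real_of_int m\<bar> powr (- (3 / 2))"
    unfolding x34 powr_minus_divide by simp
  finally show ?thesis .
qed

lemma line_summable_nonzero:
  assumes B: "B > 0" shows "(\<lambda>m. 1 / line_coeff B m) summable_on - {0}"
proof (rule summable_on_comparison_test)
  show "(\<lambda>m. 1 / \<beta> * (2 * pi) powr (- (3 / 2)) * B powr (- (1 / 4)) * \<bar>real_of_int m\<bar> powr (- (3 / 2))) summable_on - {0}"
    by (intro summable_on_cmult_right summable_int_powr) simp
qed (use line_coeff_bound[OF B] line_coeff_pos[OF B] in \<open>auto intro: less_imp_le\<close>)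

lemma UNIV_int_split: "(UNIV :: int set) = {0} \<union> - {0}" by auto

lemma line_summable: "B > 0 \<Longrightarrow> (\<lambda>m. 1 / line_coeff B m) summable_on UNIV"
  by (subst UNIV_int_split, rule summable_on_Un_disjoint) (auto intro: line_summable_nonzero)

lemma line_coeff_zero: "line_coeff B 0 = \<beta> * B"
  by (simp add: line_coeff_def)

lemma line_limit_split:
  "B > 0 \<Longrightarrow> line_limit B = 1 / (\<beta> * B) + (\<Sum>\<^sub>\<infinity>m\<in>- {0}. 1 / line_coeff B m)"
  unfolding line_limit_def
  by (subst UNIV_int_split, subst infsum_Un_disjoint) (auto intro: line_summable_nonzero simp: line_coeff_zero)

lemma line_limit_tendsto_0: "(line_limit \<longlongrightarrow> 0) at_top"
proof -
  define C where "C = 1 / \<beta> * (2 * pi) powr (- (3 / 2)) * zeta_int (3 / 2)"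
  have up: "\<forall>\<^sub>F B in at_top. line_limit B \<le> 1 / \<beta> * (1 / B) + C * B powr (- (1 / 4))"
    using eventually_gt_at_top[of 0]
  proof eventually_elim
    case (elim B)
    have "(\<Sum>\<^sub>\<infinity>m\<in>- {0}. 1 / line_coeff B m)
      \<le> (\<Sum>\<^sub>\<infinity>m\<in>- {0}. 1 / \<beta> * (2 * pi) powr (- (3 / 2)) * B powr (- (1 / 4)) * \<bar>real_of_int m\<bar> powr (- (3 / 2)))"
      by (intro infsum_mono line_summable_nonzero elim line_coeff_bound summable_on_cmult_right summable_int_powr) auto
    also have "\<dots> = C * B powr (- (1 / 4))"
      by (subst infsum_cmult_right') (simp add: C_def zeta_int_def)
    finally show ?case using line_limit_split[OF elim] by simp
  qed
  have low: "\<forall>\<^sub>F B in at_top. 0 \<le> line_limit B"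
    using eventually_gt_at_top[of 0]
    by eventually_elim (auto simp: line_limit_def intro!: infsum_nonneg less_imp_le[OF line_coeff_pos])
  have "((\<lambda>B :: real. 1 / B) \<longlongrightarrow> 0) at_top"
    by (intro real_tendsto_divide_at_top[OF tendsto_const] filterlim_ident)
  moreover have "((\<lambda>B :: real. B powr (- (1 / 4))) \<longlongrightarrow> 0) at_top"
    by (intro tendsto_neg_powr filterlim_ident) simp
  ultimately have "((\<lambda>B. 1 / \<beta> * (1 / B) + C * B powr (- (1 / 4))) \<longlongrightarrow> 1 / \<beta> * 0 + C * 0) at_top"
    by (intro tendsto_add tendsto_mult tendsto_const)
  then show ?thesis using tendsto_sandwich[OF low up tendsto_const] by simp
qed

lemma line_coeff_strict_mono: "B < B' \<Longrightarrow> line_coeff B m < line_coeff B' m"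
  unfolding line_coeff_def using beta by simp

lemma line_limit_strict_antimono:
  assumes B: "0 < B" "B < B'"
  shows "line_limit B' < line_limit B"
proof -
  have le: "1 / line_coeff B' m \<le> 1 / line_coeff B m" for m
    using line_coeff_strict_mono[OF B(2), of m] line_coeff_pos[OF B(1), of m] by (intro frac_le) auto
  have "(\<Sum>\<^sub>\<infinity>m\<in>- {0}. 1 / line_coeff B' m) \<le> (\<Sum>\<^sub>\<infinity>m\<in>- {0}. 1 / line_coeff B m)"
    using B le by (intro infsum_mono line_summable_nonzero) auto
  moreover have "1 / (\<beta> * B') < 1 / (\<beta> * B)"
    using B beta by (intro divide_strict_left_mono mult_pos_pos) auto
  ultimately show ?thesis using line_limit_split[of B] line_limit_split[of B'] B by simp
qed

text \<open>The threshold is the infimum of the arguments where the limit density falls below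
  \<open>r\<close>. It is positive since the zero mode alone contributes
  \<open>1 / (\<beta> * b)\<close>, and strict monotonicity gives the two one-sided inequalities
  that trap the rescaled potential.\<close>

lemma ex_line_threshold:
  assumes r: "r > 0"
  obtains B where "B > 0" "\<And>b. 0 < b \<Longrightarrow> b < B \<Longrightarrow> r < line_limit b" "\<And>b. B < b \<Longrightarrow> line_limit b < r"
proof -
  define A where "A = {b. b > 0 \<and> line_limit b < r}"
  have lower: "1 / (\<beta> * r) \<le> b" if "b \<in> A" for b
  proof -
    have b: "b > 0" "line_limit b < r" using that by (auto simp: A_def)
    have "0 \<le> (\<Sum>\<^sub>\<infinity>m\<in>- {0}. 1 / line_coeff b m)"
      using line_coeff_pos[OF b(1)] by (intro infsum_nonneg) (auto intro: less_imp_le)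
    then have "1 / (\<beta> * b) < r" using line_limit_split[OF b(1)] b by linarith
    then show ?thesis using b r beta by (simp add: field_simps)
  qed
  have bdd: "bdd_below A" using lower by (rule bdd_belowI)
  have "\<forall>\<^sub>F b in at_top. line_limit b < r \<and> b > 0"
    using order_tendstoD(2)[OF line_limit_tendsto_0 r] eventually_gt_at_top[of 0] by eventually_elim simp
  from eventually_happens'[OF trivial_limit_at_top_linorder this] have ne: "A \<noteq> {}" by (auto simp: A_def)
  define B where "B = Inf A"
  have "1 / (\<beta> * r) \<le> B" unfolding B_def using ne lower by (rule cInf_greatest)
  moreover have "0 < 1 / (\<beta> * r)" using r beta by simp
  ultimately have B: "B > 0" by linarith
  have below: "r < line_limit b" if b: "0 < b" "b < B" for b
  proof -
    obtain c where c: "b < c" "c < B" using dense b by blast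
    have "c \<notin> A" using c cInf_lower[OF _ bdd, of c] by (auto simp: B_def)
    then have "r \<le> line_limit c" using b c by (auto simp: A_def)
    also have "\<dots> < line_limit b" using b c by (intro line_limit_strict_antimono) auto
    finally show ?thesis .
  qed
  have above: "line_limit b < r" if b: "B < b" for b
  proof -
    obtain c where c: "c \<in> A" "c < b" using b ne bdd unfolding B_def by (meson cInf_lessD)
    then show ?thesis using line_limit_strict_antimono[of c b] by (auto simp: A_def)
  qed
  show thesis using that[OF B below above] by blast
qed

lemma cls_single_axis: "cls {} \<union> cls {1} = range (axis 1)"
proof
  show "range (axis 1) \<subseteq> cls {} \<union> cls {1 :: 3}"
  proof clarify
    fix m :: int assume "axis 1 m \<notin> cls {1 :: 3}"
    then show "axis 1 m \<in> cls {}" by (cases "m = 0") (auto simp: cls_def axis_def split: if_splits)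
  qed
  show "cls {} \<union> cls {1} \<subseteq> range (axis 1)"
  proof
    fix n :: "int^3" assume n: "n \<in> cls {} \<union> cls {1}"
    have "n $ i = 0" if "i \<noteq> 1" for i using n that by (auto simp: cls_def)
    then have "n = axis 1 (n $ 1)" by (auto simp: vec_eq_iff axis_def)
    then show "n \<in> range (axis 1)" by blast
  qed
qed

lemma occ_axis:
  assumes a1: "a $ 1 = 1 / 2" and V: "V > 0"
  shows "occ \<beta> \<mu> (momentum a V (axis 1 m)) = 1 / (exp (line_coeff (- \<mu> * V) m / V) - 1)"
proof -
  have "energy (momentum a V (axis 1 m)) = (2 * pi * of_int m)\<^sup>2 / V"
  proof -
    have "2 * a $ 1 = 1" using a1 by simp
    then show ?thesis unfolding energy_momentum_axis using V by (simp add: power_divide powr_power)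
  qed
  then have "\<beta> * (energy (momentum a V (axis 1 m)) - \<mu>) = line_coeff (- \<mu> * V) m / V"
    using V by (simp add: line_coeff_def field_simps)
  then show ?thesis by (simp add: occ_def)
qed

lemma line_density_eq:
  assumes a1: "a $ 1 = 1 / 2" and V: "V > 0" and \<mu>: "\<mu> < 0"
  shows "((\<lambda>m. 1 / V * (1 / (exp (line_coeff (- \<mu> * V) m / V) - 1))) has_sum (\<Sum>S\<in>{{}, {1}}. cls_density V UNIV \<mu> S)) UNIV"
proof -
  let ?F = "\<lambda>n. occ \<beta> \<mu> (momentum a V n) * indicator UNIV (momentum a V n)"
  have s: "?F summable_on cls S" for S using V \<mu> by (rule occ_cls_summable)
  have "(?F has_sum (infsum ?F (cls {}) + infsum ?F (cls {1}))) (cls {} \<union> cls {1})"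
    by (rule has_sum_Un_disjoint[OF has_sum_infsum[OF s] has_sum_infsum[OF s]]) (rule disjoint_cls, simp)
  then have "((\<lambda>m. occ \<beta> \<mu> (momentum a V (axis 1 m))) has_sum (infsum ?F (cls {}) + infsum ?F (cls {1}))) UNIV"
    unfolding cls_single_axis using has_sum_reindex[OF inj_axis, of ?F] by (simp add: o_def)
  then have "((\<lambda>m. 1 / V * occ \<beta> \<mu> (momentum a V (axis 1 m))) has_sum 1 / V * (infsum ?F (cls {}) + infsum ?F (cls {1}))) UNIV"
    by (rule has_sum_cmult_right)
  then show ?thesis unfolding occ_axis[OF a1 V] cls_density_def by (simp add: distrib_left add_divide_distrib)
qed

text \<open>The first axis carries the whole condensate. This determines the limit of the rescaled
  potential, after which every axis mode retains a positive density.\<close>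

lemma type_II_critical_box:
  assumes a1: "a $ 1 = 1 / 2" and \<rho>: "\<rho> > rho_c \<beta>"
  shows "type_II a \<beta> \<rho>"
proof -
  let ?\<mu> = "chem_pot_free a \<beta> \<rho>"
  define r where "r = \<rho> - rho_c \<beta>"
  have r: "r > 0" using \<rho> by (simp add: r_def)
  have \<rho>0: "\<rho> > 0" using \<rho> rho_c_pos by linarith
  have neg: "\<forall>\<^sub>F V in at_top. ?\<mu> V \<le> 0" using chem_pot_free_neg[OF \<rho>0] by (auto elim: eventually_mono)
  define h where "h V B m = 1 / V * (1 / (exp (line_coeff B m / V) - 1))" for V B m
  \<comment> \<open>The potential measured in units of 1/V, the order of the axis energies;
    \<open>h V (b V) m\<close> is the density in the axis mode \<open>m\<close>.\<close>
  define b where "b V = - ?\<mu> V * V" for V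
  define s where "s V = (\<Sum>S\<in>{{}, {1}}. cls_density V UNIV (?\<mu> V) S)" for V
  have s: "(s \<longlongrightarrow> r) at_top"
    unfolding s_def r_def
  proof (rule condensate_in_classes[OF \<rho>])
    fix S :: "3 set" assume "S \<notin> {{}, {1}}" "S \<noteq> UNIV"
    then have S: "S \<noteq> {}" "S \<noteq> UNIV" "S \<noteq> {1}" by auto
    show "((\<lambda>V. cls_density V UNIV (?\<mu> V) S) \<longlongrightarrow> 0) at_top"
      using S(1,2)
    proof (cases rule: card_cases_3)
      case (1 i)
      then have "i \<noteq> 1" using S by auto
      \<comment> \<open>The two other positive exponents share the remaining 1/2, so their axes are
        negligible.\<close>
      then have "a $ i < 1 / 2" using a1 a_sum a_pos[of 2] a_pos[of 3] exhaust_3[of i] by auto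
      then show ?thesis unfolding 1 using neg by (rule cls_density_single_short)
    qed (rule cls_density_pair[OF _ neg])
  next
    show "(UNIV :: 3 set) \<notin> {{}, {1}}" by (metis UNIV_I empty_iff insertE num1_eq_iff one_neq_zero singletonD zero_neq_numeral exhaust_3 insert_iff)
  qed
  have hs: "(h V (b V) has_sum s V) UNIV" and bp: "b V > 0" if "V > 0" for V
  proof -
    have \<mu>: "?\<mu> V < 0" using that \<rho>0 by (rule chem_pot_free_solves)
    show "(h V (b V) has_sum s V) UNIV"
      using line_density_eq[OF a1 that \<mu>] unfolding h_def b_def s_def by simp
    show "b V > 0" using that \<mu> by (simp add: b_def mult_neg_pos)
  qed
  have h_mono: "h V B' m \<le> h V B m" if "V > 0" "0 < B" "B \<le> B'" for V B B' m
  proof -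
    have c: "0 < line_coeff B m" "line_coeff B m \<le> line_coeff B' m"
      using line_coeff_pos[OF that(2)] line_coeff_strict_mono[of B B' m] that by (auto simp: le_less)
    then have "0 < exp (line_coeff B m / V) - 1" "exp (line_coeff B m / V) - 1 \<le> exp (line_coeff B' m / V) - 1"
      using that by (auto intro: divide_right_mono)
    then show ?thesis unfolding h_def using that by (intro mult_left_mono frac_le) auto
  qed
  obtain B where B: "B > 0" and below: "\<And>b. 0 < b \<Longrightarrow> b < B \<Longrightarrow> r < line_limit b"
    and above: "\<And>b. B < b \<Longrightarrow> line_limit b < r"
    using ex_line_threshold[OF r] by blast
  have b: "(b \<longlongrightarrow> B) at_top"
  proof (rule order_tendstoI)
    fix u assume u: "B < u"
    show "\<forall>\<^sub>F V in at_top. b V < u"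
      using order_tendstoD(1)[OF s above[OF u]] eventually_gt_at_top[of 0]
    proof eventually_elim
      case (elim V)
      have u0: "u > 0" using u B by linarith
      show ?case
      proof (rule ccontr)
        assume "\<not> b V < u"
        \<comment> \<open>If \<open>b V\<close> were at least \<open>u\<close>, the finite-volume
          densities would lie below their limits at \<open>u\<close>, and so would their sum; but
          that limit is less than \<open>r\<close>, the limit of \<open>s\<close>.\<close>
        have "h V (b V) m \<le> 1 / line_coeff u m" for m
        proof -
          have "h V (b V) m \<le> h V u m" using elim u0 \<open>\<not> b V < u\<close> by (intro h_mono) auto
          also have "\<dots> \<le> 1 / line_coeff u m"
            unfolding h_def using elim line_coeff_pos[OF u0] by (intro bose_scaling_le) auto
          finally show ?thesis .
        qed
        then have "s V \<le> line_limit u"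
          unfolding line_limit_def using hs[of V] line_summable[OF u0] elim
          by (intro has_sum_mono[OF hs has_sum_infsum]) auto
        then show False using elim by simp
      qed
    qed
  next
    fix l assume l: "l < B"
    \<comment> \<open>Moves the lower bound into the positive range, where \<open>line_coeff\<close>
      is positive and the threshold inequality applies.\<close>
    define c where "c = max l (B / 2)"
    have c: "0 < c" "c < B" "l \<le> c" using B l by (auto simp: c_def)
    \<comment> \<open>Finitely many modes already exceed \<open>r\<close> at \<open>c\<close>, and a
      finite sum passes to the limit in V; this gives the lower half of the trap.\<close>
    have "\<exists>F. finite F \<and> r < (\<Sum>m\<in>F. 1 / line_coeff c m)"
    proof -
      have "((\<lambda>F. \<Sum>m\<in>F. 1 / line_coeff c m) \<longlongrightarrow> line_limit c) (finite_subsets_at_top UNIV)"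
        unfolding line_limit_def by (rule infsum_tendsto[OF line_summable[OF c(1)]])
      from order_tendstoD(1)[OF this below[OF c(1,2)]]
      show ?thesis unfolding eventually_finite_subsets_at_top by blast
    qed
    then obtain F where F: "finite F" "r < (\<Sum>m\<in>F. 1 / line_coeff c m)" by blast
    have "((\<lambda>V. \<Sum>m\<in>F. h V c m) \<longlongrightarrow> (\<Sum>m\<in>F. 1 / line_coeff c m)) at_top"
      unfolding h_def by (intro tendsto_sum bose_scaling tendsto_const line_coeff_pos c)
    with s have "((\<lambda>V. (\<Sum>m\<in>F. h V c m) - s V) \<longlongrightarrow> (\<Sum>m\<in>F. 1 / line_coeff c m) - r) at_top"
      by (intro tendsto_diff)
    then have "\<forall>\<^sub>F V in at_top. 0 < (\<Sum>m\<in>F. h V c m) - s V" using F by (intro order_tendstoD(1)) auto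
    then show "\<forall>\<^sub>F V in at_top. l < b V"
      using eventually_gt_at_top[of 0]
    proof eventually_elim
      case (elim V)
      show ?case
      proof (rule ccontr)
        assume "\<not> l < b V"
        then have "(\<Sum>m\<in>F. h V c m) \<le> (\<Sum>m\<in>F. h V (b V) m)"
          using c elim bp by (intro sum_mono h_mono) auto
        also have "\<dots> \<le> s V"
        proof (rule finite_sum_le_has_sum[OF hs[OF elim(2)] F(1)])
          show "0 \<le> h V (b V) m" if "m \<in> UNIV - F" for m
            unfolding h_def using line_coeff_pos[OF bp[OF elim(2)], of m] elim by simp
        qed simp
        finally show False using elim by simp
      qed
    qed
  qed
  have "((\<lambda>V. free_occ a \<beta> \<rho> V (momentum a V (axis 1 m))) \<longlongrightarrow> complex_of_real (1 / line_coeff B m)) at_top" for m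
  proof -
    have "((\<lambda>V. line_coeff (b V) m) \<longlongrightarrow> line_coeff B m) at_top"
      unfolding line_coeff_def by (intro tendsto_intros b)
    then have "((\<lambda>V. complex_of_real (1 / V * (1 / (exp (line_coeff (b V) m / V) - 1)))) \<longlongrightarrow> complex_of_real (1 / line_coeff B m)) at_top"
      by (intro tendsto_of_real bose_scaling line_coeff_pos B)
    moreover have "\<forall>\<^sub>F V in at_top. complex_of_real (1 / V * (1 / (exp (line_coeff (b V) m / V) - 1)))
        = free_occ a \<beta> \<rho> V (momentum a V (axis 1 m))"
      using eventually_gt_at_top[of 0]
    proof eventually_elim
      case (elim V)
      have k: "momentum a V (axis 1 m) \<in> dual_lattice a V" unfolding dual_lattice_def by blast
      show ?case unfolding free_occ_eq[OF elim \<rho>0 k] occ_axis[OF a1 elim] b_def ..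
    qed
    ultimately show ?thesis by (rule Lim_transform_eventually)
  qed
  moreover have "1 / line_coeff B m > 0" for m using line_coeff_pos[OF B] by simp
  ultimately have "range (\<lambda>m. axis 1 m) \<subseteq> {n. \<exists>l>0. ((\<lambda>V. free_occ a \<beta> \<rho> V (momentum a V n)) \<longlongrightarrow> complex_of_real l) at_top}"
    by blast
  moreover have "infinite (range (\<lambda>m :: int. axis (1 :: 3) m))"
    using infinite_UNIV_int finite_imageD[OF _ inj_axis] by blast
  ultimately show ?thesis unfolding type_II_def using infinite_super by blast
qed

end

section \<open>Quasi-averages\<close>

lemma iterated_limit_unique:
  fixes l :: "'b::t2_space"
  assumes "iterated_limit F f l" "iterated_limit F f l'" "F \<noteq> bot"
  shows "l = l'"
proof -
  obtain g g' where g: "\<forall>\<^sub>F s in F. (f s \<longlongrightarrow> g s) at_top" "(g \<longlongrightarrow> l) F"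
    and g': "\<forall>\<^sub>F s in F. (f s \<longlongrightarrow> g' s) at_top" "(g' \<longlongrightarrow> l') F"
    using assms unfolding iterated_limit_def by blast
  have "\<forall>\<^sub>F s in F. g s = g' s"
    using g(1) g'(1) by eventually_elim (rule tendsto_unique[OF trivial_limit_at_top_linorder])
  then have "(g' \<longlongrightarrow> l) F" by (rule Lim_transform_eventually[OF g(2)])
  then show ?thesis using g'(2) assms(3) tendsto_unique by blast
qed

lemma iterated_limit_cong:
  assumes "\<And>s. \<forall>\<^sub>F V in at_top. f s V = g s V"
  shows "iterated_limit F f l = iterated_limit F g l"
  unfolding iterated_limit_def tendsto_cong[OF assms] ..

lemma iterated_limitI:
  "\<forall>\<^sub>F s in F. (f s \<longlongrightarrow> g s) at_top \<Longrightarrow> (g \<longlongrightarrow> l) F \<Longrightarrow> iterated_limit F f l"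
  unfolding iterated_limit_def by blast

lemma eventually_neq_at_0: "\<forall>\<^sub>F \<eta> in at (0 :: complex). \<eta> \<noteq> 0"
  by (simp add: eventually_at_filter)

lemma ray_le_at_0: "ray \<theta> \<le> at 0"
proof -
  have "((\<lambda>r. complex_of_real r * cis \<theta>) \<longlongrightarrow> complex_of_real 0 * cis \<theta>) (at_right 0)"
    by (intro tendsto_intros)
  then have "filterlim (\<lambda>r. complex_of_real r * cis \<theta>) (at 0) (at_right 0)"
    unfolding filterlim_at using eventually_at_right_less[of "0 :: real"] by (auto elim: eventually_mono)
  then show ?thesis unfolding ray_def filterlim_def .
qed

lemma ray_neq_bot: "ray \<theta> \<noteq> bot"
  unfolding ray_def filtermap_bot_iff by (rule trivial_limit_at_right_real)

lemma eventually_ray: "\<forall>\<^sub>F \<eta> in ray \<theta>. \<eta> \<noteq> 0 \<and> \<eta> = complex_of_real (cmod \<eta>) * cis \<theta>"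
  unfolding ray_def eventually_filtermap
  using eventually_at_right_less[of "0 :: real"] by eventually_elim (simp add: norm_mult)

lemma lattice_mode: "mode_family a k \<Longrightarrow> V > 0 \<Longrightarrow> k V \<in> dual_lattice a V"
  by (simp add: mode_family_def)

context anisotropic_box begin

lemma total_density_tendsto:
  assumes q: "mode_family a q" and \<mu>: "\<mu> < 0"
    and s: "((\<lambda>V. 1 / (energy (q V) - \<mu>)\<^sup>2) \<longlongrightarrow> s) at_top"
  shows "((\<lambda>V. total_density a \<beta> V (q V) \<mu> \<eta>) \<longlongrightarrow> complex_of_real (bose_integral \<beta> \<mu> + (cmod \<eta>)\<^sup>2 * s)) at_top"
proof -
  have "((\<lambda>V. complex_of_real (fdens V \<mu> + (cmod \<eta>)\<^sup>2 * (1 / (energy (q V) - \<mu>)\<^sup>2)))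
      \<longlongrightarrow> complex_of_real (bose_integral \<beta> \<mu> + (cmod \<eta>)\<^sup>2 * s)) at_top"
    by (intro tendsto_of_real tendsto_add tendsto_mult tendsto_const s fdens_tendsto \<mu>)
  moreover have "\<forall>\<^sub>F V in at_top. complex_of_real (fdens V \<mu> + (cmod \<eta>)\<^sup>2 * (1 / (energy (q V) - \<mu>)\<^sup>2))
      = total_density a \<beta> V (q V) \<mu> \<eta>"
    using eventually_gt_at_top[of 0]
    by eventually_elim (simp add: total_density_eq[OF _ \<mu> lattice_mode[OF q]])
  ultimately show ?thesis by (rule Lim_transform_eventually)
qed

lemma total_density_no_source_tendsto:
  assumes q: "mode_family a q" and \<mu>: "\<mu> < 0"
  shows "((\<lambda>V. total_density a \<beta> V (q V) \<mu> 0) \<longlongrightarrow> complex_of_real (bose_integral \<beta> \<mu>)) at_top"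
proof -
  have "((\<lambda>V. complex_of_real (fdens V \<mu>)) \<longlongrightarrow> complex_of_real (bose_integral \<beta> \<mu>)) at_top"
    by (intro tendsto_of_real fdens_tendsto \<mu>)
  moreover have "\<forall>\<^sub>F V in at_top. complex_of_real (fdens V \<mu>) = total_density a \<beta> V (q V) \<mu> 0"
    using eventually_gt_at_top[of 0]
    by eventually_elim (simp add: total_density_eq[OF _ \<mu> lattice_mode[OF q]])
  ultimately show ?thesis by (rule Lim_transform_eventually)
qed

text \<open>The limit energy may be infinite. In either case the coefficient of |\<eta>|^2 has a
  finite limit, because the denominator stays away from 0, and the source drops out as \<eta> tends
  to 0.\<close>

lemma quasi_average_density_gapped:
  assumes q: "mode_family a q" and \<mu>: "\<mu> < 0"
    and e: "((\<lambda>V. ereal (energy (q V))) \<longlongrightarrow> e) at_top" "e > 0"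
  shows "iterated_limit (at 0) (\<lambda>\<eta> V. total_density a \<beta> V (q V) \<mu> \<eta>) (complex_of_real (bose_integral \<beta> \<mu>))"
proof -
  have "\<exists>s. ((\<lambda>V. 1 / (energy (q V) - \<mu>)\<^sup>2) \<longlongrightarrow> s) at_top"
  proof (cases e)
    case (real x)
    then have "((\<lambda>V. energy (q V)) \<longlongrightarrow> x) at_top" using e by simp
    moreover have "x - \<mu> \<noteq> 0" using e(2) real \<mu> by simp
    ultimately have "((\<lambda>V. 1 / (energy (q V) - \<mu>)\<^sup>2) \<longlongrightarrow> 1 / (x - \<mu>)\<^sup>2) at_top"
      by (intro tendsto_intros) auto
    then show ?thesis by blast
  next
    case PInf
    then have "filterlim (\<lambda>V. energy (q V)) at_top at_top"
      using e(1) by (simp add: tendsto_PInfty_eq_at_top)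
    then have "filterlim (\<lambda>V. - \<mu> + energy (q V)) at_top at_top"
      by (rule filterlim_tendsto_add_at_top[OF tendsto_const])
    then have "filterlim (\<lambda>V. (- \<mu> + energy (q V))\<^sup>2) at_top at_top" by (intro filterlim_pow_at_top) auto
    then have "((\<lambda>V. 1 / (- \<mu> + energy (q V))\<^sup>2) \<longlongrightarrow> 0) at_top"
      by (intro real_tendsto_divide_at_top[OF tendsto_const])
    then show ?thesis by (auto simp: add.commute)
  qed (use e(2) in simp)
  then obtain s where s: "((\<lambda>V. 1 / (energy (q V) - \<mu>)\<^sup>2) \<longlongrightarrow> s) at_top" by blast
  show ?thesis
  proof (rule iterated_limitI)
    show "\<forall>\<^sub>F \<eta> in at 0. ((\<lambda>V. total_density a \<beta> V (q V) \<mu> \<eta>) \<longlongrightarrow> complex_of_real (bose_integral \<beta> \<mu> + (cmod \<eta>)\<^sup>2 * s)) at_top"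
      by (intro always_eventually allI total_density_tendsto q \<mu> s)
    have "((\<lambda>\<eta> :: complex. complex_of_real (bose_integral \<beta> \<mu> + (cmod \<eta>)\<^sup>2 * s)) \<longlongrightarrow> complex_of_real (bose_integral \<beta> \<mu> + (cmod 0)\<^sup>2 * s)) (at 0)"
      by (intro tendsto_intros)
    then show "((\<lambda>\<eta> :: complex. complex_of_real (bose_integral \<beta> \<mu> + (cmod \<eta>)\<^sup>2 * s)) \<longlongrightarrow> complex_of_real (bose_integral \<beta> \<mu>)) (at 0)"
      by simp
  qed
qed

section \<open>The limiting condensate equation\<close>

lemma bose_integral_at_bot: "(bose_integral \<beta> \<longlongrightarrow> 0) at_bot"
proof (rule tendsto_sandwich[OF _ _ tendsto_const])
  show "\<forall>\<^sub>F \<mu> in at_bot. 0 \<le> bose_integral \<beta> \<mu>"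
    using eventually_le_at_bot[of 0] by eventually_elim (rule less_imp_le[OF bose_integral_pos])
  show "\<forall>\<^sub>F \<mu> in at_bot. bose_integral \<beta> \<mu> \<le> exp (\<beta> * \<mu>) * bose_integral \<beta> 0"
    using eventually_le_at_bot[of 0] by eventually_elim (use bose_integral_exp_bound[of _ 0] in simp)
  have "filterlim (\<lambda>\<mu>. \<beta> * \<mu>) at_bot at_bot"
    by (rule filterlim_tendsto_pos_mult_at_bot[OF tendsto_const beta filterlim_ident])
  then have "((\<lambda>\<mu>. exp (\<beta> * \<mu>) * bose_integral \<beta> 0) \<longlongrightarrow> 0 * bose_integral \<beta> 0) at_bot"
    by (intro tendsto_mult tendsto_const filterlim_compose[OF exp_at_bot])
  then show "((\<lambda>\<mu>. exp (\<beta> * \<mu>) * bose_integral \<beta> 0) \<longlongrightarrow> 0) at_bot" by simp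
qed

lemma limit_equation_strict_mono:
  assumes "x < y" "y < 0"
  shows "bose_integral \<beta> x + c\<^sup>2 / x\<^sup>2 < bose_integral \<beta> y + c\<^sup>2 / y\<^sup>2"
  using bose_integral_strict_mono[of x y] source_term_strict_mono[of x y 0 c] assms by simp

lemma limit_equation_ex1:
  assumes c: "c > 0" and \<rho>: "\<rho> > 0"
  shows "\<exists>!\<mu>. \<mu> < 0 \<and> bose_integral \<beta> \<mu> + c\<^sup>2 / \<mu>\<^sup>2 = \<rho>"
proof (rule ex1_root_neg)
  show "bose_integral \<beta> x + c\<^sup>2 / x\<^sup>2 < bose_integral \<beta> y + c\<^sup>2 / y\<^sup>2" if "x < y" "y < 0" for x y
    using that by (rule limit_equation_strict_mono)
  have "continuous_on {..<0} (bose_integral \<beta>)"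
    by (rule continuous_on_subset[OF bose_integral_continuous]) auto
  then show "continuous_on {..<0} (\<lambda>\<mu>. bose_integral \<beta> \<mu> + c\<^sup>2 / \<mu>\<^sup>2)"
    by (intro continuous_intros) auto
  show "((\<lambda>\<mu>. bose_integral \<beta> \<mu> + c\<^sup>2 / \<mu>\<^sup>2) \<longlongrightarrow> 0) at_bot"
    using tendsto_add[OF bose_integral_at_bot source_term_at_bot[of c 0]] by simp
  \<comment> \<open>Here the source term alone equals \<rho>, so the left-hand side has already
    reached it; \<open>c > 0\<close> keeps this point below 0.\<close>
  define y where "y = - c / sqrt \<rho>"
  have y: "y < 0" "c\<^sup>2 / y\<^sup>2 = \<rho>" using c \<rho> by (auto simp: y_def power_divide)
  then have "\<rho> \<le> bose_integral \<beta> y + c\<^sup>2 / y\<^sup>2" using bose_integral_pos[of y] by simp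
  then show "\<exists>y<0. \<rho> \<le> bose_integral \<beta> y + c\<^sup>2 / y\<^sup>2" using y by blast
qed (rule \<rho>)

lemma density_tendsto:
  assumes E: "((\<lambda>V. energy (q V)) \<longlongrightarrow> 0) at_top" and \<mu>: "\<mu> < 0"
  shows "((\<lambda>V. fdens V \<mu> + (cmod \<eta>)\<^sup>2 / (energy (q V) - \<mu>)\<^sup>2) \<longlongrightarrow> bose_integral \<beta> \<mu> + (cmod \<eta>)\<^sup>2 / \<mu>\<^sup>2) at_top"
proof -
  have "((\<lambda>V. fdens V \<mu> + (cmod \<eta>)\<^sup>2 / (energy (q V) - \<mu>)\<^sup>2) \<longlongrightarrow> bose_integral \<beta> \<mu> + (cmod \<eta>)\<^sup>2 / (0 - \<mu>)\<^sup>2) at_top"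
    using \<mu> by (intro tendsto_intros fdens_tendsto E) auto
  then show ?thesis by simp
qed

text \<open>The limit is the root of the limiting equation. On either side of it the finite-volume
  equation at fixed trial potentials eventually has strict inequalities, and the comparison lemmas
  trap the solution.\<close>

lemma chem_pot_lim_properties:
  assumes q: "mode_family a q" and E: "((\<lambda>V. energy (q V)) \<longlongrightarrow> 0) at_top"
    and \<rho>: "\<rho> > 0" and \<eta>: "\<eta> \<noteq> 0"
  shows "((\<lambda>V. chem_pot a \<beta> \<rho> V (q V) \<eta>) \<longlongrightarrow> chem_pot_lim a \<beta> \<rho> q \<eta>) at_top"
    and "chem_pot_lim a \<beta> \<rho> q \<eta> < 0"
    and "\<rho> = bose_integral \<beta> (chem_pot_lim a \<beta> \<rho> q \<eta>) + (cmod \<eta>)\<^sup>2 / (chem_pot_lim a \<beta> \<rho> q \<eta>)\<^sup>2"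
proof -
  obtain m where m: "m < 0" "bose_integral \<beta> m + (cmod \<eta>)\<^sup>2 / m\<^sup>2 = \<rho>"
    using limit_equation_ex1[of "cmod \<eta>" \<rho>] \<eta> \<rho> by auto
  have lim: "((\<lambda>V. chem_pot a \<beta> \<rho> V (q V) \<eta>) \<longlongrightarrow> m) at_top"
  proof (rule order_tendstoI)
    fix l assume l: "l < m"
    then have l0: "l < 0" using m by simp
    have "bose_integral \<beta> l + (cmod \<eta>)\<^sup>2 / l\<^sup>2 < \<rho>" using limit_equation_strict_mono[OF l m(1), of "cmod \<eta>"] m by simp
    from order_tendstoD(2)[OF density_tendsto[OF E l0] this] eventually_gt_at_top[of 0]
    show "\<forall>\<^sub>F V in at_top. l < chem_pot a \<beta> \<rho> V (q V) \<eta>"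
      by eventually_elim (rule chem_pot_greater[OF _ \<rho> lattice_mode[OF q] l0])
  next
    fix u assume u: "m < u"
    show "\<forall>\<^sub>F V in at_top. chem_pot a \<beta> \<rho> V (q V) \<eta> < u"
    proof (cases "u < 0")
      case True
      have "\<rho> < bose_integral \<beta> u + (cmod \<eta>)\<^sup>2 / u\<^sup>2" using limit_equation_strict_mono[OF u True, of "cmod \<eta>"] m by simp
      from order_tendstoD(1)[OF density_tendsto[OF E True] this] eventually_gt_at_top[of 0]
      show ?thesis by eventually_elim (rule chem_pot_less[OF _ \<rho> lattice_mode[OF q] True])
    next
      case False
      show ?thesis using eventually_gt_at_top[of 0]
        by eventually_elim (use False chem_pot_solves(1)[OF _ \<rho> lattice_mode[OF q]] in \<open>force intro: less_le_trans\<close>)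
    qed
  qed
  have "chem_pot_lim a \<beta> \<rho> q \<eta> = m"
    unfolding chem_pot_lim_def by (rule tendsto_Lim[OF trivial_limit_at_top_linorder lim])
  then show "((\<lambda>V. chem_pot a \<beta> \<rho> V (q V) \<eta>) \<longlongrightarrow> chem_pot_lim a \<beta> \<rho> q \<eta>) at_top"
    "chem_pot_lim a \<beta> \<rho> q \<eta> < 0"
    "\<rho> = bose_integral \<beta> (chem_pot_lim a \<beta> \<rho> q \<eta>) + (cmod \<eta>)\<^sup>2 / (chem_pot_lim a \<beta> \<rho> q \<eta>)\<^sup>2"
    using lim m by auto
qed

text \<open>\<open>\<mu>0\<close> is the chemical potential of the infinite system without source, which is pinned at \<open>0\<close>
  above the critical density.\<close>

lemma ex_limit_chem_pot:
  assumes \<rho>: "\<rho> > 0"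
  obtains \<mu>0 where "\<mu>0 \<le> 0" "\<And>l. l < \<mu>0 \<Longrightarrow> bose_integral \<beta> l < \<rho>"
    "\<And>u. \<mu>0 < u \<Longrightarrow> u < 0 \<Longrightarrow> \<rho> < bose_integral \<beta> u" "bose_integral \<beta> \<mu>0 = min \<rho> (rho_c \<beta>)"
proof (cases "\<rho> \<le> rho_c \<beta>")
  case True
  have "\<forall>\<^sub>F x in at_bot. bose_integral \<beta> x < \<rho> \<and> x < 0"
    using order_tendstoD(2)[OF bose_integral_at_bot \<rho>] eventually_gt_at_bot[of 0] by eventually_elim simp
  from eventually_happens'[OF trivial_limit_at_bot_linorder this]
  obtain x where x: "bose_integral \<beta> x < \<rho>" "x < 0" by blast
  have "continuous_on {x..0} (bose_integral \<beta>)"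
    by (rule continuous_on_subset[OF bose_integral_continuous]) auto
  then obtain m where m: "m \<le> 0" "bose_integral \<beta> m = \<rho>"
    using IVT'[of "bose_integral \<beta>" x \<rho> 0] x True by (auto simp: rho_c_def)
  show thesis
    using that[of m] m True bose_integral_strict_mono by fastforce
next
  case False
  show thesis
  proof (rule that[of 0])
    fix l :: real assume "l < 0"
    then show "bose_integral \<beta> l < \<rho>" using bose_integral_strict_mono[of l 0] False by (simp add: rho_c_def)
  qed (use False in \<open>auto simp: rho_c_def\<close>)
qed

text \<open>From below: at a fixed negative potential the source term vanishes with \<eta>, so it
  cannot make up for a deficit of the Bose integral. From above: the source term is non-negative, so
  the Bose integral at the solution is at most \<rho>. The second claim solves the equation for the
  source term and uses continuity up to 0.\<close>

lemma chem_pot_lim_tendsto: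
  assumes q: "mode_family a q" and E: "((\<lambda>V. energy (q V)) \<longlongrightarrow> 0) at_top" and \<rho>: "\<rho> > 0"
    and \<mu>0: "\<mu>0 \<le> 0" "\<And>l. l < \<mu>0 \<Longrightarrow> bose_integral \<beta> l < \<rho>" "\<And>u. \<mu>0 < u \<Longrightarrow> u < 0 \<Longrightarrow> \<rho> < bose_integral \<beta> u"
  shows "(chem_pot_lim a \<beta> \<rho> q \<longlongrightarrow> \<mu>0) (at 0)"
    and "((\<lambda>\<eta>. (cmod \<eta>)\<^sup>2 / (chem_pot_lim a \<beta> \<rho> q \<eta>)\<^sup>2) \<longlongrightarrow> \<rho> - bose_integral \<beta> \<mu>0) (at 0)"
proof -
  let ?M = "chem_pot_lim a \<beta> \<rho> q"
  note M = chem_pot_lim_properties[OF q E \<rho>]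
  show lim: "(?M \<longlongrightarrow> \<mu>0) (at 0)"
  proof (rule order_tendstoI)
    fix l assume l: "l < \<mu>0"
    have l0: "l < 0" using l \<mu>0 by linarith
    have "((\<lambda>\<eta> :: complex. bose_integral \<beta> l + (cmod \<eta>)\<^sup>2 / l\<^sup>2) \<longlongrightarrow> bose_integral \<beta> l + (cmod 0)\<^sup>2 / l\<^sup>2) (at 0)"
      using l0 by (intro tendsto_intros) auto
    then have "\<forall>\<^sub>F \<eta> :: complex in at 0. bose_integral \<beta> l + (cmod \<eta>)\<^sup>2 / l\<^sup>2 < \<rho>"
      using \<mu>0(2)[OF l] by (intro order_tendstoD(2)) auto
    then show "\<forall>\<^sub>F \<eta> in at 0. l < ?M \<eta>"
      using eventually_neq_at_0
    proof eventually_elim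
      case (elim \<eta>)
      show ?case
      proof (rule ccontr)
        assume "\<not> l < ?M \<eta>"
        then have "\<rho> \<le> bose_integral \<beta> l + (cmod \<eta>)\<^sup>2 / l\<^sup>2"
          using M(3)[OF elim(2)] limit_equation_strict_mono[of "?M \<eta>" l "cmod \<eta>"] l0
          by (cases "?M \<eta> = l") auto
        then show False using elim by simp
      qed
    qed
  next
    fix u assume u: "\<mu>0 < u"
    show "\<forall>\<^sub>F \<eta> in at 0. ?M \<eta> < u"
      using eventually_neq_at_0
    proof eventually_elim
      case (elim \<eta>)
      show ?case
      proof (cases "u < 0")
        case True
        show ?thesis
        proof (rule ccontr)
          assume "\<not> ?M \<eta> < u"
          then have "bose_integral \<beta> u \<le> bose_integral \<beta> (?M \<eta>)"
            using bose_integral_strict_mono[of u "?M \<eta>"] M(2)[OF elim] by (cases "?M \<eta> = u") auto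
          moreover have "bose_integral \<beta> (?M \<eta>) \<le> \<rho>" using M(3)[OF elim] by (metis add_increasing2 order_refl zero_le_divide_iff zero_le_power2)
          ultimately show False using \<mu>0(3)[OF u True] by linarith
        qed
      next
        case False
        then show ?thesis using M(2)[OF elim] by linarith
      qed
    qed
  qed
  have "\<forall>\<^sub>F \<eta> in at 0. ?M \<eta> \<in> {..0}"
    using eventually_neq_at_0 by eventually_elim (use M(2) in \<open>auto intro: less_imp_le\<close>)
  then have "((\<lambda>\<eta>. bose_integral \<beta> (?M \<eta>)) \<longlongrightarrow> bose_integral \<beta> \<mu>0) (at 0)"
    using \<mu>0(1) by (intro continuous_on_tendsto_compose[OF bose_integral_continuous lim]) auto
  then have "((\<lambda>\<eta>. \<rho> - bose_integral \<beta> (?M \<eta>)) \<longlongrightarrow> \<rho> - bose_integral \<beta> \<mu>0) (at 0)"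
    by (intro tendsto_diff tendsto_const)
  moreover have "\<forall>\<^sub>F \<eta> in at 0. \<rho> - bose_integral \<beta> (?M \<eta>) = (cmod \<eta>)\<^sup>2 / (?M \<eta>)\<^sup>2"
    using eventually_neq_at_0
  proof eventually_elim
    case (elim \<eta>)
    then show ?case using M(3)[OF elim] by linarith
  qed
  ultimately show "((\<lambda>\<eta>. (cmod \<eta>)\<^sup>2 / (?M \<eta>)\<^sup>2) \<longlongrightarrow> \<rho> - bose_integral \<beta> \<mu>0) (at 0)"
    by (rule Lim_transform_eventually)
qed

text \<open>The limiting potential \<open>M\<close> is negative, so the thermal density of each
  single mode disappears, that of \<open>q\<close> included; what survives in \<open>q\<close> is
  the displacement.\<close>

lemma omega_rho_limits:
  assumes q: "mode_family a q" and E: "((\<lambda>V. energy (q V)) \<longlongrightarrow> 0) at_top" and \<rho>: "\<rho> > 0" and \<eta>: "\<eta> \<noteq> 0"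
  defines "M \<equiv> chem_pot_lim a \<beta> \<rho> q \<eta>"
  shows "((\<lambda>V. omega_rho a \<beta> \<rho> V (q V) \<eta> (occ_obs V (q V))) \<longlongrightarrow> complex_of_real ((cmod \<eta>)\<^sup>2 / M\<^sup>2)) at_top"
    and "mode_family a k \<Longrightarrow> \<forall>\<^sub>F V in at_top. k V \<noteq> q V \<Longrightarrow>
      ((\<lambda>V. omega_rho a \<beta> \<rho> V (q V) \<eta> (occ_obs V (k V))) \<longlongrightarrow> 0) at_top"
    and "((\<lambda>V. omega_rho a \<beta> \<rho> V (q V) \<eta> (ann_obs V (q V))) \<longlongrightarrow> \<eta> / complex_of_real M) at_top"
    and "((\<lambda>V. omega_rho a \<beta> \<rho> V (q V) \<eta> (cre_obs V (q V))) \<longlongrightarrow> cnj \<eta> / complex_of_real M) at_top"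
proof -
  let ?m = "\<lambda>V. chem_pot a \<beta> \<rho> V (q V) \<eta>"
  have lim: "(?m \<longlongrightarrow> M) at_top" and M: "M < 0"
    unfolding M_def using chem_pot_lim_properties[OF q E \<rho> \<eta>] by auto
  have neg: "?m V < 0" if "V > 0" for V by (rule chem_pot_solves(1)[OF that \<rho> lattice_mode[OF q that]])
  have Em: "((\<lambda>V. energy (q V) - ?m V) \<longlongrightarrow> 0 - M) at_top" by (intro tendsto_diff E lim)
  have "((\<lambda>V. 1 / V * occ \<beta> (?m V) (q V) + (cmod \<eta>)\<^sup>2 / (energy (q V) - ?m V)\<^sup>2) \<longlongrightarrow> 0 + (cmod \<eta>)\<^sup>2 / (0 - M)\<^sup>2) at_top"
    using M by (intro tendsto_intros Em mode_density_tendsto_0[OF lim M]) auto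
  then have "((\<lambda>V. complex_of_real (1 / V * occ \<beta> (?m V) (q V) + (cmod \<eta>)\<^sup>2 / (energy (q V) - ?m V)\<^sup>2)) \<longlongrightarrow> complex_of_real ((cmod \<eta>)\<^sup>2 / M\<^sup>2)) at_top"
    by (intro tendsto_of_real) simp
  moreover have "\<forall>\<^sub>F V in at_top. complex_of_real (1 / V * occ \<beta> (?m V) (q V) + (cmod \<eta>)\<^sup>2 / (energy (q V) - ?m V)\<^sup>2)
      = omega_rho a \<beta> \<rho> V (q V) \<eta> (occ_obs V (q V))"
    using eventually_gt_at_top[of 0]
  proof eventually_elim
    case (elim V)
    show ?case unfolding omega_rho_def
      using omega_occ_obs[OF elim neg[OF elim] lattice_mode[OF q elim] lattice_mode[OF q elim], of \<eta>] by simp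
  qed
  ultimately show "((\<lambda>V. omega_rho a \<beta> \<rho> V (q V) \<eta> (occ_obs V (q V))) \<longlongrightarrow> complex_of_real ((cmod \<eta>)\<^sup>2 / M\<^sup>2)) at_top"
    by (rule Lim_transform_eventually)
  have ann: "((\<lambda>V. - c / complex_of_real (energy (q V) - ?m V)) \<longlongrightarrow> c / complex_of_real M) at_top" for c
  proof -
    have "((\<lambda>V. - c / complex_of_real (energy (q V) - ?m V)) \<longlongrightarrow> - c / complex_of_real (0 - M)) at_top"
      using M by (intro tendsto_divide tendsto_const tendsto_of_real Em) auto
    then show ?thesis by simp
  qed
  have "\<forall>\<^sub>F V in at_top. - \<eta> / complex_of_real (energy (q V) - ?m V) = omega_rho a \<beta> \<rho> V (q V) \<eta> (ann_obs V (q V))"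
    using eventually_gt_at_top[of 0]
    by eventually_elim (simp only: omega_rho_def omega_ann_obs[OF _ neg lattice_mode[OF q]])
  with ann show "((\<lambda>V. omega_rho a \<beta> \<rho> V (q V) \<eta> (ann_obs V (q V))) \<longlongrightarrow> \<eta> / complex_of_real M) at_top"
    by (rule Lim_transform_eventually)
  have "\<forall>\<^sub>F V in at_top. - cnj \<eta> / complex_of_real (energy (q V) - ?m V) = omega_rho a \<beta> \<rho> V (q V) \<eta> (cre_obs V (q V))"
    using eventually_gt_at_top[of 0]
    by eventually_elim (simp only: omega_rho_def omega_cre_obs[OF _ neg lattice_mode[OF q]])
  with ann show "((\<lambda>V. omega_rho a \<beta> \<rho> V (q V) \<eta> (cre_obs V (q V))) \<longlongrightarrow> cnj \<eta> / complex_of_real M) at_top"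
    by (rule Lim_transform_eventually)
  assume k: "mode_family a k" and ne: "\<forall>\<^sub>F V in at_top. k V \<noteq> q V"
  have "((\<lambda>V. complex_of_real (1 / V * occ \<beta> (?m V) (k V))) \<longlongrightarrow> complex_of_real 0) at_top"
    by (intro tendsto_of_real mode_density_tendsto_0[OF lim M])
  moreover have "\<forall>\<^sub>F V in at_top. complex_of_real (1 / V * occ \<beta> (?m V) (k V))
      = omega_rho a \<beta> \<rho> V (q V) \<eta> (occ_obs V (k V))"
    using eventually_gt_at_top[of 0] ne
  proof eventually_elim
    case (elim V)
    show ?case unfolding omega_rho_def
      using omega_occ_obs[OF elim(1) neg[OF elim(1)] lattice_mode[OF q elim(1)] lattice_mode[OF k elim(1)], of \<eta>] elim(2) by simp
  qed
  ultimately show "((\<lambda>V. omega_rho a \<beta> \<rho> V (q V) \<eta> (occ_obs V (k V))) \<longlongrightarrow> 0) at_top"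
    using Lim_transform_eventually by fastforce
qed

text \<open>The truncated difference \<open>c\<close> is the condensate density below and above the
  critical density alike, so one computation serves both regimes.\<close>

lemma quasi_averages:
  assumes q: "mode_family a q" and E: "((\<lambda>V. energy (q V)) \<longlongrightarrow> 0) at_top" and \<rho>: "\<rho> > 0"
  defines "c \<equiv> \<rho> - min \<rho> (rho_c \<beta>)"
  shows "((\<lambda>\<eta>. (cmod \<eta>)\<^sup>2 / (chem_pot_lim a \<beta> \<rho> q \<eta>)\<^sup>2) \<longlongrightarrow> c) (at 0)"
    and "quasi_average a \<beta> \<rho> q (at 0) (\<lambda>V. occ_obs V (q V)) (complex_of_real c)"
    and "mode_family a k \<Longrightarrow> \<forall>\<^sub>F V in at_top. k V \<noteq> q V \<Longrightarrow> quasi_average a \<beta> \<rho> q (at 0) (\<lambda>V. occ_obs V (k V)) 0"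
    and "((\<lambda>\<eta>. \<eta> / complex_of_real (chem_pot_lim a \<beta> \<rho> q \<eta>)) \<longlongrightarrow> - cis \<theta> * complex_of_real (sqrt c)) (ray \<theta>)"
    and "quasi_average a \<beta> \<rho> q (ray \<theta>) (\<lambda>V. ann_obs V (q V)) (- cis \<theta> * complex_of_real (sqrt c))"
    and "iterated_limit (at 0) (\<lambda>\<eta> V. omega_rho a \<beta> \<rho> V (q V) \<eta> (cre_obs V (q V)) * omega_rho a \<beta> \<rho> V (q V) \<eta> (ann_obs V (q V)))
       (complex_of_real c)"
    and "quasi_average a \<beta> \<rho> q (at 0) (\<lambda>V. odlro_obs_at a V (q V)) l
       = quasi_average a \<beta> \<rho> q (at 0) (\<lambda>V. occ_obs V (q V)) l"
proof -
  let ?M = "chem_pot_lim a \<beta> \<rho> q"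
  note L = omega_rho_limits[OF q E \<rho>]
  note P = chem_pot_lim_properties[OF q E \<rho>]
  obtain \<mu>0 where \<mu>0: "\<mu>0 \<le> 0" "\<And>l. l < \<mu>0 \<Longrightarrow> bose_integral \<beta> l < \<rho>"
    "\<And>u. \<mu>0 < u \<Longrightarrow> u < 0 \<Longrightarrow> \<rho> < bose_integral \<beta> u" and I: "bose_integral \<beta> \<mu>0 = min \<rho> (rho_c \<beta>)"
    using ex_limit_chem_pot[OF \<rho>] by blast
  show sq: "((\<lambda>\<eta>. (cmod \<eta>)\<^sup>2 / (?M \<eta>)\<^sup>2) \<longlongrightarrow> c) (at 0)"
    using chem_pot_lim_tendsto(2)[OF q E \<rho> \<mu>0] unfolding I c_def .
  then have sqc: "((\<lambda>\<eta>. complex_of_real ((cmod \<eta>)\<^sup>2 / (?M \<eta>)\<^sup>2)) \<longlongrightarrow> complex_of_real c) (at 0)"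
    by (rule tendsto_of_real)
  show "quasi_average a \<beta> \<rho> q (at 0) (\<lambda>V. occ_obs V (q V)) (complex_of_real c)"
    unfolding quasi_average_def
    by (rule iterated_limitI[OF _ sqc], rule eventually_mono[OF eventually_neq_at_0], rule L(1))
  show "quasi_average a \<beta> \<rho> q (at 0) (\<lambda>V. occ_obs V (k V)) 0"
    if "mode_family a k" "\<forall>\<^sub>F V in at_top. k V \<noteq> q V"
    unfolding quasi_average_def
    by (rule iterated_limitI[OF _ tendsto_const], rule eventually_mono[OF eventually_neq_at_0], rule L(2)[OF _ that])
  have "((\<lambda>\<eta>. - cis \<theta> * complex_of_real (sqrt ((cmod \<eta>)\<^sup>2 / (?M \<eta>)\<^sup>2))) \<longlongrightarrow> - cis \<theta> * complex_of_real (sqrt c)) (ray \<theta>)"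
    by (intro tendsto_mult tendsto_const tendsto_of_real tendsto_real_sqrt tendsto_mono[OF ray_le_at_0 sq])
  moreover have "\<forall>\<^sub>F \<eta> in ray \<theta>. - cis \<theta> * complex_of_real (sqrt ((cmod \<eta>)\<^sup>2 / (?M \<eta>)\<^sup>2)) = \<eta> / complex_of_real (?M \<eta>)"
    using eventually_ray
  proof eventually_elim
    case (elim \<eta>)
    \<comment> \<open>The negative sign of the potential turns the quotient of moduli into
      \<open>cmod \<eta> / (- ?M \<eta>)\<close>, which is where the minus in front of
      \<open>cis \<theta>\<close> arises.\<close>
    have "?M \<eta> < 0" using P(2) elim by blast
    then have "sqrt ((cmod \<eta>)\<^sup>2 / (?M \<eta>)\<^sup>2) = cmod \<eta> / (- ?M \<eta>)" by (simp add: real_sqrt_divide)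
    then have "- cis \<theta> * complex_of_real (sqrt ((cmod \<eta>)\<^sup>2 / (?M \<eta>)\<^sup>2)) = (complex_of_real (cmod \<eta>) * cis \<theta>) / complex_of_real (?M \<eta>)"
      by simp
    then show ?case using elim by metis
  qed
  ultimately show ray: "((\<lambda>\<eta>. \<eta> / complex_of_real (?M \<eta>)) \<longlongrightarrow> - cis \<theta> * complex_of_real (sqrt c)) (ray \<theta>)"
    by (rule Lim_transform_eventually)
  have "\<forall>\<^sub>F \<eta> in ray \<theta>. \<eta> \<noteq> 0" using eventually_ray by (rule eventually_mono) simp
  then show "quasi_average a \<beta> \<rho> q (ray \<theta>) (\<lambda>V. ann_obs V (q V)) (- cis \<theta> * complex_of_real (sqrt c))"
    unfolding quasi_average_def by (intro iterated_limitI[OF _ ray]) (erule eventually_mono, rule L(3))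
  show "iterated_limit (at 0) (\<lambda>\<eta> V. omega_rho a \<beta> \<rho> V (q V) \<eta> (cre_obs V (q V)) * omega_rho a \<beta> \<rho> V (q V) \<eta> (ann_obs V (q V)))
       (complex_of_real c)"
  proof (rule iterated_limitI[OF _ sqc], rule eventually_mono[OF eventually_neq_at_0])
    fix \<eta> :: complex assume \<eta>: "\<eta> \<noteq> 0"
    have "cnj \<eta> / complex_of_real (?M \<eta>) * (\<eta> / complex_of_real (?M \<eta>)) = complex_of_real ((cmod \<eta>)\<^sup>2 / (?M \<eta>)\<^sup>2)"
      unfolding of_real_divide complex_norm_square by (simp add: power2_eq_square mult.commute)
    then show "((\<lambda>V. omega_rho a \<beta> \<rho> V (q V) \<eta> (cre_obs V (q V)) * omega_rho a \<beta> \<rho> V (q V) \<eta> (ann_obs V (q V)))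
        \<longlongrightarrow> complex_of_real ((cmod \<eta>)\<^sup>2 / (?M \<eta>)\<^sup>2)) at_top"
      using tendsto_mult[OF L(4)[OF \<eta>] L(3)[OF \<eta>]] by simp
  qed
  show "quasi_average a \<beta> \<rho> q (at 0) (\<lambda>V. odlro_obs_at a V (q V)) l
       = quasi_average a \<beta> \<rho> q (at 0) (\<lambda>V. occ_obs V (q V)) l"
    unfolding quasi_average_def
  proof (rule iterated_limit_cong)
    show "\<forall>\<^sub>F V in at_top. omega_rho a \<beta> \<rho> V (q V) \<eta> (odlro_obs_at a V (q V)) = omega_rho a \<beta> \<rho> V (q V) \<eta> (occ_obs V (q V))" for \<eta>
      unfolding omega_rho_def using eventually_gt_at_top[of 0]
      by eventually_elim (rule omega_odlro_at[OF _ lattice_mode[OF q]])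
  qed
qed

text \<open>The quasi-averages in the source mode are \<open>c\<close>, up to a phase and a square
  root, so each notion in that mode amounts to \<open>c > 0\<close>. Uniqueness of iterated limits
  gives the direction from the notion to the density, and it excludes condensation in any other
  mode.\<close>

lemma quasi_average_notions:
  assumes q: "mode_family a q" and E: "((\<lambda>V. energy (q V)) \<longlongrightarrow> 0) at_top" and \<rho>: "\<rho> > 0"
  shows "BEC_qa a \<beta> \<rho> q q \<longleftrightarrow> \<rho> > rho_c \<beta>"
    and "SSB_qa a \<beta> \<rho> q \<theta> \<longleftrightarrow> \<rho> > rho_c \<beta>"
    and "ODLRO_qa_at a \<beta> \<rho> q q \<longleftrightarrow> \<rho> > rho_c \<beta>"
    and "mode_family a k \<Longrightarrow> \<forall>\<^sub>F V in at_top. k V \<noteq> q V \<Longrightarrow> \<not> BEC_qa a \<beta> \<rho> q k"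
proof -
  define c where "c = \<rho> - min \<rho> (rho_c \<beta>)"
  have c: "c \<ge> 0" "c > 0 \<longleftrightarrow> \<rho> > rho_c \<beta>" by (auto simp: c_def)
  note Q = quasi_averages[OF q E \<rho>, folded c_def]
  have at: "at (0 :: complex) \<noteq> bot" by simp
  have u: "l = l'" if "quasi_average a \<beta> \<rho> q (at 0) A l" "quasi_average a \<beta> \<rho> q (at 0) A l'" for A l l'
    using that iterated_limit_unique[OF _ _ at] unfolding quasi_average_def by blast
  show "BEC_qa a \<beta> \<rho> q q \<longleftrightarrow> \<rho> > rho_c \<beta>"
  proof
    assume "BEC_qa a \<beta> \<rho> q q"
    then obtain l where "l \<noteq> 0" "quasi_average a \<beta> \<rho> q (at 0) (\<lambda>V. occ_obs V (q V)) l" unfolding BEC_qa_def by blast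
    then have "complex_of_real c \<noteq> 0" using u[OF Q(2)] by blast
    then show "\<rho> > rho_c \<beta>" using c by simp
  next
    assume "\<rho> > rho_c \<beta>"
    then show "BEC_qa a \<beta> \<rho> q q" unfolding BEC_qa_def using Q(2) c by (intro exI[of _ "complex_of_real c"]) auto
  qed
  show "SSB_qa a \<beta> \<rho> q \<theta> \<longleftrightarrow> \<rho> > rho_c \<beta>"
  proof
    assume "SSB_qa a \<beta> \<rho> q \<theta>"
    then obtain l where l: "l \<noteq> 0" "quasi_average a \<beta> \<rho> q (ray \<theta>) (\<lambda>V. ann_obs V (q V)) l" unfolding SSB_qa_def by blast
    then have "l = - cis \<theta> * complex_of_real (sqrt c)"
      using iterated_limit_unique[OF _ _ ray_neq_bot] Q(5)[of \<theta>] unfolding quasi_average_def by blast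
    then have "c \<noteq> 0" using l(1) by auto
    then show "\<rho> > rho_c \<beta>" using c by simp
  next
    assume "\<rho> > rho_c \<beta>"
    then show "SSB_qa a \<beta> \<rho> q \<theta>"
      unfolding SSB_qa_def using Q(5)[of \<theta>] c by (intro exI[of _ "- cis \<theta> * complex_of_real (sqrt c)"]) auto
  qed
  show "ODLRO_qa_at a \<beta> \<rho> q q \<longleftrightarrow> \<rho> > rho_c \<beta>"
    unfolding ODLRO_qa_at_def Q(7)
  proof
    assume "\<exists>l>0. quasi_average a \<beta> \<rho> q (at 0) (\<lambda>V. occ_obs V (q V)) (complex_of_real l)"
    then show "\<rho> > rho_c \<beta>" using u[OF Q(2)] c by (metis of_real_eq_iff)
  next
    assume "\<rho> > rho_c \<beta>"
    then show "\<exists>l>0. quasi_average a \<beta> \<rho> q (at 0) (\<lambda>V. occ_obs V (q V)) (complex_of_real l)" using Q(2) c by blast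
  qed
  assume "mode_family a k" "\<forall>\<^sub>F V in at_top. k V \<noteq> q V"
  from Q(3)[OF this] show "\<not> BEC_qa a \<beta> \<rho> q k" unfolding BEC_qa_def using u by blast
qed

lemma ODLRO_qa_zero_mode:
  assumes q: "\<forall>V>0. q V = 0"
  shows "ODLRO_qa a \<beta> \<rho> q \<longleftrightarrow> ODLRO_qa_at a \<beta> \<rho> q q"
proof -
  have "quasi_average a \<beta> \<rho> q (at 0) (\<lambda>V. odlro_obs a V) l = quasi_average a \<beta> \<rho> q (at 0) (\<lambda>V. odlro_obs_at a V (q V)) l" for l
    unfolding quasi_average_def
  proof (rule iterated_limit_cong)
    show "\<forall>\<^sub>F V in at_top. omega_rho a \<beta> \<rho> V (q V) \<eta> (odlro_obs a V) = omega_rho a \<beta> \<rho> V (q V) \<eta> (odlro_obs_at a V (q V))" for \<eta>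
      using eventually_gt_at_top[of 0] by eventually_elim (simp add: q odlro_obs_eq_at_0)
  qed
  then show ?thesis unfolding ODLRO_qa_def ODLRO_qa_at_def by simp
qed

lemma no_source_long_box:
  assumes a1: "a $ 1 > 1 / 2" and \<rho>: "\<rho> > 0" and p: "mode_family a p"
  shows "((\<lambda>V. omega_rho a \<beta> \<rho> V (p V) 0 (occ_obs V (p V))) \<longlongrightarrow> 0) at_top"
    and "((\<lambda>V. omega_rho a \<beta> \<rho> V (p V) 0 (cre_obs V (p V)) * omega_rho a \<beta> \<rho> V (p V) 0 (ann_obs V (p V))) \<longlongrightarrow> 0) at_top"
proof -
  let ?m = "chem_pot_free a \<beta> \<rho>"
  have "((\<lambda>V. complex_of_real (1 / V * occ \<beta> (?m V) (p V))) \<longlongrightarrow> complex_of_real 0) at_top"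
    by (intro tendsto_of_real mode_density_free_tendsto_0 a1 \<rho>)
  moreover have "\<forall>\<^sub>F V in at_top. complex_of_real (1 / V * occ \<beta> (?m V) (p V)) = omega_rho a \<beta> \<rho> V (p V) 0 (occ_obs V (p V))"
    using eventually_gt_at_top[of 0]
  proof eventually_elim
    case (elim V)
    note pV = lattice_mode[OF p elim]
    show ?case unfolding omega_rho_def chem_pot_no_source[OF elim pV]
        omega_occ_obs[OF elim chem_pot_free_solves(1)[OF elim \<rho>] pV pV] by simp
  qed
  ultimately show "((\<lambda>V. omega_rho a \<beta> \<rho> V (p V) 0 (occ_obs V (p V))) \<longlongrightarrow> 0) at_top"
    using Lim_transform_eventually by fastforce
  have "\<forall>\<^sub>F V in at_top. 0 = omega_rho a \<beta> \<rho> V (p V) 0 (cre_obs V (p V)) * omega_rho a \<beta> \<rho> V (p V) 0 (ann_obs V (p V))"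
    using eventually_gt_at_top[of 0]
  proof eventually_elim
    case (elim V)
    note pV = lattice_mode[OF p elim]
    show ?case unfolding omega_rho_def chem_pot_no_source[OF elim pV]
        omega_ann_obs[OF elim chem_pot_free_solves(1)[OF elim \<rho>] pV] by simp
  qed
  then show "((\<lambda>V. omega_rho a \<beta> \<rho> V (p V) 0 (cre_obs V (p V)) * omega_rho a \<beta> \<rho> V (p V) 0 (ann_obs V (p V))) \<longlongrightarrow> 0) at_top"
    by (rule Lim_transform_eventually[OF tendsto_const])
qed

lemma types_of_condensation:
  assumes "\<rho> > rho_c \<beta>"
  shows "(a $ 1 < 1 / 2 \<longrightarrow> type_I a \<beta> \<rho>) \<and> (a $ 1 = 1 / 2 \<longrightarrow> type_II a \<beta> \<rho>) \<and> (a $ 1 > 1 / 2 \<longrightarrow> type_III a \<beta> \<rho>)"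
  using type_I_short_box type_II_critical_box type_III_long_box assms by blast

end

theorem mainTheorem3:
  fixes a :: "real^3" and \<beta> :: real and q :: "real \<Rightarrow> real^3"
  assumes "\<beta> > 0"
    and "a $ 1 \<ge> a $ 2" and "a $ 2 \<ge> a $ 3" and "a $ 3 > 0"
    and "a $ 1 + a $ 2 + a $ 3 = 1"
    and "mode_family a q"
  shows
    \<comment> \<open>the condensate equation and its unique solution\<close>
    "(\<forall>V>0. \<forall>\<mu><0. \<forall>\<eta>. total_density a \<beta> V (q V) \<mu> \<eta> = complex_of_real
        (1 / V * (1 / (exp (\<beta> * (energy (q V) - \<mu>)) - 1))
         + 1 / V * (\<Sum>\<^sub>\<infinity>k\<in>dual_lattice a V - {q V}. 1 / (exp (\<beta> * (energy k - \<mu>)) - 1))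
         + (cmod \<eta>)^2 / (energy (q V) - \<mu>)^2)) \<and>
     (\<forall>V>0. \<forall>\<rho>>0. \<forall>\<eta>. \<exists>!\<mu>. \<mu> < 0 \<and> total_density a \<beta> V (q V) \<mu> \<eta> = complex_of_real \<rho>) \<and>
     (\<forall>\<mu><0. ((\<lambda>V. total_density a \<beta> V (q V) \<mu> 0) \<longlongrightarrow> complex_of_real (bose_integral \<beta> \<mu>)) at_top) \<and>
     (\<forall>V>0. \<forall>\<mu><0. \<forall>\<eta>. omega a \<beta> V (q V) \<mu> \<eta> (odlro_obs a V) = omega a \<beta> V (q V) \<mu> \<eta> (occ_obs V 0)) \<and>

     \<comment> \<open>(i)\<close>
     (\<forall>e. ((\<lambda>V. ereal (energy (q V))) \<longlongrightarrow> e) at_top \<and> e > 0 \<longrightarrow>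
        (\<forall>\<mu><0. iterated_limit (at 0) (\<lambda>\<eta> V. total_density a \<beta> V (q V) \<mu> \<eta>)
                 (complex_of_real (bose_integral \<beta> \<mu>))) \<and>
        (\<forall>\<rho>>rho_c \<beta>. (a $ 1 < 1/2 \<longrightarrow> type_I a \<beta> \<rho>) \<and>
                        (a $ 1 = 1/2 \<longrightarrow> type_II a \<beta> \<rho>) \<and>
                        (a $ 1 > 1/2 \<longrightarrow> type_III a \<beta> \<rho>))) \<and>

     \<comment> \<open>(ii)\<close>
     (((\<lambda>V. energy (q V)) \<longlongrightarrow> 0) at_top \<longrightarrow>
        (\<forall>\<mu><0. \<forall>\<eta>. ((\<lambda>V. total_density a \<beta> V (q V) \<mu> \<eta>) \<longlongrightarrow>
             complex_of_real (bose_integral \<beta> \<mu> + (cmod \<eta>)^2 / \<mu>^2)) at_top) \<and>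
        (\<forall>\<rho>>0. \<forall>\<eta>. \<eta> \<noteq> 0 \<longrightarrow>
             ((\<lambda>V. chem_pot a \<beta> \<rho> V (q V) \<eta>) \<longlongrightarrow> chem_pot_lim a \<beta> \<rho> q \<eta>) at_top \<and>
             chem_pot_lim a \<beta> \<rho> q \<eta> < 0 \<and>
             \<rho> = bose_integral \<beta> (chem_pot_lim a \<beta> \<rho> q \<eta>)
                 + (cmod \<eta>)^2 / (chem_pot_lim a \<beta> \<rho> q \<eta>)^2) \<and>

        \<comment> \<open>(a)\<close>
        (\<forall>\<rho>. 0 < \<rho> \<and> \<rho> \<le> rho_c \<beta> \<longrightarrow>
           (\<exists>\<mu>0\<le>0. bose_integral \<beta> \<mu>0 = \<rho> \<and> (\<rho> < rho_c \<beta> \<longrightarrow> \<mu>0 < 0) \<and>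
              (chem_pot_lim a \<beta> \<rho> q \<longlongrightarrow> \<mu>0) (at 0)) \<and>
           (\<forall>k. mode_family a k \<and>
                ((\<forall>\<^sub>F V in at_top. k V = q V) \<or> (\<forall>\<^sub>F V in at_top. k V \<noteq> q V)) \<longrightarrow>
              quasi_average a \<beta> \<rho> q (at 0) (\<lambda>V. occ_obs V (k V)) 0)) \<and>

        \<comment> \<open>(b)\<close>
        (\<forall>\<rho>>rho_c \<beta>.
           (chem_pot_lim a \<beta> \<rho> q \<longlongrightarrow> 0) (at 0) \<and>
           ((\<lambda>\<eta>. (cmod \<eta>)^2 / (chem_pot_lim a \<beta> \<rho> q \<eta>)^2) \<longlongrightarrow> \<rho> - rho_c \<beta>) (at 0) \<and>
           quasi_average a \<beta> \<rho> q (at 0) (\<lambda>V. occ_obs V (q V)) (complex_of_real (\<rho> - rho_c \<beta>)) \<and>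
           (\<forall>k. mode_family a k \<and> (\<forall>\<^sub>F V in at_top. k V \<noteq> q V) \<and>
                ((\<lambda>V. energy (k V)) \<longlongrightarrow> 0) at_top \<longrightarrow>
              quasi_average a \<beta> \<rho> q (at 0) (\<lambda>V. occ_obs V (k V)) 0) \<and>
           BEC_qa a \<beta> \<rho> q q \<and>
           (\<forall>k. mode_family a k \<and> (\<forall>\<^sub>F V in at_top. k V \<noteq> q V) \<longrightarrow> \<not> BEC_qa a \<beta> \<rho> q k) \<and>
           (a $ 1 > 1/2 \<longrightarrow> type_III a \<beta> \<rho>) \<and>
           (\<forall>\<theta>. quasi_average a \<beta> \<rho> q (ray \<theta>) (\<lambda>V. ann_obs V (q V))
                    (- cis \<theta> * complex_of_real (sqrt (\<rho> - rho_c \<beta>))) \<and>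
                ((\<lambda>\<eta>. \<eta> / complex_of_real (chem_pot_lim a \<beta> \<rho> q \<eta>)) \<longlongrightarrow>
                    - cis \<theta> * complex_of_real (sqrt (\<rho> - rho_c \<beta>))) (ray \<theta>)) \<and>
           iterated_limit (at 0)
             (\<lambda>\<eta> V. omega_rho a \<beta> \<rho> V (q V) \<eta> (cre_obs V (q V))
                    * omega_rho a \<beta> \<rho> V (q V) \<eta> (ann_obs V (q V)))
             (complex_of_real (\<rho> - rho_c \<beta>)) \<and>
           quasi_average a \<beta> \<rho> q (at 0) (\<lambda>V. odlro_obs_at a V (q V))
             (complex_of_real (\<rho> - rho_c \<beta>))) \<and>
        \<comment> \<open>equivalence of the three notions, at every density\<close>
        (\<forall>\<rho>>0.
           (\<forall>\<theta>. SSB_qa a \<beta> \<rho> q \<theta> \<longleftrightarrow> BEC_qa a \<beta> \<rho> q q) \<and>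
           (ODLRO_qa_at a \<beta> \<rho> q q \<longleftrightarrow> BEC_qa a \<beta> \<rho> q q) \<and>
           ((\<forall>V>0. q V = 0) \<longrightarrow> (ODLRO_qa a \<beta> \<rho> q \<longleftrightarrow> BEC_qa a \<beta> \<rho> q q)))) \<and>

     \<comment> \<open>(c)\<close>
     (a $ 1 > 1/2 \<longrightarrow>
        (\<forall>\<rho>>0. \<forall>p. mode_family a p \<longrightarrow>
           ((\<lambda>V. omega_rho a \<beta> \<rho> V (p V) 0 (occ_obs V (p V))) \<longlongrightarrow> 0) at_top \<and>
           ((\<lambda>V. omega_rho a \<beta> \<rho> V (p V) 0 (cre_obs V (p V))
                 * omega_rho a \<beta> \<rho> V (p V) 0 (ann_obs V (p V))) \<longlongrightarrow> 0) at_top))"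
proof -
  interpret anisotropic_box a \<beta>
    using assms by unfold_locales auto
  note q = assms(6)
  show ?thesis
  proof (intro conjI, goal_cases)
    case 1
    show ?case
      unfolding occ_def[symmetric]
      using total_density_eq[OF _ _ lattice_mode[OF q]] fdens_remove[OF _ _ lattice_mode[OF q]] by simp
  next
    case 2
    show ?case using condensate_equation_ex1[OF _ _ lattice_mode[OF q]] by blast
  next
    case 3
    show ?case using total_density_no_source_tendsto[OF q] by blast
  next
    case 4
    show ?case using omega_odlro by blast
  next
    case 5
    show ?case
    proof (intro allI impI conjI)
      fix e \<mu> assume "((\<lambda>V. ereal (energy (q V))) \<longlongrightarrow> e) at_top \<and> e > 0" "\<mu> < (0 :: real)"
      then show "iterated_limit (at 0) (\<lambda>\<eta> V. total_density a \<beta> V (q V) \<mu> \<eta>) (complex_of_real (bose_integral \<beta> \<mu>))"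
        by (intro quasi_average_density_gapped[OF q]) auto
    qed (use types_of_condensation in blast)+
  next
    case 6
    show ?case
    proof (rule impI, intro conjI, goal_cases)
      case E: 1
      show ?case
      proof (intro allI impI)
        fix \<mu> :: real and \<eta> assume \<mu>: "\<mu> < 0"
        have "((\<lambda>V. 1 / (energy (q V) - \<mu>)\<^sup>2) \<longlongrightarrow> 1 / (0 - \<mu>)\<^sup>2) at_top"
          using \<mu> by (intro tendsto_intros E) auto
        from total_density_tendsto[OF q \<mu> this, of \<eta>]
        show "((\<lambda>V. total_density a \<beta> V (q V) \<mu> \<eta>) \<longlongrightarrow>
             complex_of_real (bose_integral \<beta> \<mu> + (cmod \<eta>)^2 / \<mu>^2)) at_top" by simp
      qed
    next
      case 2
      then show ?case using chem_pot_lim_properties[OF q] by blast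
    next
      case E: 3
      show ?case
      proof (intro allI impI conjI)
        fix \<rho> assume \<rho>: "0 < \<rho> \<and> \<rho> \<le> rho_c \<beta>"
        obtain \<mu>0 where \<mu>0: "\<mu>0 \<le> 0" "\<And>l. l < \<mu>0 \<Longrightarrow> bose_integral \<beta> l < \<rho>"
          "\<And>u. \<mu>0 < u \<Longrightarrow> u < 0 \<Longrightarrow> \<rho> < bose_integral \<beta> u" and I: "bose_integral \<beta> \<mu>0 = min \<rho> (rho_c \<beta>)"
          using ex_limit_chem_pot[of \<rho>] \<rho> by blast
        have I': "bose_integral \<beta> \<mu>0 = \<rho>" using I \<rho> by simp
        then have "\<rho> < rho_c \<beta> \<longrightarrow> \<mu>0 < 0" using \<mu>0(1) unfolding rho_c_def by (cases "\<mu>0 = 0") auto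
        then show "\<exists>\<mu>0\<le>0. bose_integral \<beta> \<mu>0 = \<rho> \<and> (\<rho> < rho_c \<beta> \<longrightarrow> \<mu>0 < 0) \<and>
              (chem_pot_lim a \<beta> \<rho> q \<longlongrightarrow> \<mu>0) (at 0)"
          using I' \<mu>0(1) chem_pot_lim_tendsto(1)[OF q E _ \<mu>0] \<rho> by blast
        fix k assume k: "mode_family a k \<and> ((\<forall>\<^sub>F V in at_top. k V = q V) \<or> (\<forall>\<^sub>F V in at_top. k V \<noteq> q V))"
        show "quasi_average a \<beta> \<rho> q (at 0) (\<lambda>V. occ_obs V (k V)) 0"
        proof (cases "\<forall>\<^sub>F V in at_top. k V = q V")
          case True
          have "quasi_average a \<beta> \<rho> q (at 0) (\<lambda>V. occ_obs V (k V)) 0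
              = quasi_average a \<beta> \<rho> q (at 0) (\<lambda>V. occ_obs V (q V)) 0"
            unfolding quasi_average_def by (rule iterated_limit_cong) (use True in \<open>auto elim: eventually_mono\<close>)
          then show ?thesis using quasi_averages(2)[OF q E, of \<rho>] \<rho> by simp
        next
          case False
          then show ?thesis using quasi_averages(3)[OF q E, of \<rho> k] k \<rho> by blast
        qed
      qed
    next
      case E: 4
      show ?case
      proof (rule allI, rule impI, goal_cases)
        case (1 \<rho>)
        have \<rho>0: "\<rho> > 0" using 1 rho_c_pos by linarith
        have c: "min \<rho> (rho_c \<beta>) = rho_c \<beta>" using 1 by simp
        have "bose_integral \<beta> l < \<rho>" if "l < 0" for l
          using bose_integral_strict_mono[OF that] 1 by (simp add: rho_c_def)
        then have "(chem_pot_lim a \<beta> \<rho> q \<longlongrightarrow> 0) (at 0)"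
          by (intro chem_pot_lim_tendsto(1)[OF q E \<rho>0]) auto
        then show ?case
          using quasi_averages[OF q E \<rho>0, unfolded c] types_of_condensation[OF 1]
            quasi_average_notions[OF q E \<rho>0] 1 by blast
      qed
    next
      case 5
      then show ?case
        using quasi_average_notions(1-3)[OF q] ODLRO_qa_zero_mode[of q] by simp
    qed
  next
    case 7
    show ?case using no_source_long_box by blast
  qed
qed

end
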